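(* Let $$\bar\beta:=\inf\left\{\frac{\bar S^{-\frac{Kq}{2}}\Big(\sum_{i=1}^K\|u_i\|_i^2\Big)^{\frac{Kq}{2}}-\sum_{i=1}^K\int_{\mathbb R^d}\mu_i|u_i|^{Kq}}{K\int_{\mathbb R^d}\prod_{i=1}^K|u_i|^q}\ :\ \mathbf u\in H^1(\mathbb R^d,\mathbb R^K),\ \prod_{i=1}^K u_i\not\equiv0\right\}.$$ If $q>2$, then $\ell_{\bar\beta}:=\inf_{\mathcal N_{\bar\beta}}I_{\bar\beta}$ is attained by a fully non-trivial ground state of the system with $\beta=\bar\beta$.
   Context: Fix integers $d\ge2$, $K\ge3$, reals $\lambda_i>0,\ \mu_i>0$ ($i=1,\dots,K$), and an exponent $q$ with $1\le q<\frac{2d}{K(d-2)}$ if $d\ge3$, and $1\le q<\infty$ if $d=2$. For $\beta\in\mathbb R$ the system is $$-\Delta u_i+\lambda_iu_i=\mu_i|u_i|^{Kq-2}u_i+\beta|u_i|^{q-2}u_i\prod_{j\ne i}|u_j|^q\ \text{ in }\mathbb R^d,\qquad u_i\in H^1(\mathbb R^d),\qquad i=1,\dots,K,$$ understood in the weak sense. Write $\mathbf u=(u_1,\dots,u_K)$, $\|u\|_i^2:=\int_{\mathbb R^d}(|\nabla u|^2+\lambda_iu^2)$, and $$I_\beta(\mathbf u):=\frac12\sum_{i=1}^K\|u_i\|_i^2-\frac1{Kq}\sum_{i=1}^K\int_{\mathbb R^d}\mu_i|u_i|^{Kq}-\frac\beta q\int_{\mathbb R^d}\prod_{i=1}^K|u_i|^q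 .$$ The Nehari manifold is $$\mathcal N_\beta=\Big\{\mathbf u\in H^1(\mathbb R^d,\mathbb R^K):\ \mathbf u\ne\mathbf 0,\ \sum_{i=1}^K\|u_i\|_i^2=\sum_{i=1}^K\int_{\mathbb R^d}\mu_i|u_i|^{Kq}+K\beta\int_{\mathbb R^d}\prod_{i=1}^K|u_i|^q\Big\}.$$ Set $$c_{p,\lambda,\mu}:=\inf_{u\in H^1(\mathbb R^d)\setminus\{0\}}\frac{\int_{\mathbb R^d}|\nabla u|^2+\lambda u^2}{\left(\int_{\mathbb R^d}\mu|u|^p\right)^{2/p}},\qquad \bar S:=\min_{i=1,\dots,K}c_{Kq,\lambda_i,\mu_i}.$$ A ground state (least energy solution) is a solution $\mathbf u\ne\mathbf 0$ having minimal $I_\beta$ among all non-trivial solutions; it is fully non-trivial if all its components are non-trivial. *)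

theory Defs
  imports "HOL-Analysis.Analysis"
begin

text \<open>The Euclidean space \<open>\<real>\<^sup>d\<close> is \<^typ>\<open>real ^ 'd\<close> with \<open>d = CARD('d)\<close>, and the
  components of a vector function are indexed by a finite type \<^typ>\<open>'k\<close> with \<open>K = CARD('k)\<close>.\<close>

type_synonym ('k, 'd) vfun = "'k \<Rightarrow> real ^ 'd \<Rightarrow> real"


subsection \<open>The Sobolev space \<open>H\<^sup>1\<close>\<close>

definition partial :: "'d \<Rightarrow> (real ^ 'd \<Rightarrow> real) \<Rightarrow> real ^ 'd \<Rightarrow> real" where
  "partial i f x = frechet_derivative f (at x) (axis i 1)"

fun Ck :: "nat \<Rightarrow> (real ^ 'd \<Rightarrow> real) \<Rightarrow> bool" where
  "Ck 0 f \<longleftrightarrow> continuous_on UNIV f"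
| "Ck (Suc n) f \<longleftrightarrow> (\<forall>x. f differentiable (at x)) \<and> (\<forall>i. Ck n (partial i f))"

definition test_functions :: "(real ^ 'd \<Rightarrow> real) set" where
  "test_functions = {\<phi>. (\<forall>n. Ck n \<phi>) \<and> compact (closure {x. \<phi> x \<noteq> 0})}"

definition locally_integrable :: "(real ^ 'd \<Rightarrow> 'b::{banach, second_countable_topology}) \<Rightarrow> bool" where
  "locally_integrable f \<longleftrightarrow>
     f \<in> borel_measurable lborel \<and> (\<forall>C. compact C \<longrightarrow> set_integrable lborel C f)"

definition has_weak_gradient :: "(real ^ 'd \<Rightarrow> real) \<Rightarrow> (real ^ 'd \<Rightarrow> real ^ 'd) \<Rightarrow> bool" where
  "has_weak_gradient u g \<longleftrightarrow> locally_integrable u \<and> locally_integrable g \<and>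
     (\<forall>\<phi>\<in>test_functions. \<forall>i.
        (\<integral>x. u x * partial i \<phi> x \<partial>lborel) = - (\<integral>x. g x $ i * \<phi> x \<partial>lborel))"

text \<open>A weak gradient is unique only up to null sets; the choice made here affects no integral.\<close>

definition weak_gradient :: "(real ^ 'd \<Rightarrow> real) \<Rightarrow> real ^ 'd \<Rightarrow> real ^ 'd" where
  "weak_gradient u = (SOME g. has_weak_gradient u g)"

text \<open>Members of \<open>H1\<close> are Borel representatives of the usual almost-everywhere classes; hence
  ``\<open>u = 0\<close>'' is always expressed by \<open>ae_zero\<close>.\<close>

definition H1 :: "(real ^ 'd \<Rightarrow> real) set" where
  "H1 = {u. u \<in> borel_measurable lborel \<and> integrable lborel (\<lambda>x. (u x)\<^sup>2) \<and>
            (\<exists>g. has_weak_gradient u g \<and> integrable lborel (\<lambda>x. (norm (g x))\<^sup>2))}"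

definition ae_zero :: "(real ^ 'd \<Rightarrow> real) \<Rightarrow> bool" where
  "ae_zero u \<longleftrightarrow> (AE x in lborel. u x = 0)"

definition H1_vec :: "('k, 'd::finite) vfun set" where
  "H1_vec = {u. \<forall>i. u i \<in> H1}"

definition sqnorm :: "real \<Rightarrow> (real ^ 'd \<Rightarrow> real) \<Rightarrow> real" where
  "sqnorm l u = (\<integral>x. (norm (weak_gradient u x))\<^sup>2 + l * (u x)\<^sup>2 \<partial>lborel)"


subsection \<open>The system and its variational structure\<close>

definition weak_solution ::
    "('k::finite \<Rightarrow> real) \<Rightarrow> ('k \<Rightarrow> real) \<Rightarrow> real \<Rightarrow> real \<Rightarrow> ('k, 'd::finite) vfun \<Rightarrow> bool" where
  "weak_solution lam mu q \<beta> u \<longleftrightarrow> u \<in> H1_vec \<and>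
     (\<forall>i. \<forall>v\<in>H1.
        (\<integral>x. weak_gradient (u i) x \<bullet> weak_gradient v x + lam i * u i x * v x \<partial>lborel) =
        (\<integral>x. (mu i * \<bar>u i x\<bar> powr (real CARD('k) * q - 2) * u i x
               + \<beta> * \<bar>u i x\<bar> powr (q - 2) * u i x * (\<Prod>j\<in>UNIV - {i}. \<bar>u j x\<bar> powr q)) * v x
         \<partial>lborel))"

definition energy ::
    "('k::finite \<Rightarrow> real) \<Rightarrow> ('k \<Rightarrow> real) \<Rightarrow> real \<Rightarrow> real \<Rightarrow> ('k, 'd::finite) vfun \<Rightarrow> real" where
  "energy lam mu q \<beta> u =
     1 / 2 * (\<Sum>i\<in>UNIV. sqnorm (lam i) (u i))
     - 1 / (real CARD('k) * q) * (\<Sum>i\<in>UNIV. \<integral>x. mu i * \<bar>u i x\<bar> powr (real CARD('k) * q) \<partial>lborel)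
     - \<beta> / q * (\<integral>x. (\<Prod>i\<in>UNIV. \<bar>u i x\<bar> powr q) \<partial>lborel)"

definition nontrivial :: "('k, 'd::finite) vfun \<Rightarrow> bool" where
  "nontrivial u \<longleftrightarrow> (\<exists>i. \<not> ae_zero (u i))"

definition fully_nontrivial :: "('k, 'd::finite) vfun \<Rightarrow> bool" where
  "fully_nontrivial u \<longleftrightarrow> (\<forall>i. \<not> ae_zero (u i))"

definition nehari ::
    "('k::finite \<Rightarrow> real) \<Rightarrow> ('k \<Rightarrow> real) \<Rightarrow> real \<Rightarrow> real \<Rightarrow> ('k, 'd::finite) vfun set" where
  "nehari lam mu q \<beta> = {u \<in> H1_vec. nontrivial u \<and>
     (\<Sum>i\<in>UNIV. sqnorm (lam i) (u i)) =
     (\<Sum>i\<in>UNIV. \<integral>x. mu i * \<bar>u i x\<bar> powr (real CARD('k) * q) \<partial>lborel)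
     + real CARD('k) * \<beta> * (\<integral>x. (\<Prod>i\<in>UNIV. \<bar>u i x\<bar> powr q) \<partial>lborel)}"

definition ground_state ::
    "('k::finite \<Rightarrow> real) \<Rightarrow> ('k \<Rightarrow> real) \<Rightarrow> real \<Rightarrow> real \<Rightarrow> ('k, 'd::finite) vfun \<Rightarrow> bool" where
  "ground_state lam mu q \<beta> u \<longleftrightarrow>
     weak_solution lam mu q \<beta> u \<and> nontrivial u \<and>
     (\<forall>w :: ('k, 'd) vfun. weak_solution lam mu q \<beta> w \<and> nontrivial w \<longrightarrow>
        energy lam mu q \<beta> u \<le> energy lam mu q \<beta> w)"


subsection \<open>Levels and the critical coupling\<close>

text \<open>The type argument \<open>TYPE('d)\<close> records the space \<open>\<real>\<^sup>d\<close>, which the value parameters do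
  not determine.\<close>

definition nehari_level ::
    "'d::finite itself \<Rightarrow> ('k::finite \<Rightarrow> real) \<Rightarrow> ('k \<Rightarrow> real) \<Rightarrow> real \<Rightarrow> real \<Rightarrow> real" where
  "nehari_level _ lam mu q \<beta> =
     (INF u\<in>(nehari lam mu q \<beta> :: ('k, 'd) vfun set). energy lam mu q \<beta> u)"

definition sobolev_const :: "'d::finite itself \<Rightarrow> real \<Rightarrow> real \<Rightarrow> real \<Rightarrow> real" where
  "sobolev_const _ p l m =
     (INF u\<in>{u \<in> (H1 :: (real ^ 'd \<Rightarrow> real) set). \<not> ae_zero u}.
        sqnorm l u / (\<integral>x. m * \<bar>u x\<bar> powr p \<partial>lborel) powr (2 / p))"

definition S_bar ::
    "'d::finite itself \<Rightarrow> ('k::finite \<Rightarrow> real) \<Rightarrow> ('k \<Rightarrow> real) \<Rightarrow> real \<Rightarrow> real" where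
  "S_bar T lam mu q = (MIN i\<in>UNIV. sobolev_const T (real CARD('k) * q) (lam i) (mu i))"

definition beta_bar ::
    "'d::finite itself \<Rightarrow> ('k::finite \<Rightarrow> real) \<Rightarrow> ('k \<Rightarrow> real) \<Rightarrow> real \<Rightarrow> real" where
  "beta_bar T lam mu q =
     (INF u\<in>{u \<in> (H1_vec :: ('k, 'd) vfun set). \<not> ae_zero (\<lambda>x. \<Prod>i\<in>UNIV. u i x)}.
        (S_bar T lam mu q powr (- (real CARD('k) * q / 2))
           * (\<Sum>i\<in>UNIV. sqnorm (lam i) (u i)) powr (real CARD('k) * q / 2)
         - (\<Sum>i\<in>UNIV. \<integral>x. mu i * \<bar>u i x\<bar> powr (real CARD('k) * q) \<partial>lborel))
        / (real CARD('k) * (\<integral>x. (\<Prod>i\<in>UNIV. \<bar>u i x\<bar> powr q) \<partial>lborel)))"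

end

theory Submission
  imports Defs "HOL-Complex_Analysis.Great_Picard" "HOL-Real_Asymp.Real_Asymp"
begin

text \<open>Since \<open>K \<ge> 3\<close> and \<open>q > 2\<close>, the subcriticality assumption forces \<open>d = 2\<close>. Let \<open>\<parallel>u\<parallel>\<^sup>2\<close> denote the sum of the
  squared norms of the components, put \<open>p = K q\<close>, and let \<open>G\<close> be the sum of the \<open>p\<close>-homogeneous terms
  at the critical coupling. By the definition of the critical coupling,
  \<open>G u \<le> S powr (- p / 2) * \<parallel>u\<parallel> powr p\<close> for every \<open>u\<close>, so it suffices to find a \<open>u\<close>
  with nonvanishing product for which equality holds: equality makes \<open>u\<close>, after scaling, a
  minimizer on the Nehari manifold and a critical point.

  Take a normalized minimizing sequence for the critical coupling. If the interaction integral tended to zero,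
  one component would carry almost the whole norm; as \<open>q / 2 > 1\<close> the quotient would then blow up.
  Hence the interaction stays bounded below, and by Lions' lemma suitable translates have a weak
  limit \<open>u\<close> with nonvanishing product. The Brezis--Lieb splitting gives
  \<open>1 \<le> a powr (p / 2) + (1 - a) powr (p / 2)\<close> with \<open>a = \<parallel>u\<parallel>\<^sup>2\<close> in \<open>(0, 1]\<close>, so \<open>a = 1\<close> and \<open>u\<close> attains equality.

  All functional analysis rests on one consequence of weak differentiability, the bound of
  \<open>u(x + a) - u(x)\<close> in \<open>L\<^sup>2\<close> by \<open>\<bar>a\<bar>\<close> times the \<open>L\<^sup>2\<close> norm of the gradient: applied to averages over
  cubes it yields the Sobolev and Rellich theorems.\<close>


subsection \<open>Square-integrable functions\<close>

text \<open>At the critical coupling, semitrivial functions whose only nonzero component is almost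
  optimal for \<open>S_bar\<close> come arbitrarily close to the least energy on the Nehari
  manifold. A minimizing sequence taken there may therefore lose components in the limit. This is
  why the quotient defining the coupling is minimized instead, and why everything is phrased through
  one homogeneous inequality between \<open>G\<close> and the norm. On the Nehari manifold that
  inequality bounds the norm from below, and there the energy is a fixed multiple of the squared
  norm; so an extremal of the inequality, once scaled, has least energy. Weak convergence enters
  through a single inner product, that of the sequence with its own limit, since the splitting of
  the norm asks for no more. The limit is built as a strong limit of iterated midpoints of the
  tails. It is identified by almost everywhere convergence of the functions, which determine their
  gradients.\<close>

definition L2 :: "'a measure \<Rightarrow> ('a \<Rightarrow> 'e::euclidean_space) set" where
  "L2 M = {f \<in> borel_measurable M. integrable M (\<lambda>x. (norm (f x))\<^sup>2)}"

text \<open>Only a semi-inner product on representatives: functions equal almost everywhere are not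
  identified. Values in any Euclidean space are allowed, so that scalar functions, gradients and
  whole vectors of both fall under one theory.\<close>

definition ip2 :: "'a measure \<Rightarrow> ('a \<Rightarrow> 'e::euclidean_space) \<Rightarrow> ('a \<Rightarrow> 'e) \<Rightarrow> real" where
  "ip2 M f g = (\<integral>x. f x \<bullet> g x \<partial>M)"

lemma L2_measurable [measurable_dest]: "f \<in> L2 M \<Longrightarrow> f \<in> borel_measurable M"
  by (simp add: L2_def)

lemma L2_integrable_norm: "f \<in> L2 M \<Longrightarrow> integrable M (\<lambda>x. (norm (f x))\<^sup>2)"
  by (simp add: L2_def)

lemma ip2_self: "ip2 M f f = (\<integral>x. (norm (f x))\<^sup>2 \<partial>M)"
  by (simp add: ip2_def power2_norm_eq_inner)

lemma ip2_self_nonneg [simp]: "0 \<le> ip2 M f f"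
  by (simp add: ip2_def)

lemma L2_inner_integrable:
  assumes "f \<in> L2 M" "g \<in> L2 M"
  shows "integrable M (\<lambda>x. f x \<bullet> g x)"
proof (rule Bochner_Integration.integrable_bound)
  show "integrable M (\<lambda>x. (norm (f x))\<^sup>2 + (norm (g x))\<^sup>2)"
    using assms by (intro Bochner_Integration.integrable_add L2_integrable_norm)
  show "(\<lambda>x. f x \<bullet> g x) \<in> borel_measurable M"
    using assms by (intro borel_measurable_inner L2_measurable)
  have "\<bar>a \<bullet> b\<bar> \<le> \<bar>(norm a)\<^sup>2 + (norm b)\<^sup>2\<bar>" for a b :: 'b
  proof -
    have "\<bar>a \<bullet> b\<bar> \<le> norm a * norm b" by (rule Cauchy_Schwarz_ineq2)
    also have "\<dots> \<le> (norm a)\<^sup>2 + (norm b)\<^sup>2"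
      using sum_squares_bound[of "norm a" "norm b"] zero_le_power2[of "norm a"] zero_le_power2[of "norm b"]
      by linarith
    finally show ?thesis by simp
  qed
  then show "AE x in M. norm (f x \<bullet> g x) \<le> norm ((norm (f x))\<^sup>2 + (norm (g x))\<^sup>2)" by simp
qed

lemma L2_scaleR: "f \<in> L2 M \<Longrightarrow> (\<lambda>x. c *\<^sub>R f x) \<in> L2 M"
  by (auto simp: L2_def power_mult_distrib intro: borel_measurable_scaleR)

lemma L2_add:
  assumes "f \<in> L2 M" "g \<in> L2 M"
  shows "(\<lambda>x. f x + g x) \<in> L2 M"
proof -
  have "(norm (a + b))\<^sup>2 = (norm a)\<^sup>2 + 2 * (a \<bullet> b) + (norm b)\<^sup>2" for a b :: 'b
    by (simp add: power2_norm_eq_inner inner_add inner_commute)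
  moreover have "integrable M (\<lambda>x. (norm (f x))\<^sup>2 + 2 * (f x \<bullet> g x) + (norm (g x))\<^sup>2)"
    using assms by (intro Bochner_Integration.integrable_add L2_integrable_norm integrable_mult_right L2_inner_integrable)
  ultimately show ?thesis using assms by (auto simp: L2_def intro: borel_measurable_add)
qed

lemma L2_diff:
  assumes "f \<in> L2 M" "g \<in> L2 M"
  shows "(\<lambda>x. f x - g x) \<in> L2 M"
  using L2_add[OF assms(1) L2_scaleR[OF assms(2), of "-1"]] by simp

lemma ip2_add_left:
  "f \<in> L2 M \<Longrightarrow> g \<in> L2 M \<Longrightarrow> h \<in> L2 M \<Longrightarrow> ip2 M (\<lambda>x. f x + g x) h = ip2 M f h + ip2 M g h"
  by (simp add: ip2_def inner_add_left L2_inner_integrable)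

lemma ip2_diff_left:
  "f \<in> L2 M \<Longrightarrow> g \<in> L2 M \<Longrightarrow> h \<in> L2 M \<Longrightarrow> ip2 M (\<lambda>x. f x - g x) h = ip2 M f h - ip2 M g h"
  by (simp add: ip2_def inner_diff_left L2_inner_integrable)

lemma ip2_scaleR_left: "ip2 M (\<lambda>x. c *\<^sub>R f x) h = c * ip2 M f h"
  by (simp add: ip2_def)

lemma ip2_add_self:
  assumes "f \<in> L2 M" "g \<in> L2 M"
  shows "ip2 M (\<lambda>x. f x + g x) (\<lambda>x. f x + g x) = ip2 M f f + 2 * ip2 M f g + ip2 M g g"
  using assms by (simp add: ip2_def inner_add_left inner_add_right L2_inner_integrable inner_commute[of "g _" "f _"])

lemma ip2_diff_self:
  assumes "f \<in> L2 M" "g \<in> L2 M"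
  shows "ip2 M (\<lambda>x. f x - g x) (\<lambda>x. f x - g x) = ip2 M f f - 2 * ip2 M f g + ip2 M g g"
  using assms by (simp add: ip2_def inner_diff_left inner_diff_right L2_inner_integrable inner_commute[of "g _" "f _"])

text \<open>The squared norm of \<open>f + t g\<close> is a nonnegative quadratic polynomial in
  \<open>t\<close>. If \<open>g\<close> has norm zero the polynomial is affine, so its slope must
  vanish; otherwise its minimum is inspected.\<close>

lemma ip2_Cauchy_Schwarz:
  assumes "f \<in> L2 M" "g \<in> L2 M"
  shows "(ip2 M f g)\<^sup>2 \<le> ip2 M f f * ip2 M g g"
proof -
  have q: "0 \<le> ip2 M f f + 2 * t * ip2 M f g + t\<^sup>2 * ip2 M g g" for t
  proof -
    have "0 \<le> ip2 M (\<lambda>x. f x + t *\<^sub>R g x) (\<lambda>x. f x + t *\<^sub>R g x)" by simp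
    also have "\<dots> = ip2 M f f + 2 * t * ip2 M f g + t\<^sup>2 * ip2 M g g"
      unfolding ip2_add_self[OF assms(1) L2_scaleR[OF assms(2)]]
      by (simp add: ip2_def power2_eq_square)
    finally show ?thesis .
  qed
  show ?thesis
  proof (cases "ip2 M g g = 0")
    case True
    have "ip2 M f g = 0"
    proof (rule ccontr)
      assume "ip2 M f g \<noteq> 0"
      \<comment> \<open>This \<open>t\<close> would make the affine expression equal to -1.\<close>
      then show False using q[of "- (ip2 M f f + 1) / (2 * ip2 M f g)"] True by (simp add: field_simps)
    qed
    then show ?thesis by simp
  next
    case False
    then have "ip2 M g g > 0" using ip2_self_nonneg[of M g] by linarith
    then show ?thesis using q[of "- ip2 M f g / ip2 M g g"]
      by (simp add: field_simps power2_eq_square)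
  qed
qed

lemma ip2_tendsto:
  assumes "\<And>n. f n \<in> L2 M" "F \<in> L2 M" "h \<in> L2 M"
    "(\<lambda>n. ip2 M (\<lambda>x. f n x - F x) (\<lambda>x. f n x - F x)) \<longlonglongrightarrow> 0"
  shows "(\<lambda>n. ip2 M (f n) h) \<longlonglongrightarrow> ip2 M F h"
proof -
  have 1: "\<bar>ip2 M (f n) h - ip2 M F h\<bar> \<le> sqrt (ip2 M (\<lambda>x. f n x - F x) (\<lambda>x. f n x - F x) * ip2 M h h)" for n
    using ip2_Cauchy_Schwarz[OF L2_diff[OF assms(1)[of n] assms(2)] assms(3)] assms ip2_diff_left[of "f n" M F h]
    by (intro real_le_rsqrt) simp
  have 2: "(\<lambda>n. sqrt (ip2 M (\<lambda>x. f n x - F x) (\<lambda>x. f n x - F x) * ip2 M h h)) \<longlonglongrightarrow> sqrt (0 * ip2 M h h)"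
    by (intro tendsto_intros assms)
  have "(\<lambda>n. ip2 M (f n) h - ip2 M F h) \<longlonglongrightarrow> 0"
    by (rule Lim_null_comparison[of _ "\<lambda>n. sqrt (ip2 M (\<lambda>x. f n x - F x) (\<lambda>x. f n x - F x) * ip2 M h h)"])
      (use 1 2 in auto)
  then show ?thesis by (rule LIM_zero_cancel)
qed

lemma L2_I_nn:
  assumes "f \<in> borel_measurable M" "(\<integral>\<^sup>+x. ennreal ((norm (f x))\<^sup>2) \<partial>M) \<le> ennreal e" "e \<ge> 0"
  shows "f \<in> L2 M" "ip2 M f f \<le> e"
proof -
  have 1: "integrable M (\<lambda>x. (norm (f x))\<^sup>2)"
    using assms by (intro integrableI_bounded) (auto simp: top_unique less_top[symmetric])
  then show "f \<in> L2 M" using assms by (simp add: L2_def)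
  have "ennreal (ip2 M f f) \<le> ennreal e"
    using nn_integral_eq_integral[OF 1] assms(2) by (simp add: ip2_self)
  then show "ip2 M f f \<le> e" using assms(3) by simp
qed

lemma L2_nn_integral: "f \<in> L2 M \<Longrightarrow> (\<integral>\<^sup>+x. ennreal ((norm (f x))\<^sup>2) \<partial>M) = ennreal (ip2 M f f)"
  by (simp add: ip2_self L2_integrable_norm nn_integral_eq_integral)

text \<open>Riesz--Fischer. Along a subsequence with squared increments at most
  \<open>(1/4) ^ k\<close>, a weighted series of these squares is integrable, hence finite almost
  everywhere, and this gives a pointwise limit. Fatou's lemma makes it the \<open>L2\<close> limit
  of the whole sequence.\<close>

lemma L2_complete:
  fixes f :: "nat \<Rightarrow> 'a \<Rightarrow> 'e::euclidean_space"
  assumes f: "\<And>n. f n \<in> L2 M"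
    and cauchy: "\<And>e. e > 0 \<Longrightarrow> \<exists>N. \<forall>m\<ge>N. \<forall>n\<ge>N. ip2 M (\<lambda>x. f m x - f n x) (\<lambda>x. f m x - f n x) < e"
  obtains r F where "strict_mono (r :: nat \<Rightarrow> nat)" "F \<in> L2 M" "AE x in M. (\<lambda>n. f (r n) x) \<longlonglongrightarrow> F x"
    "(\<lambda>n. ip2 M (\<lambda>x. f n x - F x) (\<lambda>x. f n x - F x)) \<longlonglongrightarrow> 0"
proof -
  define d where "d m n = ip2 M (\<lambda>x. f m x - f n x) (\<lambda>x. f m x - f n x)" for m n
  have "\<forall>k. \<exists>N. \<forall>m\<ge>N. \<forall>n\<ge>N. d m n < (1/4) ^ k"
    unfolding d_def by (intro allI cauchy) simp
  then obtain N where N: "\<And>k m n. m \<ge> N k \<Longrightarrow> n \<ge> N k \<Longrightarrow> d m n < (1/4) ^ k" by metis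
  \<comment> \<open>The sum dominates \<open>N k\<close>, and the added \<open>k\<close> makes the
    sequence strictly increasing.\<close>
  define r where "r k = (\<Sum>j\<le>k. N j) + k" for k
  have rmono: "strict_mono r" by (rule strict_mono_Suc_iff[THEN iffD2]) (simp add: r_def)
  have rN: "N k \<le> r k" for k unfolding r_def by (simp add: member_le_sum trans_le_add1)
  have meas [measurable]: "f n \<in> borel_measurable M" for n using f by (rule L2_measurable)
  define D where "D k x = f (r (Suc k)) x - f (r k) x" for k x
  have [measurable]: "D k \<in> borel_measurable M" for k unfolding D_def[abs_def] by measurable
  have DL: "D k \<in> L2 M" for k unfolding D_def[abs_def] by (intro L2_diff f)
  have "ip2 M (D k) (D k) \<le> (1/4) ^ k" for k
    using N[of k "r (Suc k)" "r k"] rN[of k] rmono unfolding d_def D_def[abs_def]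
    by (simp add: strict_mono_less_eq order.trans[OF rN] less_imp_le)
  \<comment> \<open>Half of the decay \<open>(1/4) ^ k\<close> is spent on the weight
    \<open>2 ^ k\<close>. The other half still sums, and finiteness of the weighted series makes the
    increments at a point geometric.\<close>
  then have Dk: "(\<integral>\<^sup>+x. ennreal (2 ^ k * (norm (D k x))\<^sup>2) \<partial>M) \<le> ennreal ((1/2) ^ k)" for k
  proof -
    have "(\<integral>\<^sup>+x. ennreal (2 ^ k * (norm (D k x))\<^sup>2) \<partial>M) = ennreal (2 ^ k) * ennreal (ip2 M (D k) (D k))"
      using L2_nn_integral[OF DL[of k]] by (simp add: ennreal_mult nn_integral_cmult)
    also have "\<dots> = ennreal (2 ^ k * ip2 M (D k) (D k))" by (simp add: ennreal_mult)
    also have "\<dots> \<le> ennreal (2 ^ k * (1/4) ^ k)"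
      using \<open>ip2 M (D k) (D k) \<le> (1/4) ^ k\<close> by (intro ennreal_leI mult_left_mono) auto
    also have "2 ^ k * (1/4) ^ k = (1/2 :: real) ^ k" by (simp flip: power_mult_distrib)
    finally show ?thesis .
  qed
  have "(\<integral>\<^sup>+x. (\<Sum>k. ennreal (2 ^ k * (norm (D k x))\<^sup>2)) \<partial>M) = (\<Sum>k. \<integral>\<^sup>+x. ennreal (2 ^ k * (norm (D k x))\<^sup>2) \<partial>M)"
    by (rule nn_integral_suminf) measurable
  also have "\<dots> \<le> (\<Sum>k. ennreal ((1/2) ^ k))" by (intro suminf_le Dk) auto
  also have "\<dots> < \<infinity>"
    by (subst suminf_ennreal_eq[OF _ geometric_sums]) auto
  finally have "AE x in M. (\<Sum>k. ennreal (2 ^ k * (norm (D k x))\<^sup>2)) \<noteq> \<infinity>"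
    by (intro nn_integral_PInf_AE) auto
  then have conv: "AE x in M. convergent (\<lambda>k. f (r k) x)"
  proof eventually_elim
    case (elim x)
    then obtain C where C: "(\<Sum>k. ennreal (2 ^ k * (norm (D k x))\<^sup>2)) = ennreal C" "C \<ge> 0"
      using ennreal_enn2real[symmetric] enn2real_nonneg unfolding infinity_ennreal_def less_top by blast
    have le: "norm (D k x) \<le> sqrt C * (1 / sqrt 2) ^ k" for k
    proof -
      have "ennreal (2 ^ k * (norm (D k x))\<^sup>2) \<le> ennreal C"
      proof -
        define g where "g = (\<lambda>k. ennreal (2 ^ k * (norm (D k x))\<^sup>2))"
        have "sum g {k} \<le> suminf g" by (rule sum_le_suminf) auto
        then show ?thesis using C(1) by (simp add: g_def[symmetric]) (simp add: g_def)
      qed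
      then have "2 ^ k * (norm (D k x))\<^sup>2 \<le> C" using C(2) by simp
      then have "(norm (D k x))\<^sup>2 \<le> C * (1/2) ^ k"
        by (simp add: pos_le_divide_eq power_one_over mult.commute)
      then have "norm (D k x) \<le> sqrt (C * (1/2) ^ k)" by (rule real_le_rsqrt)
      then show ?thesis by (simp add: real_sqrt_mult real_sqrt_power real_sqrt_divide)
    qed
    have "summable (\<lambda>k. sqrt C * (1 / sqrt 2) ^ k)"
      by (intro summable_mult summable_geometric) simp
    then have "summable (\<lambda>k. D k x)"
      by (rule summable_comparison_test'[of _ 0]) (use le in auto)
    then have "convergent (\<lambda>n. \<Sum>k<n. D k x)" by (simp add: summable_iff_convergent)
    moreover have "(\<Sum>k<n. D k x) = f (r n) x - f (r 0) x" for n
      unfolding D_def by (rule sum_lessThan_telescope)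
    ultimately have "convergent (\<lambda>n. f (r n) x - f (r 0) x)" by simp
    then have "convergent (\<lambda>n. (f (r n) x - f (r 0) x) + f (r 0) x)"
      by (intro convergent_add convergent_const)
    then show ?case by simp
  qed
  define F where "F x = lim (\<lambda>k. f (r k) x)" for x
  have Fm [measurable]: "F \<in> borel_measurable M"
    unfolding F_def[abs_def] by (rule borel_measurable_lim_metric) measurable
  have AEF: "AE x in M. (\<lambda>k. f (r k) x) \<longlonglongrightarrow> F x"
    using conv unfolding F_def by eventually_elim (simp add: convergent_LIMSEQ_iff)
  \<comment> \<open>The first index stays fixed while the second runs through the
    subsequence.\<close>
  have fatou: "(\<integral>\<^sup>+x. ennreal ((norm (f m x - F x))\<^sup>2) \<partial>M) \<le> ennreal ((1/4) ^ k)" if "m \<ge> N k" for m k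
  proof -
    have "(\<integral>\<^sup>+x. ennreal ((norm (f m x - F x))\<^sup>2) \<partial>M) = (\<integral>\<^sup>+x. liminf (\<lambda>n. ennreal ((norm (f m x - f (r n) x))\<^sup>2)) \<partial>M)"
    proof (rule nn_integral_cong_AE, use AEF in eventually_elim)
      case (elim x)
      have "(\<lambda>n. ennreal ((norm (f m x - f (r n) x))\<^sup>2)) \<longlonglongrightarrow> ennreal ((norm (f m x - F x))\<^sup>2)"
        using elim by (intro tendsto_intros)
      from lim_imp_Liminf[OF _ this] show ?case by simp
    qed
    also have "\<dots> \<le> liminf (\<lambda>n. \<integral>\<^sup>+x. ennreal ((norm (f m x - f (r n) x))\<^sup>2) \<partial>M)"
      by (rule nn_integral_liminf) measurable
    also have "\<dots> \<le> liminf (\<lambda>n. ennreal ((1/4) ^ k))"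
    proof (rule Liminf_mono, rule eventually_sequentiallyI[of k])
      fix n assume "n \<ge> k"
      then have "r n \<ge> N k" using rN[of k] rmono by (meson order.trans strict_mono_less_eq)
      from N[OF that this] show "(\<integral>\<^sup>+x. ennreal ((norm (f m x - f (r n) x))\<^sup>2) \<partial>M) \<le> ennreal ((1/4) ^ k)"
        using L2_nn_integral[OF L2_diff[OF f f], of m "r n"] by (simp add: d_def ennreal_leI)
    qed
    also have "\<dots> = ennreal ((1/4) ^ k)" by (rule Liminf_const) simp
    finally show ?thesis .
  qed
  have FL: "F \<in> L2 M"
  proof -
    have "(\<lambda>x. f (N 0) x - F x) \<in> L2 M" by (rule L2_I_nn(1)[OF _ fatou[of 0]]) auto
    from L2_diff[OF f[of "N 0"] this] show ?thesis by simp
  qed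
  have lim: "(\<lambda>n. ip2 M (\<lambda>x. f n x - F x) (\<lambda>x. f n x - F x)) \<longlonglongrightarrow> 0"
  proof (rule LIMSEQ_I)
    fix e :: real assume "e > 0"
    then obtain k where k: "(1/4 :: real) ^ k < e" using real_arch_pow_inv[of e "1/4"] by auto
    have "ip2 M (\<lambda>x. f n x - F x) (\<lambda>x. f n x - F x) \<le> (1/4) ^ k" if "n \<ge> N k" for n
      by (rule L2_I_nn(2)[OF _ fatou[OF that]]) auto
    then show "\<exists>no. \<forall>n\<ge>no. norm (ip2 M (\<lambda>x. f n x - F x) (\<lambda>x. f n x - F x) - 0) < e"
      using k by (intro exI[of _ "N k"]) (auto intro: le_less_trans)
  qed
  show ?thesis by (rule that[OF rmono FL AEF lim])
qed

text \<open>Iterated midpoints are convex combinations with dyadic weights, here without any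
  bookkeeping of weights. They suffice because the parallelogram law compares two elements with
  their midpoint only.\<close>

inductive midhull :: "('a \<Rightarrow> 'e::real_vector) set \<Rightarrow> ('a \<Rightarrow> 'e) \<Rightarrow> bool" for S where
  base: "f \<in> S \<Longrightarrow> midhull S f"
| mid: "midhull S f \<Longrightarrow> midhull S g \<Longrightarrow> midhull S (\<lambda>x. (1/2) *\<^sub>R (f x + g x))"

lemma midhull_mono: "midhull S f \<Longrightarrow> S \<subseteq> T \<Longrightarrow> midhull T f"
  by (induction rule: midhull.induct) (auto intro: midhull.intros)

lemma midhull_L2: "midhull S f \<Longrightarrow> S \<subseteq> L2 M \<Longrightarrow> f \<in> L2 M"
  by (induction rule: midhull.induct) (auto intro: L2_add L2_scaleR)

text \<open>Induction along midpoints. The set \<open>V\<close> is carried along because the maps of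
  interest, such as inner products with a fixed function, are midpoint-affine on square-integrable
  functions.\<close>

lemma midhull_convex:
  fixes L :: "('a \<Rightarrow> 'e::real_vector) \<Rightarrow> 'b::real_vector"
  assumes "midhull S f" "convex C" "\<And>f. f \<in> S \<Longrightarrow> L f \<in> C" "S \<subseteq> V"
    and "\<And>f g. f \<in> V \<Longrightarrow> g \<in> V \<Longrightarrow> (\<lambda>x. (1/2) *\<^sub>R (f x + g x)) \<in> V"
    and "\<And>f g. f \<in> V \<Longrightarrow> g \<in> V \<Longrightarrow> L (\<lambda>x. (1/2) *\<^sub>R (f x + g x)) = (1/2) *\<^sub>R (L f + L g)"
  shows "f \<in> V \<and> L f \<in> C"
  using assms(1)
proof induction
  case (mid f g)
  then have "(1/2) *\<^sub>R L f + (1/2) *\<^sub>R L g \<in> C" by (intro convexD[OF assms(2)]) auto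
  then show ?case using mid assms by (simp add: scaleR_add_right)
qed (use assms in auto)

text \<open>A form of Mazur's theorem: by the parallelogram law, elements of almost minimal norm in the
  midpoint hulls of the tails form a Cauchy sequence.\<close>

lemma L2_midhull_convergent:
  fixes f :: "nat \<Rightarrow> 'a \<Rightarrow> 'e::euclidean_space"
  assumes f: "\<And>n. f n \<in> L2 M" and bdd: "\<And>n. ip2 M (f n) (f n) \<le> B"
  obtains h r F where "\<And>n. midhull (f ` {n..}) (h n)" "strict_mono (r :: nat \<Rightarrow> nat)" "F \<in> L2 M"
    "AE x in M. (\<lambda>n. h (r n) x) \<longlonglongrightarrow> F x"
    "(\<lambda>n. ip2 M (\<lambda>x. h n x - F x) (\<lambda>x. h n x - F x)) \<longlonglongrightarrow> 0"
proof -
  define A where "A n = (\<lambda>g. ip2 M g g) ` {g. midhull (f ` {n..}) g}" for n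
  define d where "d n = Inf (A n)" for n
  have bb: "bdd_below (A n)" for n by (rule bdd_belowI[of _ 0]) (auto simp: A_def)
  have mem: "ip2 M (f n) (f n) \<in> A n" for n by (auto simp: A_def intro!: midhull.base)
  then have ne: "A n \<noteq> {}" for n by blast
  have dmono: "d m \<le> d n" if "m \<le> n" for m n
  proof -
    have "midhull (f ` {n..}) g \<Longrightarrow> midhull (f ` {m..}) g" for g
      using that by (elim midhull_mono) auto
    then have "A n \<subseteq> A m" by (auto simp: A_def)
    then show ?thesis unfolding d_def by (intro cInf_superset_mono ne bb)
  qed
  have dB: "d n \<le> B" for n
    using cInf_lower[OF mem bb, of n] bdd[of n] by (simp add: d_def)
  obtain D where D: "d \<longlonglongrightarrow> D"
    using incseq_convergent[of d B] dmono dB unfolding incseq_def by metis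
  have dD: "d n \<le> D" for n by (rule incseq_le[OF _ D]) (simp add: incseq_def dmono)
  have "\<exists>g. midhull (f ` {n..}) g \<and> ip2 M g g < d n + 1 / Suc n" for n
  proof -
    have "Inf (A n) < d n + 1 / Suc n" by (simp add: d_def)
    then show ?thesis using cInf_lessD[OF ne] by (force simp: A_def)
  qed
  then obtain h where h: "\<And>n. midhull (f ` {n..}) (h n)" "\<And>n. ip2 M (h n) (h n) < d n + 1 / Suc n" by metis
  have hL: "h n \<in> L2 M" for n using h(1)[of n] by (rule midhull_L2) (use f in auto)
  \<comment> \<open>The minimal squared norms \<open>d k\<close> increase to \<open>D\<close> as the
    tails shrink, so the bound tends to 0 with growing \<open>k\<close>.\<close>
  have close: "ip2 M (\<lambda>x. h m x - h n x) (\<lambda>x. h m x - h n x) \<le> 4 * (D - d k) + 4 / Suc k"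
    if "m \<ge> k" "n \<ge> k" for m n k
  proof -
    let ?g = "\<lambda>x. (1/2) *\<^sub>R (h m x + h n x)"
    have "midhull (f ` {k..}) (h m)" "midhull (f ` {k..}) (h n)"
      using that by (auto intro!: midhull_mono[OF h(1)])
    then have "ip2 M ?g ?g \<in> A k" by (auto simp: A_def intro!: midhull.mid)
    then have 1: "d k \<le> ip2 M ?g ?g" using cInf_lower[OF _ bb] by (simp add: d_def)
    have 2: "ip2 M ?g ?g = (ip2 M (h m) (h m) + 2 * ip2 M (h m) (h n) + ip2 M (h n) (h n)) / 4"
      using ip2_add_self[OF hL hL, of m n] by (simp add: ip2_def)
    have 3: "ip2 M (h j) (h j) \<le> D + 1 / Suc k" if "j \<ge> k" for j
    proof -
      have "1 / Suc j \<le> 1 / Suc k" using that by (intro divide_left_mono) auto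
      then show ?thesis using h(2)[of j] dD[of j] by linarith
    qed
    show ?thesis
    proof -
      have "4 / real (Suc k) = 4 * (1 / real (Suc k))" by simp
      then show ?thesis
        unfolding ip2_diff_self[OF hL hL] using 1 2 3[OF that(1)] 3[OF that(2)] by argo
    qed
  qed
  have tends: "(\<lambda>k. 4 * (D - d k) + 4 * (1 / real (Suc k))) \<longlonglongrightarrow> 4 * (D - D) + 4 * 0"
    by (intro tendsto_intros D LIMSEQ_Suc[OF lim_1_over_n])
  obtain r F where "strict_mono (r :: nat \<Rightarrow> nat)" "F \<in> L2 M"
    "AE x in M. (\<lambda>n. h (r n) x) \<longlonglongrightarrow> F x"
    "(\<lambda>n. ip2 M (\<lambda>x. h n x - F x) (\<lambda>x. h n x - F x)) \<longlonglongrightarrow> 0"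
  proof (rule L2_complete[OF hL])
    fix e :: real assume "e > 0"
    then obtain k where "4 * (D - d k) + 4 * (1 / real (Suc k)) < e"
      using order_tendstoD(2)[OF tends, of e] by (auto simp: eventually_sequentially)
    then show "\<exists>N. \<forall>m\<ge>N. \<forall>n\<ge>N. ip2 M (\<lambda>x. h m x - h n x) (\<lambda>x. h m x - h n x) < e"
      using close by (intro exI[of _ k]) (auto intro: le_less_trans)
  qed blast
  then show ?thesis using that h(1) by blast
qed

subsection \<open>Test functions\<close>

lemma partial_eqI:
  assumes "(f has_derivative f') (at x)"
  shows "partial i f x = f' (axis i 1)"
  using frechet_derivative_at[OF assms] by (simp add: partial_def)

lemma Ck_SucI:
  assumes "\<And>x. (f has_derivative f' x) (at x)" "\<And>i. Ck n (\<lambda>x. f' x (axis i 1))"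
  shows "Ck (Suc n) f"
proof -
  have "partial i f = (\<lambda>x. f' x (axis i 1))" for i
    using partial_eqI[OF assms(1)] by auto
  then show ?thesis using assms by (auto simp: differentiable_def)
qed

lemma Ck_const [simp]: "Ck n (\<lambda>_. c)"
proof (induction n arbitrary: c)
  case 0 then show ?case by simp
next
  case (Suc n)
  show ?case by (rule Ck_SucI[where f' = "\<lambda>_ _. 0"]) (use Suc in auto)
qed

lemma Ck_SucD: "Ck (Suc n) f \<Longrightarrow> Ck n f"
proof (induction n arbitrary: f)
  case 0
  then show ?case
    by (auto intro!: continuous_at_imp_continuous_on differentiable_imp_continuous_within)
next
  case (Suc n) then show ?case by (simp del: Ck.simps add: Ck.simps(2)[of "Suc n"] Ck.simps(2)[of n])
qed

lemma Ck_Suc_has_derivative: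
  assumes "Ck (Suc n) f"
  shows "(f has_derivative (\<lambda>h. \<Sum>i\<in>UNIV. h $ i * partial i f x)) (at x)"
proof -
  have d: "(f has_derivative frechet_derivative f (at x)) (at x)"
    using assms by (simp add: frechet_derivative_works)
  then interpret bounded_linear "frechet_derivative f (at x)" by (rule has_derivative_bounded_linear)
  have "frechet_derivative f (at x) h = (\<Sum>i\<in>UNIV. h $ i * partial i f x)" for h
  proof -
    have "frechet_derivative f (at x) h = frechet_derivative f (at x) (\<Sum>i\<in>UNIV. (h $ i) *\<^sub>R axis i 1)"
      by (simp add: basis_expansion scalar_mult_eq_scaleR[symmetric])
    then show ?thesis by (simp add: sum scaleR partial_def)
  qed
  then have "frechet_derivative f (at x) = (\<lambda>h. \<Sum>i\<in>UNIV. h $ i * partial i f x)" by blast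
  then show ?thesis using d by simp
qed

lemma Ck_add: "Ck n f \<Longrightarrow> Ck n g \<Longrightarrow> Ck n (\<lambda>x. f x + g x)"
proof (induction n arbitrary: f g)
  case 0 then show ?case by (auto intro: continuous_intros)
next
  case (Suc n)
  show ?case
  proof (rule Ck_SucI)
    show "((\<lambda>x. f x + g x) has_derivative (\<lambda>h. (\<Sum>i\<in>UNIV. h $ i * partial i f x) + (\<Sum>i\<in>UNIV. h $ i * partial i g x))) (at x)" for x
      by (intro has_derivative_add Ck_Suc_has_derivative[OF Suc.prems(1)] Ck_Suc_has_derivative[OF Suc.prems(2)])
    show "Ck n (\<lambda>x. (\<Sum>j\<in>UNIV. axis i 1 $ j * partial j f x) + (\<Sum>j\<in>UNIV. axis i 1 $ j * partial j g x))" for i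
      using Suc by (simp add: axis_def if_distrib if_distribR cong: if_cong)
  qed
qed

lemma Ck_mult: "Ck n f \<Longrightarrow> Ck n g \<Longrightarrow> Ck n (\<lambda>x. f x * g x)"
proof (induction n arbitrary: f g)
  case 0 then show ?case by (auto intro: continuous_intros)
next
  case (Suc n)
  show ?case
  proof (rule Ck_SucI)
    show "((\<lambda>x. f x * g x) has_derivative (\<lambda>h. f x * (\<Sum>i\<in>UNIV. h $ i * partial i g x) + (\<Sum>i\<in>UNIV. h $ i * partial i f x) * g x)) (at x)" for x
      by (intro has_derivative_mult Ck_Suc_has_derivative[OF Suc.prems(1)] Ck_Suc_has_derivative[OF Suc.prems(2)])
    show "Ck n (\<lambda>x. f x * (\<Sum>j\<in>UNIV. axis i 1 $ j * partial j g x) + (\<Sum>j\<in>UNIV. axis i 1 $ j * partial j f x) * g x)" for i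
    proof -
      have "Ck n f" "Ck n g" "Ck n (partial i f)" "Ck n (partial i g)"
        using Suc.prems Ck_SucD[OF Suc.prems(1)] Ck_SucD[OF Suc.prems(2)] by simp_all
      then have "Ck n (\<lambda>x. f x * partial i g x + partial i f x * g x)"
        by (intro Ck_add Suc.IH)
      then show ?thesis by (simp add: axis_def if_distrib if_distribR cong: if_cong)
    qed
  qed
qed

lemma Ck_prod: "finite I \<Longrightarrow> (\<And>i. i \<in> I \<Longrightarrow> Ck n (f i)) \<Longrightarrow> Ck n (\<lambda>x. \<Prod>i\<in>I. f i x)"
  by (induction I rule: finite_induct) (auto intro: Ck_mult)

text \<open>The functions exp(-1/t) / t^k, extended by zero, differentiate into each other: the
  derivative of member \<open>k\<close> combines the members \<open>k + 1\<close> and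
  \<open>k + 2\<close>. One induction then yields smoothness of every order.\<close>

definition expinv :: "nat \<Rightarrow> real \<Rightarrow> real" where
  "expinv k t = (if t > 0 then exp (- inverse t) * inverse t ^ k else 0)"

lemma expinv_nonneg: "0 \<le> expinv k t" and expinv_0_le_1: "expinv 0 t \<le> 1"
  by (auto simp: expinv_def)

lemma expinv_tendsto_0: "(expinv k \<longlongrightarrow> 0) (at 0)"
proof -
  have "((\<lambda>t::real. inverse t ^ k / exp (inverse t)) \<longlongrightarrow> 0) (at_right 0)"
    by (rule filterlim_compose[OF tendsto_power_div_exp_0 filterlim_inverse_at_top_right])
  then have "(expinv k \<longlongrightarrow> 0) (at_right 0)"
    by (rule Lim_transform_eventually)
      (auto simp: eventually_at_filter expinv_def exp_minus divide_inverse mult.commute)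
  moreover have "(expinv k \<longlongrightarrow> 0) (at_left 0)"
    by (rule tendsto_eventually) (auto simp: eventually_at_filter expinv_def)
  ultimately show ?thesis by (simp add: filterlim_at_split)
qed

lemma expinv_has_derivative:
  "(expinv k has_real_derivative - real k * expinv (Suc k) t + expinv (Suc (Suc k)) t) (at t)"
proof (cases t "0::real" rule: linorder_cases)
  case less
  have "((\<lambda>_. 0) has_real_derivative 0) (at t)" by simp
  then have "(expinv k has_real_derivative 0) (at t)"
    by (rule DERIV_cong_ev[OF refl _ refl, THEN iffD1, rotated])
      (use less in \<open>auto intro!: eventually_mono[OF eventually_nhds_in_open[of "{..<0}"]] simp: expinv_def\<close>)
  then show ?thesis using less by (simp add: expinv_def)
next
  case greater
  \<comment> \<open>For \<open>k = 0\<close> natural subtraction gives \<open>k - 1 = 0\<close>, and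
    the factor \<open>real k\<close> vanishes.\<close>
  have k: "real k * (inverse t ^ (k - 1) * inverse t ^ 2) = real k * inverse t ^ Suc k"
    by (cases k) (simp_all add: power2_eq_square mult_ac)
  have "((\<lambda>t. exp (- inverse t) * inverse t ^ k) has_real_derivative
      exp (- inverse t) * (inverse t ^ 2 * inverse t ^ k) - exp (- inverse t) * (real k * (inverse t ^ (k - 1) * inverse t ^ 2))) (at t)"
  proof -
    have i: "(inverse has_real_derivative - (inverse t ^ Suc (Suc 0))) (at t)"
      using greater by (intro DERIV_inverse) simp
    have e: "((\<lambda>t. exp (- inverse t)) has_real_derivative exp (- inverse t) * (inverse t)\<^sup>2) (at t)"
      using DERIV_fun_exp[OF DERIV_minus[OF i]] by (simp add: power2_eq_square)
    have p: "((\<lambda>t. inverse t ^ k) has_real_derivative real k * (- (inverse t)\<^sup>2 * inverse t ^ (k - 1))) (at t)"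
      using DERIV_power[OF i, of k] by (simp add: power2_eq_square)
    have alg: "a * c * b + d * (- c * f) * a = a * (c * b) - a * (d * (f * c))" for a b c d f :: real
      by (simp add: algebra_simps)
    show ?thesis
      using DERIV_mult[OF e p] unfolding alg .
  qed
  then have "((\<lambda>t. exp (- inverse t) * inverse t ^ k) has_real_derivative
      - real k * expinv (Suc k) t + expinv (Suc (Suc k)) t) (at t)"
    unfolding k using greater by (simp add: expinv_def power2_eq_square algebra_simps)
  then show ?thesis
    by (rule DERIV_cong_ev[OF refl _ refl, THEN iffD1, rotated])
      (use greater in \<open>auto intro!: eventually_mono[OF eventually_nhds_in_open[of "{0<..}"]] simp: expinv_def\<close>)
next
  case equal
  \<comment> \<open>The difference quotient of member \<open>k\<close> at 0 is member
    \<open>Suc k\<close>, which tends to 0.\<close>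
  have "((\<lambda>h. (expinv k h - expinv k 0) / h) \<longlongrightarrow> 0) (at 0)"
    by (rule Lim_transform_eventually[OF expinv_tendsto_0[of "Suc k"]])
      (auto simp: eventually_at_filter expinv_def divide_inverse mult_ac)
  then show ?thesis using equal by (simp add: DERIV_def expinv_def)
qed

lemma Ck_expinv: "Ck n (\<lambda>x. expinv k (c * x $ i + b))"
proof (induction n arbitrary: k)
  case 0
  have "continuous_on UNIV (expinv k)" for k
    by (rule DERIV_continuous_on) (rule DERIV_subset[OF expinv_has_derivative], simp)
  then have "continuous_on UNIV (\<lambda>x. expinv k (c * x $ i + b))"
    by (rule continuous_on_compose2[of UNIV "expinv k" UNIV "\<lambda>x. c * x $ i + b"])
      (auto intro!: continuous_on_add continuous_on_mult continuous_on_const continuous_on_component continuous_on_id)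
  then show ?case by simp
next
  case (Suc n)
  let ?D = "\<lambda>t. - real k * expinv (Suc k) t + expinv (Suc (Suc k)) t"
  show ?case
  proof (rule Ck_SucI)
    show "((\<lambda>x. expinv k (c * x $ i + b)) has_derivative (\<lambda>h. (c * h $ i) * ?D (c * x $ i + b))) (at x)" for x
    proof -
      have "((\<lambda>x. c * x $ i + b) has_derivative (\<lambda>h. c * h $ i)) (at x)"
        by (auto intro!: derivative_eq_intros bounded_linear_imp_has_derivative bounded_linear_vec_nth)
      from has_derivative_compose[OF this expinv_has_derivative[unfolded has_field_derivative_def]]
      show ?thesis by (simp add: mult.commute)
    qed
    show "Ck n (\<lambda>x. (c * axis j 1 $ i) * ?D (c * x $ i + b))" for j
      by (intro Ck_mult Ck_add Ck_const Suc)
  qed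
qed

text \<open>Each coordinate contributes one factor for the lower and one for the upper face, so the
  product is nonzero exactly on the open box. The scale \<open>Suc m\<close> drives all factors to 1
  inside as \<open>m\<close> grows. The arguments have the affine form treated by
  \<open>Ck_expinv\<close>.\<close>

definition box_bump :: "nat \<Rightarrow> real ^ 'd \<Rightarrow> real ^ 'd \<Rightarrow> real ^ 'd \<Rightarrow> real" where
  "box_bump m a b x = (\<Prod>i\<in>UNIV. expinv 0 (real (Suc m) * x $ i + - real (Suc m) * a $ i) * expinv 0 (- real (Suc m) * x $ i + real (Suc m) * b $ i))"

lemma expinv_0_pos_iff: "expinv 0 t \<noteq> 0 \<longleftrightarrow> t > 0"
  by (auto simp: expinv_def)

lemma box_bump_neq_0_iff: "box_bump m a b x \<noteq> 0 \<longleftrightarrow> x \<in> box a b"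
proof -
  have 1: "0 < Suc m * u + - Suc m * v \<longleftrightarrow> v < u" for u v :: real
  proof -
    have "Suc m * u + - Suc m * v = Suc m * (u - v)" by (simp add: algebra_simps)
    then show ?thesis by (simp add: zero_less_mult_iff)
  qed
  have 2: "0 < - Suc m * u + Suc m * v \<longleftrightarrow> u < v" for u v :: real
    using 1[of v u] by (simp add: algebra_simps)
  show ?thesis unfolding box_bump_def prod_zero_iff[OF finite] mem_box_cart
    using 1 2 expinv_0_pos_iff by (auto simp del: of_nat_Suc)
qed

lemma box_bump_range: "0 \<le> box_bump m a b x" "box_bump m a b x \<le> 1"
  unfolding box_bump_def
  by (auto intro!: prod_nonneg prod_le_1 mult_nonneg_nonneg mult_le_one expinv_nonneg expinv_0_le_1 simp del: of_nat_Suc)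

lemma box_bump_test: "box_bump m a b \<in> test_functions"
proof -
  have "{x. box_bump m a b x \<noteq> 0} = box a b" using box_bump_neq_0_iff by blast
  moreover have "bounded (box a b)" by simp
  ultimately have "compact (closure {x. box_bump m a b x \<noteq> 0})"
    by simp
  moreover have "Ck n (box_bump m a b)" for n
    unfolding box_bump_def[abs_def] by (intro Ck_prod Ck_mult Ck_expinv) auto
  ultimately show ?thesis by (simp add: test_functions_def)
qed

lemma box_bump_tendsto: "(\<lambda>m. box_bump m a b x) \<longlonglongrightarrow> indicator (box a b) x"
proof (cases "x \<in> box a b")
  case False
  then have "box_bump m a b x = 0" for m using box_bump_neq_0_iff by blast
  then show ?thesis using False by simp
next
  case True
  have *: "(\<lambda>m. expinv 0 (Suc m * t)) \<longlonglongrightarrow> 1" if "t > 0" for t :: real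
  proof -
    have "(\<lambda>m. exp (- (inverse (real (Suc m)) * inverse t))) \<longlonglongrightarrow> exp (- (0 * inverse t))"
      by (intro tendsto_intros LIMSEQ_inverse_real_of_nat)
    then show ?thesis
      using that by (simp add: expinv_def zero_less_mult_iff inverse_mult_distrib del: of_nat_Suc)
  qed
  have "(\<lambda>m. box_bump m a b x) \<longlonglongrightarrow> (\<Prod>i\<in>(UNIV::'a set). 1 * 1)"
    unfolding box_bump_def
  proof (intro tendsto_prod tendsto_mult)
    fix i :: 'a
    show "(\<lambda>m. expinv 0 (real (Suc m) * x $ i + - real (Suc m) * a $ i)) \<longlonglongrightarrow> 1"
      using *[of "x $ i - a $ i"] True by (simp add: mem_box_cart algebra_simps)
    show "(\<lambda>m. expinv 0 (- real (Suc m) * x $ i + real (Suc m) * b $ i)) \<longlonglongrightarrow> 1"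
      using *[of "b $ i - x $ i"] True by (simp add: mem_box_cart algebra_simps)
  qed
  then show ?thesis using True by simp
qed

section \<open>Closure properties of test functions\<close>

lemma test_function_Ck: "\<phi> \<in> test_functions \<Longrightarrow> Ck n \<phi>"
  by (simp add: test_functions_def)

lemma test_function_cont: "\<phi> \<in> test_functions \<Longrightarrow> continuous_on UNIV \<phi>"
  using test_function_Ck[of \<phi> 0] by simp

lemma test_function_partial_cont: "\<phi> \<in> test_functions \<Longrightarrow> continuous_on UNIV (partial i \<phi>)"
  using test_function_Ck[of \<phi> 1] by simp

lemma test_function_partial_outside:
  assumes "x \<notin> closure {x. \<phi> x \<noteq> 0}"
  shows "partial i \<phi> x = 0"
proof -
  have "((\<lambda>_. 0) has_derivative (\<lambda>_. 0)) (at x)" by simp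
  then have "(\<phi> has_derivative (\<lambda>_. 0)) (at x)"
    by (rule has_derivative_transform_within_open[of _ _ _ _ "- closure {x. \<phi> x \<noteq> 0}"])
      (use assms closure_subset[of "{x. \<phi> x \<noteq> 0}"] in \<open>auto simp: subset_iff\<close>)
  from partial_eqI[OF this] show ?thesis by simp
qed

text \<open>The definition of a weak gradient pairs a function with partial derivatives of test
  functions. As test functions themselves, these are bounded multipliers and members of
  \<open>L2\<close>.\<close>

lemma test_function_partial_mem: "\<phi> \<in> test_functions \<Longrightarrow> partial i \<phi> \<in> test_functions"
proof -
  assume a: "\<phi> \<in> test_functions"
  have "Ck n (partial i \<phi>)" for n using test_function_Ck[OF a, of "Suc n"] by simp
  moreover have "closure {x. partial i \<phi> x \<noteq> 0} \<subseteq> closure {x. \<phi> x \<noteq> 0}"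
    by (rule closure_minimal) (use test_function_partial_outside in auto)
  moreover have "compact (closure {x. \<phi> x \<noteq> 0})" using a by (simp add: test_functions_def)
  ultimately have "compact (closure {x. partial i \<phi> x \<noteq> 0})"
    by (metis closed_closure compact_Int_closed inf.absorb2)
  then show ?thesis using \<open>\<And>n. Ck n (partial i \<phi>)\<close> by (simp add: test_functions_def)
qed

lemma test_function_bounded:
  assumes "\<phi> \<in> test_functions"
  obtains M where "M > 0" "\<And>x. \<bar>\<phi> x\<bar> \<le> M"
proof -
  let ?S = "closure {x. \<phi> x \<noteq> 0}"
  have "compact (\<phi> ` ?S)"
    using assms test_function_cont[OF assms]
    by (intro compact_continuous_image) (auto simp: test_functions_def intro: continuous_on_subset)
  then obtain M where M: "M > 0" "\<forall>y\<in>\<phi> ` ?S. norm y \<le> M"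
    using compact_imp_bounded bounded_pos by metis
  have "\<bar>\<phi> x\<bar> \<le> M" for x
  proof (cases "\<phi> x = 0")
    case False
    then have "x \<in> ?S" using closure_subset[of "{x. \<phi> x \<noteq> 0}"] by auto
    then show ?thesis using M by auto
  qed (use M in auto)
  then show ?thesis using that M by blast
qed

lemma Ck_translate: "Ck n f \<Longrightarrow> Ck n (\<lambda>x. f (x + a))"
proof (induction n arbitrary: f)
  case 0
  then have "continuous_on UNIV (\<lambda>x. f (x + a))"
    by (intro continuous_on_compose2[of UNIV f UNIV "\<lambda>x. x + a"] continuous_on_add continuous_on_const continuous_on_id) auto
  then show ?case by simp
next
  case (Suc n)
  show ?case
  proof (rule Ck_SucI)
    show "((\<lambda>x. f (x + a)) has_derivative (\<lambda>h. \<Sum>i\<in>UNIV. h $ i * partial i f (x + a))) (at x)" for x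
      by (rule has_derivative_compose[of "\<lambda>x. x + a" "\<lambda>h. h" x UNIV f, simplified])
         (auto intro!: derivative_eq_intros Ck_Suc_has_derivative[OF Suc.prems])
    show "Ck n (\<lambda>x. \<Sum>j\<in>UNIV. axis i 1 $ j * partial j f (x + a))" for i
      using Suc by (simp add: axis_def if_distrib if_distribR cong: if_cong)
  qed
qed

lemma test_function_translate:
  assumes "\<phi> \<in> test_functions"
  shows "(\<lambda>x. \<phi> (x + a)) \<in> test_functions"
    and "partial i (\<lambda>x. \<phi> (x + a)) x = partial i \<phi> (x + a)"
proof -
  let ?S = "closure {x. \<phi> x \<noteq> 0}"
  have eq: "{x. \<phi> (x + a) \<noteq> 0} = (\<lambda>x. - a + x) ` {x. \<phi> x \<noteq> 0}"
    by (auto simp: image_iff) (metis add.commute add_diff_cancel_right' diff_conv_add_uminus uminus_add_conv_diff diff_add_cancel)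
  have "compact (closure {x. \<phi> (x + a) \<noteq> 0})"
    unfolding eq closure_translation using assms
    by (intro compact_translation) (simp add: test_functions_def)
  then show "(\<lambda>x. \<phi> (x + a)) \<in> test_functions"
    using assms by (simp add: test_functions_def Ck_translate)
  have "((\<lambda>x. \<phi> (x + a)) has_derivative (\<lambda>h. \<Sum>i\<in>UNIV. h $ i * partial i \<phi> (x + a))) (at x)"
    by (rule has_derivative_compose[of "\<lambda>x. x + a" "\<lambda>h. h" x UNIV \<phi>, simplified])
       (auto intro!: derivative_eq_intros Ck_Suc_has_derivative[of 0] test_function_Ck assms)
  from partial_eqI[OF this] show "partial i (\<lambda>x. \<phi> (x + a)) x = partial i \<phi> (x + a)"
    by (simp add: axis_def if_distrib if_distribR cong: if_cong)
qed

subsection \<open>Weak gradients\<close>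

lemma borel_measurable_vec_nth [measurable (raw)]:
  fixes g :: "'a \<Rightarrow> real ^ 'n"
  assumes "g \<in> borel_measurable M"
  shows "(\<lambda>x. g x $ i) \<in> borel_measurable M"
  using borel_measurable_inner[OF assms borel_measurable_const[of "axis i 1"]] by (simp add: inner_axis)

section \<open>Translation invariance and local integrability\<close>

lemma nn_integral_lborel_translate:
  fixes a :: "'a::euclidean_space"
  assumes [measurable]: "f \<in> borel_measurable borel"
  shows "(\<integral>\<^sup>+x. f (x + a) \<partial>lborel) = (\<integral>\<^sup>+x. f x \<partial>lborel)"
  by (subst (2) lborel_distr_plus[of a, symmetric]) (simp add: nn_integral_distr add.commute)

lemma integral_lborel_translate:
  fixes a :: "'a::euclidean_space" and f :: "'a \<Rightarrow> 'b::{banach, second_countable_topology}"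
  assumes [measurable]: "f \<in> borel_measurable borel"
  shows "(\<integral>x. f (x + a) \<partial>lborel) = (\<integral>x. f x \<partial>lborel)"
  by (subst (2) lborel_distr_plus[of a, symmetric]) (simp add: integral_distr add.commute)

lemma integrable_lborel_translate:
  fixes a :: "'a::euclidean_space" and f :: "'a \<Rightarrow> 'b::{banach, second_countable_topology}"
  assumes f: "integrable lborel f"
  shows "integrable lborel (\<lambda>x. f (x + a))"
proof -
  have "integrable (distr lborel borel ((+) a)) f" using f by (simp add: lborel_distr_plus)
  then show ?thesis using f by (subst (asm) integrable_distr_eq) (auto simp: add.commute)
qed

lemma locally_integrable_measurable: "locally_integrable f \<Longrightarrow> f \<in> borel_measurable borel"
  by (simp add: locally_integrable_def)

lemma locally_integrable_mult_test:
  fixes f :: "real ^ 'd \<Rightarrow> real"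
  assumes f: "locally_integrable f" and \<phi>: "\<phi> \<in> test_functions"
  shows "integrable lborel (\<lambda>x. f x * \<phi> x)"
proof -
  let ?K = "closure {x. \<phi> x \<noteq> 0}"
  obtain M where M: "M > 0" "\<And>x. \<bar>\<phi> x\<bar> \<le> M" using test_function_bounded[OF \<phi>] by blast
  have 1: "integrable lborel (\<lambda>x. M * norm (indicator ?K x *\<^sub>R f x))"
    using f \<phi> by (intro integrable_mult_right integrable_norm)
      (simp add: locally_integrable_def test_functions_def set_integrable_def)
  have [measurable]: "f \<in> borel_measurable borel" "\<phi> \<in> borel_measurable borel"
    using locally_integrable_measurable[OF f] borel_measurable_continuous_onI[OF test_function_cont[OF \<phi>]] by auto
  show ?thesis
  proof (rule Bochner_Integration.integrable_bound[OF 1])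
    have "norm (f x * \<phi> x) \<le> norm (M * norm (indicator ?K x *\<^sub>R f x))" for x
    proof (cases "\<phi> x = 0")
      case False
      then have "x \<in> ?K" using closure_subset[of "{x. \<phi> x \<noteq> 0}"] by auto
      then show ?thesis using M(1) mult_left_mono[OF M(2)[of x], of "\<bar>f x\<bar>"]
        by (simp add: abs_mult mult.commute)
    qed (use M in auto)
    then show "AE x in lborel. norm (f x * \<phi> x) \<le> norm (M * norm (indicator ?K x *\<^sub>R f x))" by simp
  qed auto
qed

text \<open>Bumps converge to indicators of open boxes, so the integral of \<open>f\<close> over
  every box vanishes. The positive and negative parts of \<open>f\<close> are then densities of
  measures that agree on an intersection-stable generator of the Borel sets, hence they coincide
  almost everywhere.\<close>

lemma fundamental_lemma:
  fixes f :: "real ^ 'd \<Rightarrow> real"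
  assumes f: "locally_integrable f" and z: "\<And>\<phi>. \<phi> \<in> test_functions \<Longrightarrow> (\<integral>x. f x * \<phi> x \<partial>lborel) = 0"
  shows "AE x in lborel. f x = 0"
proof -
  have [measurable]: "f \<in> borel_measurable borel" using locally_integrable_measurable[OF f] .
  have intc: "integrable lborel (\<lambda>x. indicator (cbox a b) x *\<^sub>R f x)" for a b
    using f by (simp add: locally_integrable_def set_integrable_def)
  have [measurable]: "box_bump m a b \<in> borel_measurable borel" for m and a b :: "real ^ 'd"
    by (rule borel_measurable_continuous_onI[OF test_function_cont[OF box_bump_test]])
  have bound: "norm (f x * box_bump m a b x) \<le> norm (indicator (cbox a b) x *\<^sub>R f x)"
    "norm (f x * indicator (box a b) x) \<le> norm (indicator (cbox a b) x *\<^sub>R f x)" for m a b x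
  proof -
    have "box_bump m a b x = 0" if "x \<notin> box a b" using that box_bump_neq_0_iff by blast
    then show "norm (f x * box_bump m a b x) \<le> norm (indicator (cbox a b) x *\<^sub>R f x)"
      using subsetD[OF box_subset_cbox, of x a b] box_bump_range[of m a b x]
      by (cases "x \<in> box a b") (auto simp: abs_mult intro: mult_left_le)
    show "norm (f x * indicator (box a b) x) \<le> norm (indicator (cbox a b) x *\<^sub>R f x)"
      using box_subset_cbox[of a b] by (auto simp: indicator_def)
  qed
  have boxint: "integrable lborel (\<lambda>x. f x * indicator (box a b) x)" for a b
    by (rule Bochner_Integration.integrable_bound[OF intc[of a b]]) (use bound in auto)
  have box0: "(\<integral>x. f x * indicator (box a b) x \<partial>lborel) = 0" for a b
  proof -
    have "(\<lambda>m. \<integral>x. f x * box_bump m a b x \<partial>lborel) \<longlonglongrightarrow> (\<integral>x. f x * indicator (box a b) x \<partial>lborel)"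
      by (rule integral_dominated_convergence[OF _ _ integrable_norm[OF intc[of a b]]])
        (use bound in \<open>auto intro!: tendsto_mult box_bump_tendsto\<close>)
    then show ?thesis using z[OF box_bump_test] by (simp add: LIMSEQ_const_iff)
  qed
  \<comment> \<open>\<open>ennreal\<close> cuts negative numbers off to 0, so
    \<open>ennreal (f x)\<close> and \<open>ennreal (- f x)\<close> are the positive and the
    negative part.\<close>
  have boxeq: "(\<integral>\<^sup>+x. ennreal (f x) * indicator (box a b) x \<partial>lborel) = (\<integral>\<^sup>+x. ennreal (- f x) * indicator (box a b) x \<partial>lborel)"
    "(\<integral>\<^sup>+x. ennreal (f x) * indicator (box a b) x \<partial>lborel) \<noteq> \<infinity>" for a b
  proof -
    let ?g = "\<lambda>x. f x * indicator (box a b) x"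
    have eq: "ennreal (f x) * indicator (box a b) x = ennreal (?g x)"
      "ennreal (- f x) * indicator (box a b) x = ennreal (- ?g x)" for x
      by (auto simp: indicator_def)
    have fin: "(\<integral>\<^sup>+x. ennreal (?g x) \<partial>lborel) \<noteq> \<infinity>" "(\<integral>\<^sup>+x. ennreal (- ?g x) \<partial>lborel) \<noteq> \<infinity>"
      using boxint[of a b] real_integrable_def by blast+
    have "enn2real (\<integral>\<^sup>+x. ennreal (?g x) \<partial>lborel) = enn2real (\<integral>\<^sup>+x. ennreal (- ?g x) \<partial>lborel)"
      using real_lebesgue_integral_def[OF boxint[of a b]] box0[of a b] by simp
    then show "(\<integral>\<^sup>+x. ennreal (f x) * indicator (box a b) x \<partial>lborel) = (\<integral>\<^sup>+x. ennreal (- f x) * indicator (box a b) x \<partial>lborel)"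
      unfolding eq using fin ennreal_enn2real unfolding infinity_ennreal_def less_top by metis
    show "(\<integral>\<^sup>+x. ennreal (f x) * indicator (box a b) x \<partial>lborel) \<noteq> \<infinity>"
      unfolding eq by (rule fin)
  qed
  have "density lborel (\<lambda>x. ennreal (f x)) = density lborel (\<lambda>x. ennreal (- f x))"
  proof (rule measure_eqI_generator_eq)
    let ?E = "range (\<lambda>(a, b). box a b::(real ^ 'd) set)"
    show "Int_stable ?E" by (auto simp: Int_stable_def box_Int_box)
    show "?E \<subseteq> Pow UNIV" "sets (density lborel (\<lambda>x. ennreal (f x))) = sigma_sets UNIV ?E"
      "sets (density lborel (\<lambda>x. ennreal (- f x))) = sigma_sets UNIV ?E"
      by (simp_all add: borel_eq_box)
    let ?A = "\<lambda>n::nat. box (- (real n *\<^sub>R One)) (real n *\<^sub>R One) :: (real ^ 'd) set"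
    show "range ?A \<subseteq> ?E" "(\<Union>i. ?A i) = UNIV"
      unfolding UN_box_eq_UNIV by auto
    show "emeasure (density lborel (\<lambda>x. ennreal (f x))) (?A i) \<noteq> \<infinity>" for i
      using boxeq(2) by (simp add: emeasure_density)
    show "emeasure (density lborel (\<lambda>x. ennreal (f x))) X = emeasure (density lborel (\<lambda>x. ennreal (- f x))) X"
      if "X \<in> ?E" for X
      using that boxeq(1) by (auto simp: emeasure_density)
  qed
  then have "AE x in lborel. ennreal (f x) = ennreal (- f x)"
    by (intro sigma_finite_measure.density_unique[OF sigma_finite_lborel]) auto
  then show ?thesis
  proof eventually_elim
    case (elim x)
    then show ?case by (cases "f x \<ge> 0") (auto simp: ennreal_neg ennreal_eq_0_iff)
  qed
qed

lemma locally_integrable_diff: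
  assumes "locally_integrable f" "locally_integrable g"
  shows "locally_integrable (\<lambda>x. f x - g x)"
  using assms unfolding locally_integrable_def by (auto intro!: borel_measurable_diff set_integral_diff)

lemma locally_integrable_add:
  assumes "locally_integrable f" "locally_integrable g"
  shows "locally_integrable (\<lambda>x. f x + g x)"
  using assms unfolding locally_integrable_def by (auto intro!: borel_measurable_add set_integral_add)

lemma locally_integrable_scaleR:
  assumes "locally_integrable f"
  shows "locally_integrable (\<lambda>x. (c::real) *\<^sub>R f x)"
  using assms unfolding locally_integrable_def by (auto intro!: borel_measurable_scaleR set_integrable_scaleR_right)

lemma locally_integrable_nth:
  fixes g :: "real ^ 'd \<Rightarrow> real ^ 'e"
  assumes "locally_integrable g"
  shows "locally_integrable (\<lambda>x. g x $ i)"
  unfolding locally_integrable_def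
proof (intro conjI allI impI)
  have [measurable]: "g \<in> borel_measurable borel" using assms by (rule locally_integrable_measurable)
  show "(\<lambda>x. g x $ i) \<in> borel_measurable lborel"
    by (simp add: borel_measurable_vec_nth)
  fix C :: "(real ^ 'd) set" assume "compact C"
  then have "integrable lborel (\<lambda>x. indicator C x *\<^sub>R g x)"
    using assms by (simp add: locally_integrable_def set_integrable_def)
  then have "integrable lborel (\<lambda>x. (indicator C x *\<^sub>R g x) $ i)"
    by (rule integrable_bounded_linear[OF bounded_linear_vec_nth])
  then show "set_integrable lborel C (\<lambda>x. g x $ i)" by (simp add: set_integrable_def)
qed

lemma L2_locally_integrable:
  fixes f :: "real ^ 'd \<Rightarrow> 'e::euclidean_space"
  assumes "f \<in> L2 lborel"
  shows "locally_integrable f"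
  unfolding locally_integrable_def
proof (intro conjI allI impI)
  show m: "f \<in> borel_measurable lborel" using assms by (rule L2_measurable)
  then have [measurable]: "f \<in> borel_measurable borel" by simp
  fix C :: "(real ^ 'd) set" assume C: "compact C"
  then have [measurable]: "C \<in> sets borel" by (simp add: borel_compact)
  have 1: "integrable lborel (\<lambda>x. indicator C x + (norm (f x))\<^sup>2)"
    by (intro Bochner_Integration.integrable_add L2_integrable_norm[OF assms] integrable_real_indicator)
      (use emeasure_bounded_finite[OF compact_imp_bounded[OF C]] in auto)
  have "norm (indicator C x *\<^sub>R f x) \<le> norm (indicator C x + (norm (f x))\<^sup>2)" for x
  proof -
    have "norm (f x) \<le> 1 + (norm (f x))\<^sup>2"
      using sum_squares_bound[of 1 "norm (f x)"] norm_ge_zero[of "f x"] unfolding power2_eq_square by linarith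
    then show ?thesis by (auto simp: indicator_def)
  qed
  then have "integrable lborel (\<lambda>x. indicator C x *\<^sub>R f x)"
    by (intro Bochner_Integration.integrable_bound[OF 1]) auto
  then show "set_integrable lborel C f" by (simp add: set_integrable_def)
qed

lemma has_weak_gradientD:
  "has_weak_gradient u g \<Longrightarrow> \<phi> \<in> test_functions \<Longrightarrow>
    (\<integral>x. u x * partial i \<phi> x \<partial>lborel) = - (\<integral>x. g x $ i * \<phi> x \<partial>lborel)"
  by (simp add: has_weak_gradient_def)

text \<open>The coordinates are compared separately by \<open>fundamental_lemma\<close>. This is
  what makes integrals of the chosen \<open>weak_gradient\<close> independent of the choice.\<close>

lemma has_weak_gradient_unique:
  assumes "has_weak_gradient u g" "has_weak_gradient u g'"
  shows "AE x in lborel. g x = g' x"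
proof -
  have "AE x in lborel. g x $ i - g' x $ i = 0" for i
  proof (rule fundamental_lemma)
    have l: "locally_integrable (\<lambda>x. g x $ i)" "locally_integrable (\<lambda>x. g' x $ i)"
      using assms by (auto simp: has_weak_gradient_def intro: locally_integrable_nth)
    then show "locally_integrable (\<lambda>x. g x $ i - g' x $ i)" by (rule locally_integrable_diff)
    fix \<phi> :: "real ^ 'a \<Rightarrow> real" assume \<phi>: "\<phi> \<in> test_functions"
    have "(\<integral>x. g x $ i * \<phi> x \<partial>lborel) = (\<integral>x. g' x $ i * \<phi> x \<partial>lborel)"
      using has_weak_gradientD[OF assms(1) \<phi>, of i] has_weak_gradientD[OF assms(2) \<phi>, of i] by simp
    moreover have "(\<integral>x. (g x $ i - g' x $ i) * \<phi> x \<partial>lborel) = (\<integral>x. g x $ i * \<phi> x \<partial>lborel) - (\<integral>x. g' x $ i * \<phi> x \<partial>lborel)"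
      using l \<phi> by (simp add: left_diff_distrib locally_integrable_mult_test)
    ultimately show "(\<integral>x. (g x $ i - g' x $ i) * \<phi> x \<partial>lborel) = 0" by simp
  qed
  then have "AE x in lborel. \<forall>i. g x $ i - g' x $ i = 0"
    by (subst AE_all_countable) auto
  then show ?thesis by eventually_elim (simp add: vec_eq_iff)
qed

lemma has_weak_gradient_add:
  assumes "has_weak_gradient u g" "has_weak_gradient v h"
  shows "has_weak_gradient (\<lambda>x. u x + v x) (\<lambda>x. g x + h x)"
  unfolding has_weak_gradient_def
proof (intro conjI ballI allI)
  show "locally_integrable (\<lambda>x. u x + v x)" "locally_integrable (\<lambda>x. g x + h x)"
    using assms by (auto simp: has_weak_gradient_def intro: locally_integrable_add)
  fix \<phi> :: "real ^ 'a \<Rightarrow> real" and i assume \<phi>: "\<phi> \<in> test_functions"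
  have "locally_integrable u" "locally_integrable v" "locally_integrable (\<lambda>x. g x $ i)" "locally_integrable (\<lambda>x. h x $ i)"
    using assms by (auto simp: has_weak_gradient_def intro: locally_integrable_nth)
  then show "(\<integral>x. (u x + v x) * partial i \<phi> x \<partial>lborel) = - (\<integral>x. (g x + h x) $ i * \<phi> x \<partial>lborel)"
    using assms \<phi> by (simp add: has_weak_gradient_def distrib_right locally_integrable_mult_test test_function_partial_mem)
qed

lemma has_weak_gradient_cmult:
  assumes "has_weak_gradient u g"
  shows "has_weak_gradient (\<lambda>x. c * u x) (\<lambda>x. c *\<^sub>R g x)"
  using assms locally_integrable_scaleR[of u c] locally_integrable_scaleR[of g c]
  by (simp add: has_weak_gradient_def mult.assoc)

lemma has_weak_gradient_translate:
  fixes u :: "real ^ 'd \<Rightarrow> real"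
  assumes "has_weak_gradient u g" "u \<in> L2 lborel" "g \<in> L2 lborel"
  shows "has_weak_gradient (\<lambda>x. u (x + a)) (\<lambda>x. g (x + a))"
    "(\<lambda>x. u (x + a)) \<in> L2 lborel" "(\<lambda>x. g (x + a)) \<in> L2 lborel"
proof -
  have [measurable]: "u \<in> borel_measurable borel" "g \<in> borel_measurable borel"
    using assms(2,3) L2_measurable by force+
  show L: "(\<lambda>x. u (x + a)) \<in> L2 lborel" "(\<lambda>x. g (x + a)) \<in> L2 lborel"
    using integrable_lborel_translate[OF L2_integrable_norm[OF assms(2)], of a]
      integrable_lborel_translate[OF L2_integrable_norm[OF assms(3)], of a] by (auto simp: L2_def)
  show "has_weak_gradient (\<lambda>x. u (x + a)) (\<lambda>x. g (x + a))"
    unfolding has_weak_gradient_def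
  proof (intro conjI ballI allI L2_locally_integrable L)
    fix \<phi> :: "real ^ 'd \<Rightarrow> real" and i assume \<phi>: "\<phi> \<in> test_functions"
    let ?\<psi> = "\<lambda>x. \<phi> (x + - a)"
    have psi: "?\<psi> \<in> test_functions" by (rule test_function_translate(1)[OF \<phi>])
    have [measurable]: "\<phi> \<in> borel_measurable borel" "partial i \<phi> \<in> borel_measurable borel"
      using \<phi> by (auto intro!: borel_measurable_continuous_onI test_function_cont test_function_partial_cont)
    have "(\<integral>x. u (x + a) * partial i \<phi> x \<partial>lborel) = (\<integral>x. u (x + a) * partial i ?\<psi> (x + a) \<partial>lborel)"
      by (simp add: test_function_translate(2)[OF \<phi>] del: add_uminus_conv_diff)
    also have "\<dots> = (\<integral>x. u x * partial i ?\<psi> x \<partial>lborel)"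
      by (rule integral_lborel_translate) (simp add: test_function_translate(2)[OF \<phi>] del: add_uminus_conv_diff)
    also have "\<dots> = - (\<integral>x. g x $ i * ?\<psi> x \<partial>lborel)"
      using assms(1) psi unfolding has_weak_gradient_def by blast
    also have "(\<integral>x. g x $ i * ?\<psi> x \<partial>lborel) = (\<integral>x. g (x + a) $ i * ?\<psi> (x + a) \<partial>lborel)"
      by (rule integral_lborel_translate[symmetric]) measurable
    finally show "(\<integral>x. u (x + a) * partial i \<phi> x \<partial>lborel) = - (\<integral>x. g (x + a) $ i * \<phi> x \<partial>lborel)"
      by simp
  qed
qed

lemma test_function_L2: 
  assumes "\<phi> \<in> test_functions" shows "\<phi> \<in> L2 lborel"
proof -
  have [measurable]: "\<phi> \<in> borel_measurable borel"
    using assms by (auto intro!: borel_measurable_continuous_onI test_function_cont)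
  have "locally_integrable \<phi>"
    unfolding locally_integrable_def set_integrable_def
    using borel_integrable_compact[of _ \<phi>] continuous_on_subset[OF test_function_cont[OF assms]] by simp
  from locally_integrable_mult_test[OF this assms] show ?thesis
    by (simp add: L2_def power2_eq_square)
qed

text \<open>Both sides of the defining identity are inner products with fixed square-integrable
  functions, hence continuous. Strong convergence is the right hypothesis because weak limits arise
  later as strong limits of midpoint combinations.\<close>

lemma has_weak_gradient_limit:
  fixes u :: "nat \<Rightarrow> real ^ 'd \<Rightarrow> real"
  assumes w: "\<And>n. has_weak_gradient (u n) (g n)" "\<And>n. u n \<in> L2 lborel" "\<And>n. g n \<in> L2 lborel"
    and L: "U \<in> L2 lborel" "G \<in> L2 lborel"
    and lim: "(\<lambda>n. ip2 lborel (\<lambda>x. u n x - U x) (\<lambda>x. u n x - U x)) \<longlonglongrightarrow> 0"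
     "(\<lambda>n. ip2 lborel (\<lambda>x. g n x - G x) (\<lambda>x. g n x - G x)) \<longlonglongrightarrow> 0"
  shows "has_weak_gradient U G"
  unfolding has_weak_gradient_def
proof (intro conjI ballI allI L2_locally_integrable L)
  fix \<phi> :: "real ^ 'd \<Rightarrow> real" and i :: 'd assume \<phi>: "\<phi> \<in> test_functions"
  have L2a: "(\<lambda>x. \<phi> x *\<^sub>R axis i (1::real) :: real ^ 'd) \<in> L2 lborel" (is "?h \<in> _")
    using test_function_L2[OF \<phi>] by (auto simp: L2_def intro!: borel_measurable_scaleR)
  have "(\<lambda>n. ip2 lborel (u n) (partial i \<phi>)) \<longlonglongrightarrow> ip2 lborel U (partial i \<phi>)"
    by (intro ip2_tendsto w L lim test_function_L2 test_function_partial_mem \<phi>)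
  moreover have "(\<lambda>n. - ip2 lborel (g n) ?h) \<longlonglongrightarrow> - ip2 lborel G ?h"
    by (intro tendsto_minus ip2_tendsto w L lim L2a)
  moreover have "ip2 lborel (u n) (partial i \<phi>) = - ip2 lborel (g n) ?h" for n
    using w(1)[of n] \<phi> unfolding has_weak_gradient_def by (simp add: ip2_def inner_axis mult.commute)
  ultimately have "ip2 lborel U (partial i \<phi>) = - ip2 lborel G ?h"
    using LIMSEQ_unique by auto
  then show "(\<integral>x. U x * partial i \<phi> x \<partial>lborel) = - (\<integral>x. G x $ i * \<phi> x \<partial>lborel)"
    by (simp add: ip2_def inner_axis mult.commute)
qed

subsection \<open>Translations of Sobolev functions\<close>

text \<open>An explicit gradient argument keeps the arbitrary choice in \<open>weak_gradient\<close>
  out of computations: sums, multiples and translates come with evident gradients.\<close>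

definition H1_pair :: "(real ^ 'd \<Rightarrow> real) \<Rightarrow> (real ^ 'd \<Rightarrow> real ^ 'd) \<Rightarrow> bool" where
  "H1_pair u g \<longleftrightarrow> has_weak_gradient u g \<and> u \<in> L2 lborel \<and> g \<in> L2 lborel"

lemma L2_borel: "f \<in> L2 lborel \<Longrightarrow> f \<in> borel_measurable borel"
  using L2_measurable[of f lborel] by simp

lemma H1_pair_measurable:
  assumes "H1_pair u g" shows "u \<in> borel_measurable borel" "g \<in> borel_measurable borel"
  using assms by (auto simp: H1_pair_def intro: L2_borel)

text \<open>Cauchy--Schwarz against the indicator of \<open>S\<close>. An infinite integral on the
  right makes the bound trivial except for \<open>s = 0\<close>, where the product is 0 by
  convention; then \<open>S\<close> is a null set.\<close>

lemma sq_set_integral_le: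
  fixes h :: "'a \<Rightarrow> real"
  assumes [measurable]: "S \<in> sets M" "h \<in> borel_measurable M" and fin: "emeasure M S = ennreal s" "s \<ge> 0"
  shows "ennreal ((\<integral>x. indicator S x * h x \<partial>M)\<^sup>2) \<le> ennreal s * (\<integral>\<^sup>+x. indicator S x * ennreal ((h x)\<^sup>2) \<partial>M)"
proof (cases "(\<integral>\<^sup>+x. indicator S x * ennreal ((h x)\<^sup>2) \<partial>M) = \<infinity>")
  case True
  show ?thesis
  proof (cases "s = 0")
    case False
    then show ?thesis using True fin by (simp add: ennreal_mult_eq_top_iff ennreal_mult_top)
  next
    case True
    have "AE x in M. x \<notin> S" using fin True by (intro AE_not_in) auto
    then have "(\<integral>x. indicator S x * h x \<partial>M) = (\<integral>x. 0 \<partial>M)"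
      by (intro integral_cong_AE) auto
    then show ?thesis by simp
  qed
next
  case False
  define c where "c = enn2real (\<integral>\<^sup>+x. indicator S x * ennreal ((h x)\<^sup>2) \<partial>M)"
  have c: "(\<integral>\<^sup>+x. indicator S x * ennreal ((h x)\<^sup>2) \<partial>M) = ennreal c" "c \<ge> 0"
    using False by (auto simp: c_def less_top)
  have e: "indicator S x * ennreal ((h x)\<^sup>2) = ennreal ((norm (indicator S x * h x))\<^sup>2)" for x
    by (auto simp: indicator_def)
  have k: "(\<lambda>x. indicator S x * h x) \<in> L2 M" "ip2 M (\<lambda>x. indicator S x * h x) (\<lambda>x. indicator S x * h x) \<le> c"
    by (rule L2_I_nn[of _ _ c]; use c e in simp)+
  have "(\<integral>\<^sup>+x. ennreal ((norm (indicator S x :: real))\<^sup>2) \<partial>M) = (\<integral>\<^sup>+x. indicator S x \<partial>M)"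
    by (intro nn_integral_cong) (auto simp: indicator_def)
  then have i: "(indicator S :: _ \<Rightarrow> real) \<in> L2 M" "ip2 M (indicator S :: _ \<Rightarrow> real) (indicator S) \<le> s"
    by (intro L2_I_nn[of _ _ s]; use fin in simp)+
  have "(\<integral>x. indicator S x * h x \<partial>M) = ip2 M (indicator S) (\<lambda>x. indicator S x * h x)"
    unfolding ip2_def by (intro Bochner_Integration.integral_cong) (auto simp: indicator_def)
  then have "(\<integral>x. indicator S x * h x \<partial>M)\<^sup>2 \<le> s * c"
    using ip2_Cauchy_Schwarz[OF i(1) k(1)] mult_mono[OF i(2) k(2)] fin by simp
  then show ?thesis unfolding c(1) using fin c by (simp flip: ennreal_mult)
qed

abbreviation I01 :: "real \<Rightarrow> real" where "I01 \<equiv> indicator {0..1}"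

text \<open>Tonelli: by translation invariance the integral over \<open>x\<close> does not depend on
  \<open>t\<close>, and \<open>t\<close> ranges over an interval of length 1.\<close>

lemma integrable_pair_translate:
  fixes F :: "'a::euclidean_space \<Rightarrow> real" and b :: 'a
  assumes F: "integrable lborel F"
  shows "integrable (lborel \<Otimes>\<^sub>M lborel) (\<lambda>(x, t). I01 t * F (x + t *\<^sub>R b))"
proof (rule integrableI_bounded)
  have [measurable]: "F \<in> borel_measurable borel" using F by auto
  show m: "(\<lambda>(x, t). I01 t * F (x + t *\<^sub>R b)) \<in> borel_measurable (lborel \<Otimes>\<^sub>M lborel)"
    by measurable
  have "(\<integral>\<^sup>+p. ennreal (norm (case p of (x, t) \<Rightarrow> I01 t * F (x + t *\<^sub>R b))) \<partial>(lborel \<Otimes>\<^sub>M lborel))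
     = (\<integral>\<^sup>+t. (\<integral>\<^sup>+x. ennreal (norm (I01 t * F (x + t *\<^sub>R b))) \<partial>lborel) \<partial>lborel)"
    by (subst lborel_pair.nn_integral_snd[symmetric]) auto
  also have "\<dots> = (\<integral>\<^sup>+t. indicator {0..1::real} t * (\<integral>\<^sup>+x. ennreal (norm (F x)) \<partial>lborel) \<partial>lborel)"
  proof (intro nn_integral_cong)
    fix t :: real
    have "(\<integral>\<^sup>+x. ennreal (norm (I01 t * F (x + t *\<^sub>R b))) \<partial>lborel) = indicator {0..1} t * (\<integral>\<^sup>+x. ennreal (norm (F (x + t *\<^sub>R b))) \<partial>lborel)"
      by (auto simp: indicator_def)
    also have "(\<integral>\<^sup>+x. ennreal (norm (F (x + t *\<^sub>R b))) \<partial>lborel) = (\<integral>\<^sup>+x. ennreal (norm (F x)) \<partial>lborel)"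
      by (rule nn_integral_lborel_translate) measurable
    finally show "(\<integral>\<^sup>+x. ennreal (norm (I01 t * F (x + t *\<^sub>R b))) \<partial>lborel) = indicator {0..1} t * (\<integral>\<^sup>+x. ennreal (norm (F x)) \<partial>lborel)" .
  qed
  also have "\<dots> = (\<integral>\<^sup>+x. ennreal (norm (F x)) \<partial>lborel)"
    by (subst nn_integral_multc) auto
  also have "\<dots> < \<infinity>" using F by (simp add: integrable_iff_bounded)
  finally show "(\<integral>\<^sup>+p. ennreal (norm (case p of (x, t) \<Rightarrow> I01 t * F (x + t *\<^sub>R b))) \<partial>(lborel \<Otimes>\<^sub>M lborel)) < \<infinity>" .
qed

text \<open>Joint integrability follows by bounding the product by the sum of the squares, each of
  which involves only one translated function.\<close>

lemma Fubini_translate: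
  fixes U V :: "'a::euclidean_space \<Rightarrow> real" and b c :: 'a
  assumes "U \<in> L2 lborel" "V \<in> L2 lborel"
  shows "(\<integral>x. (\<integral>t. I01 t * (U (x + t *\<^sub>R b) * V (x + t *\<^sub>R c)) \<partial>lborel) \<partial>lborel)
       = (\<integral>t. (\<integral>x. I01 t * (U (x + t *\<^sub>R b) * V (x + t *\<^sub>R c)) \<partial>lborel) \<partial>lborel)"
proof -
  have [measurable]: "U \<in> borel_measurable borel" "V \<in> borel_measurable borel"
    using assms by (auto intro: L2_borel)
  have "integrable (lborel \<Otimes>\<^sub>M lborel) (\<lambda>p. (case p of (x, t) \<Rightarrow> I01 t * (norm (U (x + t *\<^sub>R b)))\<^sup>2) +
      (case p of (x, t) \<Rightarrow> I01 t * (norm (V (x + t *\<^sub>R c)))\<^sup>2))"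
    by (intro Bochner_Integration.integrable_add integrable_pair_translate L2_integrable_norm assms)
  then have "integrable (lborel \<Otimes>\<^sub>M lborel) (\<lambda>(x, t). I01 t * (U (x + t *\<^sub>R b) * V (x + t *\<^sub>R c)))"
  proof (rule Bochner_Integration.integrable_bound)
    have "\<bar>y * z\<bar> \<le> y\<^sup>2 + z\<^sup>2" for y z :: real
      using sum_squares_bound[of "\<bar>y\<bar>" "\<bar>z\<bar>"] abs_ge_zero[of "y * z"] unfolding abs_mult power2_abs by linarith
    then have "norm (I01 t * (U x * V y)) \<le> norm (I01 t * (norm (U x))\<^sup>2 + I01 t * (norm (V y))\<^sup>2)" for t x y
      by (auto simp: indicator_def)
    then show "AE p in lborel \<Otimes>\<^sub>M lborel. norm (case p of (x, t) \<Rightarrow> I01 t * (U (x + t *\<^sub>R b) * V (x + t *\<^sub>R c)))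
       \<le> norm ((case p of (x, t) \<Rightarrow> I01 t * (norm (U (x + t *\<^sub>R b)))\<^sup>2) + (case p of (x, t) \<Rightarrow> I01 t * (norm (V (x + t *\<^sub>R c)))\<^sup>2))"
      by (intro AE_I2) (simp add: split_beta)
  qed measurable
  from lborel_pair.Fubini_integral[OF this] show ?thesis by simp
qed

lemma test_function_cmult: "\<phi> \<in> test_functions \<Longrightarrow> (\<lambda>x. c * \<phi> x) \<in> test_functions"
proof -
  assume a: "\<phi> \<in> test_functions"
  have "{x. c * \<phi> x \<noteq> 0} \<subseteq> {x. \<phi> x \<noteq> 0}" by auto
  then have "closure {x. c * \<phi> x \<noteq> 0} \<subseteq> closure {x. \<phi> x \<noteq> 0}" by (rule closure_mono)
  then have "compact (closure {x. c * \<phi> x \<noteq> 0})"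
    using a compact_Int_closed[of "closure {x. \<phi> x \<noteq> 0}" "closure {x. c * \<phi> x \<noteq> 0}"]
    by (simp add: test_functions_def Int_absorb1)
  then show ?thesis using a by (simp add: test_functions_def Ck_mult)
qed

lemma L2_sum: "finite I \<Longrightarrow> (\<And>i. i \<in> I \<Longrightarrow> f i \<in> L2 M) \<Longrightarrow> (\<lambda>x. \<Sum>i\<in>I. f i x) \<in> L2 M"
proof (induction I rule: finite_induct)
  case empty then show ?case by (simp add: L2_def)
next
  case (insert i I) then show ?case using L2_add[of "f i" M "\<lambda>x. \<Sum>i\<in>I. f i x"] by simp
qed

lemma weak_gradient_direction:
  assumes w: "has_weak_gradient u g" and \<psi>: "\<psi> \<in> test_functions"
  shows "(\<integral>x. (g x \<bullet> a) * \<psi> x \<partial>lborel) = - (\<integral>x. u x * (\<Sum>i\<in>UNIV. a $ i * partial i \<psi> x) \<partial>lborel)"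
proof -
  have l: "locally_integrable u" "\<And>i. locally_integrable (\<lambda>x. g x $ i)"
    using w by (auto simp: has_weak_gradient_def intro: locally_integrable_nth)
  have "(\<integral>x. (g x \<bullet> a) * \<psi> x \<partial>lborel) = (\<integral>x. (\<Sum>i\<in>UNIV. a $ i * (g x $ i * \<psi> x)) \<partial>lborel)"
    by (simp add: inner_vec_def sum_distrib_right sum_distrib_left mult_ac)
  also have "\<dots> = (\<Sum>i\<in>UNIV. a $ i * (\<integral>x. g x $ i * \<psi> x \<partial>lborel))"
    by (subst Bochner_Integration.integral_sum) (auto intro!: integrable_mult_right locally_integrable_mult_test l \<psi>)
  also have "\<dots> = - (\<Sum>i\<in>UNIV. a $ i * (\<integral>x. u x * partial i \<psi> x \<partial>lborel))"
    by (simp add: has_weak_gradientD[OF w \<psi>] sum_negf)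
  also have "(\<Sum>i\<in>UNIV. a $ i * (\<integral>x. u x * partial i \<psi> x \<partial>lborel)) = (\<integral>x. (\<Sum>i\<in>UNIV. a $ i * (u x * partial i \<psi> x)) \<partial>lborel)"
    by (subst Bochner_Integration.integral_sum)
      (auto intro!: integrable_mult_right locally_integrable_mult_test l \<psi> test_function_partial_mem)
  also have "\<dots> = (\<integral>x. u x * (\<Sum>i\<in>UNIV. a $ i * partial i \<psi> x) \<partial>lborel)"
    by (simp add: sum_distrib_left mult_ac)
  finally show ?thesis .
qed

text \<open>The fundamental theorem of calculus on the segment from \<open>x\<close> to
  \<open>x - a\<close>. The direction is reversed because a shift of \<open>u\<close> by
  \<open>a\<close> becomes a shift of the test function by \<open>- a\<close>.\<close>

lemma test_function_FTC:
  fixes \<phi> :: "real ^ 'd \<Rightarrow> real"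
  assumes \<phi>: "\<phi> \<in> test_functions"
  shows "(\<integral>t. I01 t * (\<Sum>i\<in>UNIV. a $ i * partial i \<phi> (x + t *\<^sub>R - a)) \<partial>lborel) = \<phi> x - \<phi> (x - a)"
proof -
  let ?F = "\<lambda>t. - \<phi> (x + t *\<^sub>R - a)" and ?f = "\<lambda>t. \<Sum>i\<in>UNIV. a $ i * partial i \<phi> (x + t *\<^sub>R - a)"
  have cont: "continuous_on UNIV ?f"
    by (intro continuous_on_sum continuous_on_mult continuous_on_const
        continuous_on_compose2[OF test_function_partial_cont[OF \<phi>]] continuous_intros) auto
  have "(?F has_vector_derivative ?f t) (at t)" for t
  proof -
    have 1: "((\<lambda>t. x + t *\<^sub>R - a) has_derivative (\<lambda>h. h *\<^sub>R - a)) (at t)"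
      by (auto intro!: derivative_eq_intros)
    have "((\<lambda>t. \<phi> (x + t *\<^sub>R - a)) has_derivative (\<lambda>h. \<Sum>i\<in>UNIV. (h *\<^sub>R - a) $ i * partial i \<phi> (x + t *\<^sub>R - a))) (at t)"
      by (rule has_derivative_compose[OF 1 Ck_Suc_has_derivative[OF test_function_Ck[OF \<phi>]]])
    then have "(?F has_derivative (\<lambda>h. - (\<Sum>i\<in>UNIV. (h *\<^sub>R - a) $ i * partial i \<phi> (x + t *\<^sub>R - a)))) (at t)"
      by (rule has_derivative_minus)
    then show ?thesis
      by (simp add: has_vector_derivative_def sum_negf sum_distrib_left mult_ac)
  qed
  then have "(\<integral>t. indicator {0..1} t *\<^sub>R ?f t \<partial>lborel) = ?F 1 - ?F 0"
  proof -
    assume d: "\<And>t. (?F has_vector_derivative ?f t) (at t)"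
    show ?thesis
    proof (rule integral_FTC_Icc)
      show "continuous_on {0..1} ?f" by (rule continuous_on_subset[OF cont]) simp
      show "(?F has_vector_derivative ?f t) (at t within {0..1})" for t
        by (rule has_vector_derivative_at_within[OF d])
    qed simp
  qed
  then show ?thesis by simp
qed

text \<open>Proved by duality: against a test function, shift and gradient move over to the test
  function, where the classical fundamental theorem applies. Then \<open>fundamental_lemma\<close>
  removes the test function.\<close>

lemma translation_identity:
  fixes u :: "real ^ 'd \<Rightarrow> real"
  assumes "H1_pair u g"
  shows "AE x in lborel. u (x + a) - u x = (\<integral>t. I01 t * (g (x + t *\<^sub>R a) \<bullet> a) \<partial>lborel)"
    and "(\<lambda>x. \<integral>t. I01 t * (g (x + t *\<^sub>R a) \<bullet> a) \<partial>lborel) \<in> borel_measurable borel"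
proof -
  have u: "has_weak_gradient u g" "u \<in> L2 lborel" "g \<in> L2 lborel" using assms by (auto simp: H1_pair_def)
  have [measurable]: "u \<in> borel_measurable borel" "g \<in> borel_measurable borel"
    using H1_pair_measurable[OF assms] by auto
  define W where "W x = (\<integral>t. I01 t * (g (x + t *\<^sub>R a) \<bullet> a) \<partial>lborel)" for x
  have Wm: "W \<in> borel_measurable borel"
    unfolding W_def[abs_def] measurable_lborel2[symmetric]
    by (rule sigma_finite_measure.borel_measurable_lebesgue_integral[OF sigma_finite_lborel]) measurable
  then show "(\<lambda>x. \<integral>t. I01 t * (g (x + t *\<^sub>R a) \<bullet> a) \<partial>lborel) \<in> borel_measurable borel"
    by (simp add: W_def[abs_def])
  note Wm [measurable]
  have ga: "(\<lambda>x. g x \<bullet> a) \<in> L2 lborel"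
  proof -
    have "integrable lborel (\<lambda>x. (norm a)\<^sup>2 * (norm (g x))\<^sup>2)"
      by (intro integrable_mult_right L2_integrable_norm u)
    then have "integrable lborel (\<lambda>x. (norm (g x \<bullet> a))\<^sup>2)"
    proof (rule Bochner_Integration.integrable_bound)
      have "(g x \<bullet> a)\<^sup>2 \<le> (norm a)\<^sup>2 * (norm (g x))\<^sup>2" for x
        using power_mono[OF Cauchy_Schwarz_ineq2[of "g x" a], of 2] by (simp add: power_mult_distrib mult.commute)
      then show "AE x in lborel. norm ((norm (g x \<bullet> a))\<^sup>2) \<le> norm ((norm a)\<^sup>2 * (norm (g x))\<^sup>2)" by simp
    qed measurable
    then show ?thesis by (simp add: L2_def)
  qed
  \<comment> \<open>Square integrability of \<open>W\<close> supplies the local integrability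
    required by \<open>fundamental_lemma\<close>.\<close>
  have WL: "W \<in> L2 lborel"
  proof (rule L2_I_nn)
    have "(\<integral>\<^sup>+x. ennreal ((norm (W x))\<^sup>2) \<partial>lborel) \<le> (\<integral>\<^sup>+x. (\<integral>\<^sup>+t. indicator {0..1} t * ennreal ((g (x + t *\<^sub>R a) \<bullet> a)\<^sup>2) \<partial>lborel) \<partial>lborel)"
    proof (rule nn_integral_mono)
      fix x show "ennreal ((norm (W x))\<^sup>2) \<le> (\<integral>\<^sup>+t. indicator {0..1} t * ennreal ((g (x + t *\<^sub>R a) \<bullet> a)\<^sup>2) \<partial>lborel)"
        using sq_set_integral_le[of "{0..1::real}" lborel "\<lambda>t. g (x + t *\<^sub>R a) \<bullet> a" 1] by (simp add: W_def)
    qed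
    also have "\<dots> = (\<integral>\<^sup>+p. ennreal (norm (case p of (x, t) \<Rightarrow> I01 t * (norm (g (x + t *\<^sub>R a) \<bullet> a))\<^sup>2)) \<partial>(lborel \<Otimes>\<^sub>M lborel))"
      by (subst lborel.nn_integral_fst[symmetric]) (auto intro!: nn_integral_cong simp: indicator_def)
    also have "\<dots> < \<infinity>"
      using integrable_pair_translate[OF L2_integrable_norm[OF ga], of a] by (simp add: integrable_iff_bounded)
    finally have fin: "(\<integral>\<^sup>+x. ennreal ((norm (W x))\<^sup>2) \<partial>lborel) < \<infinity>" .
    then show "(\<integral>\<^sup>+x. ennreal ((norm (W x))\<^sup>2) \<partial>lborel) \<le> ennreal (enn2real (\<integral>\<^sup>+x. ennreal ((norm (W x))\<^sup>2) \<partial>lborel))"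
      by simp
  qed auto
  have "AE x in lborel. u (x + a) - u x - W x = 0"
  proof (rule fundamental_lemma)
    have ua: "(\<lambda>x. u (x + a)) \<in> L2 lborel" by (rule has_weak_gradient_translate(2)[OF u])
    have l: "locally_integrable (\<lambda>x. u (x + a))" "locally_integrable u" "locally_integrable W"
      by (intro L2_locally_integrable ua u WL)+
    then show "locally_integrable (\<lambda>x. u (x + a) - u x - W x)" by (intro locally_integrable_diff)
    fix \<phi> :: "real ^ 'd \<Rightarrow> real" assume \<phi>: "\<phi> \<in> test_functions"
    note [measurable] = borel_measurable_continuous_onI[OF test_function_cont[OF \<phi>]]
    note \<phi>L = test_function_L2[OF \<phi>]
    define \<Psi> where "\<Psi> x = (\<Sum>i\<in>UNIV. a $ i * partial i \<phi> x)" for x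
    have \<Psi>L: "\<Psi> \<in> L2 lborel" unfolding \<Psi>_def[abs_def]
      by (intro L2_sum test_function_L2 test_function_cmult test_function_partial_mem \<phi>) auto
    have tr: "(\<integral>x. (g (x + t *\<^sub>R a) \<bullet> a) * \<phi> x \<partial>lborel) = - (\<integral>x. u x * \<Psi> (x + t *\<^sub>R - a) \<partial>lborel)" for t
    proof -
      let ?\<psi> = "\<lambda>x. \<phi> (x + t *\<^sub>R - a)"
      have "(\<integral>x. (g (x + t *\<^sub>R a) \<bullet> a) * \<phi> x \<partial>lborel) = (\<integral>x. (g (x + t *\<^sub>R a) \<bullet> a) * ?\<psi> (x + t *\<^sub>R a) \<partial>lborel)"
        by simp
      also have "\<dots> = (\<integral>x. (g x \<bullet> a) * ?\<psi> x \<partial>lborel)"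
        by (rule integral_lborel_translate) measurable
      also have "\<dots> = - (\<integral>x. u x * \<Psi> (x + t *\<^sub>R - a) \<partial>lborel)"
        unfolding weak_gradient_direction[OF u(1) test_function_translate(1)[OF \<phi>]]
        by (simp add: \<Psi>_def test_function_translate(2)[OF \<phi>] del: add_uminus_conv_diff scaleR_minus_right)
      finally show ?thesis .
    qed
    \<comment> \<open>The dummy shift \<open>t *\<^sub>R 0\<close> brings the untranslated factor
      into the shape of \<open>Fubini_translate\<close>.\<close>
    have "(\<integral>x. W x * \<phi> x \<partial>lborel) = (\<integral>x. (\<integral>t. I01 t * ((g (x + t *\<^sub>R a) \<bullet> a) * \<phi> (x + t *\<^sub>R 0)) \<partial>lborel) \<partial>lborel)"
    proof (rule Bochner_Integration.integral_cong[OF refl])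
      fix x show "W x * \<phi> x = (\<integral>t. I01 t * ((g (x + t *\<^sub>R a) \<bullet> a) * \<phi> (x + t *\<^sub>R 0)) \<partial>lborel)"
        by (simp add: W_def mult.assoc[symmetric])
    qed
    also have "\<dots> = (\<integral>t. (\<integral>x. I01 t * ((g (x + t *\<^sub>R a) \<bullet> a) * \<phi> (x + t *\<^sub>R 0)) \<partial>lborel) \<partial>lborel)"
      by (rule Fubini_translate[OF ga \<phi>L])
    also have "\<dots> = - (\<integral>t. (\<integral>x. I01 t * (u (x + t *\<^sub>R 0) * \<Psi> (x + t *\<^sub>R - a)) \<partial>lborel) \<partial>lborel)"
      using tr by (simp del: scaleR_minus_right)
    also have "\<dots> = - (\<integral>x. (\<integral>t. I01 t * (u (x + t *\<^sub>R 0) * \<Psi> (x + t *\<^sub>R - a)) \<partial>lborel) \<partial>lborel)"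
      by (simp only: Fubini_translate[OF u(2) \<Psi>L])
    also have "\<dots> = - (\<integral>x. u x * (\<phi> x - \<phi> (x - a)) \<partial>lborel)"
    proof -
      have "(\<integral>t. I01 t * (u (x + t *\<^sub>R 0) * \<Psi> (x + t *\<^sub>R - a)) \<partial>lborel) = u x * (\<phi> x - \<phi> (x - a))" for x
        unfolding test_function_FTC[OF \<phi>, of a x, symmetric]
        by (subst integral_mult_right_zero[symmetric]) (simp add: \<Psi>_def mult_ac del: scaleR_minus_right integral_mult_right_zero)
      then show ?thesis by simp
    qed
    also have "\<dots> = (\<integral>x. u x * \<phi> (x - a) \<partial>lborel) - (\<integral>x. u x * \<phi> x \<partial>lborel)"
      using locally_integrable_mult_test[OF l(2) \<phi>]
        locally_integrable_mult_test[OF l(2) test_function_translate(1)[OF \<phi>, of "- a"]]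
      by (simp add: right_diff_distrib)
    also have "(\<integral>x. u x * \<phi> (x - a) \<partial>lborel) = (\<integral>x. u (x + a) * \<phi> (x + a - a) \<partial>lborel)"
      by (rule integral_lborel_translate[symmetric]) measurable
    finally show "(\<integral>x. (u (x + a) - u x - W x) * \<phi> x \<partial>lborel) = 0"
      using l by (simp add: left_diff_distrib locally_integrable_mult_test[OF _ \<phi>])
  qed
  then show "AE x in lborel. u (x + a) - u x = (\<integral>t. I01 t * (g (x + t *\<^sub>R a) \<bullet> a) \<partial>lborel)"
    by (simp add: W_def)
qed

text \<open>Cauchy--Schwarz in \<open>t\<close>, then Tonelli and translation invariance. The set
  \<open>E'\<close> contains the segments on which the gradient is sampled; the bound thus stays
  local, as the Sobolev inequality on cubes demands.\<close>

lemma translation_estimate: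
  fixes u :: "real ^ 'd \<Rightarrow> real"
  assumes ug: "H1_pair u g" and [measurable]: "E \<in> sets borel" "E' \<in> sets borel"
    and sub: "\<And>x t. x \<in> E \<Longrightarrow> 0 \<le> t \<Longrightarrow> t \<le> 1 \<Longrightarrow> x + t *\<^sub>R a \<in> E'"
  shows "(\<integral>\<^sup>+x. indicator E x * ennreal ((u (x + a) - u x)\<^sup>2) \<partial>lborel)
     \<le> ennreal ((norm a)\<^sup>2) * (\<integral>\<^sup>+x. indicator E' x * ennreal ((norm (g x))\<^sup>2) \<partial>lborel)"
proof -
  have [measurable]: "u \<in> borel_measurable borel" "g \<in> borel_measurable borel"
    using H1_pair_measurable[OF ug] by auto
  let ?h = "\<lambda>y. indicator E' y * ennreal ((norm a)\<^sup>2 * (norm (g y))\<^sup>2)"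
  have "(\<integral>\<^sup>+x. indicator E x * ennreal ((u (x + a) - u x)\<^sup>2) \<partial>lborel)
     \<le> (\<integral>\<^sup>+x. (\<integral>\<^sup>+t. indicator {0..1} t * ?h (x + t *\<^sub>R a) \<partial>lborel) \<partial>lborel)"
  proof (rule nn_integral_mono_AE, use translation_identity(1)[OF ug, of a] in eventually_elim)
    case (elim x)
    show ?case
    proof (cases "x \<in> E")
      case True
      have "ennreal ((u (x + a) - u x)\<^sup>2) \<le> (\<integral>\<^sup>+t. indicator {0..1} t * ennreal ((g (x + t *\<^sub>R a) \<bullet> a)\<^sup>2) \<partial>lborel)"
        using sq_set_integral_le[of "{0..1::real}" lborel "\<lambda>t. g (x + t *\<^sub>R a) \<bullet> a" 1] elim by simp
      also have "\<dots> \<le> (\<integral>\<^sup>+t. indicator {0..1} t * ?h (x + t *\<^sub>R a) \<partial>lborel)"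
      proof (rule nn_integral_mono)
        fix t
        have "(g (x + t *\<^sub>R a) \<bullet> a)\<^sup>2 \<le> (norm a)\<^sup>2 * (norm (g (x + t *\<^sub>R a)))\<^sup>2"
          using power_mono[OF Cauchy_Schwarz_ineq2[of "g (x + t *\<^sub>R a)" a], of 2] by (simp add: power_mult_distrib mult.commute)
        then show "indicator {0..1} t * ennreal ((g (x + t *\<^sub>R a) \<bullet> a)\<^sup>2) \<le> indicator {0..1} t * ?h (x + t *\<^sub>R a)"
          using sub[OF True, of t] by (auto simp: indicator_def intro: ennreal_leI)
      qed
      finally show ?thesis using True by simp
    qed simp
  qed
  also have "\<dots> = (\<integral>\<^sup>+t. (\<integral>\<^sup>+x. indicator {0..1} t * ?h (x + t *\<^sub>R a) \<partial>lborel) \<partial>lborel)"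
    by (rule lborel_pair.Fubini'[symmetric]) measurable
  also have "\<dots> = (\<integral>\<^sup>+t. indicator {0..1::real} t * (\<integral>\<^sup>+x. ?h x \<partial>lborel) \<partial>lborel)"
  proof (rule nn_integral_cong)
    fix t :: real
    have "(\<integral>\<^sup>+x. indicator {0..1} t * ?h (x + t *\<^sub>R a) \<partial>lborel) = indicator {0..1} t * (\<integral>\<^sup>+x. ?h (x + t *\<^sub>R a) \<partial>lborel)"
      by (subst nn_integral_cmult) auto
    then show "(\<integral>\<^sup>+x. indicator {0..1} t * ?h (x + t *\<^sub>R a) \<partial>lborel) = indicator {0..1} t * (\<integral>\<^sup>+x. ?h x \<partial>lborel)"
      by (subst (asm) nn_integral_lborel_translate) auto
  qed
  also have "\<dots> = (\<integral>\<^sup>+x. ?h x \<partial>lborel)"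
    by (subst nn_integral_multc) auto
  also have "\<dots> = ennreal ((norm a)\<^sup>2) * (\<integral>\<^sup>+x. indicator E' x * ennreal ((norm (g x))\<^sup>2) \<partial>lborel)"
    by (subst nn_integral_cmult[symmetric]) (auto simp: ennreal_mult mult_ac)
  finally show ?thesis .
qed

subsection \<open>Averages over cubes\<close>

text \<open>Half-open with lower corner \<open>z\<close>, so that a cube is the disjoint union of
  its dyadic subcubes.\<close>

definition cube :: "real ^ 'd \<Rightarrow> real \<Rightarrow> (real ^ 'd) set" where
  "cube z r = {x. \<forall>k. z $ k \<le> x $ k \<and> x $ k < z $ k + r}"

lemma cube_sets [measurable]: "cube z r \<in> sets borel"
proof -
  have "cube z r = (\<Inter>k. {x. z $ k \<le> x $ k} \<inter> {x. x $ k < z $ k + r})"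
    by (auto simp: cube_def)
  also have "\<dots> \<in> sets borel"
    by (intro sets.finite_INT sets.Int borel_closed borel_open)
      (auto intro!: closed_Collect_le open_Collect_less continuous_intros)
  finally show ?thesis .
qed

lemma cube_translate: "x - a \<in> cube z r \<longleftrightarrow> x \<in> cube (z + a) r" "x + a \<in> cube z r \<longleftrightarrow> x \<in> cube (z - a) r"
  by (auto simp: cube_def algebra_simps)

lemma emeasure_cube:
  fixes z :: "real ^ 'd"
  assumes "r \<ge> 0"
  shows "emeasure lborel (cube z r) = ennreal (r ^ CARD('d))"
proof (rule antisym)
  let ?u = "z + (\<chi> k. r)"
  have b: "(?u - z) \<bullet> b = r" "z \<bullet> b \<le> ?u \<bullet> b" if "b \<in> Basis" for b :: "real ^ 'd"
    using that assms by (auto simp: Basis_vec_def inner_axis inner_add_left)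
  have p: "(\<Prod>b\<in>(Basis :: (real ^ 'd) set). (?u - z) \<bullet> b) = r ^ CARD('d)"
    using b(1) by simp
  have "cube z r \<subseteq> cbox z ?u" by (auto simp: cube_def mem_box_cart less_imp_le)
  then have "emeasure lborel (cube z r) \<le> emeasure lborel (cbox z ?u)" by (intro emeasure_mono) auto
  also have "\<dots> = ennreal (r ^ CARD('d))"
    using b(2) unfolding p[symmetric] by (intro emeasure_lborel_cbox) auto
  finally show "emeasure lborel (cube z r) \<le> ennreal (r ^ CARD('d))" .
  have "box z ?u \<subseteq> cube z r" by (auto simp: cube_def mem_box_cart less_imp_le)
  then have "emeasure lborel (box z ?u) \<le> emeasure lborel (cube z r)" by (intro emeasure_mono) auto
  moreover have "emeasure lborel (box z ?u) = ennreal (r ^ CARD('d))"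
    using b(2) unfolding p[symmetric] by (intro emeasure_lborel_box) auto
  ultimately show "ennreal (r ^ CARD('d)) \<le> emeasure lborel (cube z r)" by simp
qed

text \<open>Extended nonnegative values let monotonicity in the set and Tonelli's theorem apply
  without integrability conditions.\<close>

definition loc_energy :: "(real ^ 'd) set \<Rightarrow> (real ^ 'd \<Rightarrow> real) \<Rightarrow> (real ^ 'd \<Rightarrow> real ^ 'd) \<Rightarrow> ennreal" where
  "loc_energy E u g = (\<integral>\<^sup>+x. indicator E x * ennreal ((u x)\<^sup>2 + (norm (g x))\<^sup>2) \<partial>lborel)"

lemma loc_energy_ge:
  "(\<integral>\<^sup>+x. indicator E x * ennreal ((u x)\<^sup>2) \<partial>lborel) \<le> loc_energy E u g"
  "(\<integral>\<^sup>+x. indicator E x * ennreal ((norm (g x))\<^sup>2) \<partial>lborel) \<le> loc_energy E u g"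
  unfolding loc_energy_def
  by (intro nn_integral_mono mult_left_mono ennreal_leI; simp)+

lemma loc_energy_mono: "E \<subseteq> E' \<Longrightarrow> loc_energy E u g \<le> loc_energy E' u g"
  unfolding loc_energy_def by (intro nn_integral_mono) (auto simp: indicator_def)

text \<open>The point \<open>x\<close> is the lower corner of the averaging cube, not its centre.
  Dividing by \<open>r\<^sup>2\<close> is dividing by the volume in two dimensions.\<close>

definition avg :: "real \<Rightarrow> (real ^ 'd \<Rightarrow> real) \<Rightarrow> real ^ 'd \<Rightarrow> real" where
  "avg r u x = (\<integral>y. indicator (cube 0 r) y * u (x + y) \<partial>lborel) / r\<^sup>2"

lemma avg_measurable:
  fixes u :: "real ^ 'd \<Rightarrow> real"
  assumes [measurable]: "u \<in> borel_measurable borel"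
  shows "avg r u \<in> borel_measurable borel"
proof -
  have "(\<lambda>x. \<integral>y. indicator (cube 0 r) y * u (x + y) \<partial>lborel) \<in> borel_measurable lborel"
    by (rule sigma_finite_measure.borel_measurable_lebesgue_integral[OF sigma_finite_lborel]) measurable
  then show ?thesis unfolding avg_def[abs_def] by simp
qed

lemma integrable_cube:
  fixes u :: "real ^ 'd \<Rightarrow> real"
  assumes "u \<in> L2 lborel" "r \<ge> 0"
  shows "integrable lborel (\<lambda>y. indicator (cube z r) y * u (x + y))"
proof -
  have "(\<integral>\<^sup>+y. ennreal ((norm (indicator (cube z r) y :: real))\<^sup>2) \<partial>lborel) = emeasure lborel (cube z r)"
  proof -
    have "ennreal ((norm (indicator (cube z r) y :: real))\<^sup>2) = indicator (cube z r) y" for y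
      by (auto simp: indicator_def)
    then show ?thesis by simp
  qed
  then have 1: "(indicator (cube z r) :: _ \<Rightarrow> real) \<in> L2 lborel"
    using assms(2) by (intro L2_I_nn[of _ _ "r ^ CARD('d)"]) (auto simp: emeasure_cube)
  have "integrable lborel (\<lambda>y. (norm (u (y + x)))\<^sup>2)"
    by (intro integrable_lborel_translate L2_integrable_norm assms)
  moreover have "u \<in> borel_measurable borel" using assms(1) by (rule L2_borel)
  ultimately have 2: "(\<lambda>y. u (x + y)) \<in> L2 lborel" by (simp add: L2_def add.commute)
  show ?thesis using L2_inner_integrable[OF 1 2] by simp
qed

lemma avg_sq_le:
  fixes u :: "real ^ 'd \<Rightarrow> real"
  assumes d: "CARD('d) = 2" and "H1_pair u g" "r > 0" "cube x r \<subseteq> E"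
  shows "ennreal ((avg r u x)\<^sup>2) \<le> ennreal (1 / r\<^sup>2) * loc_energy E u g"
proof -
  have [measurable]: "u \<in> borel_measurable borel" using H1_pair_measurable[OF assms(2)] by auto
  have "ennreal ((avg r u x)\<^sup>2) = ennreal (1 / r\<^sup>2) * ennreal (1 / r\<^sup>2) * ennreal ((\<integral>y. indicator (cube 0 r) y * u (x + y) \<partial>lborel)\<^sup>2)"
    by (simp add: avg_def power_divide ennreal_mult'[symmetric] power2_eq_square)
  also have "ennreal ((\<integral>y. indicator (cube 0 r) y * u (x + y) \<partial>lborel)\<^sup>2) \<le> ennreal (r\<^sup>2) * (\<integral>\<^sup>+y. indicator (cube 0 r) y * ennreal ((u (x + y))\<^sup>2) \<partial>lborel)"
    using assms(3) d by (intro sq_set_integral_le) (auto simp: emeasure_cube)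
  also have "(\<integral>\<^sup>+y. indicator (cube 0 r) y * ennreal ((u (x + y))\<^sup>2) \<partial>lborel)
      = (\<integral>\<^sup>+y. indicator (cube x r) (y + x) * ennreal ((u (y + x))\<^sup>2) \<partial>lborel)"
    by (intro nn_integral_cong) (simp add: indicator_def cube_translate add.commute)
  also have "\<dots> = (\<integral>\<^sup>+y. indicator (cube x r) y * ennreal ((u y)\<^sup>2) \<partial>lborel)"
    by (rule nn_integral_lborel_translate) measurable
  also have "\<dots> \<le> loc_energy E u g"
    by (rule order.trans[OF loc_energy_ge(1) loc_energy_mono[OF assms(4)]])
  also have "ennreal (1 / r\<^sup>2) * ennreal (1 / r\<^sup>2) * (ennreal (r\<^sup>2) * loc_energy E u g) = ennreal (1 / r\<^sup>2) * loc_energy E u g"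
    using assms(3) by (simp add: mult.assoc[symmetric] ennreal_mult'[symmetric] power2_eq_square)
  finally show ?thesis by (simp add: mult_left_mono)
qed

text \<open>The factor depends only on \<open>norm a / r\<close>: a shift comparable to the side
  changes the average by a multiple of the local energy norm that is the same at every scale. This
  reflects that dimension two is critical.\<close>

lemma avg_shift_le:
  fixes u :: "real ^ 'd \<Rightarrow> real"
  assumes d: "CARD('d) = 2" and ug: "H1_pair u g" and r: "r > 0" and [measurable]: "E \<in> sets borel"
    and sub: "\<And>y t. y \<in> cube x r \<Longrightarrow> 0 \<le> t \<Longrightarrow> t \<le> 1 \<Longrightarrow> y + t *\<^sub>R a \<in> E"
  shows "ennreal ((avg r u (x + a) - avg r u x)\<^sup>2) \<le> ennreal ((norm a)\<^sup>2 / r\<^sup>2) * loc_energy E u g"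
proof -
  have [measurable]: "u \<in> borel_measurable borel" using H1_pair_measurable[OF ug] by auto
  have uL: "u \<in> L2 lborel" using ug by (simp add: H1_pair_def)
  have "avg r u (x + a) - avg r u x = (\<integral>y. indicator (cube 0 r) y * (u (x + y + a) - u (x + y)) \<partial>lborel) / r\<^sup>2"
    using integrable_cube[OF uL, of r 0 "x + a"] integrable_cube[OF uL, of r 0 x] r
    by (simp add: avg_def right_diff_distrib diff_divide_distrib add_ac)
  then have "ennreal ((avg r u (x + a) - avg r u x)\<^sup>2) = ennreal (1 / r\<^sup>2) * ennreal (1 / r\<^sup>2)
      * ennreal ((\<integral>y. indicator (cube 0 r) y * (u (x + y + a) - u (x + y)) \<partial>lborel)\<^sup>2)"
    by (simp add: power_divide ennreal_mult'[symmetric] power2_eq_square)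
  also have "ennreal ((\<integral>y. indicator (cube 0 r) y * (u (x + y + a) - u (x + y)) \<partial>lborel)\<^sup>2)
      \<le> ennreal (r\<^sup>2) * (\<integral>\<^sup>+y. indicator (cube 0 r) y * ennreal ((u (x + y + a) - u (x + y))\<^sup>2) \<partial>lborel)"
    using r d by (intro sq_set_integral_le) (auto simp: emeasure_cube)
  also have "(\<integral>\<^sup>+y. indicator (cube 0 r) y * ennreal ((u (x + y + a) - u (x + y))\<^sup>2) \<partial>lborel)
      = (\<integral>\<^sup>+y. indicator (cube x r) (y + x) * ennreal ((u (y + x + a) - u (y + x))\<^sup>2) \<partial>lborel)"
    by (intro nn_integral_cong) (simp add: indicator_def cube_translate add.commute)
  also have "\<dots> = (\<integral>\<^sup>+y. indicator (cube x r) y * ennreal ((u (y + a) - u y)\<^sup>2) \<partial>lborel)"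
    by (rule nn_integral_lborel_translate) measurable
  also have "\<dots> \<le> ennreal ((norm a)\<^sup>2) * (\<integral>\<^sup>+x. indicator E x * ennreal ((norm (g x))\<^sup>2) \<partial>lborel)"
    by (rule translation_estimate[OF ug]) (use sub in auto)
  also have "\<dots> \<le> ennreal ((norm a)\<^sup>2) * loc_energy E u g"
    by (intro mult_left_mono loc_energy_ge) simp
  also have "ennreal (1 / r\<^sup>2) * ennreal (1 / r\<^sup>2) * (ennreal (r\<^sup>2) * (ennreal ((norm a)\<^sup>2) * loc_energy E u g)) = ennreal ((norm a)\<^sup>2 / r\<^sup>2) * loc_energy E u g"
    using r by (simp add: mult.assoc[symmetric] ennreal_mult'[symmetric] power2_eq_square)
  finally show ?thesis by (simp add: mult_left_mono)
qed

lemma ennreal_sq_le: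
  assumes "ennreal (a\<^sup>2) \<le> ennreal c * e" "e \<le> ennreal (N\<^sup>2)" "c * N\<^sup>2 \<le> b\<^sup>2" "b \<ge> 0" "c \<ge> 0"
  shows "\<bar>a\<bar> \<le> b"
proof -
  have "ennreal (a\<^sup>2) \<le> ennreal c * ennreal (N\<^sup>2)"
    by (rule order.trans[OF assms(1)]) (intro mult_left_mono assms, simp)
  then have "ennreal (a\<^sup>2) \<le> ennreal (c * N\<^sup>2)" using assms by (simp add: ennreal_mult)
  then have "a\<^sup>2 \<le> b\<^sup>2" using assms by (simp add: ennreal_le_iff)
  then show ?thesis using assms(4) abs_le_square_iff[of a b] by simp
qed

text \<open>A set \<open>S\<close> of coordinates encodes one dyadic subcube: it lists the
  directions in which the subcube is displaced by \<open>r\<close>.\<close>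

definition corner :: "real \<Rightarrow> 'd set \<Rightarrow> real ^ 'd" where
  "corner r S = (\<chi> k. if k \<in> S then r else 0)"

text \<open>A point of the large cube selects exactly one subcube, given by the coordinates that are
  at least \<open>r\<close>.\<close>

lemma cube_split:
  assumes "r > 0"
  shows "(indicator (cube 0 (2 * r)) y :: real) = (\<Sum>S\<in>Pow (UNIV :: 'd::finite set). indicator (cube (corner r S) r) (y :: real ^ 'd))"
proof (cases "y \<in> cube 0 (2 * r)")
  case True
  define S0 where "S0 = {k. y $ k \<ge> r}"
  have "y \<in> cube (corner r S) r \<longleftrightarrow> S = S0" for S
  proof
    assume "y \<in> cube (corner r S) r"
    then have "k \<in> S \<longleftrightarrow> y $ k \<ge> r" for k using assms by (auto simp: cube_def corner_def split: if_splits dest!: spec[of _ k])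
    then show "S = S0" by (auto simp: S0_def)
  next
    assume "S = S0" then show "y \<in> cube (corner r S) r"
      using True by (auto simp: S0_def cube_def corner_def)
  qed
  then have "indicator (cube (corner r S) r) y = (if S = S0 then 1 else 0 :: real)" for S by (simp add: indicator_def)
  then show ?thesis using True by simp
next
  case False
  have "y \<notin> cube (corner r S) r" for S
  proof
    assume y: "y \<in> cube (corner r S) r"
    have "0 \<le> y $ k \<and> y $ k < 2 * r" for k
      using y assms by (auto simp: cube_def corner_def split: if_splits dest!: spec[of _ k])
    then show False using False by (auto simp: cube_def)
  qed
  then show ?thesis using False by simp
qed

lemma avg_split:
  fixes u :: "real ^ 'd \<Rightarrow> real"
  assumes "u \<in> L2 lborel" "r > 0"
  shows "avg (2 * r) u x = (\<Sum>S\<in>Pow (UNIV :: 'd set). avg r u (x + corner r S)) / 4"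
proof -
  have [measurable]: "u \<in> borel_measurable borel" using assms(1) by (rule L2_borel)
  have eq: "(\<integral>y. indicator (cube (corner r S) r) y * u (x + y) \<partial>lborel)
     = (\<integral>y. indicator (cube 0 r) y * u (x + corner r S + y) \<partial>lborel)" for S :: "'d set"
  proof -
    have "(\<integral>y. indicator (cube (corner r S) r) y * u (x + y) \<partial>lborel)
      = (\<integral>y. indicator (cube (corner r S) r) (y + corner r S) * u (x + (y + corner r S)) \<partial>lborel)"
      by (rule integral_lborel_translate[symmetric]) measurable
    then show ?thesis by (simp add: indicator_def cube_translate add_ac)
  qed
  have "(\<integral>y. indicator (cube 0 (2 * r)) y * u (x + y) \<partial>lborel)
      = (\<integral>y. (\<Sum>S\<in>Pow (UNIV :: 'd set). indicator (cube (corner r S) r) y * u (x + y)) \<partial>lborel)"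
    by (simp add: cube_split[OF assms(2)] sum_distrib_right)
  also have "\<dots> = (\<Sum>S\<in>Pow (UNIV :: 'd set). (\<integral>y. indicator (cube (corner r S) r) y * u (x + y) \<partial>lborel))"
    using assms by (intro Bochner_Integration.integral_sum integrable_cube) auto
  also have "\<dots> = (\<Sum>S\<in>Pow (UNIV :: 'd set). (\<integral>y. indicator (cube 0 r) y * u (x + corner r S + y) \<partial>lborel))"
    by (rule sum.cong[OF refl eq])
  finally show ?thesis
    using assms(2) by (simp add: avg_def power_mult_distrib sum_divide_distrib mult.commute)
qed

text \<open>An average over a cube is the mean of the averages over its four subcubes, and each of
  these differs from the one at the lower corner by at most \<open>2 * N\<close>. Every halving of
  the side thus costs a constant, which gives linear growth in \<open>k\<close>.\<close>

lemma avg_bound: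
  fixes u :: "real ^ 'd \<Rightarrow> real"
  assumes d: "CARD('d) = 2" and ug: "H1_pair u g"
    and N: "loc_energy (cube x 1) u g \<le> ennreal (N\<^sup>2)" "N \<ge> 0"
  shows "\<bar>avg ((1/2) ^ k) u x\<bar> \<le> (1 + 2 * real k) * N"
proof (induction k)
  case 0
  have "ennreal ((avg 1 u x)\<^sup>2) \<le> ennreal 1 * loc_energy (cube x 1) u g"
    using avg_sq_le[OF d ug, of 1 x] by simp
  from ennreal_sq_le[OF this N(1), of N] N(2) show ?case by simp
next
  case (Suc k)
  define r :: real where "r = (1/2) ^ Suc k"
  have r: "r > 0" "2 * r \<le> 1" "2 * r = (1/2) ^ k" by (simp_all add: r_def power_le_one)
  have uL: "u \<in> L2 lborel" using ug by (simp add: H1_pair_def)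
  have diff: "\<bar>avg r u (x + corner r S) - avg r u x\<bar> \<le> 2 * N" for S :: "'d set"
  proof (rule ennreal_sq_le[OF _ N(1)])
    \<comment> \<open>At most two coordinates equal \<open>r\<close>. The resulting factor, the
      square root of 2, is rounded up to 2.\<close>
    have "(norm (corner r S))\<^sup>2 \<le> 2 * r\<^sup>2"
    proof -
      have "(norm (corner r S))\<^sup>2 = (\<Sum>k\<in>UNIV. (corner r S $ k)\<^sup>2)"
        unfolding power2_norm_eq_inner inner_vec_def by (simp add: power2_eq_square)
      also have "\<dots> \<le> (\<Sum>k\<in>(UNIV :: 'd set). r\<^sup>2)"
        by (intro sum_mono) (auto simp: corner_def)
      finally show ?thesis using d by simp
    qed
    then have "(norm (corner r S))\<^sup>2 / r\<^sup>2 \<le> 2" using r by (simp add: divide_le_eq)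
    then have "(norm (corner r S))\<^sup>2 / r\<^sup>2 * N\<^sup>2 \<le> 2 * N\<^sup>2" by (rule mult_right_mono) simp
    then show "(norm (corner r S))\<^sup>2 / r\<^sup>2 * N\<^sup>2 \<le> (2 * N)\<^sup>2"
      by (rule order.trans) (simp add: power_mult_distrib)
    show "ennreal ((avg r u (x + corner r S) - avg r u x)\<^sup>2) \<le> ennreal ((norm (corner r S))\<^sup>2 / r\<^sup>2) * loc_energy (cube x 1) u g"
    proof (rule avg_shift_le[OF d ug r(1)])
      fix y t assume y: "y \<in> cube x r" and t: "0 \<le> t" "t \<le> (1::real)"
      have "t * r \<le> r" "0 \<le> t * r" using t r by (auto intro: mult_left_le_one_le)
      moreover have "x $ k \<le> y $ k" "y $ k < x $ k + r" for k using y by (auto simp: cube_def)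
      moreover have "t * corner r S $ k = (if k \<in> S then t * r else 0)" for k by (simp add: corner_def)
      ultimately have "x $ k \<le> y $ k + t * corner r S $ k \<and> y $ k + t * corner r S $ k < x $ k + 1" for k
        using r(1,2) by (smt (verit))
      then show "y + t *\<^sub>R corner r S \<in> cube x 1" by (simp add: cube_def)
    qed simp
  qed (use N in auto)
  have "card (Pow (UNIV :: 'd set)) = 4" using d by (simp add: card_Pow)
  then have "avg (2 * r) u x - avg r u x = (\<Sum>S\<in>Pow (UNIV :: 'd set). avg r u (x + corner r S) - avg r u x) / 4"
    unfolding avg_split[OF uL r(1)] sum_subtractf by simp
  also have "\<bar>\<dots>\<bar> \<le> (\<Sum>S\<in>Pow (UNIV :: 'd set). \<bar>avg r u (x + corner r S) - avg r u x\<bar>) / 4"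
    by (simp add: divide_right_mono del: Pow_UNIV)
  also have "\<dots> \<le> (\<Sum>S\<in>Pow (UNIV :: 'd set). 2 * N) / 4"
    by (intro divide_right_mono sum_mono diff) simp
  also have "\<dots> = 2 * N" using \<open>card (Pow (UNIV :: 'd set)) = 4\<close> by simp
  finally have "\<bar>avg r u x\<bar> \<le> \<bar>avg (2 * r) u x\<bar> + 2 * N" by linarith
  also have "\<dots> \<le> (1 + 2 * real k) * N + 2 * N" using Suc r(3) by simp
  finally show ?case by (simp add: r_def algebra_simps)
qed

text \<open>The deviation from the average is itself an average of \<open>u x - u (x + y)\<close>
  over \<open>y\<close> in the cube. Cauchy--Schwarz and Tonelli reduce it to
  \<open>translation_estimate\<close> for each single shift, where the squared length of
  \<open>y\<close> is at most \<open>2 * h\<^sup>2\<close>.\<close>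

lemma avg_approx:
  fixes u :: "real ^ 'd \<Rightarrow> real"
  assumes d: "CARD('d) = 2" and ug: "H1_pair u g" and h: "h > 0" and [measurable]: "E \<in> sets borel" "E' \<in> sets borel"
    and sub: "\<And>x y. x \<in> E \<Longrightarrow> y \<in> cube 0 h \<Longrightarrow> x + y \<in> E'"
  shows "(\<integral>\<^sup>+x. indicator E x * ennreal ((u x - avg h u x)\<^sup>2) \<partial>lborel) \<le> ennreal (2 * h\<^sup>2) * loc_energy E' u g"
proof -
  have [measurable]: "u \<in> borel_measurable borel" using H1_pair_measurable[OF ug] by auto
  have uL: "u \<in> L2 lborel" using ug by (simp add: H1_pair_def)
  have one: "(\<integral>y. indicator (cube 0 h) (y :: real ^ 'd) \<partial>lborel) = h\<^sup>2"
    using h d by (simp add: measure_def emeasure_cube)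
  have pt: "ennreal ((u x - avg h u x)\<^sup>2) \<le> ennreal (1 / h\<^sup>2) * (\<integral>\<^sup>+y. indicator (cube 0 h) y * ennreal ((u (x + y) - u x)\<^sup>2) \<partial>lborel)" for x
  proof -
    have i: "integrable lborel (\<lambda>y. indicator (cube 0 h) (y :: real ^ 'd) * u x)"
      using h by (intro integrable_mult_left integrable_real_indicator) (auto simp: emeasure_cube)
    have "(\<integral>y. indicator (cube 0 h) y * (u (x + y) - u x) \<partial>lborel) = h\<^sup>2 * (avg h u x - u x)"
      using integrable_cube[OF uL, of h 0 x] h i one by (simp add: right_diff_distrib avg_def)
    then have "ennreal ((u x - avg h u x)\<^sup>2) = ennreal (1 / h\<^sup>2) * ennreal (1 / h\<^sup>2)
      * ennreal ((\<integral>y. indicator (cube 0 h) y * (u (x + y) - u x) \<partial>lborel)\<^sup>2)"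
      using h by (simp add: power_mult_distrib ennreal_mult'[symmetric] power2_commute[of "u x"] power2_eq_square[of "h\<^sup>2"])
    also have "ennreal ((\<integral>y. indicator (cube 0 h) y * (u (x + y) - u x) \<partial>lborel)\<^sup>2)
      \<le> ennreal (h\<^sup>2) * (\<integral>\<^sup>+y. indicator (cube 0 h) y * ennreal ((u (x + y) - u x)\<^sup>2) \<partial>lborel)"
      using h d by (intro sq_set_integral_le) (auto simp: emeasure_cube)
    also have "ennreal (1 / h\<^sup>2) * ennreal (1 / h\<^sup>2) * (ennreal (h\<^sup>2) * (\<integral>\<^sup>+y. indicator (cube 0 h) y * ennreal ((u (x + y) - u x)\<^sup>2) \<partial>lborel))
       = ennreal (1 / h\<^sup>2) * (\<integral>\<^sup>+y. indicator (cube 0 h) y * ennreal ((u (x + y) - u x)\<^sup>2) \<partial>lborel)"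
      using h by (simp add: mult.assoc[symmetric] ennreal_mult'[symmetric] power2_eq_square)
    finally show ?thesis by (simp add: mult_left_mono)
  qed
  have inner: "(\<integral>\<^sup>+x. indicator E x * ennreal ((u (x + y) - u x)\<^sup>2) \<partial>lborel) \<le> ennreal (2 * h\<^sup>2) * loc_energy E' u g"
    if y: "y \<in> cube 0 h" for y
  proof -
    have "(\<integral>\<^sup>+x. indicator E x * ennreal ((u (x + y) - u x)\<^sup>2) \<partial>lborel)
       \<le> ennreal ((norm y)\<^sup>2) * (\<integral>\<^sup>+x. indicator E' x * ennreal ((norm (g x))\<^sup>2) \<partial>lborel)"
    proof (rule translation_estimate[OF ug])
      fix x t assume x: "x \<in> E" and t: "0 \<le> t" "t \<le> (1 :: real)"
      have "t *\<^sub>R y \<in> cube 0 h"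
        using y t by (auto simp: cube_def intro: le_less_trans[OF mult_left_le_one_le])
      from sub[OF x this] show "x + t *\<^sub>R y \<in> E'" .
    qed auto
    also have "\<dots> \<le> ennreal (2 * h\<^sup>2) * loc_energy E' u g"
    proof (intro mult_mono loc_energy_ge ennreal_leI)
      have "(norm y)\<^sup>2 = (\<Sum>k\<in>UNIV. (y $ k)\<^sup>2)"
        unfolding power2_norm_eq_inner inner_vec_def by (simp add: power2_eq_square)
      also have "\<dots> \<le> (\<Sum>k\<in>(UNIV :: 'd set). h\<^sup>2)"
        using y by (intro sum_mono power_mono) (auto simp: cube_def less_imp_le)
      finally show "(norm y)\<^sup>2 \<le> 2 * h\<^sup>2" using d by simp
    qed auto
    finally show ?thesis .
  qed
  have "(\<integral>\<^sup>+x. indicator E x * ennreal ((u x - avg h u x)\<^sup>2) \<partial>lborel)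
      \<le> (\<integral>\<^sup>+x. indicator E x * (ennreal (1 / h\<^sup>2) * (\<integral>\<^sup>+y. indicator (cube 0 h) y * ennreal ((u (x + y) - u x)\<^sup>2) \<partial>lborel)) \<partial>lborel)"
    by (intro nn_integral_mono mult_left_mono pt) simp
  also have "\<dots> = (\<integral>\<^sup>+x. (\<integral>\<^sup>+y. ennreal (1 / h\<^sup>2) * indicator (cube 0 h) y * (indicator E x * ennreal ((u (x + y) - u x)\<^sup>2)) \<partial>lborel) \<partial>lborel)"
    by (intro nn_integral_cong, subst nn_integral_cmult[symmetric], measurable, subst nn_integral_cmult[symmetric], measurable)
      (simp add: mult_ac)
  also have "\<dots> = (\<integral>\<^sup>+y. (\<integral>\<^sup>+x. ennreal (1 / h\<^sup>2) * indicator (cube 0 h) y * (indicator E x * ennreal ((u (x + y) - u x)\<^sup>2)) \<partial>lborel) \<partial>lborel)"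
    by (rule lborel_pair.Fubini'[symmetric]) measurable
  also have "\<dots> = (\<integral>\<^sup>+y. ennreal (1 / h\<^sup>2) * indicator (cube 0 h) y * (\<integral>\<^sup>+x. indicator E x * ennreal ((u (x + y) - u x)\<^sup>2) \<partial>lborel) \<partial>lborel)"
    by (intro nn_integral_cong nn_integral_cmult) measurable
  also have "\<dots> \<le> (\<integral>\<^sup>+y. ennreal (1 / h\<^sup>2) * indicator (cube 0 h) (y :: real ^ 'd) * (ennreal (2 * h\<^sup>2) * loc_energy E' u g) \<partial>lborel)"
  proof (rule nn_integral_mono)
    fix y show "ennreal (1 / h\<^sup>2) * indicator (cube 0 h) y * (\<integral>\<^sup>+x. indicator E x * ennreal ((u (x + y) - u x)\<^sup>2) \<partial>lborel)
       \<le> ennreal (1 / h\<^sup>2) * indicator (cube 0 h) y * (ennreal (2 * h\<^sup>2) * loc_energy E' u g)"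
      using inner[of y] by (cases "y \<in> cube 0 h") (auto intro: mult_left_mono)
  qed
  also have "\<dots> = ennreal (1 / h\<^sup>2) * (\<integral>\<^sup>+y. indicator (cube 0 h) (y :: real ^ 'd) \<partial>lborel) * (ennreal (2 * h\<^sup>2) * loc_energy E' u g)"
    by (subst nn_integral_multc, measurable, subst nn_integral_cmult, measurable)
  also have "ennreal (1 / h\<^sup>2) * (\<integral>\<^sup>+y. indicator (cube 0 h) (y :: real ^ 'd) \<partial>lborel) = 1"
    using h d by (simp add: emeasure_cube ennreal_mult'[symmetric])
  finally show ?thesis by simp
qed

subsection \<open>Local Sobolev inequality\<close>

text \<open>One factor \<open>(1/2) ^ k\<close> of \<open>(1/4) ^ k\<close> absorbs the power, the
  other remains summable.\<close>

lemma summable_powr_quarter: "summable (\<lambda>k. (real k + 2) powr p * (1/4) ^ k)"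
proof -
  have "(\<lambda>k. (real k + 2) powr p * (1/2) ^ k) \<longlonglongrightarrow> 0"
    by real_asymp
  then have "Bseq (\<lambda>k. (real k + 2) powr p * (1/2) ^ k)"
    by (intro convergent_imp_Bseq convergentI)
  then obtain B where B: "\<And>k. norm ((real k + 2) powr p * (1/2) ^ k) \<le> B"
    by (elim BseqE) blast
  show ?thesis
  proof (rule summable_comparison_test'[of "\<lambda>k. B * (1/2) ^ k" 0])
    show "summable (\<lambda>k. B * (1/2 :: real) ^ k)" by (intro summable_mult summable_geometric) simp
    fix k
    have "(1/4 :: real) ^ k = (1/2) ^ k * (1/2) ^ k" by (simp flip: power_mult_distrib)
    then show "norm ((real k + 2) powr p * (1/4) ^ k) \<le> B * (1/2) ^ k"
      using mult_right_mono[OF B[of k], of "(1/2) ^ k"] by (simp add: abs_mult mult_ac)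
  qed
qed

text \<open>On the set where \<open>\<bar>u\<bar>\<close> exceeds \<open>4 (k + 1) N\<close>, the function differs by at least \<open>2 (k + 1) N\<close>
  from its average at scale \<open>2\<^sup>-\<^sup>k\<close>, because in two dimensions these averages grow only linearly
  in \<open>k\<close>. The measure of this set is therefore at most \<open>4\<^sup>-\<^sup>k\<close>.\<close>

lemma local_Sobolev:
  assumes d: "CARD('d) = 2" and p: "p \<ge> 0"
  obtains C where "C > 0" "\<And>(u :: real ^ 'd \<Rightarrow> real) g z N. H1_pair u g \<Longrightarrow> N > 0 \<Longrightarrow>
    loc_energy (cube z 2) u g \<le> ennreal (N\<^sup>2) \<Longrightarrow>
    (\<integral>\<^sup>+x. indicator (cube z 1) x * ennreal (\<bar>u x\<bar> powr p) \<partial>lborel) \<le> ennreal (C * N powr p)"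
proof -
  define S where "S = (\<Sum>k. (real k + 2) powr p * (1/4) ^ k)"
  have S: "S \<ge> 0" unfolding S_def by (intro suminf_nonneg summable_powr_quarter) simp
  define C where "C = 4 powr p * (1 + S)"
  have "C > 0" using S by (simp add: C_def)
  moreover have "(\<integral>\<^sup>+x. indicator (cube z 1) x * ennreal (\<bar>u x\<bar> powr p) \<partial>lborel) \<le> ennreal (C * N powr p)"
    if ug: "H1_pair u g" and N: "N > 0" and e: "loc_energy (cube z 2) u g \<le> ennreal (N\<^sup>2)"
    for u :: "real ^ 'd \<Rightarrow> real" and g z N
  proof -
    have [measurable]: "u \<in> borel_measurable borel" using H1_pair_measurable[OF ug] by auto
    have [measurable]: "avg r u \<in> borel_measurable borel" for r by (rule avg_measurable) measurable
    let ?E = "cube z 1"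
    let ?b = "\<lambda>k. 4 * N * real (Suc k)"
    let ?I = "\<lambda>k x. indicator ?E x * indicator {x. ?b k \<le> \<bar>u x\<bar>} x :: ennreal"
    have avgb: "\<bar>avg ((1/2) ^ k) u x\<bar> \<le> 2 * real (Suc k) * N" if x: "x \<in> ?E" for x k
    proof -
      \<comment> \<open>The averaging cubes at points of the unit cube stay inside the cube of side
        2, whose energy is bounded.\<close>
      have "cube x 1 \<subseteq> cube z 2" using x by (auto simp: cube_def) (smt (verit))+
      then have "loc_energy (cube x 1) u g \<le> ennreal (N\<^sup>2)"
        using e loc_energy_mono order.trans by blast
      from avg_bound[OF d ug this, of k] N have "\<bar>avg ((1/2) ^ k) u x\<bar> \<le> (1 + 2 * real k) * N" by simp
      also have "\<dots> \<le> 2 * real (Suc k) * N" using N by (intro mult_right_mono) auto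
      finally show ?thesis .
    qed
    have level: "(\<integral>\<^sup>+x. ?I k x \<partial>lborel) \<le> ennreal ((1/4) ^ k)" for k
    proof -
      \<comment> \<open>The square of half the level \<open>?b k\<close>: the average accounts for
        at most one half of it, so the deviation from the average must supply the other.\<close>
      define c where "c = (2 * real (Suc k) * N)\<^sup>2"
      have "(2 * N)\<^sup>2 \<le> c" unfolding c_def using N by (intro power_mono) auto
      then have c: "c > 0" "4 * N\<^sup>2 \<le> c" using N by (auto simp: c_def power_mult_distrib)
      have "?I k x \<le> ennreal (1 / c) * (indicator ?E x * ennreal ((u x - avg ((1/2) ^ k) u x)\<^sup>2))" for x
      proof (cases "x \<in> ?E \<and> ?b k \<le> \<bar>u x\<bar>")
        case True
        then have "2 * real (Suc k) * N \<le> \<bar>u x - avg ((1/2) ^ k) u x\<bar>"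
          using avgb[of x k] abs_triangle_ineq2[of "u x" "avg ((1/2) ^ k) u x"] by (simp add: algebra_simps)
        then have "c \<le> (u x - avg ((1/2) ^ k) u x)\<^sup>2"
          unfolding c_def using N power_mono[of "2 * real (Suc k) * N" "\<bar>u x - avg ((1/2) ^ k) u x\<bar>" 2] by simp
        then have "1 \<le> 1 / c * (u x - avg ((1/2) ^ k) u x)\<^sup>2" using c by simp
        from ennreal_leI[OF this] have "ennreal 1 \<le> ennreal (1 / c * (u x - avg ((1/2) ^ k) u x)\<^sup>2)" .
        also have "\<dots> = ennreal (1 / c) * ennreal ((u x - avg ((1/2) ^ k) u x)\<^sup>2)"
          using c by (intro ennreal_mult') simp
        finally show ?thesis using True by simp
      qed auto
      then have "(\<integral>\<^sup>+x. ?I k x \<partial>lborel) \<le> (\<integral>\<^sup>+x. ennreal (1 / c) * (indicator ?E x * ennreal ((u x - avg ((1/2) ^ k) u x)\<^sup>2)) \<partial>lborel)"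
        by (rule nn_integral_mono)
      also have "\<dots> = ennreal (1 / c) * (\<integral>\<^sup>+x. indicator ?E x * ennreal ((u x - avg ((1/2) ^ k) u x)\<^sup>2) \<partial>lborel)"
        by (rule nn_integral_cmult) measurable
      also have "\<dots> \<le> ennreal (1 / c) * (ennreal (2 * ((1/2) ^ k)\<^sup>2) * loc_energy (cube z 2) u g)"
      proof (intro mult_left_mono avg_approx[OF d ug])
        fix x y :: "real ^ 'd" assume x: "x \<in> ?E" and y: "y \<in> cube 0 ((1/2) ^ k)"
        have "(1/2 :: real) ^ k \<le> 1" by (simp add: power_le_one)
        then have "z $ i \<le> x $ i + y $ i \<and> x $ i + y $ i < z $ i + 2" for i
          using x y by (auto simp: cube_def dest!: spec[of _ i])
        then show "x + y \<in> cube z 2" by (simp add: cube_def)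
      qed auto
      also have "\<dots> \<le> ennreal (1 / c) * (ennreal (2 * ((1/2) ^ k)\<^sup>2) * ennreal (N\<^sup>2))"
        by (intro mult_left_mono e) auto
      also have "\<dots> = ennreal (1 / c * (2 * ((1/2) ^ k)\<^sup>2 * N\<^sup>2))"
        using c by (simp add: ennreal_mult'[symmetric] mult_ac)
      also have "\<dots> \<le> ennreal ((1/4) ^ k)"
      proof (rule ennreal_leI)
        have "((1/2 :: real) ^ k)\<^sup>2 = (1/4) ^ k" by (simp add: power2_eq_square flip: power_mult_distrib)
        then have "1 / c * (2 * ((1/2) ^ k)\<^sup>2 * N\<^sup>2) = (2 * N\<^sup>2 / c) * (1/4) ^ k" by simp
        also have "\<dots> \<le> 1 * (1/4) ^ k"
          using c zero_le_power2[of N] by (intro mult_right_mono) (auto simp: divide_le_eq)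
        finally show "1 / c * (2 * ((1/2) ^ k)\<^sup>2 * N\<^sup>2) \<le> (1/4) ^ k" by simp
      qed
      finally show ?thesis .
    qed
    let ?w = "\<lambda>k. (4 * N * (real k + 2)) powr p"
    have pt: "indicator ?E x * ennreal (\<bar>u x\<bar> powr p)
       \<le> indicator ?E x * ennreal ((4 * N) powr p) + (\<Sum>k. ennreal (?w k) * ?I k x)" for x
    proof (cases "x \<in> ?E \<and> 4 * N < \<bar>u x\<bar>")
      case True
      \<comment> \<open>With \<open>m = Suc k\<close> the value lies between
        \<open>4 * N * (k + 1)\<close> and \<open>4 * N * (k + 2)\<close>. The lower bound puts
        \<open>x\<close> into level set \<open>k\<close>, the upper one explains the
        \<open>k + 2\<close> in the weight \<open>?w\<close>; this single term already
        dominates.\<close>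
      define m where "m = nat \<lfloor>\<bar>u x\<bar> / (4 * N)\<rfloor>"
      have q: "\<bar>u x\<bar> / (4 * N) > 1" using True N by simp
      then have m: "real m \<le> \<bar>u x\<bar> / (4 * N)" "\<bar>u x\<bar> / (4 * N) < real m + 1"
        unfolding m_def by linarith+
      then have "m \<ge> 1" using q by linarith
      then obtain k where k: "m = Suc k" by (cases m) auto
      have 1: "?b k \<le> \<bar>u x\<bar>" "\<bar>u x\<bar> \<le> 4 * N * (real k + 2)"
        using m N unfolding k by (auto simp: field_simps)
      have "ennreal (\<bar>u x\<bar> powr p) \<le> ennreal (?w k)"
        using 1(2) p by (intro ennreal_leI powr_mono2) auto
      also have "\<dots> = (\<Sum>k\<in>{k}. ennreal (?w k) * ?I k x)" using True 1(1) by simp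
      also have "\<dots> \<le> (\<Sum>k. ennreal (?w k) * ?I k x)" by (rule sum_le_suminf) auto
      finally show ?thesis using True by (simp add: add_increasing)
    next
      case False
      then show ?thesis using p by (auto simp: indicator_def intro!: add_increasing2 ennreal_leI powr_mono2)
    qed
    have "(\<integral>\<^sup>+x. indicator ?E x * ennreal (\<bar>u x\<bar> powr p) \<partial>lborel)
       \<le> (\<integral>\<^sup>+x. indicator ?E x * ennreal ((4 * N) powr p) + (\<Sum>k. ennreal (?w k) * ?I k x) \<partial>lborel)"
      by (rule nn_integral_mono) (rule pt)
    also have "\<dots> = (\<integral>\<^sup>+x. indicator ?E x * ennreal ((4 * N) powr p) \<partial>lborel) + (\<integral>\<^sup>+x. (\<Sum>k. ennreal (?w k) * ?I k x) \<partial>lborel)"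
      by (rule nn_integral_add) measurable
    also have "(\<integral>\<^sup>+x. indicator ?E x * ennreal ((4 * N) powr p) \<partial>lborel) = ennreal ((4 * N) powr p)"
      using d by (subst nn_integral_multc) (auto simp: emeasure_cube)
    also have "(\<integral>\<^sup>+x. (\<Sum>k. ennreal (?w k) * ?I k x) \<partial>lborel) = (\<Sum>k. \<integral>\<^sup>+x. ennreal (?w k) * ?I k x \<partial>lborel)"
      by (rule nn_integral_suminf) measurable
    also have "\<dots> \<le> (\<Sum>k. ennreal ((4 * N) powr p * ((real k + 2) powr p * (1/4) ^ k)))"
    proof (rule suminf_le)
      fix k
      have "(\<integral>\<^sup>+x. ennreal (?w k) * ?I k x \<partial>lborel) = ennreal (?w k) * (\<integral>\<^sup>+x. ?I k x \<partial>lborel)"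
        by (rule nn_integral_cmult) measurable
      also have "\<dots> \<le> ennreal (?w k) * ennreal ((1/4) ^ k)" by (intro mult_left_mono level) simp
      also have "\<dots> = ennreal ((4 * N) powr p * ((real k + 2) powr p * (1/4) ^ k))"
        using N by (simp add: powr_mult ennreal_mult'[symmetric] mult.assoc)
      finally show "(\<integral>\<^sup>+x. ennreal (?w k) * ?I k x \<partial>lborel) \<le> ennreal ((4 * N) powr p * ((real k + 2) powr p * (1/4) ^ k))" .
    qed auto
    also have "\<dots> = ennreal ((4 * N) powr p * S)"
      unfolding S_def by (intro suminf_ennreal_eq sums_mult summable_sums summable_powr_quarter) auto
    also have "ennreal ((4 * N) powr p) + ennreal ((4 * N) powr p * S) = ennreal (C * N powr p)"
      using S N by (simp add: C_def powr_mult ennreal_plus[symmetric] algebra_simps del: ennreal_plus)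
    finally show ?thesis by (simp add: add_left_mono)
  qed
  ultimately show ?thesis using that by blast
qed

text \<open>Tonelli: the lower corners of the cubes containing a given point fill a set of volume
  \<open>r ^ CARD('d)\<close>. Integration over all positions thus replaces summation over a
  grid.\<close>

lemma nn_integral_cube_average:
  fixes f :: "real ^ 'd \<Rightarrow> ennreal"
  assumes [measurable]: "f \<in> borel_measurable borel" and "r \<ge> 0"
  shows "(\<integral>\<^sup>+z. (\<integral>\<^sup>+x. indicator (cube z r) x * f x \<partial>lborel) \<partial>lborel) = ennreal (r ^ CARD('d)) * (\<integral>\<^sup>+x. f x \<partial>lborel)"
proof -
  have "(\<integral>\<^sup>+x. indicator (cube z r) x * f x \<partial>lborel) = (\<integral>\<^sup>+y. indicator (cube 0 r) y * f (z + y) \<partial>lborel)" for z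
  proof -
    have "(\<integral>\<^sup>+x. indicator (cube z r) x * f x \<partial>lborel) = (\<integral>\<^sup>+y. indicator (cube z r) (y + z) * f (y + z) \<partial>lborel)"
      by (rule nn_integral_lborel_translate[symmetric]) measurable
    then show ?thesis by (simp add: indicator_def cube_translate add.commute)
  qed
  then have "(\<integral>\<^sup>+z. (\<integral>\<^sup>+x. indicator (cube z r) x * f x \<partial>lborel) \<partial>lborel)
     = (\<integral>\<^sup>+z. (\<integral>\<^sup>+y. indicator (cube 0 r) y * f (z + y) \<partial>lborel) \<partial>lborel)" by simp
  also have "\<dots> = (\<integral>\<^sup>+y. (\<integral>\<^sup>+z. indicator (cube 0 r) y * f (z + y) \<partial>lborel) \<partial>lborel)"
    by (rule lborel_pair.Fubini'[symmetric]) measurable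
  also have "\<dots> = (\<integral>\<^sup>+y. indicator (cube 0 r) (y :: real ^ 'd) * (\<integral>\<^sup>+z. f z \<partial>lborel) \<partial>lborel)"
  proof (rule nn_integral_cong)
    fix y :: "real ^ 'd"
    have "(\<integral>\<^sup>+z. indicator (cube 0 r) y * f (z + y) \<partial>lborel) = indicator (cube 0 r) y * (\<integral>\<^sup>+z. f (z + y) \<partial>lborel)"
      by (rule nn_integral_cmult) measurable
    also have "(\<integral>\<^sup>+z. f (z + y) \<partial>lborel) = (\<integral>\<^sup>+z. f z \<partial>lborel)"
      by (rule nn_integral_lborel_translate) measurable
    finally show "(\<integral>\<^sup>+z. indicator (cube 0 r) y * f (z + y) \<partial>lborel) = indicator (cube 0 r) y * (\<integral>\<^sup>+z. f z \<partial>lborel)" .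
  qed
  also have "\<dots> = ennreal (r ^ CARD('d)) * (\<integral>\<^sup>+x. f x \<partial>lborel)"
    using assms(2) by (subst nn_integral_multc) (auto simp: emeasure_cube)
  finally show ?thesis .
qed

lemma loc_energy_UNIV:
  assumes "H1_pair u g"
  shows "loc_energy UNIV u g = ennreal (ip2 lborel u u + ip2 lborel g g)"
proof -
  have [measurable]: "u \<in> borel_measurable borel" "g \<in> borel_measurable borel" using H1_pair_measurable[OF assms] by auto
  have "loc_energy UNIV u g = (\<integral>\<^sup>+x. ennreal ((norm (u x))\<^sup>2) + ennreal ((norm (g x))\<^sup>2) \<partial>lborel)"
    by (simp add: loc_energy_def)
  also have "\<dots> = (\<integral>\<^sup>+x. ennreal ((norm (u x))\<^sup>2) \<partial>lborel) + (\<integral>\<^sup>+x. ennreal ((norm (g x))\<^sup>2) \<partial>lborel)"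
    by (rule nn_integral_add) measurable
  also have "\<dots> = ennreal (ip2 lborel u u + ip2 lborel g g)"
    using assms unfolding H1_pair_def by (simp add: L2_nn_integral del: real_norm_def)
  finally show ?thesis .
qed

lemma loc_energy_cube_integral:
  fixes u :: "real ^ 'd \<Rightarrow> real"
  assumes d: "CARD('d) = 2" and "H1_pair u g"
  shows "(\<integral>\<^sup>+z. loc_energy (cube z 2) u g \<partial>lborel) = 4 * loc_energy UNIV u g"
proof -
  have [measurable]: "u \<in> borel_measurable borel" "g \<in> borel_measurable borel" using H1_pair_measurable[OF assms(2)] by auto
  show ?thesis
    using nn_integral_cube_average[of "\<lambda>x. ennreal ((u x)\<^sup>2 + (norm (g x))\<^sup>2)" 2] d
    by (simp add: loc_energy_def)
qed

subsection \<open>Compactness\<close>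

lemma midhull_closed:
  assumes "midhull T f" "T \<subseteq> S" "\<And>f g. f \<in> S \<Longrightarrow> g \<in> S \<Longrightarrow> (\<lambda>x. (1/2) *\<^sub>R (f x + g x)) \<in> S"
  shows "f \<in> S"
  using assms by (induction rule: midhull.induct) auto

text \<open>Exactly the stability that keeps strong limits of midpoint combinations inside the
  set.\<close>

definition L2_mid_closed :: "'a measure \<Rightarrow> ('a \<Rightarrow> 'e::euclidean_space) set \<Rightarrow> bool" where
  "L2_mid_closed M S \<longleftrightarrow> (\<forall>f\<in>S. \<forall>g\<in>S. (\<lambda>x. (1/2) *\<^sub>R (f x + g x)) \<in> S) \<and>
    (\<forall>h F. (\<forall>n. h n \<in> S) \<longrightarrow> F \<in> L2 M \<longrightarrow>
      (\<lambda>n::nat. ip2 M (\<lambda>x. h n x - F x) (\<lambda>x. h n x - F x)) \<longlonglongrightarrow> 0 \<longrightarrow> F \<in> S)"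

text \<open>Balls are convex, so pointwise convergence of \<open>P (V n x)\<close> passes to
  midpoint combinations of the tails, and this identifies the projection of their strong limit.
  \<open>P\<close> selects the coordinates in which pointwise convergence is known: later the
  functions, not their gradients.\<close>

lemma L2_Mazur_limit:
  fixes V :: "nat \<Rightarrow> 'a \<Rightarrow> 'e::euclidean_space" and P :: "'e \<Rightarrow> 'f::euclidean_space"
  assumes SL: "S \<subseteq> L2 M" and V: "\<And>n. V n \<in> S"
    and C: "L2_mid_closed M S"
    and P: "bounded_linear P"
    and bdd: "\<And>n. ip2 M (V n) (V n) \<le> B"
    and lim: "AE x in M. (\<lambda>n. P (V n x)) \<longlonglongrightarrow> v x"
  obtains h F where "\<And>n. midhull (V ` {n..}) (h n)" "F \<in> S" "AE x in M. P (F x) = v x"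
    "(\<lambda>n. ip2 M (\<lambda>x. h n x - F x) (\<lambda>x. h n x - F x)) \<longlonglongrightarrow> 0"
proof -
  have VL: "V n \<in> L2 M" for n using V SL by blast
  obtain h r F where h: "\<And>n. midhull (V ` {n..}) (h n)" and r: "strict_mono (r :: nat \<Rightarrow> nat)" and F: "F \<in> L2 M"
    "AE x in M. (\<lambda>n. h (r n) x) \<longlonglongrightarrow> F x"
    "(\<lambda>n. ip2 M (\<lambda>x. h n x - F x) (\<lambda>x. h n x - F x)) \<longlonglongrightarrow> 0"
    by (rule L2_midhull_convergent[of V M B, OF VL bdd]) (rule that)
  have hS: "h n \<in> S" for n by (rule midhull_closed[OF h]) (use V C in \<open>auto simp: L2_mid_closed_def\<close>)
  have FS: "F \<in> S" using C hS F(1,3) unfolding L2_mid_closed_def by blast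
  interpret bounded_linear P by (rule P)
  have "AE x in M. P (F x) = v x"
    using lim F(2)
  proof eventually_elim
    case (elim x)
    have "(\<lambda>n. P (h n x)) \<longlonglongrightarrow> v x"
    proof (rule tendstoI)
      fix e :: real assume "e > 0"
      then obtain N where N: "\<And>n. n \<ge> N \<Longrightarrow> dist (P (V n x)) (v x) < e"
        using elim(1) unfolding lim_sequentially by blast
      have "P (h n x) \<in> ball (v x) e" if "n \<ge> N" for n
      proof -
        have "P (f x) \<in> ball (v x) e" if "f \<in> V ` {n..}" for f
          using that N \<open>n \<ge> N\<close> by (auto simp: dist_commute)
        then show ?thesis
          using midhull_convex[OF h[of n], of "ball (v x) e" "\<lambda>f. P (f x)" UNIV] by (simp add: scaleR add)
      qed
      then show "\<forall>\<^sub>F n in sequentially. dist (P (h n x)) (v x) < e"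
        by (auto simp: eventually_sequentially dist_commute)
    qed
    then have "(\<lambda>n. P (h (r n) x)) \<longlonglongrightarrow> v x"
      using LIMSEQ_subseq_LIMSEQ[OF _ r, of "\<lambda>n. P (h n x)"] by (simp add: o_def)
    moreover have "(\<lambda>n. P (h (r n) x)) \<longlonglongrightarrow> P (F x)" by (rule tendsto[OF elim(2)])
    ultimately show ?case using LIMSEQ_unique by blast
  qed
  then show ?thesis using that[OF h FS _ F(3)] by blast
qed

text \<open>Inner products with the Mazur limit \<open>F\<close> converge along a subsequence. A
  second Mazur limit taken along it equals \<open>F\<close> almost everywhere, since
  \<open>P\<close> is injective on \<open>S\<close> in that sense, and evaluates the limit as
  \<open>ip2 M F F\<close>. Testing with \<open>F\<close> is what the expansion of the squared
  distance to \<open>F\<close> calls for.\<close>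

lemma L2_weak_limit:
  fixes V :: "nat \<Rightarrow> 'a \<Rightarrow> 'e::euclidean_space" and P :: "'e \<Rightarrow> 'f::euclidean_space"
  assumes SL: "S \<subseteq> L2 M" and V: "\<And>n. V n \<in> S"
    and C: "L2_mid_closed M S"
    and P: "bounded_linear P"
    and inj: "\<forall>F\<in>S. \<forall>G\<in>S. (AE x in M. P (F x) = P (G x)) \<longrightarrow> (AE x in M. F x = G x)"
    and bdd: "\<And>n. ip2 M (V n) (V n) \<le> B"
    and lim: "AE x in M. (\<lambda>n. P (V n x)) \<longlonglongrightarrow> v x"
  obtains F s where "strict_mono (s :: nat \<Rightarrow> nat)" "F \<in> S" "AE x in M. P (F x) = v x"
    "(\<lambda>n. ip2 M (V (s n)) F) \<longlonglongrightarrow> ip2 M F F"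
proof -
  have VL: "V n \<in> L2 M" for n using V SL by blast
  obtain h0 F where "\<And>n. midhull (V ` {n..}) (h0 n)" and F: "F \<in> S" "AE x in M. P (F x) = v x"
    and "(\<lambda>n. ip2 M (\<lambda>x. h0 n x - F x) (\<lambda>x. h0 n x - F x)) \<longlonglongrightarrow> 0"
    by (rule L2_Mazur_limit[of S M V P B v, OF SL V C P bdd lim]) (rule that)
  have FL: "F \<in> L2 M" using F SL by blast
  have "\<bar>ip2 M (V n) F\<bar> \<le> sqrt (B * ip2 M F F)" for n
  proof (rule real_le_rsqrt)
    have "(ip2 M (V n) F)\<^sup>2 \<le> ip2 M (V n) (V n) * ip2 M F F" by (rule ip2_Cauchy_Schwarz[OF VL FL])
    also have "\<dots> \<le> B * ip2 M F F" by (intro mult_right_mono bdd) simp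
    finally show "\<bar>ip2 M (V n) F\<bar>\<^sup>2 \<le> B * ip2 M F F" by simp
  qed
  then have "bounded (range (\<lambda>n. ip2 M (V n) F))" by (auto simp: bounded_iff)
  then obtain c s where s: "strict_mono (s :: nat \<Rightarrow> nat)" and c: "(\<lambda>n. ip2 M (V (s n)) F) \<longlonglongrightarrow> c"
    using bounded_imp_convergent_subsequence[of "\<lambda>n. ip2 M (V n) F"] by (auto simp: o_def)
  have lim': "AE x in M. (\<lambda>n. P (V (s n) x)) \<longlonglongrightarrow> v x"
    using lim
  proof eventually_elim
    case (elim x)
    then show ?case using LIMSEQ_subseq_LIMSEQ[OF _ s, of "\<lambda>n. P (V n x)"] by (simp add: o_def)
  qed
  obtain h G where h: "\<And>n. midhull ((\<lambda>n. V (s n)) ` {n..}) (h n)" and G: "G \<in> S" "AE x in M. P (G x) = v x"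
    and hG: "(\<lambda>n. ip2 M (\<lambda>x. h n x - G x) (\<lambda>x. h n x - G x)) \<longlonglongrightarrow> 0"
    by (rule L2_Mazur_limit[of S M "\<lambda>n. V (s n)" P B v, OF SL V C P bdd lim']) (rule that)
  have GL: "G \<in> L2 M" using G SL by blast
  have "AE x in M. F x = G x"
  proof -
    have "AE x in M. P (F x) = P (G x)" using F(2) G(2) by eventually_elim simp
    then show ?thesis using inj F(1) G(1) by blast
  qed
  then have eq: "ip2 M G F = ip2 M F F"
    unfolding ip2_def using FL GL by (intro integral_cong_AE borel_measurable_inner L2_measurable) auto
  have hL: "h n \<in> L2 M" for n by (rule midhull_L2[OF h]) (use VL in auto)
  have 1: "(\<lambda>n. ip2 M (h n) F) \<longlonglongrightarrow> ip2 M F F"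
    using ip2_tendsto[OF hL GL FL hG] eq by simp
  have 2: "(\<lambda>n. ip2 M (h n) F) \<longlonglongrightarrow> c"
  proof (rule tendstoI)
    fix e :: real assume "e > 0"
    then obtain N where N: "\<And>n. n \<ge> N \<Longrightarrow> dist (ip2 M (V (s n)) F) c < e"
      using c unfolding lim_sequentially by blast
    have "ip2 M (h n) F \<in> ball c e" if "n \<ge> N" for n
    proof -
      have "h n \<in> L2 M \<and> ip2 M (h n) F \<in> ball c e"
      proof (rule midhull_convex[OF h[of n]])
        show "ip2 M f F \<in> ball c e" if "f \<in> (\<lambda>n. V (s n)) ` {n..}" for f
          using that N \<open>n \<ge> N\<close> by (auto simp: dist_commute)
        show "(\<lambda>x. (1/2) *\<^sub>R (f x + g x)) \<in> L2 M" if "f \<in> L2 M" "g \<in> L2 M" for f g :: "'a \<Rightarrow> 'e"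
          using that by (intro L2_scaleR L2_add)
        show "ip2 M (\<lambda>x. (1/2) *\<^sub>R (f x + g x)) F = (1/2) *\<^sub>R (ip2 M f F + ip2 M g F)" if "f \<in> L2 M" "g \<in> L2 M" for f g
          unfolding ip2_scaleR_left ip2_add_left[OF that FL] by simp
      qed (use VL in auto)
      then show ?thesis by blast
    qed
    then show "\<forall>\<^sub>F n in sequentially. dist (ip2 M (h n) F) c < e"
      by (auto simp: eventually_sequentially dist_commute)
  qed
  have "c = ip2 M F F" using LIMSEQ_unique[OF 2 1] .
  then show ?thesis using that[OF s F] c by blast
qed

lemma borel_measurable_vec_lambda:
  fixes f :: "'n::finite \<Rightarrow> 'a \<Rightarrow> 'e::euclidean_space"
  assumes "\<And>i. f i \<in> borel_measurable M"
  shows "(\<lambda>x. \<chi> i. f i x) \<in> borel_measurable M"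
proof (rule borel_measurable_euclidean_space[THEN iffD2], rule ballI)
  fix b :: "'e ^ 'n" assume "b \<in> Basis"
  then obtain i c where "b = axis i c" by (auto simp: Basis_vec_def)
  then show "(\<lambda>x. (\<chi> i. f i x) \<bullet> b) \<in> borel_measurable M"
    using assms[of i] by (simp add: inner_axis)
qed

text \<open>A finite weight turns bounded pointwise convergence on the whole space into convergence
  of integrals. Being positive everywhere it loses no points, and being at most 1 it lets plain
  \<open>L2\<close> bounds control weighted ones.\<close>

lemma integrable_weight:
  obtains w :: "'a::euclidean_space \<Rightarrow> real" where "w \<in> borel_measurable borel" "\<And>x. 0 < w x" "\<And>x. w x \<le> 1"
    "(\<integral>\<^sup>+x. ennreal (w x) \<partial>lborel) < \<infinity>"
proof -
  obtain h :: "'a \<Rightarrow> ennreal" where h: "h \<in> borel_measurable lborel" "integral\<^sup>N lborel h \<noteq> \<infinity>" "\<And>x. 0 < h x" "\<And>x. h x < \<infinity>"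
    using sigma_finite_measure.Ex_finite_integrable_function[OF sigma_finite_lborel] by auto
  have [measurable]: "h \<in> borel_measurable borel" using h(1) by simp
  show ?thesis
  proof (rule that[of "\<lambda>x. min 1 (enn2real (h x))"])
    show "0 < min 1 (enn2real (h x))" for x using h(3,4)[of x] by (simp add: enn2real_positive_iff)
    have "(\<integral>\<^sup>+x. ennreal (min 1 (enn2real (h x))) \<partial>lborel) \<le> integral\<^sup>N lborel h"
    proof (rule nn_integral_mono)
      fix x
      have "ennreal (min 1 (enn2real (h x))) \<le> ennreal (enn2real (h x))" by (intro ennreal_leI) simp
      also have "\<dots> = h x" using h(4)[of x] by simp
      finally show "ennreal (min 1 (enn2real (h x))) \<le> h x" .
    qed
    also have "\<dots> < \<infinity>" using h(2) by (simp add: less_top)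
    finally show "(\<integral>\<^sup>+x. ennreal (min 1 (enn2real (h x))) \<partial>lborel) < \<infinity>" .
  qed auto
qed

text \<open>The local bounds with the whole space as the set: averages at a fixed scale are
  equicontinuous and bounded along any sequence of bounded energy.\<close>

lemma avg_lipschitz:
  fixes u :: "real ^ 'd \<Rightarrow> real"
  assumes d: "CARD('d) = 2" and ug: "H1_pair u g" and e: "ip2 lborel u u + ip2 lborel g g \<le> B\<^sup>2" and B: "B \<ge> 0" and r: "r > 0"
  shows "\<bar>avg r u x - avg r u y\<bar> \<le> norm (x - y) / r * B" "\<bar>avg r u x\<bar> \<le> B / r"
proof -
  have E: "loc_energy UNIV u g \<le> ennreal (B\<^sup>2)"
    unfolding loc_energy_UNIV[OF ug] using e by (rule ennreal_leI)
  have "ennreal ((avg r u (y + (x - y)) - avg r u y)\<^sup>2) \<le> ennreal ((norm (x - y))\<^sup>2 / r\<^sup>2) * loc_energy UNIV u g"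
    by (rule avg_shift_le[OF d ug r]) auto
  from ennreal_sq_le[OF this E, of "norm (x - y) / r * B"] r B
  show "\<bar>avg r u x - avg r u y\<bar> \<le> norm (x - y) / r * B"
    by (simp add: power_mult_distrib power_divide)
  have "ennreal ((avg r u x)\<^sup>2) \<le> ennreal (1 / r\<^sup>2) * loc_energy UNIV u g"
    by (rule avg_sq_le[OF d ug r]) simp
  from ennreal_sq_le[OF this E, of "B / r"] r B show "\<bar>avg r u x\<bar> \<le> B / r"
    by (simp add: power_divide)
qed

text \<open>An Arzela--Ascoli argument: a diagonal sequence converges for all components, all dyadic
  scales and a countable dense set of points, and the Lipschitz bound extends convergence to every
  point.\<close>

lemma avg_subsequence:
  fixes u :: "nat \<Rightarrow> 'k::finite \<Rightarrow> real ^ 'd \<Rightarrow> real"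
  assumes d: "CARD('d) = 2" and ug: "\<And>n i. H1_pair (u n i) (g n i)"
    and e: "\<And>n i. ip2 lborel (u n i) (u n i) + ip2 lborel (g n i) (g n i) \<le> B\<^sup>2" and B: "B \<ge> 0"
  obtains s where "strict_mono (s :: nat \<Rightarrow> nat)" "\<And>i k x. convergent (\<lambda>n. avg ((1/2) ^ k) (u (s n) i) x)"
proof -
  obtain D :: "(real ^ 'd) set" where D: "countable D" "\<And>X. open X \<Longrightarrow> X \<noteq> {} \<Longrightarrow> \<exists>d\<in>D. d \<in> X"
    using countable_dense_exists[where 'a = "real ^ 'd"] by auto
  \<comment> \<open>Averages at side \<open>r\<close> are only bounded by \<open>B / r\<close>; the
    prefactor provides one bound for all scales, as the diagonal principle requires.\<close>
  let ?f = "\<lambda>n (i, k, x). (1/2) ^ k * avg ((1/2) ^ k) (u n i) x"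
  have "countable ((UNIV :: 'k set) \<times> (UNIV :: nat set) \<times> D)"
    using D(1) by (intro countable_SIGMA) (auto simp: countable_finite)
  moreover have "norm (?f n p) \<le> B" for n p
  proof -
    obtain i k x where p: "p = (i, k, x)" by (cases p)
    show ?thesis using avg_lipschitz(2)[OF d ug e B, of "(1/2) ^ k" n i x]
      unfolding p by (simp add: abs_mult field_simps)
  qed
  ultimately obtain s where s: "strict_mono (s :: nat \<Rightarrow> nat)"
    and conv: "\<And>p. p \<in> UNIV \<times> UNIV \<times> D \<Longrightarrow> \<exists>l. (\<lambda>n. ?f (s n) p) \<longlonglongrightarrow> l"
    using function_convergent_subsequence[of "UNIV \<times> UNIV \<times> D" ?f B] by blast
  have "convergent (\<lambda>n. avg ((1/2) ^ k) (u (s n) i) x)" for i k x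
  proof -
    define r :: real where "r = (1/2) ^ k"
    have r: "r > 0" by (simp add: r_def)
    have "Cauchy (\<lambda>n. avg r (u (s n) i) x)"
    proof (rule metric_CauchyI)
      fix e :: real assume "e > 0"
      \<comment> \<open>A shift shorter than this changes every average by less than a third of
        \<open>e\<close>; \<open>B + 1\<close> keeps the denominator positive when
        \<open>B = 0\<close>.\<close>
      define \<delta> where "\<delta> = e * r / (3 * (B + 1))"
      have "\<delta> > 0" using \<open>e > 0\<close> r B by (simp add: \<delta>_def)
      then obtain y where y: "y \<in> D" "y \<in> ball x \<delta>" using D(2)[of "ball x \<delta>"] by auto
      have close: "\<bar>avg r (u n i) x - avg r (u n i) y\<bar> < e / 3" for n
      proof -
        have "\<bar>avg r (u n i) x - avg r (u n i) y\<bar> \<le> norm (x - y) / r * B"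
          by (rule avg_lipschitz(1)[OF d ug e B r])
        also have "\<dots> \<le> norm (x - y) / r * (B + 1)" using r by (intro mult_left_mono) auto
        also have "\<dots> < \<delta> / r * (B + 1)"
          using y(2) r B by (intro mult_strict_right_mono divide_strict_right_mono) (auto simp: dist_norm)
        also have "\<dots> = e / 3" using r B by (simp add: \<delta>_def divide_simps)
        finally show ?thesis .
      qed
      obtain l where "(\<lambda>n. r * avg r (u (s n) i) y) \<longlonglongrightarrow> l"
        using conv[of "(i, k, y)"] y(1) by (auto simp: r_def)
      then have "(\<lambda>n. (r * avg r (u (s n) i) y) / r) \<longlonglongrightarrow> l / r" by (intro tendsto_divide tendsto_const) (use r in auto)
      then have "Cauchy (\<lambda>n. avg r (u (s n) i) y)" using r by (intro LIMSEQ_imp_Cauchy) simp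
      then obtain N where "\<And>m n. m \<ge> N \<Longrightarrow> n \<ge> N \<Longrightarrow> dist (avg r (u (s m) i) y) (avg r (u (s n) i) y) < e / 3"
        using \<open>e > 0\<close> unfolding Cauchy_def by (meson divide_pos_pos zero_less_numeral)
      note N = this
      have "dist (avg r (u (s m) i) x) (avg r (u (s n) i) x) < e" if "m \<ge> N" "n \<ge> N" for m n
        using N[OF that] close[of "s m"] close[of "s n"] unfolding dist_real_def by linarith
      then show "\<exists>N. \<forall>m\<ge>N. \<forall>n\<ge>N. dist (avg r (u (s m) i) x) (avg r (u (s n) i) x) < e" by blast
    qed
    then show ?thesis by (simp add: Cauchy_convergent_iff r_def)
  qed
  then show ?thesis using that s by blast
qed

text \<open>Rellich's theorem: averaging costs \<open>O(h)\<close> in \<open>L\<^sup>2\<close> uniformly along the sequence, and the averages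
  converge pointwise, so the sequence is Cauchy in a weighted \<open>L\<^sup>2\<close> space.\<close>

lemma H1_ae_subsequence:
  fixes u :: "nat \<Rightarrow> 'k::finite \<Rightarrow> real ^ 'd \<Rightarrow> real"
  assumes d: "CARD('d) = 2" and ug: "\<And>n i. H1_pair (u n i) (g n i)"
    and e: "\<And>n i. ip2 lborel (u n i) (u n i) + ip2 lborel (g n i) (g n i) \<le> B\<^sup>2" and B: "B \<ge> 0"
  obtains s v where "strict_mono (s :: nat \<Rightarrow> nat)" "AE x in lborel. \<forall>i. (\<lambda>n. u (s n) i x) \<longlonglongrightarrow> v i x"
proof -
  obtain s where s: "strict_mono (s :: nat \<Rightarrow> nat)" and conv: "\<And>i k x. convergent (\<lambda>n. avg ((1/2) ^ k) (u (s n) i) x)"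
    by (rule avg_subsequence[of u g B, OF d ug e B]) (rule that)
  define A where "A k i x = lim (\<lambda>n. avg ((1/2) ^ k) (u (s n) i) x)" for k i x
  have A: "(\<lambda>n. avg ((1/2) ^ k) (u (s n) i) x) \<longlonglongrightarrow> A k i x" for k i x
    unfolding A_def using conv by (simp add: convergent_LIMSEQ_iff)
  have um [measurable]: "u n i \<in> borel_measurable borel" for n i using H1_pair_measurable[OF ug] by blast
  have am [measurable]: "avg r (u n i) \<in> borel_measurable borel" for r n i by (rule avg_measurable) measurable
  have Am [measurable]: "A k i \<in> borel_measurable borel" for k i
    by (rule borel_measurable_LIMSEQ_metric[OF _ A]) measurable
  obtain w :: "real ^ 'd \<Rightarrow> real" where w [measurable]: "w \<in> borel_measurable borel" and w01: "\<And>x. 0 < w x" "\<And>x. w x \<le> 1"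
    and wfin: "(\<integral>\<^sup>+x. ennreal (w x) \<partial>lborel) < \<infinity>"
    using integrable_weight by blast
  have E: "loc_energy UNIV (u n i) (g n i) \<le> ennreal (B\<^sup>2)" for n i
    unfolding loc_energy_UNIV[OF ug] using e by (rule ennreal_leI)
  \<comment> \<open>At a fixed scale the averages converge pointwise and are bounded by
    \<open>B / r\<close>; the finite weight makes this bound integrable.\<close>
  have avglim: "(\<lambda>n. \<integral>\<^sup>+x. ennreal (w x * (avg ((1/2) ^ k) (u (s n) i) x - A k i x)\<^sup>2) \<partial>lborel) \<longlonglongrightarrow> 0" for k i
  proof -
    define r :: real where "r = (1/2) ^ k"
    have r: "r > 0" by (simp add: r_def)
    have bd: "\<bar>avg r (u n i) x\<bar> \<le> B / r" for n x by (rule avg_lipschitz(2)[OF d ug e B r])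
    have bA: "\<bar>A k i x\<bar> \<le> B / r" for x
      using A[of k i x] bd unfolding r_def by (intro tendsto_upperbound[OF tendsto_rabs]) auto
    have "(\<lambda>n. \<integral>\<^sup>+x. ennreal (w x * (avg r (u (s n) i) x - A k i x)\<^sup>2) \<partial>lborel) \<longlonglongrightarrow> (\<integral>\<^sup>+x. (0::ennreal) \<partial>(lborel :: (real ^ 'd) measure))"
    proof (rule nn_integral_dominated_convergence[where w = "\<lambda>x. ennreal ((2 * B / r)\<^sup>2) * ennreal (w x)"])
      show "AE x in lborel. ennreal (w x * (avg r (u (s n) i) x - A k i x)\<^sup>2) \<le> ennreal ((2 * B / r)\<^sup>2) * ennreal (w x)" for n
      proof (rule AE_I2)
        fix x
        have "\<bar>avg r (u (s n) i) x - A k i x\<bar> \<le> 2 * B / r" using bd[of "s n" x] bA[of x] by simp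
        from power_mono[OF this, of 2] have "(avg r (u (s n) i) x - A k i x)\<^sup>2 \<le> (2 * B / r)\<^sup>2" by simp
        then have "w x * (avg r (u (s n) i) x - A k i x)\<^sup>2 \<le> (2 * B / r)\<^sup>2 * w x"
          using w01(1)[of x] by (simp add: mult.commute)
        from ennreal_leI[OF this] show "ennreal (w x * (avg r (u (s n) i) x - A k i x)\<^sup>2) \<le> ennreal ((2 * B / r)\<^sup>2) * ennreal (w x)"
          by (simp add: ennreal_mult')
      qed
      show "(\<integral>\<^sup>+x. ennreal ((2 * B / r)\<^sup>2) * ennreal (w x) \<partial>lborel) < \<infinity>"
        using wfin by (subst nn_integral_cmult) (auto simp: ennreal_mult_less_top)
      show "AE x in lborel. (\<lambda>n. ennreal (w x * (avg r (u (s n) i) x - A k i x)\<^sup>2)) \<longlonglongrightarrow> 0"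
      proof (rule AE_I2)
        fix x
        have "(\<lambda>n. ennreal (w x * (avg r (u (s n) i) x - A k i x)\<^sup>2)) \<longlonglongrightarrow> ennreal (w x * (A k i x - A k i x)\<^sup>2)"
          unfolding r_def by (intro tendsto_intros A)
        then show "(\<lambda>n. ennreal (w x * (avg r (u (s n) i) x - A k i x)\<^sup>2)) \<longlonglongrightarrow> 0" by simp
      qed
    qed measurable
    then show ?thesis by (simp add: r_def)
  qed
  have cauchy: "\<exists>N. \<forall>m\<ge>N. \<forall>n\<ge>N. (\<integral>\<^sup>+x. ennreal (w x * (u (s m) i x - u (s n) i x)\<^sup>2) \<partial>lborel) \<le> ennreal \<epsilon>" if "\<epsilon> > 0" for \<epsilon> i
  proof -
    have "(\<lambda>k. 2 * ((1/2) ^ k)\<^sup>2 * B\<^sup>2) \<longlonglongrightarrow> 2 * 0\<^sup>2 * B\<^sup>2"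
      by (intro tendsto_intros LIMSEQ_power_zero) simp
    then have "\<forall>\<^sub>F k in sequentially. 2 * ((1/2) ^ k)\<^sup>2 * B\<^sup>2 < \<epsilon> / 16"
      using that by (intro order_tendstoD(2)) auto
    \<comment> \<open>Four terms, each multiplied by 4 in the estimate of a squared sum, have to add
      up to at most \<open>\<epsilon>\<close>; hence the sixteenth.\<close>
    then obtain k where k: "2 * ((1/2) ^ k)\<^sup>2 * B\<^sup>2 < \<epsilon> / 16" by (auto simp: eventually_sequentially)
    have "\<forall>\<^sub>F n in sequentially. (\<integral>\<^sup>+x. ennreal (w x * (avg ((1/2) ^ k) (u (s n) i) x - A k i x)\<^sup>2) \<partial>lborel) < ennreal (\<epsilon> / 16)"
      using that by (intro order_tendstoD(2)[OF avglim]) simp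
    then obtain N where N: "\<And>n. n \<ge> N \<Longrightarrow> (\<integral>\<^sup>+x. ennreal (w x * (avg ((1/2) ^ k) (u (s n) i) x - A k i x)\<^sup>2) \<partial>lborel) < ennreal (\<epsilon> / 16)"
      by (auto simp: eventually_sequentially)
    let ?a = "\<lambda>n x. avg ((1/2) ^ k) (u (s n) i) x"
    \<comment> \<open>Only \<open>?g\<close> carries the weight: the averaging error is small in
      plain \<open>L2\<close>, while the averages are known to converge only against
      \<open>w\<close>.\<close>
    let ?f = "\<lambda>n x. ennreal (4 * (u (s n) i x - ?a n x)\<^sup>2)"
    let ?g = "\<lambda>n x. 4 * ennreal (w x * (?a n x - A k i x)\<^sup>2)"
    have f: "(\<integral>\<^sup>+x. ?f n x \<partial>lborel) \<le> ennreal (\<epsilon> / 4)" for n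
    proof -
      have "(\<integral>\<^sup>+x. ?f n x \<partial>lborel) = 4 * (\<integral>\<^sup>+x. indicator UNIV x * ennreal ((u (s n) i x - ?a n x)\<^sup>2) \<partial>lborel)"
        by (subst nn_integral_cmult[symmetric]) (auto simp: ennreal_mult')
      also have "\<dots> \<le> 4 * (ennreal (2 * ((1/2) ^ k)\<^sup>2) * loc_energy UNIV (u (s n) i) (g (s n) i))"
        by (intro mult_left_mono avg_approx[OF d ug]) auto
      also have "\<dots> \<le> 4 * (ennreal (2 * ((1/2) ^ k)\<^sup>2) * ennreal (B\<^sup>2))"
        by (intro mult_left_mono E) auto
      also have "\<dots> = ennreal (4 * (2 * ((1/2) ^ k)\<^sup>2 * B\<^sup>2))"
        by (subst ennreal_numeral[symmetric]) (simp only: ennreal_mult'[symmetric] zero_le_power2 zero_le_numeral mult_nonneg_nonneg)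
      also have "\<dots> \<le> ennreal (\<epsilon> / 4)" using k by (intro ennreal_leI) simp
      finally show ?thesis .
    qed
    have g: "(\<integral>\<^sup>+x. ?g n x \<partial>lborel) \<le> ennreal (\<epsilon> / 4)" if "n \<ge> N" for n
    proof -
      have "(\<integral>\<^sup>+x. ?g n x \<partial>lborel) = 4 * (\<integral>\<^sup>+x. ennreal (w x * (?a n x - A k i x)\<^sup>2) \<partial>lborel)"
        by (rule nn_integral_cmult) measurable
      also have "\<dots> \<le> 4 * ennreal (\<epsilon> / 16)" using N[OF that] by (intro mult_left_mono) auto
      also have "\<dots> = ennreal (\<epsilon> / 4)" using \<open>\<epsilon> > 0\<close> by (subst ennreal_numeral[symmetric], subst ennreal_mult'[symmetric]) auto
      finally show ?thesis .
    qed
    have "(\<integral>\<^sup>+x. ennreal (w x * (u (s m) i x - u (s n) i x)\<^sup>2) \<partial>lborel) \<le> ennreal \<epsilon>" if mn: "m \<ge> N" "n \<ge> N" for m n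
    proof -
      have pt: "ennreal (w x * (u (s m) i x - u (s n) i x)\<^sup>2) \<le> (?f m x + ?g m x) + (?f n x + ?g n x)" for x
      proof -
        have sq: "(a + b + c + d)\<^sup>2 \<le> 4 * (a\<^sup>2 + b\<^sup>2 + c\<^sup>2 + d\<^sup>2)" for a b c d :: real
        proof -
          have "0 \<le> (a - b)\<^sup>2 + (a - c)\<^sup>2 + (a - d)\<^sup>2 + (b - c)\<^sup>2 + (b - d)\<^sup>2 + (c - d)\<^sup>2" by simp
          then show ?thesis by (simp add: power2_eq_square algebra_simps)
        qed
        let ?p = "u (s m) i x - ?a m x" and ?q = "?a m x - A k i x" and ?p' = "u (s n) i x - ?a n x" and ?q' = "?a n x - A k i x"
        have "(u (s m) i x - u (s n) i x)\<^sup>2 = (?p + ?q + (- ?q') + (- ?p'))\<^sup>2" by simp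
        also have "\<dots> \<le> 4 * (?p\<^sup>2 + ?q\<^sup>2 + ?q'\<^sup>2 + ?p'\<^sup>2)" using sq[of ?p ?q "- ?q'" "- ?p'"] unfolding power2_minus .
        finally have "w x * (u (s m) i x - u (s n) i x)\<^sup>2 \<le> w x * (4 * (?p\<^sup>2 + ?q\<^sup>2 + ?q'\<^sup>2 + ?p'\<^sup>2))"
          by (rule mult_left_mono) (use w01(1)[of x] in simp)
        also have "\<dots> = (w x * (4 * ?p\<^sup>2) + 4 * (w x * ?q\<^sup>2)) + (w x * (4 * ?p'\<^sup>2) + 4 * (w x * ?q'\<^sup>2))"
          by (simp add: algebra_simps)
        also have "\<dots> \<le> (4 * ?p\<^sup>2 + 4 * (w x * ?q\<^sup>2)) + (4 * ?p'\<^sup>2 + 4 * (w x * ?q'\<^sup>2))"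
          using w01[of x] by (intro add_mono mult_left_le_one_le) (auto intro: less_imp_le)
        finally have "ennreal (w x * (u (s m) i x - u (s n) i x)\<^sup>2) \<le> ennreal ((4 * ?p\<^sup>2 + 4 * (w x * ?q\<^sup>2)) + (4 * ?p'\<^sup>2 + 4 * (w x * ?q'\<^sup>2)))"
          by (rule ennreal_leI)
        then show ?thesis using less_imp_le[OF w01(1)[of x]] by (simp add: ennreal_mult')
      qed
      have "(\<integral>\<^sup>+x. ennreal (w x * (u (s m) i x - u (s n) i x)\<^sup>2) \<partial>lborel) \<le> (\<integral>\<^sup>+x. (?f m x + ?g m x) + (?f n x + ?g n x) \<partial>lborel)"
        by (rule nn_integral_mono) (rule pt)
      also have "\<dots> = (\<integral>\<^sup>+x. ?f m x \<partial>lborel) + (\<integral>\<^sup>+x. ?g m x \<partial>lborel) + ((\<integral>\<^sup>+x. ?f n x \<partial>lborel) + (\<integral>\<^sup>+x. ?g n x \<partial>lborel))"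
        by (subst nn_integral_add, measurable)+
      also have "\<dots> \<le> ennreal (\<epsilon> / 4) + ennreal (\<epsilon> / 4) + (ennreal (\<epsilon> / 4) + ennreal (\<epsilon> / 4))"
        by (intro add_mono f g mn)
      also have "\<dots> = ennreal \<epsilon>" using \<open>\<epsilon> > 0\<close> by (simp flip: ennreal_plus)
      finally show ?thesis .
    qed
    then show ?thesis by blast
  qed
  \<comment> \<open>The square root moves the weight into the function, and stacking the components
    lets \<open>L2_complete\<close> choose one subsequence for all of them.\<close>
  define G where "G n x = (\<chi> i. sqrt (w x) * u (s n) i x)" for n x
  have gi: "(norm (G m x - G n x))\<^sup>2 = (\<Sum>i\<in>UNIV. w x * (u (s m) i x - u (s n) i x)\<^sup>2)" for m n x
    unfolding power2_norm_eq_inner inner_vec_def G_def using less_imp_le[OF w01(1)[of x]]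
    by (simp add: right_diff_distrib[symmetric] power2_eq_square mult_ac) (simp add: mult.assoc[symmetric])
  have gn: "(norm (G n x))\<^sup>2 = (\<Sum>i\<in>UNIV. w x * (u (s n) i x)\<^sup>2)" for n x
    unfolding power2_norm_eq_inner inner_vec_def G_def using less_imp_le[OF w01(1)[of x]]
    by (simp add: power2_eq_square mult_ac) (simp add: mult.assoc[symmetric])
  have Gm [measurable]: "G n \<in> borel_measurable borel" for n
    unfolding G_def[abs_def] by (rule borel_measurable_vec_lambda) measurable
  have GL: "G n \<in> L2 lborel" for n
  proof -
    have "integrable lborel (\<lambda>x. w x * (u (s n) i x)\<^sup>2)" for i
    proof (rule Bochner_Integration.integrable_bound)
      show "integrable lborel (\<lambda>x. (norm (u (s n) i x))\<^sup>2)" using ug[of "s n" i] by (simp add: H1_pair_def L2_def)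
      show "AE x in lborel. norm (w x * (u (s n) i x)\<^sup>2) \<le> norm ((norm (u (s n) i x))\<^sup>2)"
        using mult_left_le_one_le[OF zero_le_power2 less_imp_le[OF w01(1)] w01(2)] less_imp_le[OF w01(1)]
        by (intro AE_I2) (simp add: abs_mult)
    qed measurable
    then show ?thesis by (simp add: L2_def gn)
  qed
  obtain r F where r: "strict_mono (r :: nat \<Rightarrow> nat)" and F: "AE x in lborel. (\<lambda>n. G (r n) x) \<longlonglongrightarrow> F x"
  proof (rule L2_complete[OF GL])
    fix \<epsilon> :: real assume "\<epsilon> > 0"
    define \<delta> where "\<delta> = \<epsilon> / (2 * real CARD('k))"
    have \<delta>: "\<delta> > 0" using \<open>\<epsilon> > 0\<close> by (simp add: \<delta>_def)
    obtain N where N: "\<And>i m n. m \<ge> N i \<Longrightarrow> n \<ge> N i \<Longrightarrow> (\<integral>\<^sup>+x. ennreal (w x * (u (s m) i x - u (s n) i x)\<^sup>2) \<partial>lborel) \<le> ennreal \<delta>"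
    proof -
      have "\<forall>i. \<exists>N. \<forall>m\<ge>N. \<forall>n\<ge>N. (\<integral>\<^sup>+x. ennreal (w x * (u (s m) i x - u (s n) i x)\<^sup>2) \<partial>lborel) \<le> ennreal \<delta>"
        using cauchy[OF \<delta>] by (rule allI)
      from choice[OF this] show ?thesis using that by blast
    qed
    have "ip2 lborel (\<lambda>x. G m x - G n x) (\<lambda>x. G m x - G n x) < \<epsilon>" if "m \<ge> Max (range N)" "n \<ge> Max (range N)" for m n
    proof -
      have "N i \<le> m \<and> N i \<le> n" for i using that Max_ge[of "range N" "N i"] by simp
      then have N': "N i \<le> m" "N i \<le> n" for i by auto
      have "(\<integral>\<^sup>+x. ennreal ((norm (G m x - G n x))\<^sup>2) \<partial>lborel)
        = (\<integral>\<^sup>+x. (\<Sum>i\<in>UNIV. ennreal (w x * (u (s m) i x - u (s n) i x)\<^sup>2)) \<partial>lborel)"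
        unfolding gi using less_imp_le[OF w01(1)] by (intro nn_integral_cong) simp
      also have "\<dots> = (\<Sum>i\<in>UNIV. \<integral>\<^sup>+x. ennreal (w x * (u (s m) i x - u (s n) i x)\<^sup>2) \<partial>lborel)"
        by (rule nn_integral_sum) measurable
      also have "\<dots> \<le> (\<Sum>i\<in>(UNIV :: 'k set). ennreal \<delta>)" by (intro sum_mono N N')
      also have "\<dots> = ennreal (\<epsilon> / 2)" using \<delta> by (simp add: \<delta>_def ennreal_of_nat_eq_real_of_nat ennreal_mult'[symmetric])
      finally have "ip2 lborel (\<lambda>x. G m x - G n x) (\<lambda>x. G m x - G n x) \<le> \<epsilon> / 2"
        using \<open>\<epsilon> > 0\<close> by (intro L2_I_nn(2)) auto
      then show ?thesis using \<open>\<epsilon> > 0\<close> by simp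
    qed
    then show "\<exists>N. \<forall>m\<ge>N. \<forall>n\<ge>N. ip2 lborel (\<lambda>x. G m x - G n x) (\<lambda>x. G m x - G n x) < \<epsilon>" by blast
  qed blast
  have "AE x in lborel. \<forall>i. (\<lambda>n. u ((s \<circ> r) n) i x) \<longlonglongrightarrow> F x $ i / sqrt (w x)"
    using F
  proof eventually_elim
    case (elim x)
    show ?case
    proof
      fix i
      have "(\<lambda>n. G (r n) x $ i / sqrt (w x)) \<longlonglongrightarrow> F x $ i / sqrt (w x)"
        using w01(1)[of x] by (intro tendsto_intros elim) simp
      then show "(\<lambda>n. u ((s \<circ> r) n) i x) \<longlonglongrightarrow> F x $ i / sqrt (w x)"
        using w01(1)[of x] by (simp add: G_def)
    qed
  qed
  then show ?thesis using that[OF strict_mono_o[OF s r], of "\<lambda>i x. F x $ i / sqrt (w x)"] by blast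
qed

subsection \<open>The Brezis--Lieb lemma\<close>

text \<open>Homogeneity reduces the bound to the unit sphere, where compactness applies; scaling by
  2 forces \<open>F 0 = 0\<close>.\<close>

lemma homogeneous_bound:
  fixes F :: "'e::euclidean_space \<Rightarrow> real"
  assumes cont: "continuous_on UNIV F" and hom: "\<And>t y. t > 0 \<Longrightarrow> F (t *\<^sub>R y) = t powr p * F y" and p: "p > 0"
  shows "F 0 = 0" and "\<exists>M\<ge>0. \<forall>y. \<bar>F y\<bar> \<le> M * norm y powr p"
proof -
  have "F 0 = 2 powr p * F 0" using hom[of 2 0] by simp
  moreover have "2 powr p \<noteq> (1 :: real)" using p by (simp add: powr_eq_one_iff)
  ultimately show F0: "F 0 = 0" by simp
  have "compact (F ` sphere 0 1)" by (intro compact_continuous_image continuous_on_subset[OF cont]) auto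
  then obtain M where M: "M > 0" "\<forall>y\<in>F ` sphere 0 1. norm y \<le> M" using compact_imp_bounded bounded_pos by metis
  have "\<bar>F y\<bar> \<le> M * norm y powr p" for y
  proof (cases "y = 0")
    case False
    have "F y = F (norm y *\<^sub>R (y /\<^sub>R norm y))" using False by simp
    also have "\<dots> = norm y powr p * F (y /\<^sub>R norm y)" using False by (intro hom) simp
    also have "\<bar>\<dots>\<bar> \<le> norm y powr p * M"
      using M(2) False unfolding abs_mult by (intro mult_mono) auto
    finally show ?thesis by (simp add: mult.commute)
  qed (simp add: F0)
  then show "\<exists>M\<ge>0. \<forall>y. \<bar>F y\<bar> \<le> M * norm y powr p" using M(1) by (intro exI[of _ M]) auto
qed

text \<open>If \<open>b\<close> is small relative to \<open>a\<close>, division by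
  \<open>norm a\<close> reduces the claim to uniform continuity of \<open>F\<close> on a ball.
  Otherwise \<open>norm b\<close> controls both \<open>norm a\<close> and
  \<open>norm (a + b)\<close>.\<close>

lemma homogeneous_diff_bound:
  fixes F :: "'e::euclidean_space \<Rightarrow> real"
  assumes cont: "continuous_on UNIV F" and hom: "\<And>t y. t > 0 \<Longrightarrow> F (t *\<^sub>R y) = t powr p * F y" and p: "p > 0"
    and \<epsilon>: "\<epsilon> > 0"
  shows "\<exists>C\<ge>0. \<forall>a b. \<bar>F (a + b) - F a\<bar> \<le> \<epsilon> * norm a powr p + C * norm b powr p"
proof -
  obtain M where M: "M \<ge> 0" "\<And>y. \<bar>F y\<bar> \<le> M * norm y powr p" using homogeneous_bound(2)[of F p, OF cont hom p] by blast
  \<comment> \<open>Radius 2 suffices: after scaling one point has norm 1, and the other is closer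
    to it than \<open>\<delta> \<le> 1\<close>.\<close>
  have "uniformly_continuous_on (cball 0 2) F"
    by (intro compact_uniformly_continuous continuous_on_subset[OF cont]) auto
  then obtain \<delta>0 where \<delta>0: "\<delta>0 > 0" "\<And>x y. x \<in> cball 0 2 \<Longrightarrow> y \<in> cball 0 2 \<Longrightarrow> dist y x < \<delta>0 \<Longrightarrow> dist (F y) (F x) < \<epsilon>"
    using \<epsilon> unfolding uniformly_continuous_on_def by metis
  define \<delta> where "\<delta> = min \<delta>0 1"
  have \<delta>: "\<delta> > 0" "\<delta> \<le> 1" "\<delta> \<le> \<delta>0" using \<delta>0(1) by (auto simp: \<delta>_def)
  define C where "C = M * ((1 / \<delta> + 1) powr p + (1 / \<delta>) powr p)"
  have "\<bar>F (a + b) - F a\<bar> \<le> \<epsilon> * norm a powr p + C * norm b powr p" for a b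
  proof (cases "norm b < \<delta> * norm a")
    case True
    then have a: "norm a > 0" using \<delta> by (metis mult_zero_right norm_ge_zero not_less zero_less_norm_iff norm_zero)
    define x where "x = a /\<^sub>R norm a"
    define y where "y = (a + b) /\<^sub>R norm a"
    have "norm (y - x) < \<delta>"
      using True a by (simp add: x_def y_def scaleR_add_right divide_inverse[symmetric] divide_less_eq mult.commute)
    moreover have "norm x = 1" using a by (simp add: x_def)
    moreover have "norm y \<le> norm x + norm (y - x)" by (metis add.commute diff_add_cancel norm_triangle_ineq)
    ultimately have "dist (F y) (F x) < \<epsilon>" using \<delta> by (intro \<delta>0(2)) (auto simp: dist_norm)
    moreover have "F a = norm a powr p * F x" "F (a + b) = norm a powr p * F y"
      using hom[of "norm a" x] hom[of "norm a" y] a by (simp_all add: x_def y_def)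
    ultimately have "\<bar>F (a + b) - F a\<bar> \<le> norm a powr p * \<epsilon>"
      by (simp add: dist_real_def right_diff_distrib[symmetric] abs_mult mult_left_mono)
    then show ?thesis using M(1) by (simp add: C_def mult.commute add_increasing2)
  next
    case False
    then have ab: "norm a \<le> 1 / \<delta> * norm b" using \<delta> by (simp add: field_simps)
    have "norm (a + b) \<le> (1 / \<delta> + 1) * norm b" using ab norm_triangle_ineq[of a b] by (simp add: algebra_simps)
    then have "norm (a + b) powr p \<le> ((1 / \<delta> + 1) * norm b) powr p" using p by (intro powr_mono2) auto
    also have "\<dots> = (1 / \<delta> + 1) powr p * norm b powr p" by (rule powr_mult)
    finally have 1: "norm (a + b) powr p \<le> (1 / \<delta> + 1) powr p * norm b powr p" .
    have "norm a powr p \<le> (1 / \<delta> * norm b) powr p" using p ab by (intro powr_mono2) auto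
    also have "\<dots> = (1 / \<delta>) powr p * norm b powr p" by (rule powr_mult)
    finally have 2: "norm a powr p \<le> (1 / \<delta>) powr p * norm b powr p" .
    have "\<bar>F (a + b) - F a\<bar> \<le> M * norm (a + b) powr p + M * norm a powr p"
      using M(2)[of "a + b"] M(2)[of a] by linarith
    also have "\<dots> \<le> M * ((1 / \<delta> + 1) powr p * norm b powr p) + M * ((1 / \<delta>) powr p * norm b powr p)"
      by (intro add_mono mult_left_mono 1 2 M)
    also have "\<dots> = C * norm b powr p" by (simp add: C_def algebra_simps)
    also have "\<dots> \<le> \<epsilon> * norm a powr p + C * norm b powr p" using \<epsilon> by simp
    finally show ?thesis .
  qed
  moreover have "C \<ge> 0" using M(1) by (simp add: C_def)
  ultimately show ?thesis by blast
qed

lemma powr_add_le: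
  fixes a b :: real
  assumes "a \<ge> 0" "b \<ge> 0" "p > 0"
  shows "(a + b) powr p \<le> 2 powr p * (a powr p + b powr p)"
proof -
  have "(a + b) powr p \<le> (2 * max a b) powr p" using assms by (intro powr_mono2) auto
  also have "\<dots> = 2 powr p * max a b powr p" using assms by (simp add: powr_mult)
  also have "max a b powr p \<le> a powr p + b powr p" by (auto simp: max_def)
  finally show ?thesis by (simp add: mult_left_mono)
qed

text \<open>The defect \<open>h n x\<close> exceeds
  \<open>\<epsilon> * norm (U n x - u x) powr p\<close> by at most a multiple of
  \<open>norm (u x) powr p\<close>. Dominated convergence removes this excess, and what remains is
  \<open>\<epsilon>\<close> times a bounded integral.\<close>

lemma Brezis_Lieb:
  fixes F :: "'e::euclidean_space \<Rightarrow> real" and U :: "nat \<Rightarrow> 'a \<Rightarrow> 'e"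
  assumes cont: "continuous_on UNIV F" and hom: "\<And>t y. t > 0 \<Longrightarrow> F (t *\<^sub>R y) = t powr p * F y" and p: "p > 0"
    and [measurable]: "\<And>n. U n \<in> borel_measurable M" "u \<in> borel_measurable M"
    and lim: "AE x in M. (\<lambda>n. U n x) \<longlonglongrightarrow> u x"
    and intU: "\<And>n. integrable M (\<lambda>x. norm (U n x) powr p)" and B: "\<And>n. (\<integral>x. norm (U n x) powr p \<partial>M) \<le> B"
    and intu: "integrable M (\<lambda>x. norm (u x) powr p)"
  shows "(\<lambda>n. (\<integral>x. F (U n x) \<partial>M) - (\<integral>x. F (U n x - u x) \<partial>M)) \<longlonglongrightarrow> (\<integral>x. F (u x) \<partial>M)"
proof -
  have [measurable]: "F \<in> borel_measurable borel" using cont by (rule borel_measurable_continuous_onI)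
  obtain m where m: "m \<ge> 0" "\<And>y. \<bar>F y\<bar> \<le> m * norm y powr p" using homogeneous_bound(2)[of F p, OF cont hom p] by blast
  have F0: "F 0 = 0" using homogeneous_bound(1)[of F p, OF cont hom p] by blast
  have diffp: "norm (U n x - u x) powr p \<le> 2 powr p * (norm (U n x) powr p + norm (u x) powr p)" for n x
  proof -
    have "norm (U n x - u x) powr p \<le> (norm (U n x) + norm (u x)) powr p"
      using p by (intro powr_mono2 norm_triangle_ineq4) auto
    also have "\<dots> \<le> 2 powr p * (norm (U n x) powr p + norm (u x) powr p)" using p by (intro powr_add_le) auto
    finally show ?thesis .
  qed
  have intd: "integrable M (\<lambda>x. norm (U n x - u x) powr p)" for n
  proof (rule Bochner_Integration.integrable_bound)
    show "integrable M (\<lambda>x. 2 powr p * (norm (U n x) powr p + norm (u x) powr p))" using intU intu by simp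
    show "AE x in M. norm (norm (U n x - u x) powr p) \<le> norm (2 powr p * (norm (U n x) powr p + norm (u x) powr p))"
      using diffp by (intro AE_I2) simp
  qed measurable
  have intF: "integrable M (\<lambda>x. F (V x))" if [measurable]: "V \<in> borel_measurable M" and "integrable M (\<lambda>x. norm (V x) powr p)" for V
  proof (rule Bochner_Integration.integrable_bound)
    show "integrable M (\<lambda>x. m * norm (V x) powr p)" using that by simp
    show "AE x in M. norm (F (V x)) \<le> norm (m * norm (V x) powr p)" using m by (intro AE_I2) simp
  qed measurable
  define B' where "B' = 2 powr p * (B + (\<integral>x. norm (u x) powr p \<partial>M))"
  have dB: "(\<integral>x. norm (U n x - u x) powr p \<partial>M) \<le> B'" for n
  proof -
    have "(\<integral>x. norm (U n x - u x) powr p \<partial>M) \<le> (\<integral>x. 2 powr p * (norm (U n x) powr p + norm (u x) powr p) \<partial>M)"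
      using intd intU intu diffp by (intro integral_mono) auto
    also have "\<dots> = 2 powr p * ((\<integral>x. norm (U n x) powr p \<partial>M) + (\<integral>x. norm (u x) powr p \<partial>M))"
      using intU intu by simp
    also have "\<dots> \<le> B'" unfolding B'_def by (intro mult_left_mono add_right_mono B) simp
    finally show ?thesis .
  qed
  have B'0: "B' \<ge> 0" by (rule order.trans[OF _ dB[of 0]]) simp
  define h where "h n x = \<bar>F (U n x) - F (U n x - u x) - F (u x)\<bar>" for n x
  have [measurable]: "h n \<in> borel_measurable M" for n unfolding h_def[abs_def] by measurable
  have inth: "integrable M (h n)" for n
    unfolding h_def[abs_def] using intU intu intd by (intro integrable_abs Bochner_Integration.integrable_diff intF) auto
  have "(\<lambda>n. (\<integral>x. F (U n x) \<partial>M) - (\<integral>x. F (U n x - u x) \<partial>M) - (\<integral>x. F (u x) \<partial>M)) \<longlonglongrightarrow> 0"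
  proof (rule LIMSEQ_I)
    fix e :: real assume e: "e > 0"
    \<comment> \<open>Leaves \<open>e / 2\<close> for the dominated part; \<open>B' + 1\<close>
      avoids a zero denominator.\<close>
    define \<epsilon> where "\<epsilon> = e / (2 * (B' + 1))"
    have \<epsilon>: "\<epsilon> > 0" "\<epsilon> * B' \<le> e / 2" using e B'0 by (auto simp: \<epsilon>_def field_simps)
    obtain C where C: "C \<ge> 0" "\<And>a b. \<bar>F (a + b) - F a\<bar> \<le> \<epsilon> * norm a powr p + C * norm b powr p"
      using homogeneous_diff_bound[of F p \<epsilon>, OF cont hom p \<epsilon>(1)] by blast
    define W where "W n x = max 0 (h n x - \<epsilon> * norm (U n x - u x) powr p)" for n x
    have Wle: "W n x \<le> (C + m) * norm (u x) powr p" for n x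
    proof -
      have "h n x \<le> \<epsilon> * norm (U n x - u x) powr p + C * norm (u x) powr p + m * norm (u x) powr p"
        using C(2)[of "U n x - u x" "u x"] m(2)[of "u x"] unfolding h_def by simp
      then show ?thesis using C(1) m(1) by (simp add: W_def algebra_simps)
    qed
    have intW: "integrable M (W n)" for n
      unfolding W_def[abs_def] using inth intd by (intro integrable_max) auto
    have "(\<lambda>n. \<integral>x. W n x \<partial>M) \<longlonglongrightarrow> (\<integral>x. 0 \<partial>M)"
    proof (rule integral_dominated_convergence[where w = "\<lambda>x. (C + m) * norm (u x) powr p"])
      show "integrable M (\<lambda>x. (C + m) * norm (u x) powr p)" using intu by simp
      show "AE x in M. norm (W n x) \<le> (C + m) * norm (u x) powr p" for n
        using Wle by (intro AE_I2) (simp add: W_def)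
      show "AE x in M. (\<lambda>n. W n x) \<longlonglongrightarrow> 0"
        using lim
      proof eventually_elim
        case (elim x)
        have F: "(F \<longlongrightarrow> F y) (nhds y)" for y
          using cont by (metis UNIV_I continuous_on_eq_continuous_at isCont_def open_UNIV tendsto_at_iff_tendsto_nhds)
        have d: "(\<lambda>n. U n x - u x) \<longlonglongrightarrow> 0" using elim by (simp add: LIM_zero_iff)
        have "(\<lambda>n. h n x) \<longlonglongrightarrow> \<bar>F (u x) - F 0 - F (u x)\<bar>"
          unfolding h_def by (intro tendsto_intros filterlim_compose[OF F elim] filterlim_compose[OF F d])
        then have "(\<lambda>n. h n x) \<longlonglongrightarrow> 0" by (simp add: F0)
        moreover have "(\<lambda>n. \<epsilon> * norm (U n x - u x) powr p) \<longlonglongrightarrow> \<epsilon> * 0"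
          by (intro tendsto_mult tendsto_const tendsto_zero_powrI[OF tendsto_norm_zero[OF d] tendsto_const]) (use p in auto)
        ultimately have "(\<lambda>n. max 0 (h n x - \<epsilon> * norm (U n x - u x) powr p)) \<longlonglongrightarrow> max 0 (0 - \<epsilon> * 0)"
          by (intro tendsto_max tendsto_const tendsto_diff)
        then show ?case by (simp add: W_def)
      qed
    qed (auto simp: W_def[abs_def])
    then have "\<forall>\<^sub>F n in sequentially. (\<integral>x. W n x \<partial>M) < e / 2" using e by (intro order_tendstoD(2)) auto
    then obtain N where N: "\<And>n. n \<ge> N \<Longrightarrow> (\<integral>x. W n x \<partial>M) < e / 2" by (auto simp: eventually_sequentially)
    have "\<bar>(\<integral>x. F (U n x) \<partial>M) - (\<integral>x. F (U n x - u x) \<partial>M) - (\<integral>x. F (u x) \<partial>M)\<bar> < e" if "n \<ge> N" for n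
    proof -
      have "(\<integral>x. F (U n x) \<partial>M) - (\<integral>x. F (U n x - u x) \<partial>M) - (\<integral>x. F (u x) \<partial>M)
         = (\<integral>x. F (U n x) - F (U n x - u x) - F (u x) \<partial>M)"
        using intU intd intu by (simp add: intF)
      also have "\<bar>\<dots>\<bar> \<le> (\<integral>x. h n x \<partial>M)" unfolding h_def by (rule integral_abs_bound)
      also have "\<dots> \<le> (\<integral>x. W n x + \<epsilon> * norm (U n x - u x) powr p \<partial>M)"
        using inth intW intd by (intro integral_mono) (auto simp: W_def)
      also have "\<dots> = (\<integral>x. W n x \<partial>M) + \<epsilon> * (\<integral>x. norm (U n x - u x) powr p \<partial>M)"
        using intW intd by simp
      also have "\<dots> < e / 2 + \<epsilon> * B'"
        using N[OF that] dB[of n] \<epsilon>(1) by (intro add_less_le_mono mult_left_mono) auto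
      also have "\<dots> \<le> e" using \<epsilon>(2) by simp
      finally show ?thesis .
    qed
    then show "\<exists>no. \<forall>n\<ge>no. norm ((\<integral>x. F (U n x) \<partial>M) - (\<integral>x. F (U n x - u x) \<partial>M) - (\<integral>x. F (u x) \<partial>M) - 0) < e"
      by auto
  qed
  then show ?thesis by (rule LIM_zero_cancel)
qed

subsection \<open>Sobolev and Lions inequalities\<close>

lemma loc_energy_finite:
  assumes "H1_pair u g"
  obtains l where "loc_energy E u g = ennreal l" "0 \<le> l" "l \<le> ip2 lborel u u + ip2 lborel g g"
proof -
  have "loc_energy E u g \<le> ennreal (ip2 lborel u u + ip2 lborel g g)"
    using loc_energy_mono[of E UNIV u g] loc_energy_UNIV[OF assms] by simp
  moreover have "0 \<le> ip2 lborel u u + ip2 lborel g g" by simp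
  ultimately show ?thesis using that[of "enn2real (loc_energy E u g)"]
    by (metis enn2real_leI enn2real_nonneg ennreal_enn2real_if ennreal_neq_top neq_top_trans)
qed

text \<open>Moving the cube to the origin turns \<open>z\<close> into a parameter of a jointly
  measurable integrand.\<close>

lemma loc_energy_cube_measurable:
  assumes "H1_pair u g"
  shows "(\<lambda>z. loc_energy (cube z r) u g) \<in> borel_measurable borel"
proof -
  have [measurable]: "u \<in> borel_measurable borel" "g \<in> borel_measurable borel" using H1_pair_measurable[OF assms] by auto
  have "loc_energy (cube z r) u g = (\<integral>\<^sup>+y. indicator (cube 0 r) y * ennreal ((u (y + z))\<^sup>2 + (norm (g (y + z)))\<^sup>2) \<partial>lborel)" for z
  proof -
    have "loc_energy (cube z r) u g = (\<integral>\<^sup>+y. indicator (cube z r) (y + z) * ennreal ((u (y + z))\<^sup>2 + (norm (g (y + z)))\<^sup>2) \<partial>lborel)"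
      unfolding loc_energy_def by (rule nn_integral_lborel_translate[symmetric]) measurable
    then show ?thesis by (simp add: indicator_def cube_translate)
  qed
  then show ?thesis by simp
qed

text \<open>The local energy itself takes the place of the auxiliary bound \<open>N\<close>. If it
  is zero, a case excluded by \<open>N > 0\<close> in \<open>local_Sobolev\<close>, then
  \<open>u\<close> vanishes almost everywhere on the cube.\<close>

lemma local_Sobolev_real:
  assumes d: "CARD('d) = 2" and p: "p > 0"
  obtains C where "C > 0" "\<And>(u :: real ^ 'd \<Rightarrow> real) g z l. H1_pair u g \<Longrightarrow> l \<ge> 0 \<Longrightarrow>
    loc_energy (cube z 2) u g = ennreal l \<Longrightarrow>
    (\<integral>\<^sup>+x. indicator (cube z 1) x * ennreal (\<bar>u x\<bar> powr p) \<partial>lborel) \<le> ennreal (C * l powr (p / 2))"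
proof -
  obtain C where C: "C > 0" "\<And>(u :: real ^ 'd \<Rightarrow> real) g z N. H1_pair u g \<Longrightarrow> N > 0 \<Longrightarrow>
    loc_energy (cube z 2) u g \<le> ennreal (N\<^sup>2) \<Longrightarrow>
    (\<integral>\<^sup>+x. indicator (cube z 1) x * ennreal (\<bar>u x\<bar> powr p) \<partial>lborel) \<le> ennreal (C * N powr p)"
    using local_Sobolev[OF d, of p] p by auto
  have "(\<integral>\<^sup>+x. indicator (cube z 1) x * ennreal (\<bar>u x\<bar> powr p) \<partial>lborel) \<le> ennreal (C * l powr (p / 2))"
    if ug: "H1_pair u g" and l: "l \<ge> 0" "loc_energy (cube z 2) u g = ennreal l" for u :: "real ^ 'd \<Rightarrow> real" and g z l
  proof (cases "l = 0")
    case False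
    then have "l > 0" using l by simp
    then have "(sqrt l) powr p = l powr (p / 2)" by (simp add: powr_half_sqrt[symmetric] powr_powr)
    then show ?thesis using C(2)[OF ug, of "sqrt l" z] l \<open>l > 0\<close> by simp
  next
    case True
    have [measurable]: "u \<in> borel_measurable borel" using H1_pair_measurable[OF ug] by auto
    have "(\<integral>\<^sup>+x. indicator (cube z 2) x * ennreal ((u x)\<^sup>2) \<partial>lborel) = 0"
      using loc_energy_ge(1)[of "cube z 2" u g] l True by simp
    then have "AE x in lborel. indicator (cube z 2) x * ennreal ((u x)\<^sup>2) = 0"
      by (subst (asm) nn_integral_0_iff_AE) auto
    then have "AE x in lborel. indicator (cube z 1) x * ennreal (\<bar>u x\<bar> powr p) = 0"
    proof eventually_elim
      case (elim x)
      have "x \<in> cube z 1 \<Longrightarrow> x \<in> cube z 2" by (auto simp: cube_def) (smt (verit))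
      then show ?case using elim by (auto simp: indicator_def split: if_splits)
    qed
    then have "(\<integral>\<^sup>+x. indicator (cube z 1) x * ennreal (\<bar>u x\<bar> powr p) \<partial>lborel) = (\<integral>\<^sup>+x. 0 \<partial>(lborel :: (real ^ 'd) measure))"
      by (rule nn_integral_cong_AE)
    then show ?thesis by simp
  qed
  then show ?thesis using that C(1) by blast
qed

text \<open>Lions' vanishing lemma, with the sum over a partition into cubes replaced by an integral over
  all translates of one cube.\<close>

lemma Lions_lemma:
  assumes d: "CARD('d) = 2" and p: "p \<ge> 2"
  shows "\<exists>C>0. \<forall>(u :: 'k::finite \<Rightarrow> real ^ 'd \<Rightarrow> real) g f A. (\<forall>i. H1_pair (u i) (g i)) \<longrightarrow>
    f \<in> borel_measurable borel \<longrightarrow> (\<forall>x. f x \<le> (\<Sum>i\<in>UNIV. \<bar>u i x\<bar> powr p)) \<longrightarrow> A \<ge> 0 \<longrightarrow>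
    (\<forall>z. (\<integral>\<^sup>+x. indicator (cube z 1) x * ennreal (f x) \<partial>lborel) \<le> ennreal A) \<longrightarrow>
    (\<integral>\<^sup>+x. ennreal (f x) \<partial>lborel) \<le> ennreal (C * A powr (1 - 2 / p) * (\<Sum>i\<in>UNIV. ip2 lborel (u i) (u i) + ip2 lborel (g i) (g i)))"
proof -
  obtain C0 where C0: "C0 > 0" "\<And>(u :: real ^ 'd \<Rightarrow> real) g z l. H1_pair u g \<Longrightarrow> l \<ge> 0 \<Longrightarrow>
    loc_energy (cube z 2) u g = ennreal l \<Longrightarrow>
    (\<integral>\<^sup>+x. indicator (cube z 1) x * ennreal (\<bar>u x\<bar> powr p) \<partial>lborel) \<le> ennreal (C0 * l powr (p / 2))"
    using local_Sobolev_real[OF d, of p] p by auto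
  define C1 where "C1 = (C0 * real CARD('k)) powr (2 / p)"
  have C1: "C1 > 0" using C0 by (simp add: C1_def)
  have "(\<integral>\<^sup>+x. ennreal (f x) \<partial>lborel) \<le> ennreal (4 * C1 * A powr (1 - 2 / p) * (\<Sum>i\<in>UNIV. ip2 lborel (u i) (u i) + ip2 lborel (g i) (g i)))"
    if ug: "\<And>i. H1_pair (u i) (g i)" and fm: "f \<in> borel_measurable borel" and fle: "\<And>x. f x \<le> (\<Sum>i\<in>UNIV. \<bar>u i x\<bar> powr p)"
      and A: "A \<ge> 0" "\<And>z. (\<integral>\<^sup>+x. indicator (cube z 1) x * ennreal (f x) \<partial>lborel) \<le> ennreal A"
    for u :: "'k \<Rightarrow> real ^ 'd \<Rightarrow> real" and g f A
  proof -
    note [measurable] = fm H1_pair_measurable[OF ug] loc_energy_cube_measurable[OF ug]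
    define B where "B = A powr (1 - 2 / p) * C1"
    have B: "B \<ge> 0" using C1 by (simp add: B_def)
    have pt: "(\<integral>\<^sup>+x. indicator (cube z 1) x * ennreal (f x) \<partial>lborel) \<le> ennreal B * (\<Sum>i\<in>UNIV. loc_energy (cube z 2) (u i) (g i))" for z
    proof -
      obtain l where l: "\<And>i. loc_energy (cube z 2) (u i) (g i) = ennreal (l i)" "\<And>i. l i \<ge> 0"
      proof -
        have "\<forall>i. \<exists>l. loc_energy (cube z 2) (u i) (g i) = ennreal l \<and> 0 \<le> l"
          using loc_energy_finite[OF ug] by metis
        from choice[OF this] show ?thesis using that by blast
      qed
      define L where "L = (\<Sum>i\<in>UNIV. l i)"
      have L: "L \<ge> 0" "\<And>i. l i \<le> L" using l(2) by (auto simp: L_def intro!: sum_nonneg member_le_sum)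
      have "(\<integral>\<^sup>+x. indicator (cube z 1) x * ennreal (f x) \<partial>lborel) \<le> (\<integral>\<^sup>+x. (\<Sum>i\<in>UNIV. indicator (cube z 1) x * ennreal (\<bar>u i x\<bar> powr p)) \<partial>lborel)"
      proof (rule nn_integral_mono)
        fix x
        have "ennreal (f x) \<le> (\<Sum>i\<in>UNIV. ennreal (\<bar>u i x\<bar> powr p))" using fle[of x] by (simp add: ennreal_leI)
        then show "indicator (cube z 1) x * ennreal (f x) \<le> (\<Sum>i\<in>UNIV. indicator (cube z 1) x * ennreal (\<bar>u i x\<bar> powr p))"
          unfolding sum_distrib_left[symmetric] by (rule mult_left_mono) simp
      qed
      also have "\<dots> = (\<Sum>i\<in>UNIV. \<integral>\<^sup>+x. indicator (cube z 1) x * ennreal (\<bar>u i x\<bar> powr p) \<partial>lborel)"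
        by (rule nn_integral_sum) measurable
      also have "\<dots> \<le> (\<Sum>i\<in>(UNIV :: 'k set). ennreal (C0 * L powr (p / 2)))"
      proof (rule sum_mono)
        fix i
        have "(\<integral>\<^sup>+x. indicator (cube z 1) x * ennreal (\<bar>u i x\<bar> powr p) \<partial>lborel) \<le> ennreal (C0 * l i powr (p / 2))"
          by (rule C0(2)[OF ug l(2) l(1)])
        also have "\<dots> \<le> ennreal (C0 * L powr (p / 2))"
          using C0(1) p L l(2) by (intro ennreal_leI mult_left_mono powr_mono2) auto
        finally show "(\<integral>\<^sup>+x. indicator (cube z 1) x * ennreal (\<bar>u i x\<bar> powr p) \<partial>lborel) \<le> ennreal (C0 * L powr (p / 2))" .
      qed
      also have "\<dots> = ennreal (C0 * real CARD('k) * L powr (p / 2))"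
        using C0(1) by (simp add: ennreal_of_nat_eq_real_of_nat ennreal_mult'[symmetric] mult_ac)
      finally have a: "(\<integral>\<^sup>+x. indicator (cube z 1) x * ennreal (f x) \<partial>lborel) \<le> ennreal (C0 * real CARD('k) * L powr (p / 2))" .
      define b where "b = enn2real (\<integral>\<^sup>+x. indicator (cube z 1) x * ennreal (f x) \<partial>lborel)"
      have b: "(\<integral>\<^sup>+x. indicator (cube z 1) x * ennreal (f x) \<partial>lborel) = ennreal b" "b \<ge> 0"
        using A(2)[of z] by (auto simp: b_def intro!: ennreal_enn2real[symmetric] intro: le_less_trans)
      \<comment> \<open>Interpolation: one power of \<open>b\<close> is estimated by the small
        number \<open>A\<close>, the other by the Sobolev inequality. The exponent
        \<open>2 / p\<close> makes the latter linear in the local energy, which can then be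
        integrated over \<open>z\<close>.\<close>
      have "b = b powr (1 - 2 / p) * b powr (2 / p)"
        using b(2) by (simp add: powr_add[symmetric])
      also have "\<dots> \<le> A powr (1 - 2 / p) * (C0 * real CARD('k) * L powr (p / 2)) powr (2 / p)"
      proof (intro mult_mono powr_mono2)
        show "b \<le> A" using A(2)[of z] A(1) unfolding b(1) by (simp add: ennreal_le_iff)
        show "b \<le> C0 * real CARD('k) * L powr (p / 2)" using a C0(1) unfolding b(1) by (simp add: ennreal_le_iff)
      qed (use b p in auto)
      also have "(C0 * real CARD('k) * L powr (p / 2)) powr (2 / p) = C1 * L"
        using p L by (simp add: C1_def powr_mult powr_powr)
      finally have "b \<le> B * L" by (simp add: B_def mult_ac)
      then have "ennreal b \<le> ennreal (B * L)" by (rule ennreal_leI)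
      also have "\<dots> = ennreal B * (\<Sum>i\<in>UNIV. loc_energy (cube z 2) (u i) (g i))"
        using B l by (simp add: L_def ennreal_mult' )
      finally show ?thesis unfolding b(1) .
    qed
    have "(\<integral>\<^sup>+x. ennreal (f x) \<partial>lborel) = (\<integral>\<^sup>+z. (\<integral>\<^sup>+x. indicator (cube z 1) x * ennreal (f x) \<partial>lborel) \<partial>lborel)"
      using nn_integral_cube_average[of "\<lambda>x. ennreal (f x)" 1] by simp
    also have "\<dots> \<le> (\<integral>\<^sup>+z. ennreal B * (\<Sum>i\<in>UNIV. loc_energy (cube z 2) (u i) (g i)) \<partial>lborel)"
      by (rule nn_integral_mono) (rule pt)
    also have "\<dots> = ennreal B * (\<Sum>i\<in>UNIV. \<integral>\<^sup>+z. loc_energy (cube z 2) (u i) (g i) \<partial>lborel)"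
      by (subst nn_integral_cmult) (auto intro!: nn_integral_sum simp: nn_integral_sum)
    also have "\<dots> = ennreal B * (\<Sum>i\<in>UNIV. ennreal (4 * (ip2 lborel (u i) (u i) + ip2 lborel (g i) (g i))))"
      using loc_energy_cube_integral[OF d ug] loc_energy_UNIV[OF ug] by (simp add: ennreal_mult')
    also have "\<dots> = ennreal B * ennreal (\<Sum>i\<in>UNIV. 4 * (ip2 lborel (u i) (u i) + ip2 lborel (g i) (g i)))"
      by (subst sum_ennreal) auto
    also have "\<dots> = ennreal (4 * C1 * A powr (1 - 2 / p) * (\<Sum>i\<in>UNIV. ip2 lborel (u i) (u i) + ip2 lborel (g i) (g i)))"
      unfolding sum_distrib_left[symmetric] using B
      by (simp add: ennreal_mult'[symmetric] B_def mult_ac del: distrib_left_numeral)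
    finally show ?thesis .
  qed
  then show ?thesis using C1 by (intro exI[of _ "4 * C1"]) simp
qed

text \<open>Since \<open>p / 2 \<ge> 1\<close>, all but one power of the local energy may be
  replaced by the total energy. What remains is linear and is integrated over all positions of the
  cube.\<close>

lemma global_Sobolev:
  assumes d: "CARD('d) = 2" and p: "p \<ge> 2"
  obtains C where "C > 0" "\<And>(u :: real ^ 'd \<Rightarrow> real) g. H1_pair u g \<Longrightarrow>
    integrable lborel (\<lambda>x. \<bar>u x\<bar> powr p) \<and>
    (\<integral>x. \<bar>u x\<bar> powr p \<partial>lborel) \<le> C * (ip2 lborel u u + ip2 lborel g g) powr (p / 2)"
proof -
  obtain C0 where C0: "C0 > 0" "\<And>(u :: real ^ 'd \<Rightarrow> real) g z l. H1_pair u g \<Longrightarrow> l \<ge> 0 \<Longrightarrow>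
    loc_energy (cube z 2) u g = ennreal l \<Longrightarrow>
    (\<integral>\<^sup>+x. indicator (cube z 1) x * ennreal (\<bar>u x\<bar> powr p) \<partial>lborel) \<le> ennreal (C0 * l powr (p / 2))"
    using local_Sobolev_real[OF d, of p] p by auto
  have "integrable lborel (\<lambda>x. \<bar>u x\<bar> powr p) \<and> (\<integral>x. \<bar>u x\<bar> powr p \<partial>lborel) \<le> 4 * C0 * (ip2 lborel u u + ip2 lborel g g) powr (p / 2)"
    if ug: "H1_pair u g" for u :: "real ^ 'd \<Rightarrow> real" and g
  proof -
    note [measurable] = H1_pair_measurable[OF ug] loc_energy_cube_measurable[OF ug]
    define e where "e = ip2 lborel u u + ip2 lborel g g"
    have e: "e \<ge> 0" by (simp add: e_def)
    have pt: "(\<integral>\<^sup>+x. indicator (cube z 1) x * ennreal (\<bar>u x\<bar> powr p) \<partial>lborel) \<le> ennreal (C0 * e powr (p / 2 - 1)) * loc_energy (cube z 2) u g" for z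
    proof -
      obtain l where l: "loc_energy (cube z 2) u g = ennreal l" "0 \<le> l" "l \<le> e"
        using loc_energy_finite[OF ug] unfolding e_def by metis
      have "l powr (p / 2) = l powr (p / 2 - 1) * l powr 1" unfolding powr_add[symmetric] by simp
      also have "\<dots> \<le> e powr (p / 2 - 1) * l" using l p by (intro mult_mono powr_mono2) auto
      finally have "C0 * l powr (p / 2) \<le> C0 * e powr (p / 2 - 1) * l" using C0(1) by simp
      then have "ennreal (C0 * l powr (p / 2)) \<le> ennreal (C0 * e powr (p / 2 - 1)) * ennreal l"
        using C0(1) l by (subst ennreal_mult[symmetric]) (auto intro: ennreal_leI)
      then show ?thesis using C0(2)[OF ug l(2) l(1)] unfolding l(1) by (rule order.trans[rotated])
    qed
    have "(\<integral>\<^sup>+x. ennreal (\<bar>u x\<bar> powr p) \<partial>lborel) = (\<integral>\<^sup>+z. (\<integral>\<^sup>+x. indicator (cube z 1) x * ennreal (\<bar>u x\<bar> powr p) \<partial>lborel) \<partial>lborel)"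
      using nn_integral_cube_average[of "\<lambda>x. ennreal (\<bar>u x\<bar> powr p)" 1] by simp
    also have "\<dots> \<le> (\<integral>\<^sup>+z. ennreal (C0 * e powr (p / 2 - 1)) * loc_energy (cube z 2) u g \<partial>lborel)"
      by (rule nn_integral_mono) (rule pt)
    also have "\<dots> = ennreal (C0 * e powr (p / 2 - 1)) * (4 * ennreal e)"
      by (subst nn_integral_cmult) (auto simp: loc_energy_cube_integral[OF d ug] loc_energy_UNIV[OF ug] e_def)
    also have "\<dots> = ennreal (4 * C0 * (e powr (p / 2 - 1) * e powr 1))"
    proof -
      have "4 * ennreal e = ennreal (4 * e)" using e by (simp add: ennreal_mult')
      then show ?thesis using e C0(1) by (simp only: ennreal_mult'[symmetric] mult_nonneg_nonneg powr_ge_zero less_imp_le)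
        (simp add: mult_ac)
    qed
    also have "e powr (p / 2 - 1) * e powr 1 = e powr (p / 2)" unfolding powr_add[symmetric] by simp
    finally have le: "(\<integral>\<^sup>+x. ennreal (\<bar>u x\<bar> powr p) \<partial>lborel) \<le> ennreal (4 * C0 * e powr (p / 2))" .
    have int: "integrable lborel (\<lambda>x. \<bar>u x\<bar> powr p)"
      using le by (intro integrableI_bounded) (auto intro: le_less_trans)
    moreover have "(\<integral>x. \<bar>u x\<bar> powr p \<partial>lborel) \<le> 4 * C0 * e powr (p / 2)"
      using le C0(1) nn_integral_eq_integral[OF int] by (simp add: ennreal_le_iff)
    ultimately show ?thesis by (simp add: e_def)
  qed
  then show ?thesis using that[of "4 * C0"] C0(1) by simp
qed

section \<open>Explicit gradients and the chosen \<open>weak_gradient\<close>\<close>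

lemma H1_pair_weak_gradient:
  assumes "u \<in> H1" shows "H1_pair u (weak_gradient u)"
proof -
  obtain g where g: "has_weak_gradient u g" "integrable lborel (\<lambda>x. (norm (g x))\<^sup>2)"
    and u: "u \<in> borel_measurable lborel" "integrable lborel (\<lambda>x. (u x)\<^sup>2)"
    using assms unfolding H1_def by blast
  have w: "has_weak_gradient u (weak_gradient u)"
    unfolding weak_gradient_def by (rule someI[of "has_weak_gradient u", OF g(1)])
  then have [measurable]: "weak_gradient u \<in> borel_measurable borel" "g \<in> borel_measurable borel"
    using g(1) by (auto simp: has_weak_gradient_def locally_integrable_def)
  \<comment> \<open>The gradient picked by choice need not be the square-integrable one from the
    definition of \<open>H1\<close>; uniqueness up to null sets transfers integrability.\<close>
  have "AE x in lborel. g x = weak_gradient u x" by (rule has_weak_gradient_unique[OF g(1) w])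
  then have "AE x in lborel. (norm (g x))\<^sup>2 = (norm (weak_gradient u x))\<^sup>2" by eventually_elim simp
  then have "integrable lborel (\<lambda>x. (norm (weak_gradient u x))\<^sup>2)"
    using g(2) by (subst integrable_cong_AE[symmetric, of "\<lambda>x. (norm (g x))\<^sup>2"]) auto
  then show ?thesis using w u by (simp add: H1_pair_def L2_def)
qed

lemma H1_pair_imp_H1: "H1_pair u g \<Longrightarrow> u \<in> H1"
  by (auto simp: H1_pair_def H1_def L2_def)

lemma weak_gradient_AE:
  assumes "H1_pair u g" shows "AE x in lborel. weak_gradient u x = g x"
  using has_weak_gradient_unique[of u "weak_gradient u" g] H1_pair_weak_gradient[OF H1_pair_imp_H1[OF assms]] assms
  by (auto simp: H1_pair_def)

lemma weak_gradient_integral: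
  assumes "H1_pair u g" "H1_pair v h"
  shows "(\<integral>x. weak_gradient u x \<bullet> weak_gradient v x + l * u x * v x \<partial>lborel) = ip2 lborel g h + l * ip2 lborel u v"
proof -
  note [measurable] = H1_pair_measurable[OF assms(1)] H1_pair_measurable[OF assms(2)]
    H1_pair_measurable(2)[OF H1_pair_weak_gradient[OF H1_pair_imp_H1[OF assms(1)]]]
    H1_pair_measurable(2)[OF H1_pair_weak_gradient[OF H1_pair_imp_H1[OF assms(2)]]]
  have "(\<integral>x. weak_gradient u x \<bullet> weak_gradient v x + l * u x * v x \<partial>lborel) = (\<integral>x. g x \<bullet> h x + l * (u x \<bullet> v x) \<partial>lborel)"
  proof (rule integral_cong_AE)
    show "AE x in lborel. weak_gradient u x \<bullet> weak_gradient v x + l * u x * v x = g x \<bullet> h x + l * (u x \<bullet> v x)"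
      using weak_gradient_AE[OF assms(1)] weak_gradient_AE[OF assms(2)] by eventually_elim simp
  qed measurable
  also have "\<dots> = ip2 lborel g h + l * ip2 lborel u v"
    using assms unfolding ip2_def H1_pair_def
    by (subst Bochner_Integration.integral_add) (auto intro!: L2_inner_integrable integrable_mult_right simp del: inner_real_def)
  finally show ?thesis .
qed

lemma sqnorm_eq:
  assumes "H1_pair u g" shows "sqnorm l u = ip2 lborel g g + l * ip2 lborel u u"
  using weak_gradient_integral[OF assms assms, of l]
  by (simp add: sqnorm_def power2_norm_eq_inner power2_eq_square[of "u _"] mult.assoc)

lemma H1_pair_add: "H1_pair u g \<Longrightarrow> H1_pair v h \<Longrightarrow> H1_pair (\<lambda>x. u x + v x) (\<lambda>x. g x + h x)"
  by (simp add: H1_pair_def has_weak_gradient_add L2_add)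

lemma H1_pair_cmult: "H1_pair u g \<Longrightarrow> H1_pair (\<lambda>x. c * u x) (\<lambda>x. c *\<^sub>R g x)"
  using L2_scaleR[of u lborel c] by (simp add: H1_pair_def has_weak_gradient_cmult L2_scaleR)

lemma H1_pair_translate: "H1_pair u g \<Longrightarrow> H1_pair (\<lambda>x. u (x + a)) (\<lambda>x. g (x + a))"
  using has_weak_gradient_translate by (auto simp: H1_pair_def)

lemma ip2_translate:
  fixes f g :: "'a::euclidean_space \<Rightarrow> 'e::euclidean_space"
  assumes "f \<in> borel_measurable borel" "g \<in> borel_measurable borel"
  shows "ip2 lborel (\<lambda>x. f (x + a)) (\<lambda>x. g (x + a)) = ip2 lborel f g"
  unfolding ip2_def using assms by (intro integral_lborel_translate) measurable

section \<open>Test functions as Sobolev functions\<close>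

lemma test_function_integrable:
  assumes "\<phi> \<in> test_functions" shows "integrable lborel \<phi>"
proof -
  let ?K = "closure {x. \<phi> x \<noteq> 0}"
  have "integrable lborel (\<lambda>x. indicator ?K x *\<^sub>R \<phi> x)"
    using assms by (intro borel_integrable_compact continuous_on_subset[OF test_function_cont])
      (auto simp: test_functions_def)
  moreover have "(\<lambda>x. indicator ?K x *\<^sub>R \<phi> x) = \<phi>"
    using closure_subset[of "{x. \<phi> x \<noteq> 0}"] by (auto simp: indicator_def fun_eq_iff)
  ultimately show ?thesis by simp
qed

text \<open>The fundamental theorem along unit segments in direction \<open>i\<close>, integrated
  over the whole space: the difference of \<open>\<phi>\<close> and its translate integrates to 0,
  the other side to the integral of the partial derivative.\<close>

lemma integral_partial_test_function:
  assumes \<phi>: "\<phi> \<in> test_functions" shows "(\<integral>x. partial i \<phi> x \<partial>lborel) = 0"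
proof -
  have ax: "(\<Sum>j\<in>UNIV. axis i 1 $ j * partial j \<phi> x) = partial i \<phi> x" for x
    by (simp add: axis_def if_distrib if_distribR cong: if_cong)
  have int: "integrable lborel (partial i \<phi>)" by (intro test_function_integrable test_function_partial_mem \<phi>)
  have m [measurable]: "\<phi> \<in> borel_measurable borel" "partial i \<phi> \<in> borel_measurable borel"
    using \<phi> by (auto intro!: borel_measurable_continuous_onI test_function_cont test_function_partial_cont)
  have "(\<integral>x. \<phi> x - \<phi> (x + - axis i 1) \<partial>lborel) = (\<integral>x. (\<integral>t. I01 t * partial i \<phi> (x + t *\<^sub>R - axis i 1) \<partial>lborel) \<partial>lborel)"
    using test_function_FTC[OF \<phi>, of "axis i 1"] unfolding ax by simp
  also have "\<dots> = (\<integral>t. (\<integral>x. I01 t * partial i \<phi> (x + t *\<^sub>R - axis i 1) \<partial>lborel) \<partial>lborel)"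
    using lborel_pair.Fubini_integral[OF integrable_pair_translate[OF int, of "- axis i 1"]] by simp
  also have "\<dots> = (\<integral>t. I01 t * (\<integral>x. partial i \<phi> x \<partial>lborel) \<partial>lborel)"
    using integral_lborel_translate[OF m(2)] by (simp del: scaleR_minus_right)
  also have "\<dots> = (\<integral>x. partial i \<phi> x \<partial>lborel)" by simp
  also have "(\<integral>x. \<phi> x - \<phi> (x + - axis i 1) \<partial>lborel) = 0"
    using test_function_integrable[OF \<phi>] test_function_integrable[OF test_function_translate(1)[OF \<phi>]]
      integral_lborel_translate[OF m(1), of "- axis i 1"]
    by (simp del: add_uminus_conv_diff)
  finally show ?thesis by simp
qed

text \<open>The preceding identity, applied to the product of two test functions, is integration by
  parts. The result supplies explicit elements of \<open>H1\<close>, used to show that the infima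
  below range over nonempty sets.\<close>

lemma test_function_H1_pair:
  assumes \<phi>: "\<phi> \<in> test_functions"
  shows "H1_pair \<phi> (\<lambda>x. \<chi> i. partial i \<phi> x)"
proof -
  have [measurable]: "\<phi> \<in> borel_measurable borel" "partial i \<phi> \<in> borel_measurable borel" for i
    using \<phi> by (auto intro!: borel_measurable_continuous_onI test_function_cont test_function_partial_cont)
  have m: "(\<lambda>x. \<chi> i. partial i \<phi> x) \<in> borel_measurable lborel"
    by (rule borel_measurable_vec_lambda) measurable
  have "integrable lborel (\<lambda>x. \<Sum>i\<in>UNIV. (norm (partial i \<phi> x))\<^sup>2)"
    by (intro Bochner_Integration.integrable_sum L2_integrable_norm test_function_L2 test_function_partial_mem \<phi>)
  moreover have "(norm (\<chi> i. partial i \<phi> x))\<^sup>2 = (\<Sum>i\<in>UNIV. (norm (partial i \<phi> x))\<^sup>2)" for x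
    unfolding power2_norm_eq_inner inner_vec_def by simp
  ultimately have gL: "(\<lambda>x. \<chi> i. partial i \<phi> x) \<in> L2 lborel" using m by (simp add: L2_def)
  have "(\<integral>x. \<phi> x * partial i \<psi> x \<partial>lborel) = - (\<integral>x. partial i \<phi> x * \<psi> x \<partial>lborel)" if \<psi>: "\<psi> \<in> test_functions" for \<psi> i
  proof -
    let ?c = "\<lambda>x. \<phi> x * \<psi> x"
    have "{x. ?c x \<noteq> 0} \<subseteq> {x. \<phi> x \<noteq> 0}" by auto
    then have "closure {x. ?c x \<noteq> 0} \<subseteq> closure {x. \<phi> x \<noteq> 0}" by (rule closure_mono)
    then have "compact (closure {x. ?c x \<noteq> 0})"
      using \<phi> compact_Int_closed[of "closure {x. \<phi> x \<noteq> 0}" "closure {x. ?c x \<noteq> 0}"]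
      by (simp add: test_functions_def Int_absorb1)
    then have c: "?c \<in> test_functions" using \<phi> \<psi> by (simp add: test_functions_def Ck_mult)
    have "partial i ?c x = \<phi> x * partial i \<psi> x + partial i \<phi> x * \<psi> x" for x
      using partial_eqI[OF has_derivative_mult[OF Ck_Suc_has_derivative[OF test_function_Ck[OF \<phi>, of 1, unfolded One_nat_def]]
          Ck_Suc_has_derivative[OF test_function_Ck[OF \<psi>, of 1, unfolded One_nat_def]]]]
      by (simp add: axis_def if_distrib if_distribR cong: if_cong)
    then have "(\<integral>x. \<phi> x * partial i \<psi> x + partial i \<phi> x * \<psi> x \<partial>lborel) = 0"
      using integral_partial_test_function[OF c, of i] by simp
    moreover have "integrable lborel (\<lambda>x. \<phi> x * partial i \<psi> x)" "integrable lborel (\<lambda>x. partial i \<phi> x * \<psi> x)"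
      using \<phi> \<psi> by (auto intro!: locally_integrable_mult_test L2_locally_integrable test_function_L2 test_function_partial_mem)
    ultimately show ?thesis by simp
  qed
  then have "has_weak_gradient \<phi> (\<lambda>x. \<chi> i. partial i \<phi> x)"
    unfolding has_weak_gradient_def using gL test_function_L2[OF \<phi>] by (auto intro: L2_locally_integrable)
  then show ?thesis using gL test_function_L2[OF \<phi>] by (simp add: H1_pair_def)
qed

subsection \<open>The critical coupling\<close>

text \<open>Every factor is replaced by the largest one, and the power obtained is a single term of
  the sum.\<close>

lemma prod_powr_le_sum:
  fixes y :: "'i \<Rightarrow> real"
  assumes "finite I" "I \<noteq> {}" "\<And>i. i \<in> I \<Longrightarrow> y i \<ge> 0" "r > 0"
  shows "(\<Prod>i\<in>I. y i powr r) \<le> (\<Sum>i\<in>I. y i powr (r * real (card I)))"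
proof -
  define m where "m = Max (y ` I)"
  have "m \<in> y ` I" unfolding m_def using assms by (intro Max_in) auto
  then obtain k where k: "k \<in> I" "m = y k" by auto
  have le: "y i \<le> y k" if "i \<in> I" for i
    unfolding k(2)[symmetric] m_def using that assms(1) by (intro Max_ge) auto
  have "(\<Prod>i\<in>I. y i powr r) \<le> (\<Prod>i\<in>I. y k powr r)"
    using assms le by (intro prod_mono) (auto intro: powr_mono2)
  also have "\<dots> = y k powr (r * real (card I))"
    using card_0_eq[OF assms(1)] assms(2) by (cases "y k = 0") (simp_all add: powr_power mult.commute)
  also have "\<dots> \<le> (\<Sum>i\<in>I. y i powr (r * real (card I)))"
    using assms k by (intro member_le_sum) auto
  finally show ?thesis .
qed

lemma powr_square: "((x :: real) powr a)\<^sup>2 = x powr (2 * a)"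
  unfolding power2_eq_square powr_add[symmetric] by simp

lemma sum_powr_le_powr_sum:
  fixes a :: "'i \<Rightarrow> real"
  assumes "finite I" "\<And>i. i \<in> I \<Longrightarrow> a i \<ge> 0" "s \<ge> 1" "\<And>i. i \<in> I \<Longrightarrow> a i \<le> m"
  shows "(\<Sum>i\<in>I. a i powr s) \<le> m powr (s - 1) * (\<Sum>i\<in>I. a i)"
proof -
  have "a i powr s \<le> m powr (s - 1) * a i" if "i \<in> I" for i
  proof -
    have "a i powr s = a i powr (s - 1) * a i powr 1" unfolding powr_add[symmetric] by simp
    also have "\<dots> \<le> m powr (s - 1) * a i" using assms that by (auto intro!: mult_mono powr_mono2)
    finally show ?thesis .
  qed
  then show ?thesis by (simp add: sum_distrib_left sum_mono)
qed

text \<open>The situation once the dimension is known to be two; \<open>p\<close> is the common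
  degree of homogeneity of the nonlinear terms of the energy.\<close>

locale planar_system =
  fixes T :: "'d::finite itself" and lam mu :: "'k::finite \<Rightarrow> real" and q p :: real
  assumes d2: "CARD('d) = 2" and K3: "CARD('k) \<ge> 3" and lam_pos: "\<And>i. lam i > 0" and mu_pos: "\<And>i. mu i > 0" and q2: "q > 2"
    and p_eq: "p = real CARD('k) * q"
begin

lemma p_gt: "p > 6"
proof -
  have "3 * 2 < real CARD('k) * q" using K3 q2 by (intro mult_le_less_imp_less) auto
  then show ?thesis by (simp add: p_eq)
qed

definition nrm :: "('k, 'd) vfun \<Rightarrow> real" where "nrm u = (\<Sum>i\<in>UNIV. sqnorm (lam i) (u i))"
definition Mu :: "('k, 'd) vfun \<Rightarrow> real" where "Mu u = (\<Sum>i\<in>UNIV. \<integral>x. mu i * \<bar>u i x\<bar> powr p \<partial>lborel)"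
definition Dq :: "('k, 'd) vfun \<Rightarrow> real" where "Dq u = (\<integral>x. (\<Prod>i\<in>UNIV. \<bar>u i x\<bar> powr q) \<partial>lborel)"
definition S :: real where "S = S_bar T lam mu q"
text \<open>The constant in \<open>G u \<le> cS * nrm u powr (p / 2)\<close>;
  \<open>beta_attained\<close> shows that it is optimal and attained.\<close>

definition cS :: real where "cS = S powr (- (p / 2))"
definition \<beta> :: real where "\<beta> = beta_bar T lam mu q"
definition G :: "('k, 'd) vfun \<Rightarrow> real" where "G u = Mu u + real CARD('k) * \<beta> * Dq u"

lemma H1_vecD: "u \<in> H1_vec \<Longrightarrow> H1_pair (u i) (weak_gradient (u i))"
  by (simp add: H1_vec_def H1_pair_weak_gradient)

lemma H1_vecI: "(\<And>i. H1_pair (u i) (g i)) \<Longrightarrow> u \<in> H1_vec"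
  by (auto simp: H1_vec_def intro: H1_pair_imp_H1)

lemma H1_measurable: "u \<in> H1 \<Longrightarrow> u \<in> borel_measurable borel"
  by (simp add: H1_def)

lemma H1_vec_measurable: "u \<in> H1_vec \<Longrightarrow> u i \<in> borel_measurable borel"
  by (simp add: H1_vec_def H1_measurable)

lemma sqnorm_nonneg: "u \<in> H1 \<Longrightarrow> 0 \<le> sqnorm (lam i) u"
  using sqnorm_eq[OF H1_pair_weak_gradient, of u "lam i"] lam_pos[of i] by simp

text \<open>A maximum over the finitely many components yields one constant for all of them, so
  Sobolev bounds in the plain energy become bounds in the norms of the system.\<close>

lemma energy_le_sqnorm:
  obtains c where "c > 0" "\<And>i (u :: real ^ 'd \<Rightarrow> real) g. H1_pair u g \<Longrightarrow> ip2 lborel u u + ip2 lborel g g \<le> c * sqnorm (lam i) u"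
proof -
  define c where "c = Max (range (\<lambda>i. max 1 (1 / lam i)))"
  have c: "max 1 (1 / lam i) \<le> c" for i unfolding c_def by (intro Max_ge) auto
  then have c1: "1 \<le> c" "1 \<le> c * lam i" for i using lam_pos[of i] by (auto simp: divide_le_eq dest!: spec)
  have "ip2 lborel u u + ip2 lborel g g \<le> c * sqnorm (lam i) u" if "H1_pair u g" for i and u :: "real ^ 'd \<Rightarrow> real" and g
  proof -
    have "1 * ip2 lborel g g \<le> c * ip2 lborel g g" "1 * ip2 lborel u u \<le> c * lam i * ip2 lborel u u"
      using c1(1) c1(2)[of i] by (intro mult_right_mono; simp)+
    then show ?thesis unfolding sqnorm_eq[OF that] by (simp add: algebra_simps)
  qed
  then show ?thesis using that[of c] c1(1) by simp
qed

lemma Sobolev: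
  assumes s: "s \<ge> 2"
  obtains C where "C > 0" "\<And>i (u :: real ^ 'd \<Rightarrow> real). u \<in> H1 \<Longrightarrow> integrable lborel (\<lambda>x. \<bar>u x\<bar> powr s) \<and>
     (\<integral>x. \<bar>u x\<bar> powr s \<partial>lborel) \<le> C * sqnorm (lam i) u powr (s / 2)"
proof -
  obtain C where C: "C > 0" "\<And>(u :: real ^ 'd \<Rightarrow> real) g. H1_pair u g \<Longrightarrow> integrable lborel (\<lambda>x. \<bar>u x\<bar> powr s) \<and>
    (\<integral>x. \<bar>u x\<bar> powr s \<partial>lborel) \<le> C * (ip2 lborel u u + ip2 lborel g g) powr (s / 2)"
    using global_Sobolev[OF d2 s] by metis
  obtain c where c: "c > 0" "\<And>i (u :: real ^ 'd \<Rightarrow> real) g. H1_pair u g \<Longrightarrow> ip2 lborel u u + ip2 lborel g g \<le> c * sqnorm (lam i) u"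
    using energy_le_sqnorm by metis
  show ?thesis
  proof (rule that[of "C * c powr (s / 2)"])
    show "C * c powr (s / 2) > 0" using C c by simp
    fix i and u :: "real ^ 'd \<Rightarrow> real" assume u: "u \<in> H1"
    note ug = H1_pair_weak_gradient[OF u]
    have "(ip2 lborel u u + ip2 lborel (weak_gradient u) (weak_gradient u)) powr (s / 2) \<le> (c * sqnorm (lam i) u) powr (s / 2)"
      using s c(2)[OF ug] by (intro powr_mono2) auto
    also have "\<dots> = c powr (s / 2) * sqnorm (lam i) u powr (s / 2)" by (rule powr_mult)
    finally have "C * (ip2 lborel u u + ip2 lborel (weak_gradient u) (weak_gradient u)) powr (s / 2) \<le> C * (c powr (s / 2) * sqnorm (lam i) u powr (s / 2))"
      using C(1) by simp
    then show "integrable lborel (\<lambda>x. \<bar>u x\<bar> powr s) \<and>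
     (\<integral>x. \<bar>u x\<bar> powr s \<partial>lborel) \<le> C * c powr (s / 2) * sqnorm (lam i) u powr (s / 2)"
      using C(2)[OF ug] by (simp add: mult.assoc)
  qed
qed

lemma integrable_powr:
  fixes u :: "real ^ 'd \<Rightarrow> real"
  assumes "u \<in> H1" "s \<ge> 2" shows "integrable lborel (\<lambda>x. \<bar>u x\<bar> powr s)"
  using Sobolev[OF assms(2)] assms(1) by metis

text \<open>The free set and exponent cover the interaction with \<open>q\<close>, its square with
  \<open>2 * q\<close>, and the squared product without one component.\<close>

lemma integrable_prod:
  fixes u :: "('k, 'd) vfun"
  assumes u: "u \<in> H1_vec" and "J \<noteq> {}" "r * real (card J) \<ge> 2"
  shows "integrable lborel (\<lambda>x. \<Prod>i\<in>J. \<bar>u i x\<bar> powr r)"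
    "(\<integral>x. (\<Prod>i\<in>J. \<bar>u i x\<bar> powr r) \<partial>lborel) \<le> (\<Sum>i\<in>J. \<integral>x. \<bar>u i x\<bar> powr (r * real (card J)) \<partial>lborel)"
proof -
  note [measurable] = H1_vec_measurable[OF u]
  have r: "r > 0" using assms(3) by (smt (verit) of_nat_0_le_iff mult_nonpos_nonneg)
  have i: "integrable lborel (\<lambda>x. \<bar>u i x\<bar> powr (r * real (card J)))" for i
    using u assms(3) by (intro integrable_powr) (auto simp: H1_vec_def)
  have le: "(\<Prod>i\<in>J. \<bar>u i x\<bar> powr r) \<le> (\<Sum>i\<in>J. \<bar>u i x\<bar> powr (r * real (card J)))" for x
    using assms(2) r by (intro prod_powr_le_sum) auto
  show int: "integrable lborel (\<lambda>x. \<Prod>i\<in>J. \<bar>u i x\<bar> powr r)"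
  proof (rule Bochner_Integration.integrable_bound)
    show "integrable lborel (\<lambda>x. \<Sum>i\<in>J. \<bar>u i x\<bar> powr (r * real (card J)))" using i by simp
    show "AE x in lborel. norm (\<Prod>i\<in>J. \<bar>u i x\<bar> powr r) \<le> norm (\<Sum>i\<in>J. \<bar>u i x\<bar> powr (r * real (card J)))"
      using le by (intro AE_I2) (simp add: prod_nonneg sum_nonneg)
  qed measurable
  have "(\<integral>x. (\<Prod>i\<in>J. \<bar>u i x\<bar> powr r) \<partial>lborel) \<le> (\<integral>x. (\<Sum>i\<in>J. \<bar>u i x\<bar> powr (r * real (card J))) \<partial>lborel)"
    using i int le by (intro integral_mono) auto
  also have "\<dots> = (\<Sum>i\<in>J. \<integral>x. \<bar>u i x\<bar> powr (r * real (card J)) \<partial>lborel)"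
    using i by simp
  finally show "(\<integral>x. (\<Prod>i\<in>J. \<bar>u i x\<bar> powr r) \<partial>lborel) \<le> (\<Sum>i\<in>J. \<integral>x. \<bar>u i x\<bar> powr (r * real (card J)) \<partial>lborel)" .
qed

lemma integrable_Dq: "u \<in> H1_vec \<Longrightarrow> integrable lborel (\<lambda>x. \<Prod>i\<in>UNIV. \<bar>(u :: ('k, 'd) vfun) i x\<bar> powr q)"
  using p_gt by (intro integrable_prod) (auto simp: mult.commute p_eq)

lemma integral_powr_pos:
  fixes u :: "real ^ 'd \<Rightarrow> real"
  assumes "u \<in> H1" "\<not> ae_zero u" shows "(\<integral>x. \<bar>u x\<bar> powr p \<partial>lborel) > 0"
proof -
  have "(\<integral>x. \<bar>u x\<bar> powr p \<partial>lborel) \<noteq> 0"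
    using assms p_gt integral_nonneg_eq_0_iff_AE[OF integrable_powr[OF assms(1), of p]] by (auto simp: ae_zero_def)
  moreover have "(\<integral>x. \<bar>u x\<bar> powr p \<partial>lborel) \<ge> 0" by simp
  ultimately show ?thesis by linarith
qed

lemma Dq_nonneg: "Dq u \<ge> 0" by (auto simp: Dq_def intro!: integral_nonneg_AE AE_I2 prod_nonneg)

lemma Dq_eq_0_iff:
  assumes "u \<in> H1_vec" shows "Dq u = 0 \<longleftrightarrow> ae_zero (\<lambda>x. \<Prod>i\<in>UNIV. u i x)"
proof -
  have "Dq u = 0 \<longleftrightarrow> (AE x in lborel. (\<Prod>i\<in>UNIV. \<bar>u i x\<bar> powr q) = 0)"
    unfolding Dq_def by (rule integral_nonneg_eq_0_iff_AE[OF integrable_Dq[OF assms]]) (auto intro!: AE_I2 prod_nonneg)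
  then show ?thesis by (simp add: ae_zero_def)
qed

lemma Dq_pos: "u \<in> H1_vec \<Longrightarrow> \<not> ae_zero (\<lambda>x. \<Prod>i\<in>UNIV. u i x) \<Longrightarrow> Dq u > 0"
  using Dq_nonneg[of u] Dq_eq_0_iff[of u] by linarith

lemma Mu_eq: "Mu u = (\<Sum>i\<in>UNIV. mu i * (\<integral>x. \<bar>u i x\<bar> powr p \<partial>lborel))"
  by (simp add: Mu_def)

definition bump :: "real ^ 'd \<Rightarrow> real" where "bump = box_bump 0 0 (\<chi> i. 1)"

lemma bump_H1: "bump \<in> H1"
  unfolding bump_def by (rule H1_pair_imp_H1[OF test_function_H1_pair[OF box_bump_test]])

lemma bump_not_ae_zero: "\<not> ae_zero bump"
proof
  assume "ae_zero bump"
  then have "AE x in lborel. x \<notin> box (0 :: real ^ 'd) (\<chi> i. 1)"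
    unfolding ae_zero_def bump_def by eventually_elim (use box_bump_neq_0_iff in blast)
  then have "emeasure lborel (box (0 :: real ^ 'd) (\<chi> i. 1)) = 0"
    using AE_iff_measurable[of "box 0 (\<chi> i. 1)" lborel "\<lambda>x. x \<notin> box (0 :: real ^ 'd) (\<chi> i. 1)"] by auto
  moreover have "emeasure lborel (box (0 :: real ^ 'd) (\<chi> i. 1)) = 1"
  proof -
    have "((\<chi> i. 1) :: real ^ 'd) \<bullet> b = 1" if "b \<in> Basis" for b
      using that by (auto simp: Basis_vec_def inner_axis)
    then show ?thesis by (simp add: emeasure_lborel_box_eq)
  qed
  ultimately show False by simp
qed

text \<open>A real infimum is informative over a nonempty set that is bounded below;
  \<open>bump\<close> and the Sobolev inequality provide both, with a positive bound for each
  component. The inequality is the defining property of \<open>S\<close> raised to the power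
  \<open>p / 2\<close>.\<close>

lemma S_pos: "S > 0" and S_ineq: "(u :: real ^ 'd \<Rightarrow> real) \<in> H1 \<Longrightarrow> mu i * (\<integral>x. \<bar>u x\<bar> powr p \<partial>lborel) \<le> cS * sqnorm (lam i) u powr (p / 2)"
proof -
  have p2: "p \<ge> 2" using p_gt by simp
  let ?A = "\<lambda>i. (\<lambda>u :: real ^ 'd \<Rightarrow> real. sqnorm (lam i) u / (\<integral>x. mu i * \<bar>u x\<bar> powr p \<partial>lborel) powr (2 / p)) ` {u \<in> H1. \<not> ae_zero u}"
  obtain C where C: "C > 0" "\<And>i (u :: real ^ 'd \<Rightarrow> real). u \<in> H1 \<Longrightarrow> integrable lborel (\<lambda>x. \<bar>u x\<bar> powr p) \<and>
     (\<integral>x. \<bar>u x\<bar> powr p \<partial>lborel) \<le> C * sqnorm (lam i) u powr (p / 2)"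
    using Sobolev[OF p2] by metis
  have lower: "1 / (mu i * C) powr (2 / p) \<le> sqnorm (lam i) u / (\<integral>x. mu i * \<bar>u x\<bar> powr p \<partial>lborel) powr (2 / p)"
    if u: "u \<in> H1" "\<not> ae_zero u" for i and u :: "real ^ 'd \<Rightarrow> real"
  proof -
    define N where "N = (\<integral>x. mu i * \<bar>u x\<bar> powr p \<partial>lborel)"
    have N: "N > 0" using integral_powr_pos[OF u] mu_pos[of i] by (simp add: N_def)
    have "N \<le> mu i * C * sqnorm (lam i) u powr (p / 2)"
      using C(2)[OF u(1), of i] mu_pos[of i] by (simp add: mult.assoc N_def)
    then have "N powr (2 / p) \<le> (mu i * C * sqnorm (lam i) u powr (p / 2)) powr (2 / p)"
      using N p2 by (intro powr_mono2) auto
    also have "\<dots> = (mu i * C) powr (2 / p) * sqnorm (lam i) u"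
      using p_gt sqnorm_nonneg[OF u(1)] by (simp add: powr_mult powr_powr)
    finally show ?thesis using N C(1) mu_pos[of i] unfolding N_def[symmetric]
      by (simp add: pos_divide_le_eq pos_le_divide_eq mult.commute)
  qed
  have bdd: "bdd_below (?A i)" for i using lower by (intro bdd_belowI) auto
  have ne: "?A i \<noteq> {}" for i using bump_H1 bump_not_ae_zero by blast
  have "sobolev_const T p (lam i) (mu i) \<ge> 1 / (mu i * C) powr (2 / p)" for i
    unfolding sobolev_const_def by (rule cInf_greatest[OF ne]) (use lower in auto)
  moreover have "1 / (mu i * C) powr (2 / p) > 0" for i using C(1) mu_pos[of i] by simp
  ultimately have pos: "sobolev_const T p (lam i) (mu i) > 0" for i by (rule less_le_trans[rotated])
  have "S \<in> range (\<lambda>i. sobolev_const T p (lam i) (mu i))"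
    unfolding S_def S_bar_def p_eq[symmetric] by (rule Min_in) auto
  then show S0: "S > 0" using pos by auto
  assume u: "u \<in> H1"
  show "mu i * (\<integral>x. \<bar>u x\<bar> powr p \<partial>lborel) \<le> cS * sqnorm (lam i) u powr (p / 2)"
  proof (cases "ae_zero u")
    case True
    have [measurable]: "u \<in> borel_measurable borel" using H1_measurable[OF u] .
    have "(\<integral>x. \<bar>u x\<bar> powr p \<partial>lborel) = (\<integral>x. 0 \<partial>(lborel :: (real ^ 'd) measure))"
      by (rule integral_cong_AE) (use True in \<open>auto simp: ae_zero_def\<close>)
    then show ?thesis by (simp add: cS_def)
  next
    case False
    define N where "N = (\<integral>x. mu i * \<bar>u x\<bar> powr p \<partial>lborel)"
    have N: "N > 0" using integral_powr_pos[OF u False] mu_pos[of i] by (simp add: N_def)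
    have "S \<le> sobolev_const T p (lam i) (mu i)"
      unfolding S_def S_bar_def p_eq[symmetric] by (rule Min_le) auto
    also have "\<dots> \<le> sqnorm (lam i) u / N powr (2 / p)"
      unfolding sobolev_const_def N_def using u False by (intro cInf_lower bdd) auto
    finally have "S * N powr (2 / p) \<le> sqnorm (lam i) u" using N by (simp add: field_simps)
    then have "(S * N powr (2 / p)) powr (p / 2) \<le> sqnorm (lam i) u powr (p / 2)"
      using S0 N p2 by (intro powr_mono2) auto
    moreover have "(S * N powr (2 / p)) powr (p / 2) = S powr (p / 2) * N"
      using p_gt N by (simp add: powr_mult powr_powr)
    ultimately have "cS * (S powr (p / 2) * N) \<le> cS * sqnorm (lam i) u powr (p / 2)"
      by (simp add: cS_def mult_left_mono)
    moreover have "cS * S powr (p / 2) = 1" using S0 by (simp add: cS_def powr_add[symmetric])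
    ultimately show ?thesis by (simp add: mult.assoc[symmetric] N_def)
  qed
qed

lemma cS_pos: "cS > 0" using S_pos by (simp add: cS_def)

lemma nrm_nonneg: "u \<in> H1_vec \<Longrightarrow> nrm u \<ge> 0"
  by (auto simp: nrm_def H1_vec_def intro!: sum_nonneg sqnorm_nonneg)

lemma sqnorm_le_nrm: "u \<in> H1_vec \<Longrightarrow> sqnorm (lam i) (u i) \<le> nrm u"
  unfolding nrm_def by (rule member_le_sum) (auto simp: H1_vec_def intro: sqnorm_nonneg)

lemma Mu_le_sum: "u \<in> H1_vec \<Longrightarrow> Mu u \<le> cS * (\<Sum>i\<in>UNIV. sqnorm (lam i) (u i) powr (p / 2))"
  unfolding Mu_eq sum_distrib_left by (intro sum_mono S_ineq) (simp add: H1_vec_def)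

text \<open>Any common bound \<open>m\<close> of the squared norms is allowed, not just their sum.
  With \<open>m\<close> the largest of them this measures how far one component is from carrying
  everything, a gain exploited in \<open>Dq_bounded_below\<close>.\<close>

lemma sum_powr_le_nrm:
  assumes u: "u \<in> H1_vec" and m: "\<And>i. sqnorm (lam i) (u i) \<le> m"
  shows "(\<Sum>i\<in>UNIV. sqnorm (lam i) (u i) powr (p / 2)) \<le> m powr (p / 2 - 1) * nrm u"
  unfolding nrm_def using p_gt m u by (intro sum_powr_le_powr_sum) (auto simp: H1_vec_def intro: sqnorm_nonneg)

lemma Mu_le: assumes "u \<in> H1_vec" shows "Mu u \<le> cS * nrm u powr (p / 2)"
proof -
  have "Mu u \<le> cS * (nrm u powr (p / 2 - 1) * nrm u powr 1)"
    using Mu_le_sum[OF assms] sum_powr_le_nrm[OF assms sqnorm_le_nrm[OF assms]] cS_pos nrm_nonneg[OF assms]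
    by (auto intro: order.trans mult_left_mono)
  then show ?thesis unfolding powr_add[symmetric] by simp
qed

abbreviation admissible :: "('k, 'd) vfun set" where
  "admissible \<equiv> {u \<in> H1_vec. \<not> ae_zero (\<lambda>x. \<Prod>i\<in>UNIV. u i x)}"

definition quot :: "('k, 'd) vfun \<Rightarrow> real" where
  "quot u = (cS * nrm u powr (p / 2) - Mu u) / (real CARD('k) * Dq u)"

lemma beta_eq: "\<beta> = (INF u\<in>admissible. quot u)"
  unfolding \<beta>_def beta_bar_def quot_def cS_def S_def nrm_def Mu_def Dq_def p_eq[symmetric] ..

lemma quot_nonneg: "u \<in> admissible \<Longrightarrow> 0 \<le> quot u"
  unfolding quot_def using Mu_le Dq_pos by (auto intro!: divide_nonneg_pos mult_pos_pos)

lemma beta_le: "u \<in> admissible \<Longrightarrow> \<beta> \<le> quot u"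
  unfolding beta_eq by (rule cINF_lower) (auto intro!: bdd_belowI[of _ 0] quot_nonneg)

lemma admissible_nonempty: "admissible \<noteq> {}"
proof -
  have "(\<lambda>_ :: 'k. bump) \<in> admissible"
    using bump_not_ae_zero by (auto simp: H1_vec_def bump_H1 ae_zero_def)
  then show ?thesis by blast
qed

lemma beta_nonneg: "\<beta> \<ge> 0"
  unfolding beta_eq by (rule cINF_greatest[OF admissible_nonempty quot_nonneg])

text \<open>If the product vanishes, the interaction does too and \<open>Mu_le\<close> remains;
  otherwise this is the definition of \<open>\<beta>\<close> solved for \<open>G u\<close>.\<close>

lemma G_le: assumes u: "u \<in> H1_vec" shows "G u \<le> cS * nrm u powr (p / 2)"
proof (cases "ae_zero (\<lambda>x. \<Prod>i\<in>UNIV. u i x)")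
  case True
  then show ?thesis using Mu_le[OF u] Dq_eq_0_iff[OF u] by (simp add: G_def)
next
  case False
  then have "\<beta> \<le> quot u" "Dq u > 0" using u beta_le Dq_pos by auto
  then show ?thesis unfolding quot_def G_def by (simp add: field_simps)
qed

lemma nrm_scale: "u \<in> H1_vec \<Longrightarrow> nrm (\<lambda>i x. t * u i x) = t\<^sup>2 * nrm u"
proof -
  assume u: "u \<in> H1_vec"
  have "sqnorm (lam i) (\<lambda>x. t * u i x) = t\<^sup>2 * sqnorm (lam i) (u i)" for i
    unfolding sqnorm_eq[OF H1_vecD[OF u]] sqnorm_eq[OF H1_pair_cmult[OF H1_vecD[OF u]]]
    by (simp add: ip2_def power2_eq_square algebra_simps)
  then show ?thesis by (simp add: nrm_def sum_distrib_left)
qed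

lemma Mu_scale: "t > 0 \<Longrightarrow> Mu (\<lambda>i x. t * u i x) = t powr p * Mu u"
  by (simp add: Mu_eq sum_distrib_left abs_mult powr_mult mult_ac)

lemma Dq_scale: "t > 0 \<Longrightarrow> Dq (\<lambda>i x. t * u i x) = t powr p * Dq u"
  by (simp add: Dq_def abs_mult powr_mult prod.distrib powr_power mult.commute[of q] p_eq)

lemma scale_H1_vec: "u \<in> H1_vec \<Longrightarrow> (\<lambda>i x. t * u i x) \<in> H1_vec"
  by (rule H1_vecI[OF H1_pair_cmult[OF H1_vecD]])

lemma nrm_pos:
  assumes "u \<in> H1_vec" "\<not> ae_zero (u i)" shows "nrm u > 0"
proof -
  have "nrm u \<noteq> 0"
  proof
    assume 0: "nrm u = 0"
    have ui: "u i \<in> H1" using assms(1) by (simp add: H1_vec_def)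
    have "sqnorm (lam i) (u i) = 0" using sqnorm_le_nrm[OF assms(1), of i] sqnorm_nonneg[OF ui, of i] 0 by simp
    then have "mu i * (\<integral>x. \<bar>u i x\<bar> powr p \<partial>lborel) \<le> 0" using S_ineq[OF ui, of i] by simp
    then show False using integral_powr_pos[OF ui assms(2)] mu_pos[of i] by (simp add: mult_le_0_iff)
  qed
  then show ?thesis using nrm_nonneg[OF assms(1)] by simp
qed

lemma admissible_component:
  assumes "\<not> ae_zero (\<lambda>x. \<Prod>i\<in>UNIV. u i x)" shows "\<not> ae_zero ((u :: ('k, 'd) vfun) i)"
proof
  assume "ae_zero (u i)"
  then have "AE x in lborel. (\<Prod>i\<in>UNIV. u i x) = 0" unfolding ae_zero_def by eventually_elim auto
  then show False using assms by (simp add: ae_zero_def)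
qed

text \<open>Cauchy--Schwarz separates \<open>u j\<close> from the product of the other components.
  On the unit sphere the latter is bounded by the Sobolev inequality, and the former yields the
  power \<open>q / 2\<close> of its squared norm.\<close>

lemma Dq_le_component:
  obtains C where "C > 0" "\<And>u j. u \<in> H1_vec \<Longrightarrow> nrm u = 1 \<Longrightarrow> Dq u \<le> C * sqnorm (lam j) (u j) powr (q / 2)"
proof -
  \<comment> \<open>The exponent that \<open>prod_powr_le_sum\<close> produces from the squared
    product of the other \<open>CARD('k) - 1\<close> factors.\<close>
  define r where "r = 2 * q * (real CARD('k) - 1)"
  have r: "r \<ge> 2"
  proof -
    have "2 * q * 1 \<le> r" unfolding r_def using K3 q2 by (intro mult_left_mono) auto
    then show ?thesis using q2 by simp
  qed
  have "2 * q \<ge> 2" using q2 by simp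
  then obtain C1 where C1: "C1 > 0" "\<And>i (u :: real ^ 'd \<Rightarrow> real). u \<in> H1 \<Longrightarrow> integrable lborel (\<lambda>x. \<bar>u x\<bar> powr (2 * q)) \<and>
     (\<integral>x. \<bar>u x\<bar> powr (2 * q) \<partial>lborel) \<le> C1 * sqnorm (lam i) u powr (2 * q / 2)"
    using Sobolev by metis
  obtain C2 where C2: "C2 > 0" "\<And>i (u :: real ^ 'd \<Rightarrow> real). u \<in> H1 \<Longrightarrow> integrable lborel (\<lambda>x. \<bar>u x\<bar> powr r) \<and>
     (\<integral>x. \<bar>u x\<bar> powr r \<partial>lborel) \<le> C2 * sqnorm (lam i) u powr (r / 2)"
    using Sobolev[OF r] by metis
  define C where "C = sqrt (C1 * (real CARD('k) * C2))"
  have "C > 0" using C1 C2 by (simp add: C_def)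
  moreover have "Dq u \<le> C * sqnorm (lam j) (u j) powr (q / 2)" if u: "u \<in> H1_vec" and n: "nrm u = 1" for u j
  proof -
    note [measurable] = H1_vec_measurable[OF u]
    have uH: "u i \<in> H1" for i using u by (simp add: H1_vec_def)
    let ?J = "UNIV - {j}"
    have J: "card ?J = CARD('k) - 1" "?J \<noteq> {}" using K3 by (auto simp: card_Diff_singleton) (metis card_1_singleton_iff One_nat_def Suc_n_not_le_n numeral_3_eq_3 Suc_leD UNIV_eq_I Diff_eq_empty_iff subset_singletonD UNIV_not_empty card.empty)
    have rJ: "2 * q * real (card ?J) = r" using K3 by (simp add: J r_def of_nat_diff)
    let ?f = "\<lambda>x. \<bar>u j x\<bar> powr q" and ?h = "\<lambda>x. \<Prod>i\<in>?J. \<bar>u i x\<bar> powr q"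
    have f2: "(norm (?f x))\<^sup>2 = \<bar>u j x\<bar> powr (2 * q)" for x
      by (simp add: powr_square)
    have h2: "(norm (?h x))\<^sup>2 = (\<Prod>i\<in>?J. \<bar>u i x\<bar> powr (2 * q))" for x
      by (simp add: prod_power_distrib powr_square)
    have int_h: "integrable lborel (\<lambda>x. \<Prod>i\<in>?J. \<bar>u i x\<bar> powr (2 * q))"
      by (rule integrable_prod(1)[OF u J(2)]) (use rJ r in simp)
    have L: "?f \<in> L2 lborel" "?h \<in> L2 lborel"
      unfolding L2_def mem_Collect_eq f2 h2 using C1(2)[OF uH, of j j] int_h by auto
    have "ip2 lborel ?f ?f \<le> C1 * sqnorm (lam j) (u j) powr q"
      unfolding ip2_self f2 using C1(2)[OF uH, of j j] by simp
    moreover have "ip2 lborel ?h ?h \<le> real CARD('k) * C2"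
    proof -
      have "ip2 lborel ?h ?h \<le> (\<Sum>i\<in>?J. \<integral>x. \<bar>u i x\<bar> powr r \<partial>lborel)"
        unfolding ip2_self h2 using integrable_prod(2)[OF u J(2), of "2 * q"] rJ r by simp
      also have "\<dots> \<le> (\<Sum>i\<in>?J. C2)"
      proof (rule sum_mono)
        fix i
        have "sqnorm (lam i) (u i) powr (r / 2) \<le> 1 powr (r / 2)"
          using sqnorm_le_nrm[OF u, of i] n r sqnorm_nonneg[OF uH] by (intro powr_mono2) auto
        then have "C2 * sqnorm (lam i) (u i) powr (r / 2) \<le> C2" using C2(1) by simp
        then show "(\<integral>x. \<bar>u i x\<bar> powr r \<partial>lborel) \<le> C2"
          using conjunct2[OF C2(2)[OF uH, of i i]] by (rule order.trans[rotated])
      qed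
      also have "\<dots> \<le> real CARD('k) * C2" using C2(1) J K3 by (simp add: mult_right_mono)
      finally show ?thesis .
    qed
    ultimately have "(ip2 lborel ?f ?h)\<^sup>2 \<le> (C1 * sqnorm (lam j) (u j) powr q) * (real CARD('k) * C2)"
      using ip2_Cauchy_Schwarz[OF L] C1(1) by (elim order.trans) (intro mult_mono, auto)
    then have "ip2 lborel ?f ?h \<le> sqrt ((C1 * sqnorm (lam j) (u j) powr q) * (real CARD('k) * C2))"
      by (rule real_le_rsqrt)
    also have "\<dots> = C * sqrt (sqnorm (lam j) (u j) powr q)"
      by (simp add: C_def real_sqrt_mult)
    also have "sqrt (sqnorm (lam j) (u j) powr q) = sqnorm (lam j) (u j) powr (q / 2)"
      by (simp add: powr_half_sqrt[symmetric] powr_powr)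
    also have "ip2 lborel ?f ?h = Dq u"
      unfolding ip2_def Dq_def by (intro Bochner_Integration.integral_cong refl) (simp add: prod.remove[of UNIV j])
    finally show ?thesis .
  qed
  ultimately show ?thesis using that by blast
qed

text \<open>If \<open>Dq u\<close> were small, all but one of the components would be small, of total size \<open>t\<close> say; then
  the numerator of \<open>quot u\<close> is at least of order \<open>t\<close> while \<open>Dq u\<close> is of order \<open>t\<close> to the power \<open>q / 2 > 1\<close>.\<close>

lemma Dq_bounded_below:
  obtains \<delta> where "\<delta> > 0" "\<And>u. u \<in> admissible \<Longrightarrow> nrm u = 1 \<Longrightarrow> quot u \<le> \<beta> + 1 \<Longrightarrow> Dq u \<ge> \<delta>"
proof -
  obtain C where C: "C > 0" "\<And>u j. u \<in> H1_vec \<Longrightarrow> nrm u = 1 \<Longrightarrow> Dq u \<le> C * sqnorm (lam j) (u j) powr (q / 2)"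
    using Dq_le_component by metis
  define b where "b = real CARD('k) * (\<beta> + 1)"
  have b: "b > 0" using beta_nonneg K3 by (simp add: b_def)
  \<comment> \<open>For \<open>0 < t < t0\<close> one has
    \<open>b * C * t powr (q / 2) < cS * t\<close>, because \<open>q / 2 > 1\<close>. The lower and
    upper estimates of \<open>Dq u\<close> are then incompatible, which forces
    \<open>t \<ge> t0\<close>.\<close>
  define t0 where "t0 = (cS / (b * C)) powr (1 / (q / 2 - 1))"
  have t0: "t0 > 0" using cS_pos b C(1) by (simp add: t0_def)
  have "Dq u \<ge> cS * t0 / b" if u: "u \<in> admissible" and n: "nrm u = 1" and Q: "quot u \<le> \<beta> + 1" for u
  proof -
    have uv: "u \<in> H1_vec" and D: "Dq u > 0" using u Dq_pos by auto
    let ?a = "\<lambda>i. sqnorm (lam i) (u i)"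
    have a0: "?a i \<ge> 0" for i using uv by (auto simp: H1_vec_def intro: sqnorm_nonneg)
    define m where "m = Max (range ?a)"
    have am: "?a i \<le> m" for i unfolding m_def by (intro Max_ge) auto
    have "m \<in> range ?a" unfolding m_def by (rule Max_in) auto
    then obtain i0 where i0: "m = ?a i0" by auto
    define t where "t = 1 - m"
    have m: "0 \<le> m" "m \<le> 1" using i0 a0 sqnorm_le_nrm[OF uv] n by auto
    have "card (UNIV - {i0}) > 0" using K3 by (simp add: card_Diff_singleton)
    \<comment> \<open>Any second component will do: its squared norm is part of
      \<open>t = 1 - m\<close>.\<close>
    then obtain j where j: "j \<noteq> i0" by (metis Diff_iff card_gt_0_iff ex_in_conv singletonI)
    have "?a i0 + ?a j = (\<Sum>i\<in>{i0, j}. ?a i)" using j by simp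
    also have "\<dots> \<le> nrm u" unfolding nrm_def using a0 by (intro sum_mono2) auto
    finally have ajt: "?a j \<le> t" using n i0 by (simp add: t_def)
    have "cS * t \<le> cS * 1 powr (p / 2) - Mu u"
    proof -
      \<comment> \<open>As \<open>p / 2 - 1 \<ge> 1\<close> and \<open>m \<le> 1\<close>, the
        exponent may be lowered to 1; so \<open>Mu u\<close> falls short of \<open>cS\<close> by at
        least \<open>cS * t\<close>.\<close>
      have "m powr (p / 2 - 1) \<le> m powr 1" using m p_gt by (intro powr_mono') auto
      then have "(\<Sum>i\<in>UNIV. ?a i powr (p / 2)) \<le> m"
        using sum_powr_le_nrm[OF uv am] n m(1) by simp
      then have "cS * (\<Sum>i\<in>UNIV. ?a i powr (p / 2)) \<le> cS * m" using cS_pos by simp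
      then have "Mu u \<le> cS * m" using Mu_le_sum[OF uv] by linarith
      then show ?thesis by (simp add: t_def algebra_simps)
    qed
    also have "\<dots> = quot u * (real CARD('k) * Dq u)" using D n by (simp add: quot_def)
    also have "\<dots> \<le> (\<beta> + 1) * (real CARD('k) * Dq u)" using Q D by (intro mult_right_mono) auto
    also have "\<dots> = b * Dq u" by (simp add: b_def)
    finally have le: "cS * t \<le> b * Dq u" .
    have "?a j powr (q / 2) \<le> t powr (q / 2)" using ajt a0 q2 by (intro powr_mono2) auto
    then have D2: "Dq u \<le> C * t powr (q / 2)" using C(2)[OF uv n, of j] C(1) by (meson mult_left_mono less_imp_le order.trans)
    have t: "t > 0"
    proof (rule ccontr)
      assume "\<not> t > 0"
      then have "t = 0" using m by (simp add: t_def)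
      then show False using D2 D q2 by simp
    qed
    have "cS * t \<le> b * (C * t powr (q / 2))" using le D2 b by (meson mult_left_mono less_imp_le order.trans)
    also have "t powr (q / 2) = t powr (q / 2 - 1) * t powr 1" unfolding powr_add[symmetric] by simp
    finally have "cS * t \<le> b * C * t powr (q / 2 - 1) * t" using t by (simp add: mult.assoc)
    then have "cS / (b * C) \<le> t powr (q / 2 - 1)" using t b C(1) by (simp add: field_simps)
    then have "t0 \<le> (t powr (q / 2 - 1)) powr (1 / (q / 2 - 1))"
      unfolding t0_def using q2 cS_pos b C(1) by (intro powr_mono2) auto
    also have "\<dots> = t" using t q2 by (simp add: powr_powr)
    finally have "cS * t0 \<le> b * Dq u" using le cS_pos by (meson mult_left_mono less_imp_le order.trans)
    then show ?thesis using b by (simp add: field_simps)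
  qed
  moreover have "cS * t0 / b > 0" using cS_pos t0 b by simp
  ultimately show ?thesis using that by blast
qed

end

subsection \<open>Weak limits of vector functions\<close>

lemma L2_bounded_linear:
  fixes A :: "'e::euclidean_space \<Rightarrow> 'f::euclidean_space"
  assumes "bounded_linear A"
  shows "\<exists>K. \<forall>f \<in> L2 M. (\<lambda>x. A (f x)) \<in> L2 M \<and> ip2 M (\<lambda>x. A (f x)) (\<lambda>x. A (f x)) \<le> K * ip2 M f f"
proof -
  interpret bounded_linear A by (rule assms)
  obtain K where K: "\<And>x. norm (A x) \<le> norm x * K" using bounded by blast
  have le: "(norm (A x))\<^sup>2 \<le> K\<^sup>2 * (norm x)\<^sup>2" for x
    using power_mono[OF K[of x], of 2] by (simp add: power_mult_distrib mult.commute)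
  have Am: "A \<in> borel_measurable borel"
    by (intro borel_measurable_continuous_onI linear_continuous_on assms)
  have "(\<lambda>x. A (f x)) \<in> L2 M \<and> ip2 M (\<lambda>x. A (f x)) (\<lambda>x. A (f x)) \<le> K\<^sup>2 * ip2 M f f" if f: "f \<in> L2 M" for f
  proof -
    have m: "(\<lambda>x. A (f x)) \<in> borel_measurable M" by (rule measurable_compose[OF L2_measurable[OF f] Am])
    have i: "integrable M (\<lambda>x. K\<^sup>2 * (norm (f x))\<^sup>2)" by (intro integrable_mult_right L2_integrable_norm f)
    have j: "integrable M (\<lambda>x. (norm (A (f x)))\<^sup>2)"
      by (rule Bochner_Integration.integrable_bound[OF i]) (use le m in \<open>auto simp: abs_mult\<close>)
    have "(\<integral>x. (norm (A (f x)))\<^sup>2 \<partial>M) \<le> (\<integral>x. K\<^sup>2 * (norm (f x))\<^sup>2 \<partial>M)"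
      by (rule integral_mono[OF j i le])
    then show ?thesis using m j by (simp add: L2_def ip2_self)
  qed
  then show ?thesis by blast
qed

lemma L2_compose_bounded_linear: "bounded_linear A \<Longrightarrow> f \<in> L2 M \<Longrightarrow> (\<lambda>x. A (f x)) \<in> L2 M"
  using L2_bounded_linear[of A M] by blast

lemma has_weak_gradient_cong_AE:
  assumes "has_weak_gradient u g" "locally_integrable u'" "AE x in lborel. u x = u' x"
  shows "has_weak_gradient u' g"
  unfolding has_weak_gradient_def
proof (intro conjI ballI allI)
  show "locally_integrable u'" "locally_integrable g" using assms by (auto simp: has_weak_gradient_def)
  fix \<phi> :: "real ^ 'a \<Rightarrow> real" and i :: 'a assume \<phi>: "\<phi> \<in> test_functions"
  have [measurable]: "u \<in> borel_measurable borel" "u' \<in> borel_measurable borel" "partial i \<phi> \<in> borel_measurable borel"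
    using assms \<phi> by (auto simp: has_weak_gradient_def intro: locally_integrable_measurable borel_measurable_continuous_onI test_function_partial_cont)
  have "(\<integral>x. u' x * partial i \<phi> x \<partial>lborel) = (\<integral>x. u x * partial i \<phi> x \<partial>lborel)"
    using assms(3) by (intro integral_cong_AE) auto
  then show "(\<integral>x. u' x * partial i \<phi> x \<partial>lborel) = - (\<integral>x. g x $ i * \<phi> x \<partial>lborel)"
    using has_weak_gradientD[OF assms(1) \<phi>] by simp
qed

lemma powr_sum_le:
  fixes a :: "'i \<Rightarrow> real"
  assumes "finite I" "I \<noteq> {}" "\<And>i. i \<in> I \<Longrightarrow> a i \<ge> 0" "s > 0"
  shows "(\<Sum>i\<in>I. a i) powr s \<le> real (card I) powr s * (\<Sum>i\<in>I. a i powr s)"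
proof -
  define m where "m = Max (a ` I)"
  have "m \<in> a ` I" unfolding m_def using assms by (intro Max_in) auto
  then obtain k where k: "k \<in> I" "m = a k" by auto
  have le: "a i \<le> a k" if "i \<in> I" for i
    unfolding k(2)[symmetric] m_def using that assms(1) by (intro Max_ge) auto
  have "(\<Sum>i\<in>I. a i) \<le> real (card I) * a k" using sum_bounded_above[of I a "a k"] le by simp
  then have "(\<Sum>i\<in>I. a i) powr s \<le> (real (card I) * a k) powr s"
    using assms by (intro powr_mono2) (auto intro: sum_nonneg)
  also have "\<dots> = real (card I) powr s * a k powr s" by (rule powr_mult)
  also have "a k powr s \<le> (\<Sum>i\<in>I. a i powr s)" using assms k by (intro member_le_sum) auto
  finally show ?thesis by (simp add: mult_left_mono)
qed

context planar_system
begin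

text \<open>One function into a Euclidean space carries all components and gradients, so that the
  \<open>L2\<close> theory treats the whole vector at once. The factor \<open>sqrt (lam i)\<close>
  makes \<open>nrm\<close> its squared norm.\<close>

definition stack :: "('k, 'd) vfun \<Rightarrow> ('k \<Rightarrow> real ^ 'd \<Rightarrow> real ^ 'd) \<Rightarrow> real ^ 'd \<Rightarrow> (real \<times> (real ^ 'd)) ^ 'k" where
  "stack u g x = (\<chi> i. (sqrt (lam i) * u i x, g i x))"

text \<open>The second entry is rescaled because \<open>stack\<close> multiplies the function by
  \<open>sqrt (lam i)\<close> and leaves the gradient as it is.\<close>

definition weak_pairs :: "(real ^ 'd \<Rightarrow> (real \<times> (real ^ 'd)) ^ 'k) set" where
  "weak_pairs = {W \<in> L2 lborel. \<forall>i. has_weak_gradient (\<lambda>x. fst (W x $ i)) (\<lambda>x. sqrt (lam i) *\<^sub>R snd (W x $ i))}"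

lemma stack_inner: "stack u g x \<bullet> stack v h x = (\<Sum>i\<in>UNIV. lam i * (u i x \<bullet> v i x) + g i x \<bullet> h i x)"
proof -
  have "sqrt (lam i) * a * (sqrt (lam i) * b) = lam i * (a * b)" for i and a b :: real
  proof -
    have "sqrt (lam i) * a * (sqrt (lam i) * b) = (sqrt (lam i) * sqrt (lam i)) * (a * b)" by (simp only: mult_ac)
    then show ?thesis using lam_pos[of i] by simp
  qed
  then have "stack u g x $ i \<bullet> stack v h x $ i = lam i * (u i x \<bullet> v i x) + g i x \<bullet> h i x" for i
    by (simp add: stack_def)
  then show ?thesis by (subst inner_vec_def) simp
qed

lemma stack_pairs:
  assumes ug: "\<And>i. H1_pair (u i) (g i)"
  shows "stack u g \<in> weak_pairs" "nrm u = ip2 lborel (stack u g) (stack u g)"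
proof -
  have L: "u i \<in> L2 lborel" "g i \<in> L2 lborel" for i using ug by (auto simp: H1_pair_def)
  have m: "stack u g \<in> borel_measurable lborel"
    unfolding stack_def[abs_def] using H1_pair_measurable[OF ug]
    by (intro borel_measurable_vec_lambda borel_measurable_Pair) auto
  have n: "(norm (stack u g x))\<^sup>2 = (\<Sum>i\<in>UNIV. lam i * (norm (u i x))\<^sup>2 + (norm (g i x))\<^sup>2)" for x
    unfolding power2_norm_eq_inner stack_inner ..
  have int: "integrable lborel (\<lambda>x. lam i * (norm (u i x))\<^sup>2)" "integrable lborel (\<lambda>x. (norm (g i x))\<^sup>2)" for i
    by (intro integrable_mult_right L2_integrable_norm L)+
  then have "integrable lborel (\<lambda>x. (norm (stack u g x))\<^sup>2)" unfolding n by simp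
  then have BL: "stack u g \<in> L2 lborel" using m by (simp add: L2_def)
  have "has_weak_gradient (\<lambda>x. fst (stack u g x $ i)) (\<lambda>x. sqrt (lam i) *\<^sub>R snd (stack u g x $ i))" for i
    using has_weak_gradient_cmult[of "u i" "g i" "sqrt (lam i)"] ug by (simp add: stack_def H1_pair_def)
  then show "stack u g \<in> weak_pairs" using BL by (simp add: weak_pairs_def)
  have "ip2 lborel (stack u g) (stack u g) = (\<integral>x. (\<Sum>i\<in>UNIV. lam i * (norm (u i x))\<^sup>2 + (norm (g i x))\<^sup>2) \<partial>lborel)"
    unfolding ip2_self n ..
  also have "\<dots> = (\<Sum>i\<in>UNIV. lam i * ip2 lborel (u i) (u i) + ip2 lborel (g i) (g i))"
    using int by (subst Bochner_Integration.integral_sum) (auto simp: ip2_self)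
  finally show "nrm u = ip2 lborel (stack u g) (stack u g)"
    by (simp add: nrm_def sqnorm_eq[OF ug] add.commute)
qed

lemma bounded_linear_fst_nth: "bounded_linear (\<lambda>y :: (real \<times> (real ^ 'd)) ^ 'k. fst (y $ i))"
  and bounded_linear_snd_nth: "bounded_linear (\<lambda>y :: (real \<times> (real ^ 'd)) ^ 'k. snd (y $ i))"
  by (intro bounded_linear_fst_comp bounded_linear_snd_comp bounded_linear_vec_nth)+

lemma weak_pairs_components:
  assumes "W \<in> weak_pairs"
  shows "(\<lambda>x. fst (W x $ i)) \<in> L2 lborel" "(\<lambda>x. snd (W x $ i)) \<in> L2 lborel"
  using assms by (auto simp: weak_pairs_def intro: L2_compose_bounded_linear[OF bounded_linear_fst_nth] L2_compose_bounded_linear[OF bounded_linear_snd_nth])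

text \<open>Bounded linear projections to the entries preserve strong convergence, so both closure
  properties reduce to those of weak gradients.\<close>

lemma weak_pairs_closed: "L2_mid_closed lborel weak_pairs"
  unfolding L2_mid_closed_def
proof (intro conjI ballI allI impI)
  fix f g assume fg: "f \<in> weak_pairs" "g \<in> weak_pairs"
  have "has_weak_gradient (\<lambda>x. (1/2) * (fst (f x $ i) + fst (g x $ i))) (\<lambda>x. (1/2) *\<^sub>R (sqrt (lam i) *\<^sub>R snd (f x $ i) + sqrt (lam i) *\<^sub>R snd (g x $ i)))" for i
    using fg by (intro has_weak_gradient_cmult has_weak_gradient_add) (auto simp: weak_pairs_def)
  moreover have "(\<lambda>x. (1/2) *\<^sub>R (f x + g x)) \<in> L2 lborel"
    using fg by (intro L2_scaleR L2_add) (auto simp: weak_pairs_def)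
  ultimately show "(\<lambda>x. (1/2) *\<^sub>R (f x + g x)) \<in> weak_pairs"
    by (simp add: weak_pairs_def scaleR_add_right distrib_left mult.commute)
next
  fix h :: "nat \<Rightarrow> real ^ 'd \<Rightarrow> (real \<times> (real ^ 'd)) ^ 'k" and F
  assume h: "\<forall>n. h n \<in> weak_pairs" and F: "F \<in> L2 lborel"
    and lim: "(\<lambda>n. ip2 lborel (\<lambda>x. h n x - F x) (\<lambda>x. h n x - F x)) \<longlonglongrightarrow> 0"
  have hL: "h n \<in> L2 lborel" for n using h by (simp add: weak_pairs_def)
  have comp: "(\<lambda>n. ip2 lborel (\<lambda>x. A (h n x) - A (F x)) (\<lambda>x. A (h n x) - A (F x))) \<longlonglongrightarrow> 0"
    "(\<lambda>x. A (h n x)) \<in> L2 lborel" "(\<lambda>x. A (F x)) \<in> L2 lborel"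
    if A: "bounded_linear A" for A :: "(real \<times> (real ^ 'd)) ^ 'k \<Rightarrow> 'f::euclidean_space" and n
  proof -
    obtain K where K: "\<forall>f \<in> L2 (lborel :: (real ^ 'd) measure). (\<lambda>x. A (f x)) \<in> L2 lborel \<and> ip2 lborel (\<lambda>x. A (f x)) (\<lambda>x. A (f x)) \<le> K * ip2 lborel f f"
      using L2_bounded_linear[OF A] ..
    show "(\<lambda>x. A (h n x)) \<in> L2 lborel" "(\<lambda>x. A (F x)) \<in> L2 lborel"
      by (intro L2_compose_bounded_linear[OF A] hL F)+
    have le: "ip2 lborel (\<lambda>x. A (h n x) - A (F x)) (\<lambda>x. A (h n x) - A (F x)) \<le> K * ip2 lborel (\<lambda>x. h n x - F x) (\<lambda>x. h n x - F x)" for n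
      using bspec[OF K L2_diff[OF hL[of n] F]] by (simp add: bounded_linear.linear[OF A] linear_diff)
    have lim': "(\<lambda>n. K * ip2 lborel (\<lambda>x. h n x - F x) (\<lambda>x. h n x - F x)) \<longlonglongrightarrow> 0"
      using tendsto_mult_left[OF lim, of K] by simp
    show "(\<lambda>n. ip2 lborel (\<lambda>x. A (h n x) - A (F x)) (\<lambda>x. A (h n x) - A (F x))) \<longlonglongrightarrow> 0"
      by (rule tendsto_sandwich[OF always_eventually[OF allI[OF ip2_self_nonneg]] always_eventually[OF allI[OF le]] tendsto_const lim'])
  qed
  have "has_weak_gradient (\<lambda>x. fst (F x $ i)) (\<lambda>x. sqrt (lam i) *\<^sub>R snd (F x $ i))" for i
  proof (rule has_weak_gradient_limit)
    note bl = bounded_linear_fst_nth[of i] bounded_linear_compose[OF bounded_linear_scaleR_right[of "sqrt (lam i)"] bounded_linear_snd_nth[of i]]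
    show "has_weak_gradient (\<lambda>x. fst (h n x $ i)) (\<lambda>x. sqrt (lam i) *\<^sub>R snd (h n x $ i))" for n
      using h by (simp add: weak_pairs_def)
    show "(\<lambda>x. fst (h n x $ i)) \<in> L2 lborel" "(\<lambda>x. sqrt (lam i) *\<^sub>R snd (h n x $ i)) \<in> L2 lborel" for n
      by (rule comp(2)[OF bl(1)], rule comp(2)[OF bl(2)])
    show "(\<lambda>x. fst (F x $ i)) \<in> L2 lborel" "(\<lambda>x. sqrt (lam i) *\<^sub>R snd (F x $ i)) \<in> L2 lborel"
      by (rule comp(3)[OF bl(1)], rule comp(3)[OF bl(2)])
    show "(\<lambda>n. ip2 lborel (\<lambda>x. fst (h n x $ i) - fst (F x $ i)) (\<lambda>x. fst (h n x $ i) - fst (F x $ i))) \<longlonglongrightarrow> 0"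
      by (rule comp(1)[OF bl(1)])
    show "(\<lambda>n. ip2 lborel (\<lambda>x. sqrt (lam i) *\<^sub>R snd (h n x $ i) - sqrt (lam i) *\<^sub>R snd (F x $ i))
        (\<lambda>x. sqrt (lam i) *\<^sub>R snd (h n x $ i) - sqrt (lam i) *\<^sub>R snd (F x $ i))) \<longlonglongrightarrow> 0"
      by (rule comp(1)[OF bl(2)])
  qed
  then show "F \<in> weak_pairs" using F by (simp add: weak_pairs_def)
qed

text \<open>A function determines its weak gradient almost everywhere. This is the injectivity asked
  for by \<open>L2_weak_limit\<close>, where pointwise convergence is known for the functions
  alone.\<close>

lemma weak_pairs_inj:
  assumes F: "F \<in> weak_pairs" and H: "H \<in> weak_pairs" and eq: "AE x in lborel. (\<chi> i. fst (F x $ i)) = (\<chi> i. fst (H x $ i))"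
  shows "AE x in lborel. F x = H x"
proof -
  have "AE x in lborel. snd (F x $ i) = snd (H x $ i)" for i
  proof -
    have "AE x in lborel. fst (F x $ i) = fst (H x $ i)" using eq by eventually_elim (simp add: vec_eq_iff)
    then have "has_weak_gradient (\<lambda>x. fst (H x $ i)) (\<lambda>x. sqrt (lam i) *\<^sub>R snd (F x $ i))"
      using has_weak_gradient_cong_AE[OF _ L2_locally_integrable[OF weak_pairs_components(1)[OF H]]] F
      unfolding weak_pairs_def by blast
    moreover have "has_weak_gradient (\<lambda>x. fst (H x $ i)) (\<lambda>x. sqrt (lam i) *\<^sub>R snd (H x $ i))"
      using H by (simp add: weak_pairs_def)
    ultimately have "AE x in lborel. sqrt (lam i) *\<^sub>R snd (F x $ i) = sqrt (lam i) *\<^sub>R snd (H x $ i)"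
      by (rule has_weak_gradient_unique)
    moreover have "sqrt (lam i) \<noteq> 0" using lam_pos[of i] by simp
    ultimately show ?thesis by simp
  qed
  then have "AE x in lborel. \<forall>i. snd (F x $ i) = snd (H x $ i)" by (subst AE_all_countable) auto
  then show ?thesis using eq by eventually_elim (simp add: vec_eq_iff prod_eq_iff)
qed

lemma energy_bound:
  obtains c where "c > 0" "\<And>u i. u \<in> H1_vec \<Longrightarrow>
    ip2 lborel (u i) (u i) + ip2 lborel (weak_gradient (u i)) (weak_gradient (u i)) \<le> c * nrm u"
proof -
  obtain c where c: "c > 0" "\<And>i (u :: real ^ 'd \<Rightarrow> real) g. H1_pair u g \<Longrightarrow> ip2 lborel u u + ip2 lborel g g \<le> c * sqnorm (lam i) u"
    using energy_le_sqnorm by metis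
  have "ip2 lborel (u i) (u i) + ip2 lborel (weak_gradient (u i)) (weak_gradient (u i)) \<le> c * nrm u" if u: "u \<in> H1_vec" for u i
  proof -
    have "c * sqnorm (lam i) (u i) \<le> c * nrm u" using sqnorm_le_nrm[OF u, of i] c(1) by simp
    then show ?thesis using c(2)[OF H1_vecD[OF u], of i i] by linarith
  qed
  then show ?thesis using that c(1) by blast
qed

lemma diff_H1_vec:
  assumes "u \<in> H1_vec" "v \<in> H1_vec"
  shows "(\<lambda>i x. u i x - v i x) \<in> (H1_vec :: ('k, 'd) vfun set)"
proof (rule H1_vecI)
  fix i show "H1_pair (\<lambda>x. u i x - v i x) (\<lambda>x. weak_gradient (u i) x - weak_gradient (v i) x)"
    using H1_pair_add[OF H1_vecD[OF assms(1), of i] H1_pair_cmult[OF H1_vecD[OF assms(2), of i], of "-1"]] by simp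
qed

text \<open>Rellich's theorem provides the pointwise limit, \<open>L2_weak_limit\<close> the inner
  product with it. Expanding the squared distance to the limit then splits the norm.\<close>

lemma weak_limit:
  fixes V :: "nat \<Rightarrow> ('k, 'd) vfun"
  assumes V: "\<And>n. V n \<in> H1_vec" and nV: "\<And>n. nrm (V n) = 1"
  obtains s u where "strict_mono (s :: nat \<Rightarrow> nat)" "u \<in> H1_vec" "AE x in lborel. \<forall>i. (\<lambda>n. V (s n) i x) \<longlonglongrightarrow> u i x"
    "(\<lambda>n. nrm (\<lambda>i x. V (s n) i x - u i x)) \<longlonglongrightarrow> 1 - nrm u"
proof -
  obtain c where c: "c > 0" "\<And>u i. u \<in> H1_vec \<Longrightarrow>
    ip2 lborel (u i) (u i) + ip2 lborel (weak_gradient (u i)) (weak_gradient (u i)) \<le> c * nrm u"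
    using energy_bound by metis
  define gV where "gV n i = weak_gradient (V n i)" for n i
  have Vp: "H1_pair (V n i) (gV n i)" for n i unfolding gV_def by (rule H1_vecD[OF V])
  have e: "ip2 lborel (V n i) (V n i) + ip2 lborel (gV n i) (gV n i) \<le> (sqrt c)\<^sup>2" for n i
    using c(2)[OF V, of n i] c(1) nV by (simp add: gV_def)
  have sc: "sqrt c \<ge> 0" using c(1) by simp
  obtain s1 v where s1: "strict_mono (s1 :: nat \<Rightarrow> nat)" and v: "AE x in lborel. \<forall>i. (\<lambda>n. V (s1 n) i x) \<longlonglongrightarrow> v i x"
    by (rule H1_ae_subsequence[of V gV "sqrt c", OF d2 Vp e sc]) (rule that)
  define W where "W n = stack (V (s1 n)) (gV (s1 n))" for n
  have Wp: "W n \<in> weak_pairs" and W1: "ip2 lborel (W n) (W n) = 1" for n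
    using stack_pairs[OF Vp[of "s1 n"]] nV[of "s1 n"] by (simp_all add: W_def)
  define P :: "(real \<times> (real ^ 'd)) ^ 'k \<Rightarrow> real ^ 'k" where "P y = (\<chi> i. fst (y $ i))" for y
  have "linear P" by (auto simp: linear_iff P_def vec_eq_iff)
  then have Pb: "bounded_linear P" by (simp add: linear_conv_bounded_linear)
  have limW: "AE x in lborel. (\<lambda>n. P (W n x)) \<longlonglongrightarrow> (\<chi> i. sqrt (lam i) * v i x)"
    using v
  proof eventually_elim
    case (elim x)
    show ?case unfolding P_def W_def stack_def
      by (rule vec_tendstoI) (use elim in \<open>auto intro!: tendsto_intros\<close>)
  qed
  have sub: "weak_pairs \<subseteq> L2 lborel" by (auto simp: weak_pairs_def)
  have inj: "\<forall>F\<in>weak_pairs. \<forall>H\<in>weak_pairs. (AE x in lborel. P (F x) = P (H x)) \<longrightarrow> (AE x in lborel. F x = H x)"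
    using weak_pairs_inj unfolding P_def by blast
  have W1': "ip2 lborel (W n) (W n) \<le> 1" for n using W1 by simp
  obtain F s2 where s2: "strict_mono (s2 :: nat \<Rightarrow> nat)" and F: "F \<in> weak_pairs" "AE x in lborel. P (F x) = (\<chi> i. sqrt (lam i) * v i x)"
    and lim: "(\<lambda>n. ip2 lborel (W (s2 n)) F) \<longlonglongrightarrow> ip2 lborel F F"
    by (rule L2_weak_limit[of weak_pairs lborel W P 1 "\<lambda>x. \<chi> i. sqrt (lam i) * v i x", OF sub Wp weak_pairs_closed Pb inj W1' limW]) (rule that)
  define u where "u i x = (1 / sqrt (lam i)) * fst (F x $ i)" for i x
  \<comment> \<open>The two factors cancel but match the form that \<open>H1_pair_cmult\<close>
    produces when the scaling of \<open>stack\<close> is undone.\<close>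
  define g where "g i x = (1 / sqrt (lam i)) *\<^sub>R sqrt (lam i) *\<^sub>R snd (F x $ i)" for i x
  have up: "H1_pair (u i) (g i)" for i
  proof -
    have "H1_pair (\<lambda>x. fst (F x $ i)) (\<lambda>x. sqrt (lam i) *\<^sub>R snd (F x $ i))"
      using F(1) weak_pairs_components[OF F(1), of i] by (simp add: H1_pair_def weak_pairs_def L2_scaleR)
    from H1_pair_cmult[OF this, of "1 / sqrt (lam i)"] show ?thesis by (simp add: u_def[abs_def] g_def[abs_def])
  qed
  then have uH: "u \<in> H1_vec" by (rule H1_vecI)
  have Fb: "F = stack u g"
  proof
    fix x
    have "sqrt (lam i) \<noteq> 0" for i using lam_pos[of i] by simp
    then show "F x = stack u g x" by (simp add: stack_def u_def g_def vec_eq_iff prod_eq_iff)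
  qed
  have nu: "nrm u = ip2 lborel F F" using stack_pairs(2)[OF up] Fb by simp
  define s where "s = s1 \<circ> s2"
  have s: "strict_mono s" unfolding s_def by (rule strict_mono_o[OF s1 s2])
  have "AE x in lborel. \<forall>i. (\<lambda>n. V (s n) i x) \<longlonglongrightarrow> u i x"
    using v F(2)
  proof eventually_elim
    case (elim x)
    have "sqrt (lam i) \<noteq> 0" for i using lam_pos[of i] by simp
    then have "u i x = v i x" for i using elim(2) by (simp add: u_def P_def vec_eq_iff)
    then show ?case using elim(1) LIMSEQ_subseq_LIMSEQ[OF _ s2] by (fastforce simp: s_def o_def)
  qed
  moreover have "nrm (\<lambda>i x. V (s n) i x - u i x) = 1 - 2 * ip2 lborel (W (s2 n)) F + nrm u" for n
  proof -
    have pr: "H1_pair (\<lambda>x. V (s n) i x - u i x) (\<lambda>x. gV (s n) i x - g i x)" for i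
      using H1_pair_add[OF Vp[of "s n" i] H1_pair_cmult[OF up[of i], of "-1"]] by simp
    have "stack (\<lambda>i x. V (s n) i x - u i x) (\<lambda>i x. gV (s n) i x - g i x) = (\<lambda>x. W (s2 n) x - F x)"
      unfolding Fb by (auto simp: fun_eq_iff W_def stack_def s_def vec_eq_iff right_diff_distrib)
    then have "nrm (\<lambda>i x. V (s n) i x - u i x) = ip2 lborel (\<lambda>x. W (s2 n) x - F x) (\<lambda>x. W (s2 n) x - F x)"
      using stack_pairs(2)[OF pr] by simp
    also have "\<dots> = ip2 lborel (W (s2 n)) (W (s2 n)) - 2 * ip2 lborel (W (s2 n)) F + ip2 lborel F F"
      using Wp F(1) sub by (intro ip2_diff_self) auto
    finally show ?thesis using W1 nu by simp
  qed
  moreover have "(\<lambda>n. 1 - 2 * ip2 lborel (W (s2 n)) F + nrm u) \<longlonglongrightarrow> 1 - 2 * ip2 lborel F F + nrm u"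
    by (intro tendsto_intros lim)
  ultimately show ?thesis using that[OF s uH] nu by simp
qed

end

subsection \<open>Attainment of the critical coupling\<close>

context planar_system
begin

lemma translate:
  fixes u :: "('k, 'd) vfun"
  assumes u: "u \<in> H1_vec"
  shows "(\<lambda>i x. u i (x + z)) \<in> H1_vec" "nrm (\<lambda>i x. u i (x + z)) = nrm u"
    "Mu (\<lambda>i x. u i (x + z)) = Mu u" "Dq (\<lambda>i x. u i (x + z)) = Dq u"
proof -
  note [measurable] = H1_vec_measurable[OF u]
  note tr = H1_pair_translate[OF H1_vecD[OF u], of _ z]
  show "(\<lambda>i x. u i (x + z)) \<in> H1_vec" by (rule H1_vecI[OF tr])
  show "nrm (\<lambda>i x. u i (x + z)) = nrm u"
    unfolding nrm_def sqnorm_eq[OF tr] sqnorm_eq[OF H1_vecD[OF u]]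
    using H1_pair_measurable[OF H1_vecD[OF u]] by (simp add: ip2_translate)
  show "Mu (\<lambda>i x. u i (x + z)) = Mu u"
    unfolding Mu_def by (intro sum.cong refl integral_lborel_translate[of "\<lambda>x. mu _ * \<bar>u _ x\<bar> powr p"]) measurable
  show "Dq (\<lambda>i x. u i (x + z)) = Dq u"
    unfolding Dq_def by (intro integral_lborel_translate[of "\<lambda>x. \<Prod>i\<in>UNIV. \<bar>u i x\<bar> powr q"]) measurable
qed

lemma nn_integral_Dq:
  assumes "u \<in> H1_vec"
  shows "(\<integral>\<^sup>+x. ennreal (\<Prod>i\<in>UNIV. \<bar>u i x\<bar> powr q) \<partial>lborel) = ennreal (Dq u)"
  unfolding Dq_def by (rule nn_integral_eq_integral[OF integrable_Dq[OF assms]]) (auto intro!: AE_I2 prod_nonneg)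

text \<open>If every unit cube carried at most \<open>A\<close>, Lions' lemma would bound the whole
  interaction integral by \<open>\<delta> / 2\<close>.\<close>

lemma non_vanishing:
  assumes \<delta>: "\<delta> > 0"
  obtains A where "A > 0" "\<And>u. u \<in> H1_vec \<Longrightarrow> nrm u = 1 \<Longrightarrow> Dq u \<ge> \<delta> \<Longrightarrow>
    \<exists>z. (\<integral>\<^sup>+x. indicator (cube z 1) x * ennreal (\<Prod>i\<in>UNIV. \<bar>u i x\<bar> powr q) \<partial>lborel) > ennreal A"
proof -
  have p2: "p \<ge> 2" using p_gt by simp
  obtain C where C: "C > 0" "\<forall>(u :: ('k, 'd) vfun) g f A. (\<forall>i. H1_pair (u i) (g i)) \<longrightarrow>
    f \<in> borel_measurable borel \<longrightarrow> (\<forall>x. f x \<le> (\<Sum>i\<in>UNIV. \<bar>u i x\<bar> powr p)) \<longrightarrow> A \<ge> 0 \<longrightarrow>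
    (\<forall>z. (\<integral>\<^sup>+x. indicator (cube z 1) x * ennreal (f x) \<partial>lborel) \<le> ennreal A) \<longrightarrow>
    (\<integral>\<^sup>+x. ennreal (f x) \<partial>lborel) \<le> ennreal (C * A powr (1 - 2 / p) * (\<Sum>i\<in>UNIV. ip2 lborel (u i) (u i) + ip2 lborel (g i) (g i)))"
    using Lions_lemma[OF d2 p2, where 'k = 'k] by blast
  obtain c where c: "c > 0" "\<And>u i. u \<in> H1_vec \<Longrightarrow>
    ip2 lborel (u i) (u i) + ip2 lborel (weak_gradient (u i)) (weak_gradient (u i)) \<le> c * nrm u"
    by (rule energy_bound) (rule that)
  \<comment> \<open>The value of \<open>A powr (1 - 2 / p)\<close> for which the bound of Lions'
    lemma, with total energy at most \<open>CARD('k) * c\<close>, equals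
    \<open>\<delta> / 2\<close>.\<close>
  define b where "b = \<delta> / (2 * C * (real CARD('k) * c))"
  have b: "b > 0" using \<delta> C(1) c(1) K3 by (simp add: b_def)
  have e0: "1 - 2 / p > 0" using p_gt by simp
  define A where "A = b powr (1 / (1 - 2 / p))"
  have A: "A > 0" "A powr (1 - 2 / p) = b" using b e0 p_gt by (simp_all add: A_def powr_powr)
  have "\<exists>z. (\<integral>\<^sup>+x. indicator (cube z 1) x * ennreal (\<Prod>i\<in>UNIV. \<bar>u i x\<bar> powr q) \<partial>lborel) > ennreal A"
    if u: "u \<in> H1_vec" and n: "nrm u = 1" and D: "Dq u \<ge> \<delta>" for u
  proof (rule ccontr)
    assume "\<not> ?thesis"
    then have le: "(\<integral>\<^sup>+x. indicator (cube z 1) x * ennreal (\<Prod>i\<in>UNIV. \<bar>u i x\<bar> powr q) \<partial>lborel) \<le> ennreal A" for z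
      by (meson not_le)
    note [measurable] = H1_vec_measurable[OF u]
    have "ennreal (Dq u) \<le> ennreal (C * A powr (1 - 2 / p) * (\<Sum>i\<in>UNIV. ip2 lborel (u i) (u i) + ip2 lborel (weak_gradient (u i)) (weak_gradient (u i))))"
      unfolding nn_integral_Dq[OF u, symmetric]
    proof (rule C(2)[rule_format])
      show "(\<Prod>i\<in>UNIV. \<bar>u i x\<bar> powr q) \<le> (\<Sum>i\<in>UNIV. \<bar>u i x\<bar> powr p)" for x
        using prod_powr_le_sum[of UNIV "\<lambda>i. \<bar>u i x\<bar>" q] q2 by (simp add: p_eq mult.commute)
    qed (use A le H1_vecD[OF u] in auto)
    also have "\<dots> \<le> ennreal (C * b * (\<Sum>i\<in>(UNIV :: 'k set). c))"
      using c(2)[OF u] n C(1) b unfolding A(2) by (intro ennreal_leI mult_left_mono sum_mono) auto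
    also have "C * b * (\<Sum>i\<in>(UNIV :: 'k set). c) = \<delta> / 2"
      using C(1) c(1) K3 by (simp add: b_def)
    finally have "Dq u \<le> \<delta> / 2" using \<delta> by (simp add: ennreal_le_iff)
    then show False using D \<delta> by simp
  qed
  then show ?thesis using that A(1) by blast
qed

text \<open>Numerator and denominator of the quotient are both homogeneous of degree
  \<open>p\<close>, so almost minimal elements can be normalized.\<close>

lemma minimizing_element:
  assumes e: "e > 0"
  shows "\<exists>u\<in>admissible. nrm u = 1 \<and> quot u \<le> \<beta> + e"
proof -
  have "Inf (quot ` admissible) < \<beta> + e" using e by (simp add: beta_eq)
  then obtain u where u: "u \<in> admissible" "quot u < \<beta> + e"
    using cInf_lessD[of "quot ` admissible"] admissible_nonempty by auto
  have uv: "u \<in> H1_vec" and D: "Dq u > 0" using u(1) Dq_pos by auto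
  have n: "nrm u > 0" using nrm_pos[OF uv admissible_component[of u undefined]] u(1) by blast
  define t where "t = 1 / sqrt (nrm u)"
  have t: "t > 0" "t\<^sup>2 * nrm u = 1" using n by (auto simp: t_def power_divide)
  define w where "w = (\<lambda>i x. t * u i x)"
  have wv: "w \<in> H1_vec" unfolding w_def by (rule scale_H1_vec[OF uv])
  have "Dq w > 0" using D t by (simp add: w_def Dq_scale)
  then have wa: "w \<in> admissible" using wv Dq_eq_0_iff[OF wv] by auto
  have nw: "nrm w = 1" using t by (simp add: w_def nrm_scale[OF uv])
  have "t powr p * nrm u powr (p / 2) = (t\<^sup>2 * nrm u) powr (p / 2)"
    using t(1) n by (simp add: powr_mult powr_powr flip: powr_numeral)
  then have "t powr p * nrm u powr (p / 2) = nrm w powr (p / 2)" using t nw by simp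
  then have "quot w = (t powr p * (cS * nrm u powr (p / 2) - Mu u)) / (t powr p * (real CARD('k) * Dq u))"
    using t(1) unfolding quot_def by (simp add: w_def Mu_scale Dq_scale algebra_simps)
  also have "\<dots> = quot u" using t(1) unfolding quot_def by simp
  finally show ?thesis using u(2) wa nw by (intro bexI[of _ w]) auto
qed

text \<open>If the limit product vanished, the products truncated at height \<open>M\<close> on the
  fixed cube would tend to 0 by dominated convergence. The part above \<open>M\<close> is uniformly
  small because the squares have bounded integrals; together this contradicts the lower bound
  \<open>A\<close>.\<close>

lemma limit_admissible:
  fixes V :: "nat \<Rightarrow> ('k, 'd) vfun"
  assumes V: "\<And>n. V n \<in> H1_vec" and nV: "\<And>n. nrm (V n) = 1" and A: "A > 0"
    and low: "\<And>n. (\<integral>\<^sup>+x. indicator (cube 0 1) x * ennreal (\<Prod>i\<in>UNIV. \<bar>V n i x\<bar> powr q) \<partial>lborel) > ennreal A"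
    and u: "u \<in> H1_vec" and lim: "AE x in lborel. \<forall>i. (\<lambda>n. V n i x) \<longlonglongrightarrow> u i x"
  shows "\<not> ae_zero (\<lambda>x. \<Prod>i\<in>UNIV. u i x)"
proof
  assume z: "ae_zero (\<lambda>x. \<Prod>i\<in>UNIV. u i x)"
  note [measurable] = H1_vec_measurable[OF V]
  have p2: "2 * p \<ge> 2" using p_gt by simp
  obtain C where C: "C > 0" "\<And>i (u :: real ^ 'd \<Rightarrow> real). u \<in> H1 \<Longrightarrow> integrable lborel (\<lambda>x. \<bar>u x\<bar> powr (2 * p)) \<and>
     (\<integral>x. \<bar>u x\<bar> powr (2 * p) \<partial>lborel) \<le> C * sqnorm (lam i) u powr (2 * p / 2)"
    using Sobolev[OF p2] by metis
  define f where "f n x = (\<Prod>i\<in>UNIV. \<bar>V n i x\<bar> powr q)" for n x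
  have f0: "f n x \<ge> 0" for n x by (simp add: f_def prod_nonneg)
  have fm [measurable]: "f n \<in> borel_measurable borel" for n unfolding f_def[abs_def] by measurable
  define C2 where "C2 = real CARD('k) * C"
  have C2: "C2 > 0" using C(1) K3 by (simp add: C2_def)
  have f2: "(f n x)\<^sup>2 = (\<Prod>i\<in>UNIV. \<bar>V n i x\<bar> powr (2 * q))" for n x
    by (simp add: f_def prod_power_distrib powr_square)
  have ex: "2 * q * real (card (UNIV :: 'k set)) = 2 * p" by (simp add: p_eq)
  have int2: "integrable lborel (\<lambda>x. (f n x)\<^sup>2)" for n
    unfolding f2 using p2 by (intro integrable_prod(1)[OF V]) (auto simp: p_eq mult_ac)
  have I2: "(\<integral>x. (f n x)\<^sup>2 \<partial>lborel) \<le> C2" for n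
  proof -
    have VH: "V n i \<in> H1" for i using V by (simp add: H1_vec_def)
    have "(\<integral>x. (f n x)\<^sup>2 \<partial>lborel) \<le> (\<Sum>i\<in>UNIV. \<integral>x. \<bar>V n i x\<bar> powr (2 * q * real (card (UNIV :: 'k set))) \<partial>lborel)"
      unfolding f2 by (rule integrable_prod(2)[OF V]) (use p2 ex in auto)
    also have "\<dots> \<le> (\<Sum>i\<in>(UNIV :: 'k set). C)"
      unfolding ex
    proof (rule sum_mono)
      fix i
      have "sqnorm (lam i) (V n i) powr (2 * p / 2) \<le> 1 powr (2 * p / 2)"
        using sqnorm_le_nrm[OF V, of i n] nV[of n] p_gt sqnorm_nonneg[OF VH] by (intro powr_mono2) auto
      then have "C * sqnorm (lam i) (V n i) powr (2 * p / 2) \<le> C" using C(1) by simp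
      then show "(\<integral>x. \<bar>V n i x\<bar> powr (2 * p) \<partial>lborel) \<le> C"
        using conjunct2[OF C(2)[OF VH, of i i]] by (rule order.trans[rotated])
    qed
    finally show ?thesis by (simp add: C2_def)
  qed
  \<comment> \<open>The part above \<open>M\<close> is at most \<open>(f n x)\<^sup>2 / M\<close>,
    so this choice limits its integral to \<open>A / 2\<close>.\<close>
  define M where "M = 2 * C2 / A"
  have M: "M > 0" "C2 / M = A / 2" using C2 A by (auto simp: M_def)
  define g where "g n x = indicator (cube 0 1) x * min (f n x) M" for n and x :: "real ^ 'd"
  have gm [measurable]: "g n \<in> borel_measurable borel" for n unfolding g_def[abs_def] by measurable
  have iw: "integrable lborel (\<lambda>x. M * indicator (cube 0 1) (x :: real ^ 'd))"
    by (intro integrable_mult_right integrable_real_indicator) (auto simp: emeasure_cube)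
  have gle: "norm (g n x) \<le> M * indicator (cube 0 1) x" for n x
    using f0 M(1) by (auto simp: g_def indicator_def)
  have intg: "integrable lborel (g n)" for n
    by (rule Bochner_Integration.integrable_bound[OF iw]) (use gle M(1) in \<open>auto intro!: AE_I2 simp: abs_mult\<close>)
  have "(\<lambda>n. \<integral>x. g n x \<partial>lborel) \<longlonglongrightarrow> (\<integral>x. 0 \<partial>(lborel :: (real ^ 'd) measure))"
  proof (rule integral_dominated_convergence[OF _ _ iw])
    show "AE x in lborel. (\<lambda>n. g n x) \<longlonglongrightarrow> 0"
      using lim z unfolding ae_zero_def
    proof eventually_elim
      case (elim x)
      have "(\<lambda>n. f n x) \<longlonglongrightarrow> (\<Prod>i\<in>UNIV. \<bar>u i x\<bar> powr q)"
        unfolding f_def using elim(1) q2 by (intro tendsto_prod tendsto_powr' tendsto_rabs tendsto_const) auto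
      moreover have "(\<Prod>i\<in>UNIV. \<bar>u i x\<bar> powr q) = 0" using elim(2) by simp
      ultimately have "(\<lambda>n. indicator (cube 0 1) x * min (f n x) M) \<longlonglongrightarrow> indicator (cube 0 1) x * min 0 M"
        by (intro tendsto_intros) simp
      then show ?case using M(1) by (simp add: g_def)
    qed
  qed (use gle in auto)
  then have "\<forall>\<^sub>F n in sequentially. (\<integral>x. g n x \<partial>lborel) < A / 2" using A by (intro order_tendstoD(2)) auto
  then obtain n where n: "(\<integral>x. g n x \<partial>lborel) < A / 2" by (auto simp: eventually_sequentially)
  have pt: "indicator (cube 0 1) x * ennreal (f n x) \<le> ennreal (g n x + (f n x)\<^sup>2 / M)" for x
  proof (cases "x \<in> cube 0 1")
    case True
    have "f n x \<le> min (f n x) M + (f n x)\<^sup>2 / M"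
    proof (cases "f n x \<le> M")
      case False
      then have "M * f n x \<le> (f n x)\<^sup>2" using f0 by (simp add: power2_eq_square mult_right_mono)
      then have "f n x \<le> (f n x)\<^sup>2 / M" using M(1) by (simp add: field_simps)
      then show ?thesis using M(1) f0[of n x] by (simp add: min_def)
    qed (use M in simp)
    then show ?thesis using True by (simp add: g_def ennreal_leI)
  qed simp
  have int3: "integrable lborel (\<lambda>x. g n x + (f n x)\<^sup>2 / M)" using intg int2 by simp
  have "ennreal A < (\<integral>\<^sup>+x. indicator (cube 0 1) x * ennreal (f n x) \<partial>lborel)"
    using low[of n] by (simp add: f_def)
  also have "\<dots> \<le> (\<integral>\<^sup>+x. ennreal (g n x + (f n x)\<^sup>2 / M) \<partial>lborel)"
    by (rule nn_integral_mono) (rule pt)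
  also have "\<dots> = ennreal (\<integral>x. g n x + (f n x)\<^sup>2 / M \<partial>lborel)"
    using f0 M(1) by (intro nn_integral_eq_integral[OF int3] AE_I2) (auto simp: g_def)
  also have "(\<integral>x. g n x + (f n x)\<^sup>2 / M \<partial>lborel) = (\<integral>x. g n x \<partial>lborel) + (\<integral>x. (f n x)\<^sup>2 \<partial>lborel) / M"
    using intg int2 by simp
  finally have "A < (\<integral>x. g n x \<partial>lborel) + (\<integral>x. (f n x)\<^sup>2 \<partial>lborel) / M" using A by (simp add: ennreal_less_iff)
  moreover have "(\<integral>x. (f n x)\<^sup>2 \<partial>lborel) / M \<le> C2 / M" using I2[of n] M(1) by (simp add: divide_right_mono)
  ultimately show False using n M(2) by linarith
qed

text \<open>The integrand of \<open>G\<close> as a homogeneous function on Euclidean space, the form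
  to which the Brezis--Lieb lemma applies.\<close>

definition \<Phi> :: "real ^ 'k \<Rightarrow> real" where
  "\<Phi> y = (\<Sum>i\<in>UNIV. mu i * \<bar>y $ i\<bar> powr p) + real CARD('k) * \<beta> * (\<Prod>i\<in>UNIV. \<bar>y $ i\<bar> powr q)"

lemma \<Phi>_continuous: "continuous_on UNIV \<Phi>"
  unfolding \<Phi>_def[abs_def] using p_gt q2
  by (intro continuous_on_add continuous_on_sum continuous_on_mult continuous_on_const continuous_on_prod
      continuous_on_powr' continuous_on_rabs continuous_on_component continuous_on_id ballI conjI) auto

lemma \<Phi>_homogeneous: "t > 0 \<Longrightarrow> \<Phi> (t *\<^sub>R y) = t powr p * \<Phi> y"
proof -
  assume t: "t > 0"
  have "(\<Prod>i\<in>(UNIV :: 'k set). t powr q) = t powr p" using t by (simp add: powr_power p_eq)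
  then show ?thesis using t
    by (simp add: \<Phi>_def abs_mult powr_mult prod.distrib sum_distrib_left distrib_left mult_ac)
qed

lemma G_integral: assumes u: "u \<in> H1_vec" shows "G u = (\<integral>x. \<Phi> (\<chi> i. u i x) \<partial>lborel)"
proof -
  have "integrable lborel (\<lambda>x. \<bar>u i x\<bar> powr p)" for i
    using u p_gt by (intro integrable_powr) (auto simp: H1_vec_def)
  then show ?thesis
    using integrable_Dq[OF u] by (simp add: G_def Mu_def Dq_def \<Phi>_def)
qed

lemma norm_powr_integrable:
  fixes u :: "('k, 'd) vfun"
  assumes u: "u \<in> H1_vec"
  shows "integrable lborel (\<lambda>x. norm (\<chi> i. u i x) powr p)"
    "(\<integral>x. norm (\<chi> i. u i x) powr p \<partial>lborel) \<le> real CARD('k) powr p * (\<Sum>i\<in>UNIV. \<integral>x. \<bar>u i x\<bar> powr p \<partial>lborel)"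
proof -
  note [measurable] = H1_vec_measurable[OF u]
  have [measurable]: "(\<lambda>x. \<chi> i. u i x) \<in> borel_measurable borel" by (rule borel_measurable_vec_lambda) measurable
  have i: "integrable lborel (\<lambda>x. \<bar>u i x\<bar> powr p)" for i
    using u p_gt by (intro integrable_powr) (auto simp: H1_vec_def)
  have le: "norm (\<chi> i. u i x) powr p \<le> real CARD('k) powr p * (\<Sum>i\<in>UNIV. \<bar>u i x\<bar> powr p)" for x
  proof -
    have "norm (\<chi> i. u i x) \<le> (\<Sum>i\<in>UNIV. \<bar>u i x\<bar>)" using norm_le_l1_cart[of "\<chi> i. u i x"] by simp
    then have "norm (\<chi> i. u i x) powr p \<le> (\<Sum>i\<in>UNIV. \<bar>u i x\<bar>) powr p" using p_gt by (intro powr_mono2) auto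
    also have "\<dots> \<le> real CARD('k) powr p * (\<Sum>i\<in>UNIV. \<bar>u i x\<bar> powr p)" using p_gt by (intro powr_sum_le) auto
    finally show ?thesis .
  qed
  have j: "integrable lborel (\<lambda>x. real CARD('k) powr p * (\<Sum>i\<in>UNIV. \<bar>u i x\<bar> powr p))" using i by simp
  show k: "integrable lborel (\<lambda>x. norm (\<chi> i. u i x) powr p)"
  proof (rule Bochner_Integration.integrable_bound[OF j])
    show "AE x in lborel. norm (norm (\<chi> i. u i x) powr p) \<le> norm (real CARD('k) powr p * (\<Sum>i\<in>UNIV. \<bar>u i x\<bar> powr p))"
      using le by (intro AE_I2) (simp add: abs_mult sum_nonneg)
  qed measurable
  have "(\<integral>x. norm (\<chi> i. u i x) powr p \<partial>lborel) \<le> (\<integral>x. real CARD('k) powr p * (\<Sum>i\<in>UNIV. \<bar>u i x\<bar> powr p) \<partial>lborel)"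
    by (rule integral_mono[OF k j le])
  also have "\<dots> = real CARD('k) powr p * (\<Sum>i\<in>UNIV. \<integral>x. \<bar>u i x\<bar> powr p \<partial>lborel)" using i by simp
  finally show "(\<integral>x. norm (\<chi> i. u i x) powr p \<partial>lborel) \<le> real CARD('k) powr p * (\<Sum>i\<in>UNIV. \<integral>x. \<bar>u i x\<bar> powr p \<partial>lborel)" .
qed

text \<open>The Brezis--Lieb lemma for \<open>\<Phi>\<close>; its uniform bound comes from the
  Sobolev inequality on the unit sphere of \<open>nrm\<close>.\<close>

lemma G_splitting:
  fixes V :: "nat \<Rightarrow> ('k, 'd) vfun"
  assumes V: "\<And>n. V n \<in> H1_vec" and nV: "\<And>n. nrm (V n) = 1"
    and u: "u \<in> H1_vec" and lim: "AE x in lborel. \<forall>i. (\<lambda>n. V n i x) \<longlonglongrightarrow> u i x"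
  shows "(\<lambda>n. G (V n) - G (\<lambda>i x. V n i x - u i x)) \<longlonglongrightarrow> G u"
proof -
  have p0: "p > 0" and p2: "p \<ge> 2" using p_gt by simp_all
  obtain C where C: "C > 0" "\<And>i (u :: real ^ 'd \<Rightarrow> real). u \<in> H1 \<Longrightarrow> integrable lborel (\<lambda>x. \<bar>u x\<bar> powr p) \<and>
     (\<integral>x. \<bar>u x\<bar> powr p \<partial>lborel) \<le> C * sqnorm (lam i) u powr (p / 2)"
    using Sobolev[OF p2] by metis
  have bd: "(\<integral>x. norm (\<chi> i. V n i x) powr p \<partial>lborel) \<le> real CARD('k) powr p * (real CARD('k) * C)" for n
  proof -
    have VH: "V n i \<in> H1" for i using V by (simp add: H1_vec_def)
    have "(\<Sum>i\<in>UNIV. \<integral>x. \<bar>V n i x\<bar> powr p \<partial>lborel) \<le> (\<Sum>i\<in>(UNIV :: 'k set). C)"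
    proof (rule sum_mono)
      fix i
      have "sqnorm (lam i) (V n i) powr (p / 2) \<le> 1 powr (p / 2)"
        using sqnorm_le_nrm[OF V, of i n] nV[of n] p_gt sqnorm_nonneg[OF VH] by (intro powr_mono2) auto
      then have "C * sqnorm (lam i) (V n i) powr (p / 2) \<le> C" using C(1) by simp
      then show "(\<integral>x. \<bar>V n i x\<bar> powr p \<partial>lborel) \<le> C"
        using conjunct2[OF C(2)[OF VH, of i i]] by (rule order.trans[rotated])
    qed
    then have "real CARD('k) powr p * (\<Sum>i\<in>UNIV. \<integral>x. \<bar>V n i x\<bar> powr p \<partial>lborel) \<le> real CARD('k) powr p * (real CARD('k) * C)"
      by (intro mult_left_mono) auto
    with norm_powr_integrable(2)[OF V, of n] show ?thesis by (rule order.trans)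
  qed
  have m: "(\<lambda>x. \<chi> i. v i x) \<in> borel_measurable lborel" if "v \<in> H1_vec" for v :: "('k, 'd) vfun"
    using H1_vec_measurable[OF that] by (intro borel_measurable_vec_lambda) simp
  have lim': "AE x in lborel. (\<lambda>n. \<chi> i. V n i x) \<longlonglongrightarrow> (\<chi> i. u i x)"
    using lim by eventually_elim (intro vec_tendstoI, simp)
  have "(\<lambda>n. (\<integral>x. \<Phi> (\<chi> i. V n i x) \<partial>lborel) - (\<integral>x. \<Phi> ((\<chi> i. V n i x) - (\<chi> i. u i x)) \<partial>lborel)) \<longlonglongrightarrow> (\<integral>x. \<Phi> (\<chi> i. u i x) \<partial>lborel)"
    by (rule Brezis_Lieb[OF \<Phi>_continuous \<Phi>_homogeneous p0 m[OF V] m[OF u] lim' norm_powr_integrable(1)[OF V] bd norm_powr_integrable(1)[OF u]])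
  moreover have "(\<chi> i. V n i x) - (\<chi> i. u i x) = (\<chi> i. V n i x - u i x)" for n x by (simp add: vec_eq_iff)
  ultimately show ?thesis
    by (simp add: G_integral[OF V] G_integral[OF u] G_integral[OF diff_H1_vec[OF V u]])
qed

text \<open>Both numbers lie strictly between 0 and 1 and shrink under a power above 1. This rules
  out that the norm splits into two nonzero parts.\<close>

lemma powr_split_less:
  fixes a s :: real
  assumes "0 < a" "a < 1" "s > 1"
  shows "a powr s + (1 - a) powr s < 1"
proof -
  have "b powr s < b" if "0 < b" "b < 1" for b :: real
    using powr_less_mono'[of b 1 s] that assms(3) by simp
  from this[of a] this[of "1 - a"] assms show ?thesis by simp
qed

lemma beta_attained: "\<exists>u\<in>admissible. nrm u = 1 \<and> G u = cS"
proof -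
  obtain \<delta> where \<delta>: "\<delta> > 0" "\<And>u. u \<in> admissible \<Longrightarrow> nrm u = 1 \<Longrightarrow> quot u \<le> \<beta> + 1 \<Longrightarrow> Dq u \<ge> \<delta>"
    by (rule Dq_bounded_below) (rule that)
  obtain A where A: "A > 0" "\<And>u. u \<in> H1_vec \<Longrightarrow> nrm u = 1 \<Longrightarrow> Dq u \<ge> \<delta> \<Longrightarrow>
    \<exists>z. (\<integral>\<^sup>+x. indicator (cube z 1) x * ennreal (\<Prod>i\<in>UNIV. \<bar>u i x\<bar> powr q) \<partial>lborel) > ennreal A"
    by (rule non_vanishing[OF \<delta>(1)]) (rule that)
  have "\<forall>n::nat. \<exists>u. u \<in> admissible \<and> nrm u = 1 \<and> quot u \<le> \<beta> + 1 / Suc n"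
  proof
    fix n :: nat
    have "1 / real (Suc n) > 0" by simp
    from minimizing_element[OF this] show "\<exists>u. u \<in> admissible \<and> nrm u = 1 \<and> quot u \<le> \<beta> + 1 / Suc n" by blast
  qed
  from choice[OF this] obtain U where "\<forall>n::nat. U n \<in> admissible \<and> nrm (U n) = 1 \<and> quot (U n) \<le> \<beta> + 1 / Suc n" ..
  then have U: "\<And>n. U n \<in> admissible" "\<And>n. nrm (U n) = 1" "\<And>n::nat. quot (U n) \<le> \<beta> + 1 / Suc n" by blast+
  have UH: "U n \<in> H1_vec" for n using U(1) by blast
  have "quot (U n) \<le> \<beta> + 1" for n
  proof -
    have "1 / real (Suc n) \<le> 1" by simp
    then show ?thesis using U(3)[of n] by linarith
  qed
  then have D: "Dq (U n) \<ge> \<delta>" for n using U by (intro \<delta>(2)) auto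
  obtain z where z: "\<And>n. (\<integral>\<^sup>+x. indicator (cube (z n) 1) x * ennreal (\<Prod>i\<in>UNIV. \<bar>U n i x\<bar> powr q) \<partial>lborel) > ennreal A"
  proof -
    have "\<forall>n. \<exists>z. (\<integral>\<^sup>+x. indicator (cube z 1) x * ennreal (\<Prod>i\<in>UNIV. \<bar>U n i x\<bar> powr q) \<partial>lborel) > ennreal A"
      using A(2)[OF UH U(2) D] ..
    from choice[OF this] show ?thesis using that by blast
  qed
  \<comment> \<open>Recentring moves the cubes that carry interaction to the origin, where the lower
    bound survives in the limit.\<close>
  define V where "V n = (\<lambda>i x. U n i (x + z n))" for n
  have V: "V n \<in> H1_vec" "nrm (V n) = 1" "Mu (V n) = Mu (U n)" "Dq (V n) = Dq (U n)" for n
    using translate[OF UH, of n "z n"] U(2) by (simp_all add: V_def)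
  have low: "(\<integral>\<^sup>+x. indicator (cube 0 1) x * ennreal (\<Prod>i\<in>UNIV. \<bar>V n i x\<bar> powr q) \<partial>lborel) > ennreal A" for n
  proof -
    note [measurable] = H1_vec_measurable[OF UH]
    have "(\<integral>\<^sup>+x. indicator (cube (z n) 1) (x + z n) * ennreal (\<Prod>i\<in>UNIV. \<bar>U n i (x + z n)\<bar> powr q) \<partial>lborel)
      = (\<integral>\<^sup>+x. indicator (cube (z n) 1) x * ennreal (\<Prod>i\<in>UNIV. \<bar>U n i x\<bar> powr q) \<partial>lborel)"
      by (rule nn_integral_lborel_translate) measurable
    then show ?thesis using z[of n] by (simp add: V_def indicator_def cube_translate)
  qed
  obtain s u where s: "strict_mono (s :: nat \<Rightarrow> nat)" and u: "u \<in> H1_vec"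
    and lim: "AE x in lborel. \<forall>i. (\<lambda>n. V (s n) i x) \<longlonglongrightarrow> u i x"
    and nlim: "(\<lambda>n. nrm (\<lambda>i x. V (s n) i x - u i x)) \<longlonglongrightarrow> 1 - nrm u"
    by (rule weak_limit[of V, OF V(1,2)]) (rule that)
  have ua: "u \<in> admissible"
    using limit_admissible[of "\<lambda>n. V (s n)" A u, OF V(1) V(2) A(1) low u lim] u by blast
  \<comment> \<open>\<open>cS - G (V n)\<close> is the excess of the quotient over
    \<open>\<beta>\<close> times \<open>CARD('k) * Dq (U n)\<close>, and the interaction is bounded
    above.\<close>
  have Glim: "(\<lambda>n. G (V n)) \<longlonglongrightarrow> cS"
  proof -
    obtain C where C: "C > 0" "\<And>u j. u \<in> H1_vec \<Longrightarrow> nrm u = 1 \<Longrightarrow> Dq u \<le> C * sqnorm (lam j) (u j) powr (q / 2)"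
      by (rule Dq_le_component) (rule that)
    have DC: "Dq (U n) \<le> C" for n
    proof -
      \<comment> \<open>\<open>undefined\<close> serves as an arbitrary component.\<close>
      have "sqnorm (lam undefined) (U n undefined) powr (q / 2) \<le> 1 powr (q / 2)"
        using sqnorm_le_nrm[OF UH, of undefined n] U(2)[of n] q2 UH[of n] by (intro powr_mono2 sqnorm_nonneg) (auto simp: H1_vec_def)
      then have "C * sqnorm (lam undefined) (U n undefined) powr (q / 2) \<le> C" using C(1) by simp
      then show ?thesis using C(2)[OF UH U(2), of n undefined] by linarith
    qed
    have le: "cS - real CARD('k) * C * (1 / real (Suc n)) \<le> G (V n)" for n
    proof -
      have D0: "Dq (U n) > 0" using D[of n] \<delta>(1) by simp
      have "cS - Mu (U n) = quot (U n) * (real CARD('k) * Dq (U n))" using D0 U(2) by (simp add: quot_def)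
      also have "\<dots> \<le> (\<beta> + 1 / Suc n) * (real CARD('k) * Dq (U n))" using D0 U(3) by (intro mult_right_mono) auto
      finally have "cS - G (V n) \<le> 1 / Suc n * (real CARD('k) * Dq (U n))" by (simp add: G_def V algebra_simps)
      also have "\<dots> \<le> 1 / Suc n * (real CARD('k) * C)" using DC by (intro mult_left_mono) auto
      finally show ?thesis by (simp add: mult_ac)
    qed
    have up: "G (V n) \<le> cS" for n using G_le[OF V(1), of n] V(2)[of n] by simp
    have "(\<lambda>n. cS - real CARD('k) * C * (1 / real (Suc n))) \<longlonglongrightarrow> cS - real CARD('k) * C * 0"
      by (intro tendsto_intros LIMSEQ_Suc[OF lim_1_over_n])
    then have l: "(\<lambda>n. cS - real CARD('k) * C * (1 / real (Suc n))) \<longlonglongrightarrow> cS" by simp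
    show ?thesis
      by (rule tendsto_sandwich[OF always_eventually[OF allI[OF le]] always_eventually[OF allI[OF up]] l tendsto_const])
  qed
  define a where "a = nrm u"
  have a0: "a > 0" using nrm_pos[OF u admissible_component[of u undefined]] ua unfolding a_def by blast
  have a1: "a \<le> 1"
    using LIMSEQ_le_const[OF nlim] nrm_nonneg[OF diff_H1_vec[OF V(1) u]] unfolding a_def by (metis diff_ge_0_iff_ge)
  have "(\<lambda>n. G (V (s n)) - (G (V (s n)) - G (\<lambda>i x. V (s n) i x - u i x))) \<longlonglongrightarrow> cS - G u"
    using LIMSEQ_subseq_LIMSEQ[OF Glim s] by (intro tendsto_diff G_splitting[OF V(1) V(2) u lim]) (simp add: o_def)
  then have l1: "(\<lambda>n. G (\<lambda>i x. V (s n) i x - u i x)) \<longlonglongrightarrow> cS - G u" by simp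
  have l2: "(\<lambda>n. cS * nrm (\<lambda>i x. V (s n) i x - u i x) powr (p / 2)) \<longlonglongrightarrow> cS * (1 - a) powr (p / 2)"
    unfolding a_def using p_gt nrm_nonneg[OF diff_H1_vec[OF V(1) u]]
    by (intro tendsto_mult tendsto_const tendsto_powr'[OF nlim]) auto
  have "cS - G u \<le> cS * (1 - a) powr (p / 2)"
    by (rule LIMSEQ_le[OF l1 l2]) (use G_le[OF diff_H1_vec[OF V(1) u]] in auto)
  moreover have Gu: "G u \<le> cS * a powr (p / 2)" using G_le[OF u] by (simp add: a_def)
  \<comment> \<open>Adding the bounds for the limit and for the remainder eliminates
    \<open>G u\<close>.\<close>
  ultimately have "cS * 1 \<le> cS * (a powr (p / 2) + (1 - a) powr (p / 2))" by (simp add: distrib_left)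
  then have "1 \<le> a powr (p / 2) + (1 - a) powr (p / 2)" using cS_pos by simp
  then have "a = 1" using powr_split_less[of a "p / 2"] a0 a1 p_gt by fastforce
  moreover have "G u = cS" using Gu \<open>cS - G u \<le> cS * (1 - a) powr (p / 2)\<close> \<open>a = 1\<close> p_gt by simp
  ultimately show ?thesis using ua by (auto simp: a_def)
qed

end

subsection \<open>Euler--Lagrange equations and ground states\<close>

text \<open>Away from 0 the two signs reduce to the ordinary power rule. At 0 the difference
  quotient is bounded by \<open>\<bar>h\<bar> powr (s - 1)\<close>, which tends to 0 as
  \<open>s > 1\<close>.\<close>

lemma abs_powr_has_derivative:
  assumes s: "s > 1"
  shows "((\<lambda>y :: real. \<bar>y\<bar> powr s) has_real_derivative s * \<bar>a\<bar> powr (s - 2) * a) (at a)"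
proof (cases a "0 :: real" rule: linorder_cases)
  case greater
  have e: "a powr (s - 1) = a powr (s - 2) * a"
    using greater powr_add[of a "s - 2" 1] by simp
  have "((\<lambda>y. y powr s) has_real_derivative s * a powr (s - 1)) (at a)"
    by (rule has_real_derivative_powr[OF greater])
  then have "((\<lambda>y. \<bar>y\<bar> powr s) has_real_derivative s * a powr (s - 1)) (at a)"
    by (rule DERIV_cong_ev[OF refl _ refl, THEN iffD1, rotated])
      (use greater in \<open>auto intro!: eventually_mono[OF eventually_nhds_in_open[of "{0<..}"]]\<close>)
  then show ?thesis using greater by (simp add: e mult.assoc)
next
  case less
  have e: "(- a) powr (s - 1) = (- a) powr (s - 2) * - a"
    using less powr_add[of "- a" "s - 2" 1] by simp
  have "((\<lambda>y. (- y) powr s) has_real_derivative s * (- a) powr (s - 1) * - 1) (at a)"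
    by (rule DERIV_chain2[OF has_real_derivative_powr]) (use less in \<open>auto intro!: derivative_eq_intros\<close>)
  then have "((\<lambda>y. \<bar>y\<bar> powr s) has_real_derivative s * (- a) powr (s - 1) * - 1) (at a)"
    by (rule DERIV_cong_ev[OF refl _ refl, THEN iffD1, rotated])
      (use less in \<open>auto intro!: eventually_mono[OF eventually_nhds_in_open[of "{..<0}"]]\<close>)
  then show ?thesis using less by (simp add: e mult.assoc)
next
  case equal
  have "((\<lambda>h :: real. \<bar>h\<bar> powr s / h) \<longlongrightarrow> 0) (at 0)"
  proof (rule Lim_null_comparison[of _ "\<lambda>h. \<bar>h\<bar> powr (s - 1)"])
    have "norm (\<bar>h\<bar> powr s / h) \<le> \<bar>h\<bar> powr (s - 1)" if "h \<noteq> 0" for h :: real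
      using that powr_add[of "\<bar>h\<bar>" "s - 1" 1] by simp
    then show "\<forall>\<^sub>F h in at 0. norm (\<bar>h\<bar> powr s / h) \<le> \<bar>h\<bar> powr (s - 1)"
      by (auto simp: eventually_at_filter)
    show "((\<lambda>h :: real. \<bar>h\<bar> powr (s - 1)) \<longlongrightarrow> 0) (at 0)"
      by (rule tendsto_zero_powrI[OF tendsto_rabs_zero[OF tendsto_ident_at] tendsto_const]) (use s in auto)
  qed
  then show ?thesis using equal by (simp add: DERIV_def)
qed

text \<open>The mean value inequality on the interval from \<open>- m\<close> to \<open>m\<close>;
  it provides the majorant for differentiation under the integral.\<close>

lemma abs_powr_diff_le:
  fixes y z :: real
  assumes "s > 1" "\<bar>y\<bar> \<le> m" "\<bar>z\<bar> \<le> m"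
  shows "\<bar>\<bar>y\<bar> powr s - \<bar>z\<bar> powr s\<bar> \<le> s * m powr (s - 1) * \<bar>y - z\<bar>"
proof -
  have "norm (\<bar>y\<bar> powr s - \<bar>z\<bar> powr s) \<le> s * m powr (s - 1) * norm (y - z)"
  proof (rule field_differentiable_bound[of "{-m..m}"])
    fix w assume w: "w \<in> {-m..m}"
    show "((\<lambda>y. \<bar>y\<bar> powr s) has_field_derivative s * \<bar>w\<bar> powr (s - 2) * w) (at w within {-m..m})"
      by (rule DERIV_subset[OF abs_powr_has_derivative[OF assms(1)]]) simp
    have "norm (s * \<bar>w\<bar> powr (s - 2) * w) = s * \<bar>w\<bar> powr (s - 1)"
      using assms(1) powr_add[of "\<bar>w\<bar>" "s - 2" 1] by (simp add: abs_mult)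
    also have "\<dots> \<le> s * m powr (s - 1)" using assms(1) w by (intro mult_left_mono powr_mono2) auto
    finally show "norm (s * \<bar>w\<bar> powr (s - 2) * w) \<le> s * m powr (s - 1)" .
  qed (use assms in auto)
  then show ?thesis by simp
qed

text \<open>Dominated convergence along the steps \<open>1 / Suc n\<close>. The weight
  \<open>R\<close> is the constant \<open>mu i\<close> for the pure power and the product of the
  other components for the interaction, so that one lemma serves both terms.\<close>

lemma integral_powr_difference_quotient:
  fixes R a v :: "'a \<Rightarrow> real"
  assumes s: "s > 1" and [measurable]: "R \<in> borel_measurable M" "a \<in> borel_measurable M" "v \<in> borel_measurable M"
    and R: "\<And>x. R x \<ge> 0" and int: "integrable M (\<lambda>x. R x * (\<bar>a x\<bar> + \<bar>v x\<bar>) powr s)"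
  shows "(\<lambda>n. ((\<integral>x. R x * \<bar>a x + 1 / Suc n * v x\<bar> powr s \<partial>M) - (\<integral>x. R x * \<bar>a x\<bar> powr s \<partial>M)) / (1 / Suc n))
      \<longlonglongrightarrow> (\<integral>x. R x * (s * \<bar>a x\<bar> powr (s - 2) * a x * v x) \<partial>M)"
    and "integrable M (\<lambda>x. R x * (s * \<bar>a x\<bar> powr (s - 2) * a x * v x))"
proof -
  let ?t = "\<lambda>n. 1 / real (Suc n)"
  have t: "0 < ?t n" "?t n \<le> 1" for n by auto
  have tv: "\<bar>?t n * v x\<bar> \<le> \<bar>v x\<bar>" for n x
    using mult_right_mono[OF t(2)[of n], of "\<bar>v x\<bar>"] unfolding abs_mult abs_of_pos[OF t(1)] by simp
  have atv: "\<bar>a x + ?t n * v x\<bar> \<le> \<bar>a x\<bar> + \<bar>v x\<bar>" for n x using tv[of n x] by linarith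
  have i: "integrable M (\<lambda>x. R x * \<bar>a x + ?t n * v x\<bar> powr s)" for n
  proof (rule Bochner_Integration.integrable_bound[OF int])
    show "AE x in M. norm (R x * \<bar>a x + ?t n * v x\<bar> powr s) \<le> norm (R x * (\<bar>a x\<bar> + \<bar>v x\<bar>) powr s)"
      using R s atv by (intro AE_I2) (simp add: abs_mult mult_left_mono powr_mono2 del: of_nat_Suc)
  qed measurable
  have i0: "integrable M (\<lambda>x. R x * \<bar>a x\<bar> powr s)"
  proof (rule Bochner_Integration.integrable_bound[OF int])
    show "AE x in M. norm (R x * \<bar>a x\<bar> powr s) \<le> norm (R x * (\<bar>a x\<bar> + \<bar>v x\<bar>) powr s)"
      using R s by (intro AE_I2) (simp add: abs_mult mult_left_mono powr_mono2)
  qed measurable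
  let ?Q = "\<lambda>n x. R x * ((\<bar>a x + ?t n * v x\<bar> powr s - \<bar>a x\<bar> powr s) / ?t n)"
  have int': "integrable M (\<lambda>x. s * (R x * (\<bar>a x\<bar> + \<bar>v x\<bar>) powr s))" using int by simp
  have pw: "m powr (s - 1) * y \<le> m powr s" if "0 \<le> y" "y \<le> m" for m y :: real
  proof -
    have "m powr (s - 1) * y \<le> m powr (s - 1) * m powr 1" using that by (intro mult_left_mono) auto
    then show ?thesis unfolding powr_add[symmetric] by simp
  qed
  have bound: "norm (?Q n x) \<le> s * (R x * (\<bar>a x\<bar> + \<bar>v x\<bar>) powr s)" for n x
  proof -
    let ?m = "\<bar>a x\<bar> + \<bar>v x\<bar>"
    have "\<bar>\<bar>a x + ?t n * v x\<bar> powr s - \<bar>a x\<bar> powr s\<bar> \<le> s * ?m powr (s - 1) * \<bar>(a x + ?t n * v x) - a x\<bar>"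
      by (rule abs_powr_diff_le[OF s atv]) simp
    also have "\<dots> = ?t n * (s * (?m powr (s - 1) * \<bar>v x\<bar>))" using t[of n] by (simp add: abs_mult)
    also have "\<dots> \<le> ?t n * (s * ?m powr s)" using s t[of n] by (intro mult_left_mono pw) auto
    finally have "\<bar>\<bar>a x + ?t n * v x\<bar> powr s - \<bar>a x\<bar> powr s\<bar> / ?t n \<le> s * ?m powr s"
      using t(1)[of n] by (subst pos_divide_le_eq) (simp_all add: mult.commute del: of_nat_Suc)
    then have "\<bar>(\<bar>a x + ?t n * v x\<bar> powr s - \<bar>a x\<bar> powr s) / ?t n\<bar> \<le> s * ?m powr s"
      unfolding abs_divide using t(1)[of n] by (simp del: of_nat_Suc)
    from mult_left_mono[OF this R[of x]] show ?thesis using R[of x]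
      unfolding real_norm_def abs_mult by (simp add: mult_ac)
  qed
  have lim: "(\<lambda>n. ?Q n x) \<longlonglongrightarrow> R x * (s * \<bar>a x\<bar> powr (s - 2) * a x * v x)" for x
  proof -
    have "((\<lambda>t. a x + t * v x) has_real_derivative v x) (at 0)" by (auto intro!: derivative_eq_intros)
    then have "((\<lambda>t. \<bar>a x + t * v x\<bar> powr s) has_real_derivative s * \<bar>a x\<bar> powr (s - 2) * a x * v x) (at 0)"
      using DERIV_chain2[of "\<lambda>y. \<bar>y\<bar> powr s" _ "\<lambda>t. a x + t * v x" 0 "v x" UNIV] abs_powr_has_derivative[OF s, of "a x"] by simp
    then have "((\<lambda>t. (\<bar>a x + t * v x\<bar> powr s - \<bar>a x\<bar> powr s) / t) \<longlongrightarrow> s * \<bar>a x\<bar> powr (s - 2) * a x * v x) (at 0)"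
      by (simp add: DERIV_def)
    moreover have "filterlim ?t (at 0) sequentially"
      using LIMSEQ_Suc[OF lim_1_over_n] by (auto simp: filterlim_at simp del: of_nat_Suc)
    ultimately have "(\<lambda>n. (\<bar>a x + ?t n * v x\<bar> powr s - \<bar>a x\<bar> powr s) / ?t n) \<longlonglongrightarrow> s * \<bar>a x\<bar> powr (s - 2) * a x * v x"
      by (rule filterlim_compose)
    then show ?thesis by (intro tendsto_mult tendsto_const)
  qed
  have "(\<lambda>n. \<integral>x. ?Q n x \<partial>M) \<longlonglongrightarrow> (\<integral>x. R x * (s * \<bar>a x\<bar> powr (s - 2) * a x * v x) \<partial>M)"
    by (rule integral_dominated_convergence[OF _ _ int']) (use lim bound in auto)
  moreover have "(\<integral>x. ?Q n x \<partial>M) = ((\<integral>x. R x * \<bar>a x + ?t n * v x\<bar> powr s \<partial>M) - (\<integral>x. R x * \<bar>a x\<bar> powr s \<partial>M)) / ?t n" for n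
  proof -
    have "?Q n x = (R x * \<bar>a x + ?t n * v x\<bar> powr s - R x * \<bar>a x\<bar> powr s) / ?t n" for x
      by (simp add: right_diff_distrib diff_divide_distrib)
    then have "(\<integral>x. ?Q n x \<partial>M) = (\<integral>x. (R x * \<bar>a x + ?t n * v x\<bar> powr s - R x * \<bar>a x\<bar> powr s) / ?t n \<partial>M)"
      by (simp only:)
    also have "\<dots> = (\<integral>x. R x * \<bar>a x + ?t n * v x\<bar> powr s - R x * \<bar>a x\<bar> powr s \<partial>M) / ?t n"
      by (rule integral_divide_zero)
    finally show ?thesis by (simp only: Bochner_Integration.integral_diff[OF i i0])
  qed
  ultimately show "(\<lambda>n. ((\<integral>x. R x * \<bar>a x + ?t n * v x\<bar> powr s \<partial>M) - (\<integral>x. R x * \<bar>a x\<bar> powr s \<partial>M)) / ?t n)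
      \<longlonglongrightarrow> (\<integral>x. R x * (s * \<bar>a x\<bar> powr (s - 2) * a x * v x) \<partial>M)" by simp
  show "integrable M (\<lambda>x. R x * (s * \<bar>a x\<bar> powr (s - 2) * a x * v x))"
  proof (rule integrable_dominated_convergence[OF _ _ int'])
    show "AE x in M. (\<lambda>n. ?Q n x) \<longlonglongrightarrow> R x * (s * \<bar>a x\<bar> powr (s - 2) * a x * v x)" using lim by simp
    show "AE x in M. norm (?Q n x) \<le> s * (R x * (\<bar>a x\<bar> + \<bar>v x\<bar>) powr s)" for n using bound by (intro AE_I2)
  qed measurable
qed

section \<open>The Euler--Lagrange equation of an extremal\<close>

context planar_system
begin

definition form :: "'k \<Rightarrow> (real ^ 'd \<Rightarrow> real) \<Rightarrow> (real ^ 'd \<Rightarrow> real) \<Rightarrow> real" where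
  "form i u v = (\<integral>x. weak_gradient u x \<bullet> weak_gradient v x + lam i * u x * v x \<partial>lborel)"

definition nonlin :: "('k, 'd) vfun \<Rightarrow> 'k \<Rightarrow> real ^ 'd \<Rightarrow> real" where
  "nonlin u i x = mu i * \<bar>u i x\<bar> powr (p - 2) * u i x
     + \<beta> * \<bar>u i x\<bar> powr (q - 2) * u i x * (\<Prod>j\<in>UNIV - {i}. \<bar>u j x\<bar> powr q)"

lemma form_self: "u \<in> H1 \<Longrightarrow> form i u u = sqnorm (lam i) u"
  unfolding form_def weak_gradient_integral[OF H1_pair_weak_gradient H1_pair_weak_gradient]
  by (simp add: sqnorm_eq[OF H1_pair_weak_gradient])

lemma form_cmult:
  assumes "u \<in> H1" "v \<in> H1"
  shows "form i (\<lambda>x. c * u x) v = c * form i u v" "form i u (\<lambda>x. c * v x) = c * form i u v"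
  unfolding form_def
    weak_gradient_integral[OF H1_pair_cmult[OF H1_pair_weak_gradient[OF assms(1)]] H1_pair_weak_gradient[OF assms(2)]]
    weak_gradient_integral[OF H1_pair_weak_gradient[OF assms(1)] H1_pair_cmult[OF H1_pair_weak_gradient[OF assms(2)]]]
    weak_gradient_integral[OF H1_pair_weak_gradient[OF assms(1)] H1_pair_weak_gradient[OF assms(2)]]
  by (simp_all add: ip2_def algebra_simps)

lemma sqnorm_add_cmult:
  assumes u: "u \<in> H1" and v: "v \<in> H1"
  shows "sqnorm (lam i) (\<lambda>x. u x + t * v x) = sqnorm (lam i) u + 2 * t * form i u v + t\<^sup>2 * sqnorm (lam i) v"
proof -
  note up = H1_pair_weak_gradient[OF u] and vp = H1_pair_weak_gradient[OF v]
  have L: "u \<in> L2 lborel" "v \<in> L2 lborel" "weak_gradient u \<in> L2 lborel" "weak_gradient v \<in> L2 lborel"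
    using up vp by (auto simp: H1_pair_def)
  have tv: "(\<lambda>x. t * v x) \<in> L2 lborel" using L2_scaleR[OF L(2), of t] by simp
  show ?thesis
    unfolding sqnorm_eq[OF H1_pair_add[OF up H1_pair_cmult[OF vp]]] sqnorm_eq[OF up] sqnorm_eq[OF vp] form_def
      weak_gradient_integral[OF up vp] ip2_add_self[OF L(1) tv] ip2_add_self[OF L(3) L2_scaleR[OF L(4)]]
    by (simp add: ip2_def power2_eq_square algebra_simps)
qed

lemma update_H1_vec: "u \<in> H1_vec \<Longrightarrow> w \<in> H1 \<Longrightarrow> u(i := w) \<in> (H1_vec :: ('k, 'd) vfun set)"
  by (simp add: H1_vec_def)

lemma nrm_update: "nrm (u(i := w)) = sqnorm (lam i) w + (\<Sum>j\<in>UNIV - {i}. sqnorm (lam j) (u j))"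
  unfolding nrm_def by (subst sum.remove[of _ i]) (auto intro!: sum.cong)

text \<open>The dependence on one component is a pure power plus a power weighted by the other
  components, the two shapes covered by \<open>integral_powr_difference_quotient\<close>.\<close>

lemma G_update:
  "G (u(i := w)) = (\<integral>x. mu i * \<bar>w x\<bar> powr p \<partial>lborel) + (\<Sum>j\<in>UNIV - {i}. \<integral>x. mu j * \<bar>u j x\<bar> powr p \<partial>lborel)
    + real CARD('k) * \<beta> * (\<integral>x. (\<Prod>j\<in>UNIV - {i}. \<bar>u j x\<bar> powr q) * \<bar>w x\<bar> powr q \<partial>lborel)"
proof -
  have "Mu (u(i := w)) = (\<integral>x. mu i * \<bar>w x\<bar> powr p \<partial>lborel) + (\<Sum>j\<in>UNIV - {i}. \<integral>x. mu j * \<bar>u j x\<bar> powr p \<partial>lborel)"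
    unfolding Mu_def by (subst sum.remove[of _ i]) (auto intro!: sum.cong)
  moreover have "(\<Prod>j\<in>UNIV. \<bar>(u(i := w)) j x\<bar> powr q) = (\<Prod>j\<in>UNIV - {i}. \<bar>u j x\<bar> powr q) * \<bar>w x\<bar> powr q" for x
    by (subst prod.remove[of _ i]) (auto intro!: prod.cong simp: mult.commute)
  ultimately show ?thesis by (simp add: G_def Dq_def)
qed

lemma integrable_abs_add_powr:
  fixes R u v :: "real ^ 'd \<Rightarrow> real"
  assumes [measurable]: "R \<in> borel_measurable lborel" "u \<in> borel_measurable lborel" "v \<in> borel_measurable lborel"
    and R: "\<And>x. R x \<ge> 0" and s: "s > 0"
    and int: "integrable lborel (\<lambda>x. R x * \<bar>u x\<bar> powr s)" "integrable lborel (\<lambda>x. R x * \<bar>v x\<bar> powr s)"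
  shows "integrable lborel (\<lambda>x. R x * (\<bar>u x\<bar> + \<bar>v x\<bar>) powr s)"
proof (rule Bochner_Integration.integrable_bound)
  show "integrable lborel (\<lambda>x. 2 powr s * (R x * \<bar>u x\<bar> powr s + R x * \<bar>v x\<bar> powr s))" using int by simp
  have "R x * (\<bar>u x\<bar> + \<bar>v x\<bar>) powr s \<le> 2 powr s * (R x * \<bar>u x\<bar> powr s + R x * \<bar>v x\<bar> powr s)" for x
    using mult_left_mono[OF powr_add_le[of "\<bar>u x\<bar>" "\<bar>v x\<bar>" s] R[of x]] s by (simp add: algebra_simps)
  then show "AE x in lborel. norm (R x * (\<bar>u x\<bar> + \<bar>v x\<bar>) powr s) \<le> norm (2 powr s * (R x * \<bar>u x\<bar> powr s + R x * \<bar>v x\<bar> powr s))"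
    using R by (intro AE_I2) (simp add: abs_mult)
qed measurable

text \<open>\<open>G_le\<close> is an equality at \<open>u\<close>, so the difference quotients of
  its two sides along \<open>u i + v / (n + 1)\<close> in component \<open>i\<close> are ordered,
  and so are their limits. Positive steps give one inequality.\<close>

lemma Euler_Lagrange_le:
  assumes u: "u \<in> H1_vec" and n: "nrm u = 1" and Gu: "G u = cS" and v: "v \<in> H1"
  shows "(\<integral>x. nonlin u i x * v x \<partial>lborel) \<le> cS * form i (u i) v"
proof -
  note [measurable] = H1_vec_measurable[OF u] H1_measurable[OF v]
  have ui: "u i \<in> H1" using u by (simp add: H1_vec_def)
  define R where "R x = (\<Prod>j\<in>UNIV - {i}. \<bar>u j x\<bar> powr q)" for x
  have R0: "R x \<ge> 0" for x by (simp add: R_def prod_nonneg)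
  have Rm [measurable]: "R \<in> borel_measurable borel" unfolding R_def[abs_def] by measurable
  let ?t = "\<lambda>n. 1 / real (Suc n)"
  define w where "w n x = u i x + ?t n * v x" for n x
  have wH: "w n \<in> H1" for n
    unfolding w_def[abs_def]
    by (rule H1_pair_imp_H1[OF H1_pair_add[OF H1_pair_weak_gradient[OF ui] H1_pair_cmult[OF H1_pair_weak_gradient[OF v]]]])
  have intR: "integrable lborel (\<lambda>x. R x * \<bar>y x\<bar> powr q)" if "y \<in> H1" for y
  proof -
    have "(\<Prod>j\<in>UNIV. \<bar>(u(i := y)) j x\<bar> powr q) = R x * \<bar>y x\<bar> powr q" for x
      unfolding R_def by (subst prod.remove[of _ i]) (auto intro!: prod.cong simp: mult.commute)
    then show ?thesis using integrable_Dq[OF update_H1_vec[OF u that, of i]] by simp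
  qed
  have p1: "p > 1" "p \<ge> 2" and q1: "q > 1" using p_gt q2 by auto
  have intp: "integrable lborel (\<lambda>x. mu i * \<bar>y x\<bar> powr p)" if "y \<in> H1" for y :: "real ^ 'd \<Rightarrow> real"
    using integrable_powr[OF that p1(2)] by simp
  note dp = integral_powr_difference_quotient[of p "\<lambda>_. mu i" lborel "u i" v, OF p1(1) _ _ _ _ integrable_abs_add_powr]
  have dp1: "(\<lambda>n. ((\<integral>x. mu i * \<bar>w n x\<bar> powr p \<partial>lborel) - (\<integral>x. mu i * \<bar>u i x\<bar> powr p \<partial>lborel)) / ?t n)
      \<longlonglongrightarrow> (\<integral>x. mu i * (p * \<bar>u i x\<bar> powr (p - 2) * u i x * v x) \<partial>lborel)"
    and dp2: "integrable lborel (\<lambda>x. mu i * (p * \<bar>u i x\<bar> powr (p - 2) * u i x * v x))"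
    unfolding w_def using mu_pos[of i] p_gt intp[OF ui] intp[OF v] by (intro dp; simp)+
  note dq = integral_powr_difference_quotient[of q R lborel "u i" v, OF q1 _ _ _ _ integrable_abs_add_powr]
  have dq1: "(\<lambda>n. ((\<integral>x. R x * \<bar>w n x\<bar> powr q \<partial>lborel) - (\<integral>x. R x * \<bar>u i x\<bar> powr q \<partial>lborel)) / ?t n)
      \<longlonglongrightarrow> (\<integral>x. R x * (q * \<bar>u i x\<bar> powr (q - 2) * u i x * v x) \<partial>lborel)"
    and dq2: "integrable lborel (\<lambda>x. R x * (q * \<bar>u i x\<bar> powr (q - 2) * u i x * v x))"
    unfolding w_def using R0 q2 intR[OF ui] intR[OF v] by (intro dq; simp)+
  have uu: "u(i := u i) = u" by simp
  have Gd: "(G (u(i := w n)) - G u) / ?t n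
     = ((\<integral>x. mu i * \<bar>w n x\<bar> powr p \<partial>lborel) - (\<integral>x. mu i * \<bar>u i x\<bar> powr p \<partial>lborel)) / ?t n
      + real CARD('k) * \<beta> * (((\<integral>x. R x * \<bar>w n x\<bar> powr q \<partial>lborel) - (\<integral>x. R x * \<bar>u i x\<bar> powr q \<partial>lborel)) / ?t n)" for n
  proof -
    have alg: "(A + X + c * B - (A' + X + c * B')) / t = (A - A') / t + c * ((B - B') / t)" for A A' B B' X c t :: real
      by (simp add: diff_divide_distrib add_divide_distrib right_diff_distrib)
    show ?thesis
      unfolding G_update G_update[of u i "u i", unfolded uu] R_def[symmetric] by (rule alg)
  qed
  have lim1: "(\<lambda>n. (G (u(i := w n)) - G u) / ?t n) \<longlonglongrightarrow>
     (\<integral>x. mu i * (p * \<bar>u i x\<bar> powr (p - 2) * u i x * v x) \<partial>lborel)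
     + real CARD('k) * \<beta> * (\<integral>x. R x * (q * \<bar>u i x\<bar> powr (q - 2) * u i x * v x) \<partial>lborel)"
    unfolding Gd by (intro tendsto_add tendsto_mult tendsto_const dp1 dq1)
  also have "(\<integral>x. mu i * (p * \<bar>u i x\<bar> powr (p - 2) * u i x * v x) \<partial>lborel)
     + real CARD('k) * \<beta> * (\<integral>x. R x * (q * \<bar>u i x\<bar> powr (q - 2) * u i x * v x) \<partial>lborel)
     = (\<integral>x. mu i * (p * \<bar>u i x\<bar> powr (p - 2) * u i x * v x) + real CARD('k) * \<beta> * (R x * (q * \<bar>u i x\<bar> powr (q - 2) * u i x * v x)) \<partial>lborel)"
    using dp2 dq2 by simp
  also have "\<dots> = (\<integral>x. p * (nonlin u i x * v x) \<partial>lborel)"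
  proof (rule Bochner_Integration.integral_cong[OF refl])
    fix x
    have "real CARD('k) * \<beta> * (R x * (q * y)) = p * (\<beta> * (R x * y))" for y by (simp add: p_eq)
    from this[of "\<bar>u i x\<bar> powr (q - 2) * u i x * v x"]
    show "mu i * (p * \<bar>u i x\<bar> powr (p - 2) * u i x * v x) + real CARD('k) * \<beta> * (R x * (q * \<bar>u i x\<bar> powr (q - 2) * u i x * v x)) = p * (nonlin u i x * v x)"
      by (simp add: nonlin_def R_def algebra_simps)
  qed
  also have "\<dots> = p * (\<integral>x. nonlin u i x * v x \<partial>lborel)" by simp
  finally have lim1: "(\<lambda>n. (G (u(i := w n)) - G u) / ?t n) \<longlonglongrightarrow> p * (\<integral>x. nonlin u i x * v x \<partial>lborel)" .
  define b c where "b = form i (u i) v" and "c = sqnorm (lam i) v"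
  have nw: "nrm (u(i := w n)) = 1 + 2 * ?t n * b + (?t n)\<^sup>2 * c" for n
    using nrm_update[of u i "u i"] n unfolding nrm_update w_def[abs_def] sqnorm_add_cmult[OF ui v] b_def c_def uu
    by (simp del: of_nat_Suc)
  have d0: "((\<lambda>t. 1 + 2 * t * b + t\<^sup>2 * c) has_real_derivative 2 * b) (at 0)"
    by (auto intro!: derivative_eq_intros)
  \<comment> \<open>The outer power is differentiated at 1, the value of
    \<open>nrm u\<close>.\<close>
  have d1: "((\<lambda>y. y powr (p / 2)) has_real_derivative p / 2) (at (1 + 2 * 0 * b + 0\<^sup>2 * c))"
    using has_real_derivative_powr[of 1 "p / 2"] by simp
  have "((\<lambda>t. (1 + 2 * t * b + t\<^sup>2 * c) powr (p / 2)) has_real_derivative p * b) (at 0)"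
    using DERIV_chain2[OF d1 d0] by simp
  then have "((\<lambda>t. ((1 + 2 * t * b + t\<^sup>2 * c) powr (p / 2) - 1) / t) \<longlongrightarrow> p * b) (at 0)"
    by (simp add: DERIV_def)
  moreover have "filterlim ?t (at 0) sequentially"
    using LIMSEQ_Suc[OF lim_1_over_n] by (auto simp: filterlim_at simp del: of_nat_Suc)
  ultimately have "(\<lambda>n. ((1 + 2 * ?t n * b + (?t n)\<^sup>2 * c) powr (p / 2) - 1) / ?t n) \<longlonglongrightarrow> p * b"
    by (rule filterlim_compose)
  then have lim2: "(\<lambda>n. cS * ((nrm (u(i := w n)) powr (p / 2) - 1) / ?t n)) \<longlonglongrightarrow> cS * (p * b)"
    unfolding nw by (intro tendsto_mult tendsto_const)
  have "p * (\<integral>x. nonlin u i x * v x \<partial>lborel) \<le> cS * (p * b)"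
  proof (rule LIMSEQ_le[OF lim1 lim2], intro exI allI impI)
    fix n
    have "G (u(i := w n)) - G u \<le> cS * (nrm (u(i := w n)) powr (p / 2) - 1)"
      using G_le[OF update_H1_vec[OF u wH, of i n]] Gu by (simp add: right_diff_distrib)
    then have "(G (u(i := w n)) - G u) / ?t n \<le> (cS * (nrm (u(i := w n)) powr (p / 2) - 1)) / ?t n"
      by (rule divide_right_mono) simp
    then show "(G (u(i := w n)) - G u) / ?t n \<le> cS * ((nrm (u(i := w n)) powr (p / 2) - 1) / ?t n)" by simp
  qed
  then show ?thesis using p_gt by (simp add: b_def mult.left_commute[of cS])
qed

text \<open>Replacing \<open>v\<close> by its negative reverses the one-sided inequality.\<close>

lemma Euler_Lagrange:
  assumes u: "u \<in> H1_vec" and n: "nrm u = 1" and Gu: "G u = cS" and v: "v \<in> H1"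
  shows "(\<integral>x. nonlin u i x * v x \<partial>lborel) = cS * form i (u i) v"
proof -
  have ui: "u i \<in> H1" using u by (simp add: H1_vec_def)
  have v': "(\<lambda>x. (-1) * v x) \<in> H1" by (rule H1_pair_imp_H1[OF H1_pair_cmult[OF H1_pair_weak_gradient[OF v]]])
  have "- (\<integral>x. nonlin u i x * v x \<partial>lborel) \<le> - (cS * form i (u i) v)"
    using Euler_Lagrange_le[OF u n Gu v', of i] unfolding form_cmult(2)[OF ui v] by simp
  then show ?thesis using Euler_Lagrange_le[OF u n Gu v, of i] by simp
qed

section \<open>The Nehari manifold and the least energy level\<close>

lemma weak_solution_iff:
  "weak_solution lam mu q \<beta> u \<longleftrightarrow> u \<in> H1_vec \<and> (\<forall>i. \<forall>v\<in>H1. form i (u i) v = (\<integral>x. nonlin u i x * v x \<partial>lborel))"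
  by (simp add: weak_solution_def form_def nonlin_def p_eq[symmetric])

lemma nehari_iff: "u \<in> nehari lam mu q \<beta> \<longleftrightarrow> u \<in> H1_vec \<and> nontrivial u \<and> nrm u = G u"
  by (simp add: nehari_def nrm_def G_def Mu_def Dq_def p_eq[symmetric])

text \<open>The constraint eliminates the nonlinear terms, so minimizing the energy on the Nehari
  manifold means minimizing the norm.\<close>

lemma energy_nehari:
  assumes "u \<in> nehari lam mu q \<beta>" shows "energy lam mu q \<beta> u = (1 / 2 - 1 / p) * nrm u"
proof -
  have "energy lam mu q \<beta> u = 1 / 2 * nrm u - 1 / p * Mu u - \<beta> / q * Dq u"
    by (simp add: energy_def nrm_def Mu_def Dq_def p_eq[symmetric])
  also have "\<beta> / q * Dq u = 1 / p * (real CARD('k) * \<beta> * Dq u)" using q2 by (simp add: p_eq)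
  finally show ?thesis using assms unfolding nehari_iff G_def by (simp add: algebra_simps)
qed

text \<open>The \<open>i\<close>-th equation is tested with \<open>u i\<close> itself. Each equation
  contributes one term \<open>\<beta> * Dq u\<close>, whence the factor \<open>CARD('k)\<close> in
  \<open>G\<close>.\<close>

lemma weak_solution_nehari:
  fixes u :: "('k, 'd) vfun"
  assumes w: "weak_solution lam mu q \<beta> u" and nt: "nontrivial u"
  shows "u \<in> nehari lam mu q \<beta>"
proof -
  have u: "u \<in> H1_vec" using w by (simp add: weak_solution_iff)
  have uH: "u i \<in> H1" for i using u by (simp add: H1_vec_def)
  have sq: "\<bar>y\<bar> powr (s - 2) * (y * y) = \<bar>y\<bar> powr s" for y s :: real
  proof (cases "y = 0")
    case False
    then have "\<bar>y\<bar> powr s = \<bar>y\<bar> powr (s - 2) * \<bar>y\<bar> powr 2" unfolding powr_add[symmetric] by simp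
    also have "\<bar>y\<bar> powr 2 = y * y" using False by (simp add: power2_eq_square flip: power2_abs)
    finally show ?thesis by simp
  qed simp
  have "sqnorm (lam i) (u i) = (\<integral>x. mu i * \<bar>u i x\<bar> powr p \<partial>lborel) + \<beta> * Dq u" for i
  proof -
    have "sqnorm (lam i) (u i) = (\<integral>x. nonlin u i x * u i x \<partial>lborel)"
      using w uH unfolding weak_solution_iff by (simp add: form_self[symmetric])
    also have "\<dots> = (\<integral>x. mu i * \<bar>u i x\<bar> powr p + \<beta> * (\<Prod>j\<in>UNIV. \<bar>u j x\<bar> powr q) \<partial>lborel)"
    proof (rule Bochner_Integration.integral_cong[OF refl])
      fix x
      have "nonlin u i x * u i x = mu i * (\<bar>u i x\<bar> powr (p - 2) * (u i x * u i x))
        + \<beta> * ((\<bar>u i x\<bar> powr (q - 2) * (u i x * u i x)) * (\<Prod>j\<in>UNIV - {i}. \<bar>u j x\<bar> powr q))"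
        by (simp add: nonlin_def algebra_simps)
      then show "nonlin u i x * u i x = mu i * \<bar>u i x\<bar> powr p + \<beta> * (\<Prod>j\<in>UNIV. \<bar>u j x\<bar> powr q)"
        by (simp add: sq prod.remove[of UNIV i])
    qed
    also have "\<dots> = (\<integral>x. mu i * \<bar>u i x\<bar> powr p \<partial>lborel) + \<beta> * Dq u"
      using integrable_powr[OF uH, of p i] integrable_Dq[OF u] p_gt by (simp add: Dq_def)
    finally show ?thesis .
  qed
  then have "nrm u = G u" by (simp add: nrm_def G_def Mu_def sum.distrib)
  then show ?thesis using u nt by (simp add: nehari_iff)
qed

text \<open>Here \<open>nrm u = G u \<le> cS * nrm u powr (p / 2)\<close>; dividing by the positive
  norm leaves a lower bound because \<open>p / 2 > 1\<close>.\<close>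

lemma nehari_nrm_ge:
  assumes "u \<in> nehari lam mu q \<beta>" shows "nrm u \<ge> cS powr (- 2 / (p - 2))"
proof -
  have u: "u \<in> H1_vec" "nrm u = G u" and "\<exists>i. \<not> ae_zero (u i)"
    using assms by (auto simp: nehari_iff nontrivial_def)
  then have n: "nrm u > 0" using nrm_pos by blast
  have "nrm u powr 1 \<le> cS * nrm u powr (p / 2)" using G_le[OF u(1)] u(2) n by simp
  also have "nrm u powr (p / 2) = nrm u powr (p / 2 - 1) * nrm u powr 1" unfolding powr_add[symmetric] by simp
  finally have "1 \<le> cS * nrm u powr (p / 2 - 1)" using n by simp
  then have "1 powr (2 / (p - 2)) \<le> (cS * nrm u powr (p / 2 - 1)) powr (2 / (p - 2))"
    using p_gt by (intro powr_mono2) auto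
  also have "\<dots> = cS powr (2 / (p - 2)) * nrm u powr ((p / 2 - 1) * (2 / (p - 2)))"
    by (simp add: powr_mult powr_powr)
  also have "(p / 2 - 1) * (2 / (p - 2)) = 1" using p_gt by (simp add: field_simps)
  finally have "1 \<le> cS powr (2 / (p - 2)) * nrm u" using n by simp
  moreover have "cS powr (2 / (p - 2)) > 0" using cS_pos by simp
  ultimately show ?thesis by (simp add: powr_minus field_simps)
qed

text \<open>An extremal solves the system up to the multiplier \<open>cS\<close>, which scaling
  absorbs. The scaled function attains the lower bound of the norm on the Nehari manifold, and
  nontrivial solutions all lie there, so it is a ground state.\<close>

lemma ground_state_exists:
  "\<exists>u :: ('k, 'd) vfun. u \<in> nehari lam mu q \<beta> \<and> energy lam mu q \<beta> u = nehari_level T lam mu q \<beta> \<and>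
    ground_state lam mu q \<beta> u \<and> fully_nontrivial u"
proof -
  obtain u where ua: "u \<in> admissible" and n: "nrm u = 1" and Gu: "G u = cS" using beta_attained by blast
  have u: "u \<in> H1_vec" using ua by simp
  \<comment> \<open>Chosen so that \<open>r powr (p - 2) * cS = 1\<close>. This normalizes the
    multiplier and makes \<open>r\<^sup>2\<close> the bound of \<open>nehari_nrm_ge\<close>.\<close>
  define r where "r = cS powr (- 1 / (p - 2))"
  have r: "r > 0" using cS_pos by (simp add: r_def)
  have r2: "r\<^sup>2 = cS powr (- 2 / (p - 2))" unfolding r_def powr_square by simp
  have "- 1 / (p - 2) * (p - 2) = - 1" using p_gt by simp
  then have rp: "r powr (p - 2) = 1 / cS"
    using cS_pos unfolding r_def powr_powr by (simp add: powr_minus divide_inverse)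
  define w where "w = (\<lambda>i x. r * u i x)"
  have w: "w \<in> H1_vec" unfolding w_def by (rule scale_H1_vec[OF u])
  have nw: "nrm w = r\<^sup>2" unfolding w_def nrm_scale[OF u] n by simp
  have rpow: "r powr p = r powr (p - 2) * r\<^sup>2" using r by (simp add: powr_diff)
  have "G w = r powr p * G u" using r by (simp add: w_def G_def Mu_scale Dq_scale algebra_simps)
  then have Gw: "G w = r\<^sup>2" using rp Gu cS_pos by (simp add: rpow)
  have full: "fully_nontrivial w"
    unfolding fully_nontrivial_def
  proof
    fix i
    have "\<not> ae_zero (u i)" using admissible_component[of u i] ua by blast
    then show "\<not> ae_zero (w i)" using r by (simp add: ae_zero_def w_def)
  qed
  then have nt: "nontrivial w" by (simp add: fully_nontrivial_def nontrivial_def)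
  have wN: "w \<in> nehari lam mu q \<beta>" using w nt nw Gw by (simp add: nehari_iff)
  have sol: "weak_solution lam mu q \<beta> w"
    unfolding weak_solution_iff
  proof (intro conjI w allI ballI)
    fix i and v :: "real ^ 'd \<Rightarrow> real" assume v: "v \<in> H1"
    have ui: "u i \<in> H1" using u by (simp add: H1_vec_def)
    \<comment> \<open>The nonlinearity is homogeneous of degree \<open>p - 1\<close>, of which the
      product of the other components contributes \<open>p - q\<close>.\<close>
    have "nonlin w i x = r powr (p - 2) * r * nonlin u i x" for x
    proof -
      have "(\<Prod>j\<in>UNIV - {i}. \<bar>w j x\<bar> powr q) = r powr (p - q) * (\<Prod>j\<in>UNIV - {i}. \<bar>u j x\<bar> powr q)"
      proof -
        have "(\<Prod>j\<in>UNIV - {i}. \<bar>w j x\<bar> powr q) = (\<Prod>j\<in>UNIV - {i}. r powr q) * (\<Prod>j\<in>UNIV - {i}. \<bar>u j x\<bar> powr q)"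
          using r by (simp add: w_def abs_mult powr_mult prod.distrib)
        also have "(\<Prod>j\<in>UNIV - {i}. r powr q) = r powr (real (CARD('k) - 1) * q)"
          using r by (simp add: powr_power)
        also have "real (CARD('k) - 1) * q = p - q" using K3 by (simp add: p_eq of_nat_diff algebra_simps)
        finally show ?thesis .
      qed
      moreover have "r powr (p - 2) = r powr (q - 2) * r powr (p - q)" unfolding powr_add[symmetric] by simp
      ultimately show ?thesis
        using r by (simp add: nonlin_def) (simp add: w_def abs_mult powr_mult algebra_simps)
    qed
    then have "(\<integral>x. nonlin w i x * v x \<partial>lborel) = (\<integral>x. r powr (p - 2) * r * (nonlin u i x * v x) \<partial>lborel)"
      by (simp add: mult.assoc)
    also have "\<dots> = r powr (p - 2) * r * (cS * form i (u i) v)"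
      by (simp add: Euler_Lagrange[OF u n Gu v])
    also have "\<dots> = r * form i (u i) v" using cS_pos by (simp add: rp)
    also have "\<dots> = form i (w i) v" unfolding w_def form_cmult(1)[OF ui v] ..
    finally show "form i (w i) v = (\<integral>x. nonlin w i x * v x \<partial>lborel)" ..
  qed
  have min: "energy lam mu q \<beta> w \<le> energy lam mu q \<beta> y" if "y \<in> nehari lam mu q \<beta>" for y :: "('k, 'd) vfun"
    unfolding energy_nehari[OF wN] energy_nehari[OF that]
    using nehari_nrm_ge[OF that] p_gt nw r2 by (intro mult_left_mono) auto
  have "nehari_level T lam mu q \<beta> = energy lam mu q \<beta> w"
    unfolding nehari_level_def by (rule cInf_eq_minimum) (use wN min in auto)
  moreover have "ground_state lam mu q \<beta> w"
    unfolding ground_state_def using sol nt min weak_solution_nehari by blast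
  ultimately show ?thesis using wN full by metis
qed

end

theorem theorem1p5:
  fixes lam mu :: "'k::finite \<Rightarrow> real" and q :: real
  assumes d_ge_2: "CARD('d::finite) \<ge> 2"
    and K_ge_3: "CARD('k) \<ge> 3"
    and lam_pos: "\<And>i. lam i > 0"
    and mu_pos: "\<And>i. mu i > 0"
    and q_ge_1: "q \<ge> 1"
    and q_subcritical:
      "CARD('d) \<ge> 3 \<Longrightarrow> q < 2 * real CARD('d) / (real CARD('k) * (real CARD('d) - 2))"
    and q_gt_2: "q > 2"
  shows "\<exists>u :: ('k, 'd) vfun.
           u \<in> nehari lam mu q (beta_bar TYPE('d) lam mu q) \<and>
           energy lam mu q (beta_bar TYPE('d) lam mu q) u
             = nehari_level TYPE('d) lam mu q (beta_bar TYPE('d) lam mu q) \<and>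
           ground_state lam mu q (beta_bar TYPE('d) lam mu q) u \<and>
           fully_nontrivial u"
proof -
  \<comment> \<open>For \<open>d \<ge> 3\<close> subcriticality reads
    \<open>K q (d - 2) < 2 d\<close>, while \<open>K q > 6\<close>; together they would give
    \<open>d < 3\<close>.\<close>
  have d2: "CARD('d) = 2"
  proof (rule ccontr)
    assume "CARD('d) \<noteq> 2"
    then have d3: "CARD('d) \<ge> 3" using d_ge_2 by simp
    define d where "d = real CARD('d)"
    have d: "d \<ge> 3" using d3 by (simp add: d_def)
    have "3 * 2 < real CARD('k) * q" using K_ge_3 q_gt_2 by (intro mult_le_less_imp_less) auto
    then have "6 * (d - 2) < real CARD('k) * q * (d - 2)" using d by (intro mult_strict_right_mono) auto
    also have "real CARD('k) * q * (d - 2) < 2 * d"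
      using q_subcritical[OF d3] d K_ge_3 unfolding d_def[symmetric] by (subst (asm) pos_less_divide_eq) (auto simp: mult_ac)
    finally show False using d by simp
  qed
  interpret planar_system "TYPE('d)" lam mu q "real CARD('k) * q"
    using d2 K_ge_3 lam_pos mu_pos q_gt_2 by unfold_locales auto
  show ?thesis using ground_state_exists unfolding \<beta>_def .
qed

end
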